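(* Let $\omega$ be a free ultrafilter on $\mathbb{N}$, let $\Gamma$ be an exact discrete group, and let $\alpha:\Gamma\curvearrowright\mathcal{A}$ be any action of $\Gamma$ by $*$-automorphisms on a C*-algebra $\mathcal{A}$. Then $\mathcal{A}^{\omega}\rtimes_{\alpha^{\omega},r}\Gamma\subset(\mathcal{A}\rtimes_{\alpha,r}\Gamma)^{\omega}$ canonically; that is, there is an injective $*$-homomorphism $\Theta:\mathcal{A}^{\omega}\rtimes_{\alpha^{\omega},r}\Gamma\to(\mathcal{A}\rtimes_{\alpha,r}\Gamma)^{\omega}$ satisfying $$\Theta\Big(\sum_{s\in F}[(a_{s}(n))_{n}]_{\omega}\,u_{s}\Big)=\Big[\Big(\sum_{s\in F}a_{s}(n)u_{s}\Big)_{n}\Big]_{\omega}$$ for every finite $F\subset\Gamma$ and all $(a_{s}(n))_{n}\in\ell^{\infty}(\mathbb{N},\mathcal{A})$, $s\in F$.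
   Context: For a C*-algebra $\mathcal{B}$, $\ell^{\infty}(\mathbb{N},\mathcal{B})$ is the C*-algebra of bounded sequences in $\mathcal{B}$, $C^{\omega}(\mathcal{B})=\{x\in\ell^{\infty}(\mathbb{N},\mathcal{B}):\lim_{n\to\omega}\|x(n)\|=0\}$, and the ultraproduct is $\mathcal{B}^{\omega}=\ell^{\infty}(\mathbb{N},\mathcal{B})/C^{\omega}(\mathcal{B})$; the class of $(x_n)_n$ is written $[(x_n)_n]_{\omega}$. The action $\alpha^{\omega}$ of $\Gamma$ on $\mathcal{A}^{\omega}$ is $\alpha^{\omega}_{g}([(x_n)_n]_{\omega})=[(\alpha_g(x_n))_n]_{\omega}$. For a discrete group $\Gamma$ acting by $\alpha$ on a C*-algebra $\mathcal{A}$ faithfully represented by $\pi:\mathcal{A}\to B(\mathcal{H})$, put $\tilde{\pi}(a)(\xi\otimes\delta_g)=(\pi(\alpha_{g^{-1}}(a))\xi)\otimes\delta_g$ on $\mathcal{H}\otimes\ell^2(\Gamma)$; the reduced crossed product $\mathcal{A}\rtimes_{\alpha,r}\Gamma$ is the closed linear span of $\{\tilde{\pi}(a)(1\otimes\lambda_s):a\in\mathcal{A},s\in\Gamma\}$, where $\lambda$ is the left regular representation. The element $\tilde{\pi}(a)(1\otimes\lambda_s)$ is written $a u_s$. A C*-algebra $\mathcal{B}$ is exact if $\,\cdot\otimes_{\min}\mathcal{B}$ preserves short exact sequences of C*-algebras; a discrete group $\Gamma$ is exact if its reduced group C*-algebra is exact (equivalently, the functor $\,\cdot\rtimes_{r}\Gamma$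 preserves short exact sequences of $\Gamma$-C*-algebras). *)

theory Defs
  imports "HOL-Analysis.Analysis"
begin

section \<open>Complex Hilbert spaces\<close>

text \<open>The inner product of \<open>real_inner\<close> is the real part of the complex one, so norm and
  topology are those of the library. \<open>cinner\<close> is linear in its first argument.\<close>

class chilbert_space = real_inner + complete_space +
  fixes scaleC :: "complex \<Rightarrow> 'a \<Rightarrow> 'a" (infixr "*\<^sub>C" 75)
    and cinner :: "'a \<Rightarrow> 'a \<Rightarrow> complex"
  assumes scaleC_add_right: "c *\<^sub>C (x + y) = c *\<^sub>C x + c *\<^sub>C y"
    and scaleC_add_left: "(c + d) *\<^sub>C x = c *\<^sub>C x + d *\<^sub>C x"
    and scaleC_scaleC: "c *\<^sub>C d *\<^sub>C x = (c * d) *\<^sub>C x"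
    and scaleR_scaleC: "r *\<^sub>R x = complex_of_real r *\<^sub>C x"
    and cinner_commute: "cinner x y = cnj (cinner y x)"
    and cinner_add_left: "cinner (x + y) z = cinner x z + cinner y z"
    and cinner_scaleC_left: "cinner (c *\<^sub>C x) y = c * cinner x y"
    and inner_cinner: "x \<bullet> y = Re (cinner x y)"

instantiation complex :: chilbert_space
begin
definition "scaleC_complex = ((*) :: complex \<Rightarrow> complex \<Rightarrow> complex)"
definition "cinner_complex x y = x * cnj (y::complex)"
instance
  by standard (auto simp: scaleC_complex_def cinner_complex_def inner_complex_def algebra_simps
      scaleR_conv_of_real)
end

lemma cinner_self: "cinner x x = complex_of_real ((norm x)\<^sup>2)"
proof -
  have "Im (cinner x x) = 0"
    by (metis cinner_commute complex_cnj_cancel_iff complex_In_mult_cnj_zero Im_complex_of_real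
        Reals_cnj_iff complex_is_Real_iff)
  moreover have "Re (cinner x x) = (norm x)\<^sup>2"
    by (simp add: inner_cinner[symmetric] power2_norm_eq_inner)
  ultimately show ?thesis by (simp add: complex_eq_iff)
qed

lemma cinner_scaleC_right: "cinner x (c *\<^sub>C y) = cnj c * cinner x y"
  by (metis cinner_commute cinner_scaleC_left complex_cnj_mult)

lemma norm_scaleC: "norm (c *\<^sub>C x) = cmod c * norm (x::'a::chilbert_space)"
proof -
  have "cinner (c *\<^sub>C x) (c *\<^sub>C x) = (c * cnj c) * cinner x x"
    by (simp add: cinner_scaleC_left cinner_scaleC_right ac_simps)
  then have "complex_of_real ((norm (c *\<^sub>C x))\<^sup>2) = complex_of_real ((cmod c * norm x)\<^sup>2)"
    by (simp add: cinner_self complex_norm_square[symmetric] power_mult_distrib)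
  then have "(norm (c *\<^sub>C x))\<^sup>2 = (cmod c * norm x)\<^sup>2" by (simp only: of_real_eq_iff)
  then show ?thesis by (simp add: power2_eq_iff_nonneg)
qed

lemma cmod_cinner_le: "cmod (cinner x y) \<le> 2 * (norm x * norm y)"
proof -
  have "\<bar>Re (cinner x y)\<bar> \<le> norm x * norm y"
    by (simp add: inner_cinner[symmetric] Cauchy_Schwarz_ineq2)
  moreover have "Im (cinner x y) = - ((\<i> *\<^sub>C x) \<bullet> y)"
    by (simp add: inner_cinner cinner_scaleC_left)
  then have "\<bar>Im (cinner x y)\<bar> \<le> norm x * norm y"
    using Cauchy_Schwarz_ineq2[of "\<i> *\<^sub>C x" y] by (simp add: norm_scaleC)
  ultimately show ?thesis using cmod_le[of "cinner x y"] by linarith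
qed

lemma scaleC_zero_right [simp]: "c *\<^sub>C (0::'a::chilbert_space) = 0"
  using norm_scaleC[of c "0::'a"] by simp


section \<open>The Hilbert space \<open>\<ell>\<^sup>2(I; H) = H \<otimes> \<ell>\<^sup>2(I)\<close>\<close>

definition sq_summable :: "('i \<Rightarrow> 'h::chilbert_space) \<Rightarrow> bool" where
  "sq_summable f \<longleftrightarrow> (\<lambda>i. (norm (f i))\<^sup>2) summable_on UNIV"

lemma sq_summable_zero: "sq_summable (\<lambda>_. 0)"
  by (simp add: sq_summable_def)

lemma sq_summable_comparison:
  assumes "sq_summable f" "\<And>i. norm (g i) \<le> C * norm (f i)"
  shows "sq_summable g"
  unfolding sq_summable_def
proof (rule summable_on_comparison_test)
  show "(\<lambda>i. C\<^sup>2 * (norm (f i))\<^sup>2) summable_on UNIV"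
    using assms(1) unfolding sq_summable_def by (rule summable_on_cmult_right)
  show "(norm (g i))\<^sup>2 \<le> C\<^sup>2 * (norm (f i))\<^sup>2" for i
    using power_mono[OF assms(2)[of i], of 2] by (simp add: power_mult_distrib)
qed auto

lemma sq_summable_add:
  assumes "sq_summable f" "sq_summable g"
  shows "sq_summable (\<lambda>i. f i + g i)"
  unfolding sq_summable_def
proof (rule summable_on_comparison_test)
  show "(\<lambda>i. 2 * (norm (f i))\<^sup>2 + 2 * (norm (g i))\<^sup>2) summable_on UNIV"
    using assms unfolding sq_summable_def by (intro summable_on_add summable_on_cmult_right)
  show "(norm (f i + g i))\<^sup>2 \<le> 2 * (norm (f i))\<^sup>2 + 2 * (norm (g i))\<^sup>2" for i
    using power_mono[OF norm_triangle_ineq[of "f i" "g i"], of 2]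
      sum_squares_bound[of "norm (f i)" "norm (g i)"]
    by (simp add: power2_sum)
qed auto

lemma sq_summable_scaleC: "sq_summable f \<Longrightarrow> sq_summable (\<lambda>i. c *\<^sub>C f i)"
  by (erule sq_summable_comparison[where C="cmod c"]) (simp add: norm_scaleC)

lemma sq_summable_scaleR: "sq_summable f \<Longrightarrow> sq_summable (\<lambda>i. r *\<^sub>R f i)"
  by (simp add: scaleR_scaleC sq_summable_scaleC)

lemma sq_summable_uminus: "sq_summable f \<Longrightarrow> sq_summable (\<lambda>i. - f i)"
  by (simp add: sq_summable_def)

lemma sq_summable_diff:
  "sq_summable f \<Longrightarrow> sq_summable g \<Longrightarrow> sq_summable (\<lambda>i. f i - g i)"
  using sq_summable_add[of f "\<lambda>i. - g i"] by (simp add: sq_summable_uminus)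

lemma sq_summable_cinner:
  assumes "sq_summable f" "sq_summable g"
  shows "(\<lambda>i. cinner (f i) (g i)) summable_on UNIV"
proof (rule abs_summable_summable, rule summable_on_comparison_test)
  show "(\<lambda>i. (norm (f i))\<^sup>2 + (norm (g i))\<^sup>2) summable_on UNIV"
    using assms unfolding sq_summable_def by (intro summable_on_add)
  show "cmod (cinner (f i) (g i)) \<le> (norm (f i))\<^sup>2 + (norm (g i))\<^sup>2" for i
    using cmod_cinner_le[of "f i" "g i"] sum_squares_bound[of "norm (f i)" "norm (g i)"]
    by (simp add: mult.assoc)
qed auto

lemma sq_summable_inner:
  assumes "sq_summable f" "sq_summable g"
  shows "(\<lambda>i. f i \<bullet> g i) summable_on UNIV"
  unfolding inner_cinner using sq_summable_cinner[OF assms] summable_on_Re by blast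

typedef (overloaded) ('i, 'h) ell2 = "{f :: 'i \<Rightarrow> 'h::chilbert_space. sq_summable f}"
  morphisms ell2_apply Abs_ell2
  using sq_summable_zero by auto

setup_lifting type_definition_ell2

instantiation ell2 :: (type, chilbert_space) real_vector
begin
lift_definition zero_ell2 :: "('a, 'b) ell2" is "\<lambda>_. 0" by (rule sq_summable_zero)
lift_definition plus_ell2 :: "('a, 'b) ell2 \<Rightarrow> ('a, 'b) ell2 \<Rightarrow> ('a, 'b) ell2"
  is "\<lambda>f g i. f i + g i" by (rule sq_summable_add)
lift_definition minus_ell2 :: "('a, 'b) ell2 \<Rightarrow> ('a, 'b) ell2 \<Rightarrow> ('a, 'b) ell2"
  is "\<lambda>f g i. f i - g i" by (rule sq_summable_diff)
lift_definition uminus_ell2 :: "('a, 'b) ell2 \<Rightarrow> ('a, 'b) ell2"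
  is "\<lambda>f i. - f i" by (rule sq_summable_uminus)
lift_definition scaleR_ell2 :: "real \<Rightarrow> ('a, 'b) ell2 \<Rightarrow> ('a, 'b) ell2"
  is "\<lambda>r f i. r *\<^sub>R f i" by (rule sq_summable_scaleR)
instance by standard (transfer; simp add: algebra_simps)+
end

instantiation ell2 :: (type, chilbert_space) real_inner
begin
lift_definition inner_ell2 :: "('a, 'b) ell2 \<Rightarrow> ('a, 'b) ell2 \<Rightarrow> real"
  is "\<lambda>f g. \<Sum>\<^sub>\<infinity>i. f i \<bullet> g i" .
definition norm_ell2 :: "('a, 'b) ell2 \<Rightarrow> real" where "norm_ell2 x = sqrt (x \<bullet> x)"
definition dist_ell2 :: "('a, 'b) ell2 \<Rightarrow> ('a, 'b) ell2 \<Rightarrow> real"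
  where "dist_ell2 x y = norm (x - y)"
definition sgn_ell2 :: "('a, 'b) ell2 \<Rightarrow> ('a, 'b) ell2" where "sgn_ell2 x = x /\<^sub>R norm x"
definition uniformity_ell2 :: "(('a, 'b) ell2 \<times> ('a, 'b) ell2) filter"
  where "uniformity_ell2 = (INF e\<in>{0<..}. principal {(x, y). dist x y < e})"
definition open_ell2 :: "('a, 'b) ell2 set \<Rightarrow> bool"
  where "open_ell2 U \<longleftrightarrow> (\<forall>x\<in>U. \<forall>\<^sub>F (x', y) in uniformity. x' = x \<longrightarrow> y \<in> U)"

lemma norm_ell2_sq: "(norm (x::('a,'b) ell2))\<^sup>2 = (\<Sum>\<^sub>\<infinity>i. (norm (ell2_apply x i))\<^sup>2)"
  unfolding norm_ell2_def inner_ell2.rep_eq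
  by (simp add: power2_norm_eq_inner[symmetric] infsum_nonneg)

lemma ell2_summable: "(\<lambda>i. (norm (ell2_apply x i))\<^sup>2) summable_on UNIV"
  using ell2_apply[of x] by (simp add: sq_summable_def)

lemma ell2_sum_le: "finite F \<Longrightarrow> (\<Sum>i\<in>F. (norm (ell2_apply x i))\<^sup>2) \<le> (norm (x::('a,'b) ell2))\<^sup>2"
  unfolding norm_ell2_sq by (rule finite_sum_le_infsum) (auto intro: ell2_summable)

lemma norm_ell2_nonneg: "norm (x::('a,'b) ell2) \<ge> 0"
  unfolding norm_ell2_def inner_ell2.rep_eq by (simp add: infsum_nonneg)

lemma norm_ell2_apply_le: "norm (ell2_apply x i) \<le> norm (x::('a,'b) ell2)"
  using ell2_sum_le[of "{i}" x] norm_ell2_nonneg[of x] by (simp add: power2_le_iff_abs_le)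

instance
proof
  fix x y z :: "('a, 'b) ell2" and r s :: real and U :: "('a, 'b) ell2 set"
  show "dist x y = norm (x - y)" by (rule dist_ell2_def)
  show "sgn x = x /\<^sub>R norm x" by (rule sgn_ell2_def)
  show "uniformity = (INF e\<in>{0<..}. principal {(x::('a, 'b) ell2, y). dist x y < e})"
    by (rule uniformity_ell2_def)
  show "open U \<longleftrightarrow> (\<forall>x\<in>U. \<forall>\<^sub>F (x', y) in uniformity. x' = x \<longrightarrow> y \<in> U)"
    by (rule open_ell2_def)
  show "x \<bullet> y = y \<bullet> x" by transfer (simp add: inner_commute)
  show "(x + y) \<bullet> z = x \<bullet> z + y \<bullet> z"
    by transfer (simp add: inner_add_left infsum_add sq_summable_inner)
  show "r *\<^sub>R x \<bullet> y = r * (x \<bullet> y)" by transfer (simp add: infsum_cmult_right')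
  show "0 \<le> x \<bullet> x" by transfer (simp add: infsum_nonneg)
  show "norm x = sqrt (x \<bullet> x)" by (rule norm_ell2_def)
  show "x \<bullet> x = 0 \<longleftrightarrow> x = 0"
  proof
    assume "x \<bullet> x = 0"
    then have "norm x = 0" by (simp add: norm_ell2_def)
    then have "ell2_apply x i = 0" for i using norm_ell2_apply_le[of x i] by simp
    then show "x = 0" by (simp add: ell2_apply_inject[symmetric] zero_ell2.rep_eq fun_eq_iff)
  qed (transfer, simp)
qed
end

lemma ell2_boundedI:
  assumes "\<And>F. finite F \<Longrightarrow> (\<Sum>i\<in>F. (norm (f i :: 'h::chilbert_space))\<^sup>2) \<le> B\<^sup>2" and "B \<ge> 0"
  shows "sq_summable f" and "norm (Abs_ell2 f) \<le> B"
proof -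
  show f: "sq_summable f"
    unfolding sq_summable_def
    by (rule nonneg_bdd_above_summable_on) (use assms in \<open>auto intro!: bdd_aboveI[of _ "B\<^sup>2"]\<close>)
  have "(norm (Abs_ell2 f))\<^sup>2 \<le> B\<^sup>2"
    unfolding norm_ell2_sq using f
    by (intro infsum_le_finite_sums) (auto simp: Abs_ell2_inverse sq_summable_def assms)
  then show "norm (Abs_ell2 f) \<le> B" using assms(2) by (rule power2_le_imp_le)
qed

instantiation ell2 :: (type, chilbert_space) chilbert_space
begin
lift_definition scaleC_ell2 :: "complex \<Rightarrow> ('a, 'b) ell2 \<Rightarrow> ('a, 'b) ell2"
  is "\<lambda>c f i. c *\<^sub>C f i" by (rule sq_summable_scaleC)
lift_definition cinner_ell2 :: "('a, 'b) ell2 \<Rightarrow> ('a, 'b) ell2 \<Rightarrow> complex"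
  is "\<lambda>f g. \<Sum>\<^sub>\<infinity>i. cinner (f i) (g i)" .
instance
proof
  fix x y z :: "('a, 'b) ell2" and r :: real and c d :: complex
  show "c *\<^sub>C (x + y) = c *\<^sub>C x + c *\<^sub>C y" "(c + d) *\<^sub>C x = c *\<^sub>C x + d *\<^sub>C x"
    "c *\<^sub>C d *\<^sub>C x = (c * d) *\<^sub>C x" "r *\<^sub>R x = complex_of_real r *\<^sub>C x"
    by (transfer; simp add: scaleC_add_right scaleC_add_left scaleC_scaleC scaleR_scaleC)+
  show "cinner x y = cnj (cinner y x)"
    by transfer (simp add: infsum_cnj[symmetric] cinner_commute[symmetric])
  show "cinner (x + y) z = cinner x z + cinner y z"
    by transfer (simp add: cinner_add_left infsum_add sq_summable_cinner)
  show "cinner (c *\<^sub>C x) y = c * cinner x y"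
    by transfer (simp add: cinner_scaleC_left infsum_cmult_right')
  show "x \<bullet> y = Re (cinner x y)"
    by transfer (simp add: inner_cinner infsum_Re sq_summable_cinner)
next
  fix X :: "nat \<Rightarrow> ('a, 'b) ell2"
  assume X: "Cauchy X"
  have "Cauchy (\<lambda>n. ell2_apply (X n) i)" for i
  proof (rule CauchyI)
    fix e :: real assume "e > 0"
    then obtain M where M: "\<forall>m\<ge>M. \<forall>n\<ge>M. norm (X m - X n) < e" using CauchyD[OF X] by blast
    have "norm (ell2_apply (X m) i - ell2_apply (X n) i) \<le> norm (X m - X n)" for m n
      using norm_ell2_apply_le[of "X m - X n" i] by (simp add: minus_ell2.rep_eq)
    then show "\<exists>M. \<forall>m\<ge>M. \<forall>n\<ge>M. norm (ell2_apply (X m) i - ell2_apply (X n) i) < e"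
      using M le_less_trans by blast
  qed
  then have "\<exists>l. (\<lambda>n. ell2_apply (X n) i) \<longlonglongrightarrow> l" for i
    using Cauchy_convergent convergent_def by blast
  then obtain L where L: "\<And>i. (\<lambda>n. ell2_apply (X n) i) \<longlonglongrightarrow> L i" by metis
  have close: "\<exists>M. \<forall>n\<ge>M. sq_summable (\<lambda>i. ell2_apply (X n) i - L i) \<and>
      norm (Abs_ell2 (\<lambda>i. ell2_apply (X n) i - L i)) \<le> e" if "e > 0" for e :: real
  proof -
    obtain M where M: "\<And>m n. m \<ge> M \<Longrightarrow> n \<ge> M \<Longrightarrow> norm (X m - X n) < e"
      using CauchyD[OF X \<open>e > 0\<close>] by blast
    have "(\<Sum>i\<in>F. (norm (ell2_apply (X n) i - L i))\<^sup>2) \<le> e\<^sup>2" if "n \<ge> M" "finite F" for n F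
    proof (rule tendsto_upperbound)
      show "(\<lambda>m. \<Sum>i\<in>F. (norm (ell2_apply (X n) i - ell2_apply (X m) i))\<^sup>2)
          \<longlonglongrightarrow> (\<Sum>i\<in>F. (norm (ell2_apply (X n) i - L i))\<^sup>2)"
        by (intro tendsto_intros L)
      have "(\<Sum>i\<in>F. (norm (ell2_apply (X n) i - ell2_apply (X m) i))\<^sup>2) \<le> e\<^sup>2" if "m \<ge> M" for m
        using ell2_sum_le[OF \<open>finite F\<close>, of "X n - X m"] M[OF \<open>n \<ge> M\<close> that]
          power_mono[of "norm (X n - X m)" e 2] by (simp add: minus_ell2.rep_eq)
      then show "\<forall>\<^sub>F m in sequentially.
          (\<Sum>i\<in>F. (norm (ell2_apply (X n) i - ell2_apply (X m) i))\<^sup>2) \<le> e\<^sup>2"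
        by (auto simp: eventually_sequentially)
    qed simp
    then show ?thesis
      by (intro exI[of _ M] allI impI conjI ell2_boundedI) (use \<open>e > 0\<close> in auto)
  qed
  obtain M where "sq_summable (\<lambda>i. ell2_apply (X M) i - L i)" using close[of 1] by auto
  from sq_summable_diff[OF ell2_apply[of "X M", simplified] this]
  have "sq_summable L" by simp
  then have eq: "Abs_ell2 (\<lambda>i. ell2_apply (X n) i - L i) = X n - Abs_ell2 L" for n
    by (metis (no_types, lifting) Abs_ell2_inverse ell2_apply_inverse mem_Collect_eq minus_ell2.rep_eq ext)
  have "X \<longlonglongrightarrow> Abs_ell2 L"
  proof (rule LIMSEQ_I)
    fix e :: real assume "e > 0"
    then obtain N where "\<forall>n\<ge>N. norm (X n - Abs_ell2 L) \<le> e / 2"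
      using close[of "e / 2"] unfolding eq by auto
    then show "\<exists>N. \<forall>n\<ge>N. norm (X n - Abs_ell2 L) < e"
      using \<open>e > 0\<close> by (intro exI[of _ N]) fastforce
  qed
  then show "convergent X" by (rule convergentI)
qed
end


definition tensor_vec :: "'h::chilbert_space \<Rightarrow> ('i, complex) ell2 \<Rightarrow> ('i, 'h) ell2" where
  "tensor_vec \<xi> v = Abs_ell2 (\<lambda>i. ell2_apply v i *\<^sub>C \<xi>)"

definition delta :: "'i \<Rightarrow> ('i, complex) ell2" where
  "delta i = Abs_ell2 (\<lambda>j. if j = i then 1 else 0)"

lemma sq_summable_delta: "sq_summable (\<lambda>j. if j = i then x else 0)"
  unfolding sq_summable_def
  by (rule finite_nonzero_values_imp_summable_on) (simp add: if_distrib cong: if_cong)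

lemma ell2_apply_tensor_vec: "ell2_apply (tensor_vec \<xi> v) i = ell2_apply v i *\<^sub>C \<xi>"
proof -
  have "sq_summable (\<lambda>i. ell2_apply v i *\<^sub>C \<xi>)"
    by (rule sq_summable_comparison[where C="norm \<xi>", OF ell2_apply[of v, simplified]])
       (simp add: norm_scaleC)
  then show ?thesis by (simp add: tensor_vec_def Abs_ell2_inverse)
qed

lemma scaleC_zero_left [simp]: "0 *\<^sub>C (x::'a::chilbert_space) = 0"
  using norm_scaleC[of 0 x] by simp

lemma scaleC_one [simp]: "1 *\<^sub>C (x::'a::chilbert_space) = x"
  using scaleR_scaleC[of 1 x] by simp

lemma ell2_apply_tensor_delta:
  "ell2_apply (tensor_vec \<xi> (delta i)) j = (if j = i then \<xi> else 0)"
  by (simp add: ell2_apply_tensor_vec delta_def Abs_ell2_inverse sq_summable_delta)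


section \<open>Bounded operators\<close>

text \<open>The library operators \<open>'h \<Rightarrow>\<^sub>L 'h\<close> are only real-linear.\<close>

type_synonym 'h op = "('h, 'h) blinfun"

definition bounded_ops :: "'h::chilbert_space op set" where
  "bounded_ops = {T. \<forall>c x. blinfun_apply T (c *\<^sub>C x) = c *\<^sub>C blinfun_apply T x}"

definition op_scale :: "complex \<Rightarrow> 'h::chilbert_space op \<Rightarrow> 'h op" where
  "op_scale c T = Blinfun (\<lambda>x. c *\<^sub>C blinfun_apply T x)"

definition op_adj :: "'h::chilbert_space op \<Rightarrow> 'h op" where
  "op_adj T = (THE S. \<forall>x y. cinner (blinfun_apply T x) y = cinner x (blinfun_apply S y))"

definition closed_cspan :: "'h::chilbert_space op set \<Rightarrow> 'h op set" where
  "closed_cspan S = closure (span {op_scale c T |c T. T \<in> S})"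

lemma op_scale_apply: "blinfun_apply (op_scale c T) x = c *\<^sub>C blinfun_apply T x"
proof -
  have "bounded_linear (\<lambda>x. c *\<^sub>C blinfun_apply T x)"
  proof (rule bounded_linear_intro)
    show "norm (c *\<^sub>C blinfun_apply T x) \<le> norm x * (cmod c * norm T)" for x
      using mult_left_mono[OF norm_blinfun[of T x], of "cmod c"]
      by (simp add: norm_scaleC ac_simps)
    show "c *\<^sub>C blinfun_apply T (r *\<^sub>R x) = r *\<^sub>R (c *\<^sub>C blinfun_apply T x)" for r x
      unfolding blinfun.scaleR_right by (simp add: scaleR_scaleC scaleC_scaleC mult.commute)
  qed (simp add: blinfun.add_right scaleC_add_right)
  then show ?thesis by (simp add: op_scale_def bounded_linear_Blinfun_apply)
qed


section \<open>C*-algebras\<close>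

record 'a cstar =
  cs_carrier :: "'a set"
  cs_zero :: 'a
  cs_add :: "'a \<Rightarrow> 'a \<Rightarrow> 'a"
  cs_scale :: "complex \<Rightarrow> 'a \<Rightarrow> 'a"
  cs_mult :: "'a \<Rightarrow> 'a \<Rightarrow> 'a"
  cs_star :: "'a \<Rightarrow> 'a"
  cs_norm :: "'a \<Rightarrow> real"

definition cs_diff :: "'a cstar \<Rightarrow> 'a \<Rightarrow> 'a \<Rightarrow> 'a" where
  "cs_diff A x y = cs_add A x (cs_scale A (- 1) y)"

text \<open>No unit is required.\<close>

locale cstar_algebra =
  fixes A :: "'a cstar"
  assumes zero_closed: "cs_zero A \<in> cs_carrier A"
    and add_closed: "\<lbrakk>x \<in> cs_carrier A; y \<in> cs_carrier A\<rbrakk> \<Longrightarrow> cs_add A x y \<in> cs_carrier A"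
    and scale_closed: "x \<in> cs_carrier A \<Longrightarrow> cs_scale A c x \<in> cs_carrier A"
    and mult_closed: "\<lbrakk>x \<in> cs_carrier A; y \<in> cs_carrier A\<rbrakk> \<Longrightarrow> cs_mult A x y \<in> cs_carrier A"
    and star_closed: "x \<in> cs_carrier A \<Longrightarrow> cs_star A x \<in> cs_carrier A"
    and add_assoc: "\<lbrakk>x \<in> cs_carrier A; y \<in> cs_carrier A; z \<in> cs_carrier A\<rbrakk>
      \<Longrightarrow> cs_add A (cs_add A x y) z = cs_add A x (cs_add A y z)"
    and add_commute: "\<lbrakk>x \<in> cs_carrier A; y \<in> cs_carrier A\<rbrakk> \<Longrightarrow> cs_add A x y = cs_add A y x"
    and add_zero: "x \<in> cs_carrier A \<Longrightarrow> cs_add A (cs_zero A) x = x"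
    and add_inverse: "x \<in> cs_carrier A \<Longrightarrow> cs_diff A x x = cs_zero A"
    and scale_add_right: "\<lbrakk>x \<in> cs_carrier A; y \<in> cs_carrier A\<rbrakk>
      \<Longrightarrow> cs_scale A c (cs_add A x y) = cs_add A (cs_scale A c x) (cs_scale A c y)"
    and scale_add_left: "x \<in> cs_carrier A
      \<Longrightarrow> cs_scale A (c + d) x = cs_add A (cs_scale A c x) (cs_scale A d x)"
    and scale_scale: "x \<in> cs_carrier A \<Longrightarrow> cs_scale A c (cs_scale A d x) = cs_scale A (c * d) x"
    and scale_one: "x \<in> cs_carrier A \<Longrightarrow> cs_scale A 1 x = x"
    and mult_assoc: "\<lbrakk>x \<in> cs_carrier A; y \<in> cs_carrier A; z \<in> cs_carrier A\<rbrakk>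
      \<Longrightarrow> cs_mult A (cs_mult A x y) z = cs_mult A x (cs_mult A y z)"
    and mult_add_left: "\<lbrakk>x \<in> cs_carrier A; y \<in> cs_carrier A; z \<in> cs_carrier A\<rbrakk>
      \<Longrightarrow> cs_mult A (cs_add A x y) z = cs_add A (cs_mult A x z) (cs_mult A y z)"
    and mult_add_right: "\<lbrakk>x \<in> cs_carrier A; y \<in> cs_carrier A; z \<in> cs_carrier A\<rbrakk>
      \<Longrightarrow> cs_mult A x (cs_add A y z) = cs_add A (cs_mult A x y) (cs_mult A x z)"
    and mult_scale_left: "\<lbrakk>x \<in> cs_carrier A; y \<in> cs_carrier A\<rbrakk>
      \<Longrightarrow> cs_mult A (cs_scale A c x) y = cs_scale A c (cs_mult A x y)"
    and mult_scale_right: "\<lbrakk>x \<in> cs_carrier A; y \<in> cs_carrier A\<rbrakk>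
      \<Longrightarrow> cs_mult A x (cs_scale A c y) = cs_scale A c (cs_mult A x y)"
    and star_star: "x \<in> cs_carrier A \<Longrightarrow> cs_star A (cs_star A x) = x"
    and star_add: "\<lbrakk>x \<in> cs_carrier A; y \<in> cs_carrier A\<rbrakk>
      \<Longrightarrow> cs_star A (cs_add A x y) = cs_add A (cs_star A x) (cs_star A y)"
    and star_scale: "x \<in> cs_carrier A
      \<Longrightarrow> cs_star A (cs_scale A c x) = cs_scale A (cnj c) (cs_star A x)"
    and star_mult: "\<lbrakk>x \<in> cs_carrier A; y \<in> cs_carrier A\<rbrakk>
      \<Longrightarrow> cs_star A (cs_mult A x y) = cs_mult A (cs_star A y) (cs_star A x)"
    and norm_nonneg: "x \<in> cs_carrier A \<Longrightarrow> cs_norm A x \<ge> 0"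
    and norm_eq_zero: "x \<in> cs_carrier A \<Longrightarrow> cs_norm A x = 0 \<longleftrightarrow> x = cs_zero A"
    and norm_add: "\<lbrakk>x \<in> cs_carrier A; y \<in> cs_carrier A\<rbrakk>
      \<Longrightarrow> cs_norm A (cs_add A x y) \<le> cs_norm A x + cs_norm A y"
    and norm_scale: "x \<in> cs_carrier A \<Longrightarrow> cs_norm A (cs_scale A c x) = cmod c * cs_norm A x"
    and norm_mult: "\<lbrakk>x \<in> cs_carrier A; y \<in> cs_carrier A\<rbrakk>
      \<Longrightarrow> cs_norm A (cs_mult A x y) \<le> cs_norm A x * cs_norm A y"
    and cstar_identity: "x \<in> cs_carrier A \<Longrightarrow> cs_norm A (cs_mult A (cs_star A x) x) = (cs_norm A x)\<^sup>2"
    and complete: "\<lbrakk>\<And>n. X n \<in> cs_carrier A;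
        \<forall>e>0. \<exists>N. \<forall>m\<ge>N. \<forall>n\<ge>N. cs_norm A (cs_diff A (X m) (X n)) < e\<rbrakk>
      \<Longrightarrow> \<exists>x\<in>cs_carrier A. (\<lambda>n. cs_norm A (cs_diff A (X n) x)) \<longlonglongrightarrow> 0"

definition star_hom :: "'a cstar \<Rightarrow> 'b cstar \<Rightarrow> ('a \<Rightarrow> 'b) \<Rightarrow> bool" where
  "star_hom A B f \<longleftrightarrow>
     (\<forall>x\<in>cs_carrier A. f x \<in> cs_carrier B) \<and>
     (\<forall>x\<in>cs_carrier A. \<forall>y\<in>cs_carrier A. f (cs_add A x y) = cs_add B (f x) (f y)) \<and>
     (\<forall>c. \<forall>x\<in>cs_carrier A. f (cs_scale A c x) = cs_scale B c (f x)) \<and>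
     (\<forall>x\<in>cs_carrier A. \<forall>y\<in>cs_carrier A. f (cs_mult A x y) = cs_mult B (f x) (f y)) \<and>
     (\<forall>x\<in>cs_carrier A. f (cs_star A x) = cs_star B (f x))"

definition short_exact ::
  "'a cstar \<Rightarrow> ('a \<Rightarrow> 'b) \<Rightarrow> 'b cstar \<Rightarrow> ('b \<Rightarrow> 'c) \<Rightarrow> 'c cstar \<Rightarrow> bool" where
  "short_exact I \<iota> A \<phi> Q \<longleftrightarrow>
     star_hom I A \<iota> \<and> star_hom A Q \<phi> \<and>
     inj_on \<iota> (cs_carrier I) \<and>
     \<iota> ` cs_carrier I = {a \<in> cs_carrier A. \<phi> a = cs_zero Q} \<and>
     \<phi> ` cs_carrier A = cs_carrier Q"

definition op_cstar :: "'h::chilbert_space op set \<Rightarrow> 'h op cstar" where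
  "op_cstar S = \<lparr>cs_carrier = S, cs_zero = 0, cs_add = (+), cs_scale = op_scale,
     cs_mult = (o\<^sub>L), cs_star = op_adj, cs_norm = norm\<rparr>"

text \<open>\<open>S\<close> is a norm-closed *-subalgebra of \<open>B(H)\<close>.\<close>

definition concrete_cstar :: "'h::chilbert_space op set \<Rightarrow> bool" where
  "concrete_cstar S \<longleftrightarrow> S \<subseteq> bounded_ops \<and> closed S \<and> subspace S \<and>
     (\<forall>c. \<forall>T\<in>S. op_scale c T \<in> S) \<and> (\<forall>T\<in>S. \<forall>R\<in>S. T o\<^sub>L R \<in> S) \<and> (\<forall>T\<in>S. op_adj T \<in> S)"

definition faithful_rep :: "'a cstar \<Rightarrow> ('a \<Rightarrow> 'h::chilbert_space op) \<Rightarrow> bool" where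
  "faithful_rep A \<pi> \<longleftrightarrow> star_hom A (op_cstar bounded_ops) \<pi> \<and> inj_on \<pi> (cs_carrier A)"


section \<open>Bounded sequences and ultraproducts\<close>

definition free_ultrafilter :: "nat filter \<Rightarrow> bool" where
  "free_ultrafilter \<omega> \<longleftrightarrow> \<omega> \<noteq> bot \<and>
     (\<forall>P. eventually P \<omega> \<or> eventually (\<lambda>n. \<not> P n) \<omega>) \<and> \<omega> \<le> cofinite"

definition linf :: "'a cstar \<Rightarrow> (nat \<Rightarrow> 'a) cstar" where
  "linf A = \<lparr>cs_carrier = {x. (\<forall>n. x n \<in> cs_carrier A) \<and> bdd_above (range (\<lambda>n. cs_norm A (x n)))},
     cs_zero = (\<lambda>_. cs_zero A), cs_add = (\<lambda>x y n. cs_add A (x n) (y n)),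
     cs_scale = (\<lambda>c x n. cs_scale A c (x n)), cs_mult = (\<lambda>x y n. cs_mult A (x n) (y n)),
     cs_star = (\<lambda>x n. cs_star A (x n)), cs_norm = (\<lambda>x. SUP n. cs_norm A (x n))\<rparr>"

definition comega :: "nat filter \<Rightarrow> 'a cstar \<Rightarrow> (nat \<Rightarrow> 'a) set" where
  "comega \<omega> A = {x \<in> cs_carrier (linf A). ((\<lambda>n. cs_norm A (x n)) \<longlongrightarrow> 0) \<omega>}"

definition coset :: "'a cstar \<Rightarrow> 'a set \<Rightarrow> 'a \<Rightarrow> 'a set" where
  "coset A J x = (\<lambda>j. cs_add A x j) ` J"

text \<open>The operations on cosets are unions over representatives, as in \<open>FactRing\<close> of HOL-Algebra;
  for a closed two-sided ideal all sets in such a union coincide.\<close>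

definition quotient_cstar :: "'a cstar \<Rightarrow> 'a set \<Rightarrow> 'a set cstar" where
  "quotient_cstar A J = \<lparr>cs_carrier = coset A J ` cs_carrier A,
     cs_zero = coset A J (cs_zero A),
     cs_add = (\<lambda>X Y. \<Union>x\<in>X. \<Union>y\<in>Y. coset A J (cs_add A x y)),
     cs_scale = (\<lambda>c X. \<Union>x\<in>X. coset A J (cs_scale A c x)),
     cs_mult = (\<lambda>X Y. \<Union>x\<in>X. \<Union>y\<in>Y. coset A J (cs_mult A x y)),
     cs_star = (\<lambda>X. \<Union>x\<in>X. coset A J (cs_star A x)),
     cs_norm = (\<lambda>X. INF x\<in>X. cs_norm A x)\<rparr>"

definition ultraproduct :: "nat filter \<Rightarrow> 'a cstar \<Rightarrow> (nat \<Rightarrow> 'a) set cstar" where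
  "ultraproduct \<omega> A = quotient_cstar (linf A) (comega \<omega> A)"

definition ultra_class :: "nat filter \<Rightarrow> 'a cstar \<Rightarrow> (nat \<Rightarrow> 'a) \<Rightarrow> (nat \<Rightarrow> 'a) set" where
  "ultra_class \<omega> A x = coset (linf A) (comega \<omega> A) x"


section \<open>Actions and reduced crossed products\<close>

text \<open>Discrete groups are types of class \<open>group_add\<close>, which is additive notation for a group that
  need not be commutative.\<close>

definition star_action :: "'a cstar \<Rightarrow> ('g::group_add \<Rightarrow> 'a \<Rightarrow> 'a) \<Rightarrow> bool" where
  "star_action A \<alpha> \<longleftrightarrow>
     (\<forall>g. star_hom A A (\<alpha> g) \<and> bij_betw (\<alpha> g) (cs_carrier A) (cs_carrier A)) \<and>
     (\<forall>a\<in>cs_carrier A. \<alpha> 0 a = a) \<and>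
     (\<forall>g h. \<forall>a\<in>cs_carrier A. \<alpha> (g + h) a = \<alpha> g (\<alpha> h a))"

definition ultra_action ::
  "nat filter \<Rightarrow> 'a cstar \<Rightarrow> ('g \<Rightarrow> 'a \<Rightarrow> 'a) \<Rightarrow> 'g \<Rightarrow> (nat \<Rightarrow> 'a) set \<Rightarrow> (nat \<Rightarrow> 'a) set" where
  "ultra_action \<omega> A \<alpha> g X = (\<Union>x\<in>X. ultra_class \<omega> A (\<lambda>n. \<alpha> g (x n)))"

text \<open>\<open>left_reg s\<close> is \<open>1 \<otimes> \<lambda>\<^sub>s\<close> on \<open>H \<otimes> \<ell>\<^sup>2(\<Gamma>)\<close>, and \<open>\<lambda>\<^sub>s\<close> itself when \<open>H\<close> is \<open>complex\<close>.\<close>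

definition left_reg :: "'g::group_add \<Rightarrow> ('g, 'h::chilbert_space) ell2 op" where
  "left_reg s = Blinfun (\<lambda>f. Abs_ell2 (\<lambda>g. ell2_apply f (- s + g)))"

definition pi_tilde ::
  "('g::group_add \<Rightarrow> 'a \<Rightarrow> 'a) \<Rightarrow> ('a \<Rightarrow> 'h::chilbert_space op) \<Rightarrow> 'a \<Rightarrow> ('g, 'h) ell2 op" where
  "pi_tilde \<alpha> \<pi> a = Blinfun (\<lambda>f. Abs_ell2 (\<lambda>g. blinfun_apply (\<pi> (\<alpha> (- g) a)) (ell2_apply f g)))"

lemma sq_summable_shift: "sq_summable f \<Longrightarrow> sq_summable (\<lambda>g. f (- s + g :: 'g::group_add))"
proof -
  have "bij (\<lambda>g::'g. - s + g)" by (rule bij_plus)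
  then show "sq_summable f \<Longrightarrow> sq_summable (\<lambda>g. f (- s + g))"
    unfolding sq_summable_def
    using summable_on_reindex_bij_betw[of "\<lambda>g. - s + g" UNIV UNIV "\<lambda>g. (norm (f g))\<^sup>2"] by blast
qed

lemma left_reg_apply:
  fixes s g :: "'g::group_add" and f :: "('g, 'h::chilbert_space) ell2"
  shows "ell2_apply (blinfun_apply (left_reg s) f) g = ell2_apply f (- s + g)"
proof -
  define S where "S = (\<lambda>f::('g, 'h) ell2. Abs_ell2 (\<lambda>g. ell2_apply f (- s + g)))"
  have app: "ell2_apply (S f) g = ell2_apply f (- s + g)" for f g
    using sq_summable_shift[OF ell2_apply[of f, simplified]] by (simp add: S_def Abs_ell2_inverse)
  have "norm (S f) = norm f" for f
  proof -
    have "(norm (S f))\<^sup>2 = (norm f)\<^sup>2"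
      unfolding norm_ell2_sq app
      using infsum_reindex_bij_betw[OF bij_plus, of "\<lambda>g. (norm (ell2_apply f g))\<^sup>2" "- s"] by simp
    then show ?thesis by (simp add: power2_eq_iff_nonneg)
  qed
  then have "bounded_linear S"
    by (intro bounded_linear_intro[where K=1])
       (auto simp: ell2_apply_inject[symmetric] fun_eq_iff app plus_ell2.rep_eq scaleR_ell2.rep_eq)
  then show ?thesis unfolding left_reg_def S_def[symmetric] by (simp add: bounded_linear_Blinfun_apply app)
qed

lemma left_reg_delta:
  "blinfun_apply (left_reg s) (tensor_vec \<xi> (delta g)) = tensor_vec \<xi> (delta (s + g))"
proof -
  have "- s + h = g \<longleftrightarrow> h = s + g" for h
    by (metis add.assoc add.left_neutral add.right_inverse add.left_inverse)
  then show ?thesis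
    by (simp add: ell2_apply_inject[symmetric] fun_eq_iff left_reg_apply ell2_apply_tensor_delta)
qed

text \<open>The boundedness assumption below always holds, *-homomorphisms being contractive.\<close>

lemma pi_tilde_apply:
  assumes "\<And>g. norm (\<pi> (\<alpha> (- g) a)) \<le> C"
  shows "ell2_apply (blinfun_apply (pi_tilde \<alpha> \<pi> a) f) g
    = blinfun_apply (\<pi> (\<alpha> (- g) a)) (ell2_apply f g)"
proof -
  define S where "S = (\<lambda>f. Abs_ell2 (\<lambda>g. blinfun_apply (\<pi> (\<alpha> (- g) a)) (ell2_apply f g)))"
  have C: "C \<ge> 0" using assms[of undefined] norm_ge_zero order_trans by blast
  have le: "norm (blinfun_apply (\<pi> (\<alpha> (- g) a)) (ell2_apply f g)) \<le> C * norm (ell2_apply f g)" for f g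
    using norm_blinfun[of "\<pi> (\<alpha> (- g) a)" "ell2_apply f g"]
      mult_right_mono[OF assms[of g], of "norm (ell2_apply f g)"] by simp
  have app: "ell2_apply (S f) g = blinfun_apply (\<pi> (\<alpha> (- g) a)) (ell2_apply f g)" for f g
    using sq_summable_comparison[OF ell2_apply[of f, simplified] le] by (simp add: S_def Abs_ell2_inverse)
  have "norm (S f) \<le> norm f * C" for f
  unfolding S_def
  proof (rule ell2_boundedI(2))
    fix F :: "'a set" assume F: "finite F"
    have "(\<Sum>g\<in>F. (norm (blinfun_apply (\<pi> (\<alpha> (- g) a)) (ell2_apply f g)))\<^sup>2)
        \<le> (\<Sum>g\<in>F. C\<^sup>2 * (norm (ell2_apply f g))\<^sup>2)"
      by (intro sum_mono) (metis le norm_ge_zero power_mono power_mult_distrib)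
    also have "\<dots> \<le> C\<^sup>2 * (norm f)\<^sup>2"
      using mult_left_mono[OF ell2_sum_le[OF F, of f], of "C\<^sup>2"] by (simp add: sum_distrib_left)
    finally show "(\<Sum>g\<in>F. (norm (blinfun_apply (\<pi> (\<alpha> (- g) a)) (ell2_apply f g)))\<^sup>2) \<le> (norm f * C)\<^sup>2"
      by (simp add: power_mult_distrib mult.commute)
  qed (use C in simp)
  then have "bounded_linear S"
    by (intro bounded_linear_intro[where K=C])
       (auto simp: ell2_apply_inject[symmetric] fun_eq_iff app plus_ell2.rep_eq scaleR_ell2.rep_eq
         blinfun.bilinear_simps)
  then show ?thesis unfolding pi_tilde_def S_def[symmetric] by (simp add: bounded_linear_Blinfun_apply app)
qed

lemma pi_tilde_delta:
  assumes "\<And>g. norm (\<pi> (\<alpha> (- g) a)) \<le> C"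
  shows "blinfun_apply (pi_tilde \<alpha> \<pi> a) (tensor_vec \<xi> (delta g))
    = tensor_vec (blinfun_apply (\<pi> (\<alpha> (- g) a)) \<xi>) (delta g)"
  by (auto simp: ell2_apply_inject[symmetric] fun_eq_iff ell2_apply_tensor_delta
      pi_tilde_apply[of \<pi> \<alpha> a C, OF assms])

text \<open>The element \<open>a u\<^sub>s\<close>.\<close>

definition cp_elem ::
  "('g::group_add \<Rightarrow> 'a \<Rightarrow> 'a) \<Rightarrow> ('a \<Rightarrow> 'h::chilbert_space op) \<Rightarrow> 'a \<Rightarrow> 'g \<Rightarrow> ('g, 'h) ell2 op" where
  "cp_elem \<alpha> \<pi> a s = pi_tilde \<alpha> \<pi> a o\<^sub>L left_reg s"

definition crossed_product ::
  "'a cstar \<Rightarrow> ('g::group_add \<Rightarrow> 'a \<Rightarrow> 'a) \<Rightarrow> ('a \<Rightarrow> 'h::chilbert_space op) \<Rightarrow> ('g, 'h) ell2 op cstar" where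
  "crossed_product A \<alpha> \<pi> = op_cstar (closed_cspan {cp_elem \<alpha> \<pi> a s |a s. a \<in> cs_carrier A})"


section \<open>Minimal tensor products and exactness\<close>

text \<open>\<open>a \<otimes> b\<close> on \<open>H \<otimes> \<ell>\<^sup>2(I)\<close>; the elementary tensors span a dense subspace, so the operator is
  unique.\<close>

definition tensor_op :: "'h::chilbert_space op \<Rightarrow> ('i, complex) ell2 op \<Rightarrow> ('i, 'h) ell2 op" where
  "tensor_op a b = (THE R. \<forall>\<xi> v. blinfun_apply R (tensor_vec \<xi> v)
     = tensor_vec (blinfun_apply a \<xi>) (blinfun_apply b v))"

definition min_tensor ::
  "'h::chilbert_space op set \<Rightarrow> ('i, complex) ell2 op set \<Rightarrow> ('i, 'h) ell2 op set" where
  "min_tensor S T = closed_cspan {tensor_op a b |a b. a \<in> S \<and> b \<in> T}"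

text \<open>\<open>induced S T f f'\<close>: the map \<open>f'\<close> is \<open>f \<otimes> id\<^sub>T\<close> on elementary tensors. Together with being
  a *-homomorphism this determines \<open>f'\<close> on \<open>min_tensor S T\<close>.\<close>

definition induced ::
  "'h::chilbert_space op set \<Rightarrow> ('i, complex) ell2 op set \<Rightarrow> ('h op \<Rightarrow> 'k::chilbert_space op) \<Rightarrow>
    (('i, 'h) ell2 op \<Rightarrow> ('i, 'k) ell2 op) \<Rightarrow> bool" where
  "induced S T f f' \<longleftrightarrow> (\<forall>a\<in>S. \<forall>b\<in>T. f' (tensor_op a b) = tensor_op (f a) b)"

text \<open>Exactness of a C*-algebra \<open>T\<close> of operators on \<open>\<ell>\<^sup>2(I)\<close>. HOL cannot quantify over all
  C*-algebras of all types inside a formula; the short exact sequences range over those of C*-algebras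
  of operators on \<open>\<ell>\<^sup>2(\<nat>)\<close>, which up to isomorphism include all short exact sequences of separable
  C*-algebras. This gives the usual notion: if \<open>x\<close> in \<open>A \<otimes> T\<close> lies in the kernel of
  \<open>A \<otimes> T \<rightarrow> A/J \<otimes> T\<close> but not in \<open>J \<otimes> T\<close>, choose a separable \<open>A\<^sub>0 \<subseteq> A\<close> with \<open>x\<close> in \<open>A\<^sub>0 \<otimes> T\<close> and
  put \<open>J\<^sub>0 = A\<^sub>0 \<inter> J\<close>; as \<open>A\<^sub>0/J\<^sub>0 \<otimes> T\<close> embeds into \<open>A/J \<otimes> T\<close>, the same \<open>x\<close> shows that the sequence
  of \<open>J\<^sub>0\<close>, \<open>A\<^sub>0\<close>, \<open>A\<^sub>0/J\<^sub>0\<close> is not preserved either.\<close>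

definition exact_cstar :: "('i, complex) ell2 op set \<Rightarrow> bool" where
  "exact_cstar T \<longleftrightarrow>
     (\<forall>(J :: (nat, complex) ell2 op set) (A :: (nat, complex) ell2 op set)
        (Q :: (nat, complex) ell2 op set) \<iota> \<phi>.
        concrete_cstar J \<and> concrete_cstar A \<and> concrete_cstar Q \<and>
        short_exact (op_cstar J) \<iota> (op_cstar A) \<phi> (op_cstar Q) \<longrightarrow>
        (\<exists>\<iota>' \<phi>'. induced J T \<iota> \<iota>' \<and> induced A T \<phi> \<phi>' \<and>
           short_exact (op_cstar (min_tensor J T)) \<iota>' (op_cstar (min_tensor A T)) \<phi>'
             (op_cstar (min_tensor Q T))))"

definition reduced_group_cstar :: "('g::group_add, complex) ell2 op set" where
  "reduced_group_cstar = closed_cspan (range left_reg)"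

definition exact_group :: "'g::group_add itself \<Rightarrow> bool" where
  "exact_group _ \<longleftrightarrow> exact_cstar (reduced_group_cstar :: ('g, complex) ell2 op set)"

end

theory Submission
  imports Defs
begin

text \<open>The formula prescribes \<open>\<Theta>\<close> on the finite sums \<open>x = \<Sum> [a\<^sub>i]\<^sub>\<omega> u\<^sub>i\<close>: the image is the class of the
  sequence \<open>y\<^sub>n = \<Sum> a\<^sub>i(n) u\<^sub>i\<close>. These pairs form a *-algebra (\<open>poly\<close>), so the theorem amounts to two
  estimates: the norm of the class of \<open>y\<close> is bounded by a multiple of the norm of \<open>x\<close>, whence \<open>\<Theta>\<close> is well
  defined and extends to the closure (locale \<open>bounded_graph\<close>), and no nonzero element of the closure
  is mapped to \<open>0\<close>. Only the existence of some universal constants matters; none of them is optimal.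

  Injectivity is visible on matrix entries (\<open>norm_entry_poly_le\<close>). The entries of \<open>x\<close> with respect to
  \<open>H \<otimes> \<ell>\<^sup>2(\<Gamma>)\<close> lie in the image of the ultraproduct, and those of \<open>y\<^sub>n\<close> represent them. The
  latter are at most as large as \<open>y\<^sub>n\<close>, so the former are small if \<open>y\<^sub>n\<close> is small for almost all \<open>n\<close>; this
  passes to the closure, where an operator without nonzero entries is \<open>0\<close>.

  For the upper bound the same entries give a partial result (\<open>matrix_bound\<close>): every finite matrix over
  the ultraproduct is represented by matrices whose norms are, for almost all \<open>n\<close>, bounded by a multiple
  of its norm. The set of these \<open>n\<close> depends on the matrix, however, and the norm of \<open>y\<^sub>n\<close> is
  seen on vectors of finite support only if that support may vary with \<open>n\<close>. Closing this gap is what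
  exactness is for (\<open>exactness_uniform\<close>). Fell's absorption principle replaces \<open>y\<^sub>n\<close> by the operator
  \<open>X\<^sub>n = \<Sum> c\<^sub>i(n) \<otimes> \<lambda>\<^sub>i\<close> with \<open>c\<^sub>i(n) = a\<^sub>i(n) u\<^sub>i\<close>, whose second factors lie in the reduced group
  C*-algebra \<open>C*\<^sub>r(\<Gamma>)\<close>. Let \<open>D\<close> be the C*-algebra generated by the block
  diagonal operators with blocks \<open>c\<^sub>i(n)\<close>, \<open>n \<in> \<nat>\<close>, arranged so that each of its elements has a
  *-strong limit along \<open>\<omega>\<close>; let \<open>\<phi>\<close> map an element to its limit and let \<open>J\<close> be the kernel of \<open>\<phi>\<close>. On
  a limit operator the partial result suffices, since a vector of fixed finite support sees only finitely
  many coordinates; so the image of \<open>\<Sum> c\<^sub>i \<otimes> \<lambda>\<^sub>i\<close> under \<open>\<phi> \<otimes> id\<close> has norm at most \<open>K\<close>. By exactness the kernel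
  of \<open>\<phi> \<otimes> id\<close> is \<open>J \<otimes> C*\<^sub>r(\<Gamma>)\<close>, hence \<open>\<Sum> c\<^sub>i \<otimes> \<lambda>\<^sub>i\<close> is the sum of an operator of norm at most \<open>800 K\<close> and of an
  element of \<open>J \<otimes> C*\<^sub>r(\<Gamma>)\<close>. The blocks of elements of \<open>J\<close> tend to \<open>0\<close> in norm (\<open>kernel_vanishes\<close>), so the
  second summand does not contribute in the limit.

  Two things make \<open>D\<close> possible. The operators \<open>c\<^sub>i(n)\<close> act on an arbitrary Hilbert space, so they are
  compressed to \<open>\<ell>\<^sup>2(\<nat>)\<close> along an orthonormal system obtained from the vectors \<open>w \<xi>\<close>, where \<open>w\<close> runs through
  the words in the \<open>c\<^sub>i(n)\<close> and their adjoints and \<open>\<xi>\<close> through countably many vectors. Orthonormalising in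
  an order that does not depend on \<open>n\<close> bounds the supports of the matrix columns uniformly in \<open>n\<close>, which
  turns weak limits into strong ones. Choosing among the \<open>\<xi>\<close> nearly norming vectors for a
  countable dense set of elements of \<open>D\<close> ensures that \<open>\<phi>\<close> detects the norms of the blocks.

  Finally, square roots \<open>\<surd>(1 - a)\<close> of small perturbations of the unit are the only functional calculus
  used. They give the continuity of *-homomorphisms, the closedness of their ranges (through an explicit
  \<open>sin (M arcsin a)\<close>, see \<open>approximate_lift_selfadjoint\<close>) and the bound for finite matrices.\<close>

section \<open>Adjoints\<close>

instance chilbert_space \<subseteq> banach ..

lemma cinner_add_right: "cinner x (y + z) = cinner x y + cinner x (z::'a::chilbert_space)"
  by (metis cinner_add_left cinner_commute complex_cnj_add)

lemma cinner_zero_left [simp]: "cinner 0 (y::'a::chilbert_space) = 0"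
  by (metis cinner_scaleC_left mult_zero_left scaleC_zero_left)

lemma cinner_zero_right [simp]: "cinner (y::'a::chilbert_space) 0 = 0"
  by (metis cinner_commute cinner_zero_left complex_cnj_zero)

lemma scaleC_minus1: "(- 1) *\<^sub>C x = - (x::'a::chilbert_space)"
  using scaleR_scaleC[of "-1" x] by simp

lemma cinner_minus_left: "cinner (- x) (y::'a::chilbert_space) = - cinner x y"
  by (metis cinner_scaleC_left mult_minus1 scaleC_minus1)

lemma cinner_minus_right: "cinner x (- (y::'a::chilbert_space)) = - cinner x y"
  by (metis cinner_commute cinner_minus_left complex_cnj_minus)

lemma cinner_diff_left: "cinner (x - y) (z::'a::chilbert_space) = cinner x z - cinner y z"
  using cinner_add_left[of x "-y" z] by (simp add: cinner_minus_left)

lemma cinner_diff_right: "cinner x (y - z) = cinner x y - cinner x (z::'a::chilbert_space)"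
  using cinner_add_right[of x y "-z"] by (simp add: cinner_minus_right)

lemma cinner_sum_left: "cinner (sum f I) (y::'a::chilbert_space) = (\<Sum>i\<in>I. cinner (f i) y)"
  by (induction I rule: infinite_finite_induct) (auto simp: cinner_add_left)

lemma cinner_sum_right: "cinner (y::'a::chilbert_space) (sum f I) = (\<Sum>i\<in>I. cinner y (f i))"
  by (induction I rule: infinite_finite_induct) (auto simp: cinner_add_right)

lemma scaleC_sum_right: "c *\<^sub>C (sum f I :: 'a::chilbert_space) = (\<Sum>i\<in>I. c *\<^sub>C f i)"
  by (induction I rule: infinite_finite_induct) (auto simp: scaleC_add_right)

lemma scaleC_diff_right: "c *\<^sub>C (x - y :: 'a::chilbert_space) = c *\<^sub>C x - c *\<^sub>C y"
  by (metis add_diff_cancel_right' diff_add_cancel scaleC_add_right)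

lemma scaleC_scaleR_commute: "c *\<^sub>C r *\<^sub>R (x :: 'a::chilbert_space) = r *\<^sub>R c *\<^sub>C x"
  by (simp add: scaleR_scaleC scaleC_scaleC mult.commute)

lemma Im_cinner: "Im (cinner x y) = - ((\<i> *\<^sub>C x) \<bullet> (y::'a::chilbert_space))"
  by (simp add: inner_cinner cinner_scaleC_left)

lemma cinner_eqI: "(\<And>x. cinner x y = cinner x z) \<Longrightarrow> y = (z::'a::chilbert_space)"
proof -
  assume "\<And>x. cinner x y = cinner x z"
  then have "(y - z) \<bullet> (y - z) = 0" by (simp add: inner_cinner cinner_diff_right)
  then show ?thesis by simp
qed

lemma bounded_linear_cinner_left: "bounded_linear (\<lambda>x. cinner x (y::'a::chilbert_space))"
  by (rule bounded_linear_intro[where K="2 * norm y"])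
     (use cmod_cinner_le[of _ y] in \<open>auto simp: cinner_add_left scaleR_scaleC cinner_scaleC_left
        scaleC_complex_def ac_simps scaleR_conv_of_real\<close>)

lemma tendsto_cinner_left: "(f \<longlongrightarrow> l) F \<Longrightarrow> ((\<lambda>n. cinner (f n) (y::'a::chilbert_space)) \<longlongrightarrow> cinner l y) F"
  by (rule bounded_linear.tendsto[OF bounded_linear_cinner_left])

lemma tendsto_cinner_right:
  assumes "(f \<longlongrightarrow> l) F" shows "((\<lambda>n. cinner (y::'a::chilbert_space) (f n)) \<longlongrightarrow> cinner y l) F"
  using tendsto_cnj[OF tendsto_cinner_left[OF assms, of y]] by (simp add: cinner_commute[symmetric])

text \<open>Minimise \<open>\<parallel>x\<parallel>\<^sup>2 / 2 - f x\<close>: by the parallelogram law a minimising sequence is Cauchy, and the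
  first variation at its limit vanishes.\<close>

lemma riesz_representation:
  fixes f :: "'a::{real_inner, complete_space} \<Rightarrow> real"
  assumes "bounded_linear f"
  shows "\<exists>z. \<forall>x. f x = x \<bullet> z"
proof -
  interpret f: bounded_linear f by fact
  define q where "q x = (norm x)\<^sup>2 / 2 - f x" for x
  obtain K where K: "\<And>x. norm (f x) \<le> norm x * K" using f.bounded by blast
  have low: "q x \<ge> - (K\<^sup>2 / 2)" for x
  proof -
    have "f x \<le> norm x * K" using K[of x] by simp
    moreover have "0 \<le> (norm x - K)\<^sup>2" by simp
    ultimately show ?thesis unfolding q_def by (simp add: power2_diff)
  qed
  define m where "m = (INF x. q x)"
  have bdd: "bdd_below (range q)" by (rule bdd_belowI[of _ "- (K\<^sup>2 / 2)"]) (use low in auto)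
  have m: "m \<le> q x" for x unfolding m_def by (rule cINF_lower[OF bdd]) simp
  have "\<exists>x. q x < m + 1 / (real n + 1)" for n
  proof -
    have "(INF x. q x) < m + 1 / (real n + 1)" unfolding m_def by simp
    from cInf_lessD[OF _ this] show ?thesis by auto
  qed
  then obtain X where X: "\<And>n. q (X n) < m + 1 / (real n + 1)" by metis
  have par: "(norm (x - y))\<^sup>2 \<le> 4 * (q x - m) + 4 * (q y - m)" for x y
  proof -
    have "q ((1/2) *\<^sub>R (x + y)) = (norm (x + y))\<^sup>2 / 8 - (f x + f y) / 2"
      by (simp add: q_def f.scaleR f.add power_mult_distrib power_divide)
    moreover have "(norm (x + y))\<^sup>2 + (norm (x - y))\<^sup>2 = 2 * (norm x)\<^sup>2 + 2 * (norm y)\<^sup>2"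
      by (simp add: power2_norm_eq_inner inner_add_left inner_add_right inner_diff_left inner_diff_right)
    moreover have "m \<le> q ((1/2) *\<^sub>R (x + y))" by (rule m)
    ultimately show ?thesis unfolding q_def by (simp add: field_simps)
  qed
  have "Cauchy X"
  proof (rule CauchyI)
    fix e :: real assume e: "e > 0"
    obtain M :: nat where M: "8 / e\<^sup>2 < real M" using reals_Archimedean2 by blast
    have "norm (X i - X j) < e" if "i \<ge> M" "j \<ge> M" for i j
    proof -
      have le: "q (X i) - m < e\<^sup>2 / 8" if "i \<ge> M" for i
      proof -
        have "8 / e\<^sup>2 < real i + 1" using M that by linarith
        then have "1 / (real i + 1) < e\<^sup>2 / 8" using e by (simp add: field_simps)
        then show ?thesis using X[of i] by linarith
      qed
      have "(norm (X i - X j))\<^sup>2 < e\<^sup>2" using par[of "X i" "X j"] le[OF that(1)] le[OF that(2)] by argo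
      then show ?thesis using e by (simp add: power_less_imp_less_base)
    qed
    then show "\<exists>M. \<forall>i\<ge>M. \<forall>j\<ge>M. norm (X i - X j) < e" by blast
  qed
  then obtain z where z: "X \<longlonglongrightarrow> z" using Cauchy_convergent convergent_def by blast
  have "(\<lambda>n. q (X n)) \<longlonglongrightarrow> q z"
    unfolding q_def by (intro tendsto_intros z f.tendsto) auto
  moreover have "(\<lambda>n. m + 1 / (real n + 1)) \<longlonglongrightarrow> m + 0"
    by (intro tendsto_intros) (use LIMSEQ_inverse_real_of_nat in \<open>simp add: inverse_eq_divide add.commute\<close>)
  ultimately have "q z \<le> m + 0" by (rule LIMSEQ_le) (use X less_imp_le in blast)
  then have min: "q z \<le> q x" for x using m[of x] by simp
  have "f x = x \<bullet> z" for x
  proof (rule ccontr)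
    define d where "d = x \<bullet> z - f x"
    assume "f x \<noteq> x \<bullet> z"
    then have d: "d \<noteq> 0" by (simp add: d_def)
    have *: "0 \<le> t * d + t\<^sup>2 * (norm x)\<^sup>2 / 2" for t
    proof -
      have "q (z + t *\<^sub>R x) = q z + t * d + t\<^sup>2 * (norm x)\<^sup>2 / 2"
        unfolding q_def d_def f.add f.scaleR power2_norm_eq_inner
        by (simp add: inner_add_left inner_add_right inner_commute[of z x] algebra_simps power2_eq_square)
      then show ?thesis using min[of "z + t *\<^sub>R x"] by simp
    qed
    define N where "N = (norm x)\<^sup>2 + 1"
    have N: "N > 0" "(norm x)\<^sup>2 \<le> N" unfolding N_def by (auto intro: add_nonneg_pos)
    have "0 \<le> (- d / N) * d + (- d / N)\<^sup>2 * (norm x)\<^sup>2 / 2" by (rule *)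
    also have "\<dots> \<le> (- d / N) * d + (- d / N)\<^sup>2 * N / 2"
      using N by (intro add_left_mono divide_right_mono mult_left_mono) auto
    also have "\<dots> = - (d\<^sup>2 / N) / 2" using N by (simp add: field_simps power2_eq_square)
    also have "\<dots> < 0" using N d by simp
    finally show False by simp
  qed
  then show ?thesis by blast
qed

lemma adjoint_exists:
  fixes T :: "'a::chilbert_space \<Rightarrow>\<^sub>L 'b::chilbert_space"
  assumes lin: "\<And>c x. blinfun_apply T (c *\<^sub>C x) = c *\<^sub>C blinfun_apply T x"
  shows "\<exists>S. \<forall>x y. cinner (blinfun_apply T x) y = cinner x (blinfun_apply S y)"
proof -
  have "\<exists>z. \<forall>x. blinfun_apply T x \<bullet> y = x \<bullet> z" for y
    by (rule riesz_representation)
       (rule bounded_linear_compose[OF bounded_linear_inner_left blinfun.bounded_linear_right])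
  then obtain S where S: "\<And>x y. blinfun_apply T x \<bullet> y = x \<bullet> S y" by metis
  have eqI: "u = v" if "\<And>x. x \<bullet> u = x \<bullet> v" for u v :: 'a
    using that[of "u - v"] by (metis inner_diff_right inner_eq_zero_iff right_minus_eq)
  have "bounded_linear S"
  proof (rule bounded_linear_intro[where K="norm T"])
    show "S (x + y) = S x + S y" for x y
      by (rule eqI) (metis S inner_add_right)
    show "S (r *\<^sub>R x) = r *\<^sub>R S x" for r x
      by (rule eqI) (metis S inner_scaleR_right)
    show "norm (S y) \<le> norm y * norm T" for y
    proof (cases "S y = 0")
      case False
      have "(norm (S y))\<^sup>2 = blinfun_apply T (S y) \<bullet> y" by (simp add: S power2_norm_eq_inner)
      also have "\<dots> \<le> norm (blinfun_apply T (S y)) * norm y" by (rule norm_cauchy_schwarz)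
      also have "\<dots> \<le> norm T * norm (S y) * norm y" by (intro mult_right_mono norm_blinfun) auto
      finally show ?thesis using False by (simp add: power2_eq_square ac_simps)
    qed simp
  qed
  moreover have "cinner (blinfun_apply T x) y = cinner x (S y)" for x y
    by (simp add: complex_eq_iff inner_cinner[symmetric] Im_cinner S lin[symmetric])
  ultimately show ?thesis by (metis bounded_linear_Blinfun_apply)
qed

lemma op_adjI:
  assumes "\<And>x y. cinner (blinfun_apply T x) y = cinner x (blinfun_apply S y)"
  shows "op_adj T = S"
  unfolding op_adj_def
proof (rule the_equality)
  show "S' = S" if "\<forall>x y. cinner (blinfun_apply T x) y = cinner x (blinfun_apply S' y)" for S'
    by (rule blinfun_eqI, rule cinner_eqI) (metis assms that)
qed (use assms in blast)

lemma bounded_opsD: "T \<in> bounded_ops \<Longrightarrow> blinfun_apply T (c *\<^sub>C x) = c *\<^sub>C blinfun_apply T x"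
  by (simp add: bounded_ops_def)

lemma op_adj_cinner:
  assumes "T \<in> bounded_ops"
  shows "cinner (blinfun_apply T x) y = cinner x (blinfun_apply (op_adj T) y)"
  using adjoint_exists[of T] bounded_opsD[OF assms] op_adjI by metis

lemma op_adj_cinner':
  assumes "T \<in> bounded_ops"
  shows "cinner (blinfun_apply (op_adj T) x) y = cinner x (blinfun_apply T y)"
  by (metis assms cinner_commute op_adj_cinner)

lemma op_adj_inner: "T \<in> bounded_ops \<Longrightarrow> blinfun_apply T x \<bullet> y = x \<bullet> blinfun_apply (op_adj T) y"
  by (simp add: inner_cinner op_adj_cinner)

lemma op_adj_in [simp]: assumes "T \<in> bounded_ops" shows "op_adj T \<in> bounded_ops"
  unfolding bounded_ops_def
proof (intro CollectI allI, rule cinner_eqI)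
  fix c x y
  have "cinner y (blinfun_apply (op_adj T) (c *\<^sub>C x)) = cinner (blinfun_apply T y) (c *\<^sub>C x)"
    by (simp add: op_adj_cinner[OF assms])
  also have "\<dots> = cinner y (c *\<^sub>C blinfun_apply (op_adj T) x)"
    by (simp add: cinner_scaleC_right op_adj_cinner[OF assms])
  finally show "cinner y (blinfun_apply (op_adj T) (c *\<^sub>C x)) = cinner y (c *\<^sub>C blinfun_apply (op_adj T) x)" .
qed

lemma op_adj_adj [simp]: "T \<in> bounded_ops \<Longrightarrow> op_adj (op_adj T) = T"
  by (rule op_adjI) (simp add: op_adj_cinner')

lemma bounded_ops_zero [simp]: "0 \<in> bounded_ops" by (simp add: bounded_ops_def)
lemma bounded_ops_id [simp]: "id_blinfun \<in> bounded_ops" by (simp add: bounded_ops_def)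
lemma bounded_ops_add [simp]: "S \<in> bounded_ops \<Longrightarrow> T \<in> bounded_ops \<Longrightarrow> S + T \<in> bounded_ops"
  by (simp add: bounded_ops_def blinfun.add_left scaleC_add_right)
lemma bounded_ops_diff [simp]: "S \<in> bounded_ops \<Longrightarrow> T \<in> bounded_ops \<Longrightarrow> S - T \<in> bounded_ops"
  by (simp add: bounded_ops_def blinfun.diff_left scaleC_diff_right)
lemma bounded_ops_scaleR [simp]: "T \<in> bounded_ops \<Longrightarrow> r *\<^sub>R T \<in> bounded_ops"
  by (simp add: bounded_ops_def blinfun.scaleR_left scaleC_scaleR_commute)
lemma bounded_ops_scale [simp]: "T \<in> bounded_ops \<Longrightarrow> op_scale c T \<in> bounded_ops"
  by (simp add: bounded_ops_def op_scale_apply scaleC_scaleC mult.commute)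
lemma bounded_ops_comp [simp]: "S \<in> bounded_ops \<Longrightarrow> T \<in> bounded_ops \<Longrightarrow> S o\<^sub>L T \<in> bounded_ops"
  by (simp add: bounded_ops_def)
lemma bounded_ops_sum [simp]: "(\<And>i. i \<in> I \<Longrightarrow> f i \<in> bounded_ops) \<Longrightarrow> sum f I \<in> bounded_ops"
  by (induction I rule: infinite_finite_induct) auto

lemma op_adj_zero [simp]: "op_adj 0 = 0" by (rule op_adjI) simp
lemma op_adj_id [simp]: "op_adj id_blinfun = id_blinfun" by (rule op_adjI) simp
lemma op_adj_add: "S \<in> bounded_ops \<Longrightarrow> T \<in> bounded_ops \<Longrightarrow> op_adj (S + T) = op_adj S + op_adj T"
  by (rule op_adjI) (simp add: blinfun.add_left cinner_add_left cinner_add_right op_adj_cinner)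
lemma op_adj_diff: "S \<in> bounded_ops \<Longrightarrow> T \<in> bounded_ops \<Longrightarrow> op_adj (S - T) = op_adj S - op_adj T"
  by (rule op_adjI) (simp add: blinfun.diff_left cinner_diff_left cinner_diff_right op_adj_cinner)
lemma op_adj_uminus: "T \<in> bounded_ops \<Longrightarrow> op_adj (- T) = - op_adj T"
  by (rule op_adjI) (simp add: blinfun.minus_left cinner_minus_left cinner_minus_right op_adj_cinner)
lemma op_adj_scale: "T \<in> bounded_ops \<Longrightarrow> op_adj (op_scale c T) = op_scale (cnj c) (op_adj T)"
  by (rule op_adjI) (simp add: op_scale_apply cinner_scaleC_left cinner_scaleC_right op_adj_cinner)
lemma scaleR_op_scale: "r *\<^sub>R T = op_scale (of_real r) T"
  by (rule blinfun_eqI) (simp add: op_scale_apply blinfun.scaleR_left scaleR_scaleC)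
lemma op_adj_scaleR: "T \<in> bounded_ops \<Longrightarrow> op_adj (r *\<^sub>R T) = r *\<^sub>R op_adj T"
  by (simp add: scaleR_op_scale op_adj_scale)
lemma op_adj_comp: "S \<in> bounded_ops \<Longrightarrow> T \<in> bounded_ops \<Longrightarrow> op_adj (S o\<^sub>L T) = op_adj T o\<^sub>L op_adj S"
  by (rule op_adjI) (simp add: op_adj_cinner)

lemma norm_op_adj_le: assumes "T \<in> bounded_ops" shows "norm (op_adj T) \<le> norm T"
proof (rule norm_blinfun_bound)
  fix y
  let ?S = "blinfun_apply (op_adj T) y"
  show "norm ?S \<le> norm T * norm y"
  proof (cases "?S = 0")
    case False
    have "(norm ?S)\<^sup>2 = blinfun_apply T ?S \<bullet> y" by (simp add: op_adj_inner[OF assms] power2_norm_eq_inner)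
    also have "\<dots> \<le> norm (blinfun_apply T ?S) * norm y" by (rule norm_cauchy_schwarz)
    also have "\<dots> \<le> norm T * norm ?S * norm y" by (intro mult_right_mono norm_blinfun) auto
    finally have "norm ?S * norm ?S \<le> (norm T * norm y) * norm ?S" by (simp only: power2_eq_square ac_simps)
    then show ?thesis by (rule mult_right_le_imp_le) (use False in simp)
  qed simp
qed simp

lemma norm_op_adj [simp]: "T \<in> bounded_ops \<Longrightarrow> norm (op_adj T) = norm T"
  by (rule order_antisym) (use norm_op_adj_le[of T] norm_op_adj_le[OF op_adj_in[of T]] in simp_all)

lemma norm_adj_comp:
  assumes "T \<in> bounded_ops" shows "norm (op_adj T o\<^sub>L T) = (norm T)\<^sup>2"
proof (rule antisym)
  show "norm (op_adj T o\<^sub>L T) \<le> (norm T)\<^sup>2"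
    using norm_blinfun_compose[of "op_adj T" T] assms by (simp add: power2_eq_square)
  have "norm T \<le> sqrt (norm (op_adj T o\<^sub>L T))"
  proof (rule norm_blinfun_bound)
    fix x
    have "(norm (blinfun_apply T x))\<^sup>2 = x \<bullet> blinfun_apply (op_adj T o\<^sub>L T) x"
      by (simp add: power2_norm_eq_inner op_adj_inner[OF assms])
    also have "\<dots> \<le> norm x * norm (blinfun_apply (op_adj T o\<^sub>L T) x)" by (rule norm_cauchy_schwarz)
    also have "\<dots> \<le> norm x * (norm (op_adj T o\<^sub>L T) * norm x)" by (intro mult_left_mono norm_blinfun) auto
    also have "\<dots> = (sqrt (norm (op_adj T o\<^sub>L T)) * norm x)\<^sup>2" by (simp add: power_mult_distrib power2_eq_square)
    finally show "norm (blinfun_apply T x) \<le> sqrt (norm (op_adj T o\<^sub>L T)) * norm x"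
      by (rule power2_le_imp_le) simp
  qed simp
  then show "(norm T)\<^sup>2 \<le> norm (op_adj T o\<^sub>L T)"
    by (metis norm_ge_zero power_mono real_sqrt_pow2)
qed

lemma norm_op_scale: "norm (op_scale c T) = cmod c * norm (T :: 'h::chilbert_space op)"
proof (rule antisym)
  have le: "norm (op_scale c T) \<le> cmod c * norm T" for c and T :: "'h op"
  proof (rule norm_blinfun_bound)
    show "norm (blinfun_apply (op_scale c T) x) \<le> cmod c * norm T * norm x" for x
      using mult_left_mono[OF norm_blinfun[of T x], of "cmod c"] by (simp add: op_scale_apply norm_scaleC ac_simps)
  qed simp
  show "norm (op_scale c T) \<le> cmod c * norm T" by (rule le)
  show "cmod c * norm T \<le> norm (op_scale c T)"
  proof (cases "c = 0")
    case False
    have "op_scale (1 / c) (op_scale c T) = T"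
      using False by (intro blinfun_eqI) (simp add: op_scale_apply scaleC_scaleC)
    then have "norm T \<le> cmod (1 / c) * norm (op_scale c T)" by (metis le)
    then show ?thesis using False by (simp add: norm_divide field_simps)
  qed simp
qed

lemma op_scale_add: "op_scale c (S + T) = op_scale c S + op_scale c T"
  by (rule blinfun_eqI) (simp add: op_scale_apply blinfun.add_left scaleC_add_right)
lemma op_scale_add_left: "op_scale (c + d) T = op_scale c T + op_scale d T"
  by (rule blinfun_eqI) (simp add: op_scale_apply blinfun.add_left scaleC_add_left)
lemma op_scale_scale: "op_scale c (op_scale d T) = op_scale (c * d) T"
  by (rule blinfun_eqI) (simp add: op_scale_apply scaleC_scaleC)
lemma op_scale_one [simp]: "op_scale 1 T = T"
  by (rule blinfun_eqI) (simp add: op_scale_apply)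
lemma op_scale_zero [simp]: "op_scale c 0 = 0"
  by (rule blinfun_eqI) (simp add: op_scale_apply)
lemma op_scale_zero_left [simp]: "op_scale 0 T = 0"
  by (rule blinfun_eqI) (simp add: op_scale_apply)
lemma op_scale_minus1: "op_scale (- 1) T = - T"
  by (rule blinfun_eqI) (simp add: op_scale_apply blinfun.minus_left scaleC_minus1)
lemma op_scale_scaleR: "op_scale c (r *\<^sub>R T) = r *\<^sub>R op_scale c T"
  by (simp add: scaleR_op_scale op_scale_scale mult.commute)
lemma op_scale_comp_left: "op_scale c S o\<^sub>L T = op_scale c (S o\<^sub>L T)"
  by (rule blinfun_eqI) (simp add: op_scale_apply)
lemma op_scale_comp_right: "S \<in> bounded_ops \<Longrightarrow> S o\<^sub>L op_scale c T = op_scale c (S o\<^sub>L T)"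
  by (rule blinfun_eqI) (simp add: op_scale_apply bounded_opsD)

lemmas comp_add_left = bounded_bilinear.add_left[OF bounded_bilinear_blinfun_compose]
lemmas comp_add_right = bounded_bilinear.add_right[OF bounded_bilinear_blinfun_compose]
lemmas comp_diff_left = bounded_bilinear.diff_left[OF bounded_bilinear_blinfun_compose]
lemmas comp_diff_right = bounded_bilinear.diff_right[OF bounded_bilinear_blinfun_compose]
lemmas comp_minus_left = bounded_bilinear.minus_left[OF bounded_bilinear_blinfun_compose]
lemmas comp_minus_right = bounded_bilinear.minus_right[OF bounded_bilinear_blinfun_compose]
lemmas comp_scaleR_left = bounded_bilinear.scaleR_left[OF bounded_bilinear_blinfun_compose]
lemmas comp_scaleR_right = bounded_bilinear.scaleR_right[OF bounded_bilinear_blinfun_compose]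
lemmas comp_zero_left = bounded_bilinear.zero_left[OF bounded_bilinear_blinfun_compose]
lemmas comp_zero_right = bounded_bilinear.zero_right[OF bounded_bilinear_blinfun_compose]

lemma comp_assoc: "(S o\<^sub>L T) o\<^sub>L R = S o\<^sub>L (T o\<^sub>L R)" by (rule blinfun_eqI) simp
lemma comp_id [simp]: "T o\<^sub>L id_blinfun = T" "id_blinfun o\<^sub>L T = T" by (auto intro: blinfun_eqI)

lemma bounded_linear_op_scale: "bounded_linear (op_scale c :: 'h::chilbert_space op \<Rightarrow> _)"
  by (rule bounded_linear_intro[where K="cmod c"])
     (auto simp: op_scale_add op_scale_scaleR norm_op_scale)

lemma closed_bounded_ops: "closed (bounded_ops :: 'h::chilbert_space op set)"
proof -
  have "bounded_ops = (\<Inter>c. \<Inter>x. {T :: 'h op. blinfun_apply T (c *\<^sub>C x) - blinfun_apply (op_scale c T) x = 0})"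
    by (auto simp: bounded_ops_def op_scale_apply)
  also have "closed \<dots>"
    by (intro closed_INT ballI closed_Collect_eq continuous_intros
        bounded_linear.continuous_on[OF bounded_linear_op_scale] continuous_on_id)
  finally show ?thesis .
qed

lemma tendsto_op_adj:
  assumes "(f \<longlongrightarrow> T) F" "\<And>n. f n \<in> bounded_ops" "T \<in> bounded_ops"
  shows "((\<lambda>n. op_adj (f n)) \<longlongrightarrow> op_adj T) F"
proof -
  have "((\<lambda>n. norm (f n - T)) \<longlongrightarrow> 0) F"
    by (rule tendsto_norm_zero, rule LIM_zero, rule assms(1))
  then have "((\<lambda>n. norm (op_adj (f n) - op_adj T)) \<longlongrightarrow> 0) F"
    using assms(2,3) by (simp add: op_adj_diff[symmetric])
  then show ?thesis by (rule LIM_zero_cancel[OF tendsto_norm_zero_cancel])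
qed

section \<open>Concrete C*-algebras\<close>

lemma concrete_cstarD:
  assumes "concrete_cstar S"
  shows "S \<subseteq> bounded_ops" "closed S" "subspace S" "0 \<in> S"
    "x \<in> S \<Longrightarrow> y \<in> S \<Longrightarrow> x + y \<in> S" "x \<in> S \<Longrightarrow> y \<in> S \<Longrightarrow> x - y \<in> S" "x \<in> S \<Longrightarrow> op_scale c x \<in> S"
    "x \<in> S \<Longrightarrow> y \<in> S \<Longrightarrow> x o\<^sub>L y \<in> S" "x \<in> S \<Longrightarrow> op_adj x \<in> S" "x \<in> S \<Longrightarrow> x \<in> bounded_ops"
  using assms subspace_add[of S x y] subspace_diff[of S x y] subspace_0[of S]
  unfolding concrete_cstar_def by (simp_all add: subset_iff)

lemma cstar_algebra_op_cstar:
  assumes "concrete_cstar S" shows "cstar_algebra (op_cstar S)"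
proof -
  note D = concrete_cstarD[OF assms]
  have diff: "cs_diff (op_cstar S) x y = x - y" for x y
    by (simp add: cs_diff_def op_cstar_def op_scale_minus1)
  note ops = op_cstar_def diff D op_scale_add op_scale_add_left op_scale_scale op_scale_minus1 comp_assoc
      comp_add_left comp_add_right op_scale_comp_left op_scale_comp_right op_adj_add op_adj_scale
      op_adj_comp norm_triangle_ineq norm_op_scale norm_adj_comp norm_blinfun_compose
  show ?thesis
  proof
    show "cs_add (op_cstar S) x y = cs_add (op_cstar S) y x" for x y
      by (simp add: op_cstar_def add.commute)
    fix X :: "nat \<Rightarrow> 'a op"
    assume "\<And>n. X n \<in> cs_carrier (op_cstar S)"
      and "\<forall>e>0. \<exists>N. \<forall>m\<ge>N. \<forall>n\<ge>N. cs_norm (op_cstar S) (cs_diff (op_cstar S) (X m) (X n)) < e"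
    then have X: "\<And>n. X n \<in> S" and C: "\<forall>e>0. \<exists>N. \<forall>m\<ge>N. \<forall>n\<ge>N. norm (X m - X n) < e"
      unfolding diff by (simp_all add: op_cstar_def)
    have "Cauchy X" by (rule CauchyI) (simp add: C)
    then obtain x where x: "X \<longlonglongrightarrow> x" using Cauchy_convergent convergent_def by blast
    have "x \<in> S" by (rule closed_sequentially[OF D(2) X x])
    moreover have "(\<lambda>n. norm (X n - x)) \<longlonglongrightarrow> 0" by (rule tendsto_norm_zero, rule LIM_zero, rule x)
    ultimately show "\<exists>x\<in>cs_carrier (op_cstar S). (\<lambda>n. cs_norm (op_cstar S) (cs_diff (op_cstar S) (X n) x)) \<longlonglongrightarrow> 0"
      unfolding diff by (auto simp: op_cstar_def)
  qed (unfold diff, simp_all add: ops)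
qed

notation blinfun_compose (infixl "\<odot>" 70)

lemma op_scale_diff: "op_scale c (S - T) = op_scale c S - op_scale c T"
  by (rule blinfun_eqI) (simp add: op_scale_apply blinfun.diff_left scaleC_diff_right)

lemma closure_seqE:
  fixes x :: "'a::metric_space"
  assumes "x \<in> closure S"
  obtains X where "\<And>n. X n \<in> S" "X \<longlonglongrightarrow> x"
  using assms unfolding closure_sequential by auto

lemma subspace_closure:
  fixes S :: "'a::real_normed_vector set"
  assumes "subspace S" shows "subspace (closure S)"
  unfolding subspace_def
proof (intro conjI ballI allI)
  show "0 \<in> closure S" using closure_subset subspace_0[OF assms] by (rule subsetD)
next
  fix x y assume "x \<in> closure S" "y \<in> closure S"
  then obtain X Y where "\<And>n. X n \<in> S" "X \<longlonglongrightarrow> x" "\<And>n. Y n \<in> S" "Y \<longlonglongrightarrow> y"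
    unfolding closure_sequential by metis
  then show "x + y \<in> closure S" unfolding closure_sequential
    by (intro exI[of _ "\<lambda>n. X n + Y n"]) (simp add: tendsto_add subspace_add[OF assms])
next
  fix c :: real and x assume "x \<in> closure S"
  then obtain X where "\<And>n. X n \<in> S" "X \<longlonglongrightarrow> x" unfolding closure_sequential by metis
  then show "c *\<^sub>R x \<in> closure S" unfolding closure_sequential
    by (intro exI[of _ "\<lambda>n. c *\<^sub>R X n"]) (simp add: tendsto_scaleR subspace_scale[OF assms])
qed

lemma closed_cspan_subset:
  assumes "G \<subseteq> K" "closed K" "subspace K" "\<And>c T. T \<in> G \<Longrightarrow> op_scale c T \<in> K"
  shows "closed_cspan G \<subseteq> K"
  unfolding closed_cspan_def
  by (intro closure_minimal span_minimal) (use assms in auto)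

lemma closed_cspan_base: "T \<in> G \<Longrightarrow> T \<in> closed_cspan G"
  unfolding closed_cspan_def
  by (rule subsetD[OF closure_subset], rule span_base) (use op_scale_one[of T, symmetric] in blast)

lemma closed_closed_cspan: "closed (closed_cspan G)" by (simp add: closed_cspan_def)

lemma subspace_closed_cspan: "subspace (closed_cspan G)"
  unfolding closed_cspan_def by (intro subspace_closure subspace_span)

lemma cspan_scale: "T \<in> span {op_scale c T |c T. T \<in> G} \<Longrightarrow> op_scale c T \<in> span {op_scale c T |c T. T \<in> G}"
proof (induction rule: span_induct_alt)
  case (step r x y)
  obtain d T where "x = op_scale d T" "T \<in> G" using step(1) by blast
  then have "op_scale c x \<in> {op_scale c T |c T. T \<in> G}"
    by (intro CollectI exI[of _ "c * d"] exI[of _ T]) (simp add: op_scale_scale)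
  then show ?case using step by (simp add: op_scale_add op_scale_scaleR span_add span_scale span_base)
qed (simp add: span_zero)

lemma closed_cspan_scale: assumes "T \<in> closed_cspan G" shows "op_scale c T \<in> closed_cspan G"
proof -
  obtain X where X: "\<And>n. X n \<in> span {op_scale c T |c T. T \<in> G}" "X \<longlonglongrightarrow> T"
    by (rule closure_seqE[OF assms[unfolded closed_cspan_def]]) (rule that, assumption+)
  have "(\<lambda>n. op_scale c (X n)) \<longlonglongrightarrow> op_scale c T"
    by (rule bounded_linear.tendsto[OF bounded_linear_op_scale X(2)])
  then show ?thesis unfolding closed_cspan_def closure_sequential
    by (intro exI[of _ "\<lambda>n. op_scale c (X n)"] conjI allI cspan_scale[OF X(1)])
qed

lemma closed_cspan_bounded_ops: "G \<subseteq> bounded_ops \<Longrightarrow> closed_cspan G \<subseteq> bounded_ops"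
  by (rule closed_cspan_subset) (auto simp: closed_bounded_ops subspace_def)

text \<open>Products pass to the closed span in one factor at a time: the set of \<open>S\<close> for which \<open>S \<odot> T\<close> stays
  in it is a closed subspace that contains the generators. The same argument serves for adjoints.\<close>

lemma concrete_closed_cspan:
  assumes G: "G \<subseteq> bounded_ops" and mult: "\<And>S T. S \<in> G \<Longrightarrow> T \<in> G \<Longrightarrow> S \<odot> T \<in> closed_cspan G"
    and adj: "\<And>T. T \<in> G \<Longrightarrow> op_adj T \<in> closed_cspan G"
  shows "concrete_cstar (closed_cspan G)"
proof -
  let ?C = "closed_cspan G"
  note C = closed_closed_cspan[of G] subspace_closed_cspan[of G]
  have B: "?C \<subseteq> bounded_ops" by (rule closed_cspan_bounded_ops[OF G])
  have blin: "bounded_linear (\<lambda>S. S \<odot> T)" "bounded_linear (\<lambda>S. T \<odot> S)" for T :: "'a op"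
    by (rule bounded_bilinear.bounded_linear_left[OF bounded_bilinear_blinfun_compose]
        bounded_bilinear.bounded_linear_right[OF bounded_bilinear_blinfun_compose])+
  have vim: "closed {S. f S \<in> ?C}" "subspace {S. f S \<in> ?C}" if "bounded_linear f" for f :: "'a op \<Rightarrow> 'a op"
  proof -
    interpret f: bounded_linear f by fact
    have "closed (f -` ?C)"
      by (rule continuous_closed_vimage[OF C(1)]) (simp add: f.isCont)
    then show "closed {S. f S \<in> ?C}" by (simp add: vimage_def)
    show "subspace {S. f S \<in> ?C}"
      using C(2) by (auto simp: subspace_def f.zero f.add f.scaleR)
  qed
  have 1: "S \<odot> T \<in> ?C" if T: "T \<in> G" and "S \<in> ?C" for S T
  proof -
    have "?C \<subseteq> {S. S \<odot> T \<in> ?C}"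
      by (rule closed_cspan_subset)
         (use vim[OF blin(1)] mult T in \<open>auto simp: op_scale_comp_left closed_cspan_scale\<close>)
    then show ?thesis using that by blast
  qed
  have 2: "S \<odot> T \<in> ?C" if S: "S \<in> ?C" and "T \<in> ?C" for S T
  proof -
    have "?C \<subseteq> {T. S \<odot> T \<in> ?C}"
      by (rule closed_cspan_subset)
         (use vim[OF blin(2)] 1 S subsetD[OF B S] in \<open>auto simp: op_scale_comp_right closed_cspan_scale\<close>)
    then show ?thesis using that by blast
  qed
  have 3: "op_adj T \<in> ?C" if T: "T \<in> ?C" for T
  proof -
    let ?K = "{T \<in> bounded_ops. op_adj T \<in> ?C}"
    have "closed ?K"
      unfolding closed_sequential_limits
    proof (intro allI impI, elim conjE)
      fix f l assume f: "\<forall>n. f n \<in> ?K" and l: "f \<longlonglongrightarrow> l"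
      have lb: "l \<in> bounded_ops" by (rule closed_sequentially[OF closed_bounded_ops _ l]) (use f in simp)
      have "(\<lambda>n. op_adj (f n)) \<longlonglongrightarrow> op_adj l" by (rule tendsto_op_adj[OF l _ lb]) (use f in simp)
      then have "op_adj l \<in> ?C" by (rule closed_sequentially[OF C(1), rotated]) (use f in simp)
      then show "l \<in> ?K" using lb by simp
    qed
    moreover have "subspace ?K"
      using C(2) by (auto simp: subspace_def op_adj_add op_adj_scaleR)
    moreover have "op_scale c T \<in> ?K" if "T \<in> G" for c T
      using that subsetD[OF G that] adj by (auto simp: op_adj_scale closed_cspan_scale)
    moreover have "G \<subseteq> ?K" using G adj by auto
    ultimately have "?C \<subseteq> ?K" by (intro closed_cspan_subset) auto
    then show ?thesis using T by blast
  qed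
  show ?thesis unfolding concrete_cstar_def using B C 2 3 closed_cspan_scale by auto
qed

section \<open>Operator algebras with a complete C*-norm\<close>

text \<open>An abstract C*-algebra with a faithful representation is treated as the algebra \<open>S\<close> of its
  image operators together with the transported norm \<open>\<nu>\<close>. Identities in it are then identities of
  operators, while completeness and the C*-identity hold for \<open>\<nu>\<close> only: that \<open>\<nu>\<close> is equivalent to the
  operator norm is a conclusion, not a hypothesis.\<close>

locale cstar_ops =
  fixes S :: "'h::chilbert_space op set" and \<nu> :: "'h op \<Rightarrow> real"
  assumes S_bounded: "x \<in> S \<Longrightarrow> x \<in> bounded_ops"
    and zero_in [simp]: "0 \<in> S"
    and add_in [simp]: "x \<in> S \<Longrightarrow> y \<in> S \<Longrightarrow> x + y \<in> S"
    and scale_in [simp]: "x \<in> S \<Longrightarrow> op_scale c x \<in> S"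
    and comp_in [simp]: "x \<in> S \<Longrightarrow> y \<in> S \<Longrightarrow> x \<odot> y \<in> S"
    and adj_in [simp]: "x \<in> S \<Longrightarrow> op_adj x \<in> S"
    and nu_add: "x \<in> S \<Longrightarrow> y \<in> S \<Longrightarrow> \<nu> (x + y) \<le> \<nu> x + \<nu> y"
    and nu_scale: "x \<in> S \<Longrightarrow> \<nu> (op_scale c x) = cmod c * \<nu> x"
    and nu_comp: "x \<in> S \<Longrightarrow> y \<in> S \<Longrightarrow> \<nu> (x \<odot> y) \<le> \<nu> x * \<nu> y"
    and nu_cstar: "x \<in> S \<Longrightarrow> \<nu> (op_adj x \<odot> x) = (\<nu> x)\<^sup>2"
    and nu_nonneg [simp]: "x \<in> S \<Longrightarrow> 0 \<le> \<nu> x"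
    and nu_zeroD: "x \<in> S \<Longrightarrow> \<nu> x = 0 \<Longrightarrow> x = 0"
    and complete: "(\<And>n. X n \<in> S) \<Longrightarrow> (\<forall>e>0. \<exists>N. \<forall>m\<ge>N. \<forall>n\<ge>N. \<nu> (X m - X n) < e)
      \<Longrightarrow> \<exists>x\<in>S. (\<lambda>n. \<nu> (X n - x)) \<longlonglongrightarrow> 0"
begin

lemma scaleR_in [simp]: "x \<in> S \<Longrightarrow> r *\<^sub>R x \<in> S" by (simp add: scaleR_op_scale)
lemma minus_in [simp]: "x \<in> S \<Longrightarrow> - x \<in> S" by (metis op_scale_minus1 scale_in)
lemma diff_in [simp]: "x \<in> S \<Longrightarrow> y \<in> S \<Longrightarrow> x - y \<in> S" by (metis add_in minus_in diff_conv_add_uminus)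
lemma sum_in: "(\<And>i. i \<in> I \<Longrightarrow> g i \<in> S) \<Longrightarrow> sum g I \<in> S"
  by (induction I rule: infinite_finite_induct) auto

lemma nu_scaleR: "x \<in> S \<Longrightarrow> \<nu> (r *\<^sub>R x) = \<bar>r\<bar> * \<nu> x" by (simp add: scaleR_op_scale nu_scale)
lemma nu_minus: "x \<in> S \<Longrightarrow> \<nu> (- x) = \<nu> x" using nu_scale[of x "-1"] by (simp add: op_scale_minus1)
lemma nu_0 [simp]: "\<nu> 0 = 0" using nu_scale[of 0 0] by simp
lemma nu_diff: "x \<in> S \<Longrightarrow> y \<in> S \<Longrightarrow> \<nu> (x - y) \<le> \<nu> x + \<nu> y"
  using nu_add[of x "- y"] by (simp add: nu_minus)
lemma nu_commute: "x \<in> S \<Longrightarrow> y \<in> S \<Longrightarrow> \<nu> (x - y) = \<nu> (y - x)"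
  using nu_minus[of "x - y"] by simp

lemma nu_adj_le: assumes x: "x \<in> S" shows "\<nu> x \<le> \<nu> (op_adj x)"
proof (cases "\<nu> x = 0")
  case False
  have "\<nu> x * \<nu> x \<le> \<nu> (op_adj x) * \<nu> x"
    using nu_cstar[OF x] nu_comp[of "op_adj x" x] x by (simp add: power2_eq_square)
  then show ?thesis using False nu_nonneg[OF x] by (simp add: mult_le_cancel_right)
qed (use x in simp)

lemma nu_adj: "x \<in> S \<Longrightarrow> \<nu> (op_adj x) = \<nu> x"
  using nu_adj_le[of x] nu_adj_le[of "op_adj x"] S_bounded[of x] by simp

lemma eq_zero_by_limit:
  assumes z: "z \<in> S" and le: "\<And>n. \<nu> z \<le> t n" and t: "t \<longlonglongrightarrow> 0"
  shows "z = 0"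
proof -
  have "\<nu> z \<le> 0" by (rule LIMSEQ_le_const[OF t]) (use le in blast)
  then show ?thesis using nu_nonneg[OF z] nu_zeroD[OF z] by simp
qed

lemma geometric_limit:
  assumes X: "\<And>n. X n \<in> S" and le: "\<And>n. \<nu> (X (Suc n) - X n) \<le> K * q ^ n" and q: "0 \<le> q" "q < 1"
  shows "\<exists>x\<in>S. (\<lambda>n. \<nu> (X n - x)) \<longlonglongrightarrow> 0"
proof (rule complete[OF X], intro allI impI)
  have "0 \<le> \<nu> (X (Suc 0) - X 0)" using X by (intro nu_nonneg) simp
  then have K: "K \<ge> 0" using le[of 0] by simp
  have 1: "\<nu> (X (n + k) - X n) \<le> K * q ^ n * (1 - q ^ k) / (1 - q)" for n k
  proof (induction k)
    case (Suc k)
    have "\<nu> (X (n + Suc k) - X n) = \<nu> ((X (Suc (n + k)) - X (n + k)) + (X (n + k) - X n))" by simp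
    also have "\<dots> \<le> K * q ^ (n + k) + K * q ^ n * (1 - q ^ k) / (1 - q)"
      using nu_add[of "X (Suc (n + k)) - X (n + k)" "X (n + k) - X n"] le[of "n + k"] Suc X by simp
    also have "\<dots> = K * q ^ n * (1 - q ^ Suc k) / (1 - q)"
      using q by (simp add: field_simps power_add)
    finally show ?case .
  qed simp
  have 2: "\<nu> (X m - X n) \<le> K * q ^ n / (1 - q)" if "n \<le> m" for m n
  proof -
    have "\<nu> (X m - X n) \<le> K * q ^ n * (1 - q ^ (m - n)) / (1 - q)" using 1[of n "m - n"] that by simp
    also have "\<dots> \<le> K * q ^ n * 1 / (1 - q)"
      using q K by (intro divide_right_mono mult_left_mono) auto
    finally show ?thesis by simp
  qed
  fix e :: real assume e: "e > 0"
  have "(\<lambda>n. K * q ^ n / (1 - q)) \<longlonglongrightarrow> K * 0 / (1 - q)"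
    using q by (intro tendsto_intros LIMSEQ_power_zero) auto
  then have "eventually (\<lambda>n. K * q ^ n / (1 - q) < e) sequentially"
    using order_tendstoD(2) e by fastforce
  then obtain N where N: "\<And>n. n \<ge> N \<Longrightarrow> K * q ^ n / (1 - q) < e" by (auto simp: eventually_sequentially)
  have "\<nu> (X m - X n) < e" if "m \<ge> N" "n \<ge> N" for m n
  proof (cases "n \<le> m")
    case True then show ?thesis using 2[of n m] N[of n] that by linarith
  next
    case False then show ?thesis using 2[of m n] N[of m] that nu_commute[OF X X, of m n] by linarith
  qed
  then show "\<exists>N. \<forall>m\<ge>N. \<forall>n\<ge>N. \<nu> (X m - X n) < e" by blast
qed

text \<open>For a small self-adjoint \<open>b\<close> the square root of \<open>1 - b\<close> has the form \<open>1 + w\<close> with \<open>w\<close> in the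
  algebra: \<open>w\<close> is the fixed point of the contraction \<open>w \<mapsto> - (b + w\<^sup>2) / 2\<close>.\<close>

lemma square_root:
  assumes b: "b \<in> S" "op_adj b = b" "\<nu> b \<le> 1/2"
  obtains w where "w \<in> S" "op_adj w = w" "2 *\<^sub>R w + w \<odot> w = - b" "\<nu> w \<le> \<nu> b"
    "\<And>c. c \<in> S \<Longrightarrow> c \<odot> b = b \<odot> c \<Longrightarrow> c \<odot> w = w \<odot> c"
proof -
  define \<beta> where "\<beta> = \<nu> b"
  have beta: "0 \<le> \<beta>" "\<beta> \<le> 1/2" using b by (auto simp: \<beta>_def)
  define W where "W = rec_nat 0 (\<lambda>n x. - (1/2) *\<^sub>R (b + x \<odot> x))"
  have W0: "W 0 = 0" and WS: "W (Suc n) = - (1/2) *\<^sub>R (b + W n \<odot> W n)" for n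
    by (simp_all add: W_def)
  have W: "W n \<in> S" for n by (induction n) (auto simp: W0 WS b)
  have nuW: "\<nu> (W n) \<le> \<beta>" for n
  proof (induction n)
    case (Suc n)
    have "\<nu> (W (Suc n)) = (1/2) * \<nu> (b + W n \<odot> W n)" unfolding WS by (subst nu_scaleR) (auto simp: W b)
    also have "\<dots> \<le> (1/2) * (\<beta> + \<nu> (W n) * \<nu> (W n))"
      using nu_add[of b "W n \<odot> W n"] nu_comp[OF W W, of n n] b W unfolding \<beta>_def by simp
    also have "\<nu> (W n) * \<nu> (W n) \<le> \<beta> * 1" by (rule mult_mono) (use Suc beta W in auto)
    finally show ?case by simp
  qed (use beta W0 in simp)
  have sq: "\<nu> (x \<odot> x - y \<odot> y) \<le> (\<nu> x + \<nu> y) * \<nu> (x - y)" if "x \<in> S" "y \<in> S" for x y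
  proof -
    have "x \<odot> x - y \<odot> y = x \<odot> (x - y) + (x - y) \<odot> y" by (simp add: comp_diff_left comp_diff_right)
    then show ?thesis
      using nu_add[of "x \<odot> (x - y)" "(x - y) \<odot> y"] nu_comp[of x "x - y"] nu_comp[of "x - y" y] that
      by (simp add: algebra_simps)
  qed
  have step: "\<nu> (W (Suc n) - W n) \<le> \<beta> * (1/2) ^ n" for n
  proof (induction n)
    case 0 then show ?case using nuW[of 1] by (simp add: W0)
  next
    case (Suc n)
    have "W (Suc (Suc n)) - W (Suc n) = - (1/2) *\<^sub>R (W (Suc n) \<odot> W (Suc n) - W n \<odot> W n)"
      unfolding WS[of "Suc n"] by (subst (3) WS) (simp add: algebra_simps)
    then have "\<nu> (W (Suc (Suc n)) - W (Suc n)) = (1/2) * \<nu> (W (Suc n) \<odot> W (Suc n) - W n \<odot> W n)"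
      by (simp only:) (subst nu_scaleR, auto simp: W)
    also have "\<dots> \<le> (1/2) * ((\<nu> (W (Suc n)) + \<nu> (W n)) * \<nu> (W (Suc n) - W n))"
      using sq[OF W W] by simp
    also have "\<dots> \<le> (1/2) * (1 * (\<beta> * (1/2) ^ n))"
      using nuW[of n] nuW[of "Suc n"] beta Suc W by (intro mult_left_mono mult_mono) auto
    finally show ?case by simp
  qed
  obtain w where w: "w \<in> S" "(\<lambda>n. \<nu> (W n - w)) \<longlonglongrightarrow> 0"
    using geometric_limit[OF W step] by auto
  define t where "t n = \<nu> (W n - w)" for n
  have t: "t \<longlonglongrightarrow> 0" "(\<lambda>n. t (Suc n)) \<longlonglongrightarrow> 0" using w LIMSEQ_Suc unfolding t_def by auto
  have t': "\<nu> (w - W n) = t n" for n unfolding t_def by (rule nu_commute) (auto simp: w W)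
  have mult0: "(\<lambda>n. c * t n) \<longlonglongrightarrow> 0" for c using tendsto_mult_left[OF t(1), of c] by simp
  show thesis
  proof (rule that[of w])
    have adjW: "op_adj (W n) = W n" for n
    proof (induction n)
      case (Suc n)
      have "W n \<in> bounded_ops" "b \<in> bounded_ops" using S_bounded W b by auto
      then show ?case using Suc b by (simp add: WS op_adj_scaleR op_adj_add op_adj_comp op_adj_uminus)
    qed (simp add: W0)
    have "op_adj w - w = 0"
    proof (rule eq_zero_by_limit[OF _ _ mult0[of 2]])
      fix n
      have eq: "op_adj w - w = op_adj (w - W n) - (w - W n)"
        using S_bounded[OF w(1)] S_bounded[OF W[of n]] by (simp add: op_adj_diff adjW)
      show "\<nu> (op_adj w - w) \<le> 2 * t n"
        unfolding eq using nu_diff[of "op_adj (w - W n)" "w - W n"] nu_adj[of "w - W n"] w W t' by simp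
    qed (simp add: w)
    then show "op_adj w = w" by simp
    have "2 *\<^sub>R w + w \<odot> w + b = 0"
    proof (rule eq_zero_by_limit)
      fix n
      have "2 *\<^sub>R W (Suc n) + W n \<odot> W n + b = 0" by (simp add: WS algebra_simps)
      moreover have "2 *\<^sub>R w + w \<odot> w + b =
          2 *\<^sub>R (w - W (Suc n)) + (w \<odot> w - W n \<odot> W n) + (2 *\<^sub>R W (Suc n) + W n \<odot> W n + b)"
        by (simp add: scaleR_diff_right)
      ultimately have eq: "2 *\<^sub>R w + w \<odot> w + b = 2 *\<^sub>R (w - W (Suc n)) + (w \<odot> w - W n \<odot> W n)"
        by simp
      have "\<nu> (2 *\<^sub>R w + w \<odot> w + b) \<le> \<nu> (2 *\<^sub>R (w - W (Suc n))) + \<nu> (w \<odot> w - W n \<odot> W n)"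
        unfolding eq using w W by (intro nu_add) auto
      also have "\<dots> \<le> 2 * t (Suc n) + (\<nu> w + \<beta>) * t n"
      proof (rule add_mono)
        show "\<nu> (2 *\<^sub>R (w - W (Suc n))) \<le> 2 * t (Suc n)"
          using nu_scaleR[of "w - W (Suc n)" 2] w W t' by simp
        have "\<nu> (w \<odot> w - W n \<odot> W n) \<le> (\<nu> w + \<nu> (W n)) * t n"
          using sq[OF w(1) W[of n]] t' by simp
        also have "\<dots> \<le> (\<nu> w + \<beta>) * t n"
          using nuW[of n] w W by (intro mult_right_mono) (auto simp: t_def)
        finally show "\<nu> (w \<odot> w - W n \<odot> W n) \<le> (\<nu> w + \<beta>) * t n" .
      qed
      finally show "\<nu> (2 *\<^sub>R w + w \<odot> w + b) \<le> 2 * t (Suc n) + (\<nu> w + \<beta>) * t n" .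
    next
      have "(\<lambda>n. 2 * t (Suc n) + (\<nu> w + \<beta>) * t n) \<longlonglongrightarrow> 2 * 0 + (\<nu> w + \<beta>) * 0"
        by (intro tendsto_intros t)
      then show "(\<lambda>n. 2 * t (Suc n) + (\<nu> w + \<beta>) * t n) \<longlonglongrightarrow> 0" by simp
    qed (use w b in simp)
    then show "2 *\<^sub>R w + w \<odot> w = - b" by (simp add: eq_neg_iff_add_eq_0)
    have "\<nu> w \<le> \<beta> + t n" for n
      using nu_add[of "W n" "w - W n"] nuW[of n] t'[of n] w W by simp
    moreover have "(\<lambda>n. \<beta> + t n) \<longlonglongrightarrow> \<beta> + 0" by (intro tendsto_intros t)
    ultimately have "\<nu> w \<le> \<beta> + 0" by (intro LIMSEQ_le_const) auto
    then show "\<nu> w \<le> \<nu> b" by (simp add: \<beta>_def)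
    fix c assume c: "c \<in> S" "c \<odot> b = b \<odot> c"
    have cW: "c \<odot> W n = W n \<odot> c" for n
    proof (induction n)
      case (Suc n)
      have "c \<odot> (W n \<odot> W n) = (W n \<odot> W n) \<odot> c" by (metis Suc comp_assoc)
      then show ?case
        by (simp add: WS c(2) comp_add_left comp_add_right comp_scaleR_left comp_scaleR_right
            comp_minus_left comp_minus_right)
    qed (simp add: W0 comp_zero_left comp_zero_right)
    have "c \<odot> w - w \<odot> c = 0"
    proof (rule eq_zero_by_limit[OF _ _ mult0[of "2 * \<nu> c"]])
      fix n
      have eq: "c \<odot> w - w \<odot> c = c \<odot> (w - W n) - (w - W n) \<odot> c"
        by (simp add: comp_diff_left comp_diff_right cW)
      show "\<nu> (c \<odot> w - w \<odot> c) \<le> 2 * \<nu> c * t n"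
        unfolding eq using nu_diff[of "c \<odot> (w - W n)" "(w - W n) \<odot> c"] nu_comp[of c "w - W n"] nu_comp[of "w - W n" c]
          t'[of n] c w W by (simp add: ac_simps)
    qed (use c w in simp)
    then show "c \<odot> w = w \<odot> c" by simp
  qed (rule w)
qed

end

locale cstar_ops_hom = cstar_ops S \<nu> for S :: "'h::chilbert_space op set" and \<nu> +
  fixes f :: "'h op \<Rightarrow> 'k::chilbert_space op"
  assumes f_in: "x \<in> S \<Longrightarrow> f x \<in> bounded_ops"
    and f_add: "x \<in> S \<Longrightarrow> y \<in> S \<Longrightarrow> f (x + y) = f x + f y"
    and f_scale: "x \<in> S \<Longrightarrow> f (op_scale c x) = op_scale c (f x)"
    and f_comp: "x \<in> S \<Longrightarrow> y \<in> S \<Longrightarrow> f (x \<odot> y) = f x \<odot> f y"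
    and f_adj: "x \<in> S \<Longrightarrow> f (op_adj x) = op_adj (f x)"
begin

lemma f_scaleR: "x \<in> S \<Longrightarrow> f (r *\<^sub>R x) = r *\<^sub>R f x" by (simp add: scaleR_op_scale f_scale)
lemma f_minus: "x \<in> S \<Longrightarrow> f (- x) = - f x" using f_scale[of x "-1"] by (simp add: op_scale_minus1)
lemma f_diff: "x \<in> S \<Longrightarrow> y \<in> S \<Longrightarrow> f (x - y) = f x - f y"
  using f_add[of x "- y"] by (simp add: f_minus)
lemma f_0 [simp]: "f 0 = 0" using f_scale[of 0 0] by simp
lemma f_sum: "(\<And>i. i \<in> I \<Longrightarrow> g i \<in> S) \<Longrightarrow> f (sum g I) = (\<Sum>i\<in>I. f (g i))"
  by (induction I rule: infinite_finite_induct) (auto simp: f_add sum_in)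

text \<open>With \<open>(1 + w)\<^sup>2 = 1 - a\<^sup>* a\<close> one has \<open>\<parallel>f a \<xi>\<parallel>\<^sup>2 + \<parallel>(1 + f w) \<xi>\<parallel>\<^sup>2 = \<parallel>\<xi>\<parallel>\<^sup>2\<close>. Here and below only
  continuity with some universal constant matters.\<close>

lemma hom_bounded: assumes a: "a \<in> S" shows "norm (f a) \<le> 2 * \<nu> a"
proof (cases "\<nu> a = 0")
  case True
  then have "a = 0" using nu_zeroD[OF a] by simp
  then show ?thesis by simp
next
  case False
  define r where "r = 1 / (2 * \<nu> a)"
  have pos: "\<nu> a > 0" using False nu_nonneg[OF a] by simp
  define a' where "a' = r *\<^sub>R a"
  have a': "a' \<in> S" "\<nu> a' = 1/2" using a pos by (auto simp: a'_def nu_scaleR r_def)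
  define b where "b = op_adj a' \<odot> a'"
  have "\<nu> b = 1/4" using nu_cstar[OF a'(1)] unfolding b_def a'(2) by (simp add: power2_eq_square)
  then have b: "b \<in> S" "op_adj b = b" "\<nu> b \<le> 1/2"
    using a' S_bounded[OF a'(1)] by (auto simp: b_def op_adj_comp)
  obtain w where w: "w \<in> S" "op_adj w = w" "2 *\<^sub>R w + w \<odot> w = - b"
    using square_root[OF b] by metis
  have fb: "f b = op_adj (f a') \<odot> f a'" using a' by (simp add: b_def f_comp f_adj)
  have fw: "2 *\<^sub>R f w + f w \<odot> f w = - f b"
    using arg_cong[OF w(3), of f] w(1) b(1) by (simp add: f_add f_scaleR f_comp f_minus)
  have fwa: "op_adj (f w) = f w" using f_adj[OF w(1)] w(2) by simp
  have "norm (f a') \<le> 1"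
  proof (rule norm_blinfun_bound)
    fix x
    have "(norm (blinfun_apply (f a') x))\<^sup>2 = x \<bullet> blinfun_apply (f b) x"
      using op_adj_inner[OF f_in[OF a'(1)], of x "blinfun_apply (f a') x"] by (simp add: fb power2_norm_eq_inner)
    moreover have "blinfun_apply (f b) x = - (2 *\<^sub>R blinfun_apply (f w) x + blinfun_apply (f w) (blinfun_apply (f w) x))"
      using arg_cong[OF fw, of "\<lambda>T. - blinfun_apply T x"] by (simp add: blinfun.bilinear_simps)
    moreover have "(norm (x + blinfun_apply (f w) x))\<^sup>2 =
        (norm x)\<^sup>2 + 2 * (x \<bullet> blinfun_apply (f w) x) + x \<bullet> blinfun_apply (f w) (blinfun_apply (f w) x)"
      using op_adj_inner[OF f_in[OF w(1)], of x "blinfun_apply (f w) x"]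
      by (simp add: power2_norm_eq_inner inner_add_left inner_add_right fwa inner_commute)
    ultimately have "(norm (blinfun_apply (f a') x))\<^sup>2 + (norm (x + blinfun_apply (f w) x))\<^sup>2 = (norm x)\<^sup>2"
      by (simp add: inner_add_right inner_diff_right)
    then have "(norm (blinfun_apply (f a') x))\<^sup>2 \<le> (norm x)\<^sup>2"
      using zero_le_power2[of "norm (x + blinfun_apply (f w) x)"] by linarith
    then show "norm (blinfun_apply (f a') x) \<le> 1 * norm x" using power2_le_imp_le by auto
  qed simp
  then show ?thesis using pos a by (simp add: a'_def f_scaleR r_def field_simps)
qed

text \<open>The element \<open>y\<close> below is \<open>sin (M arcsin (a / M))\<close>, the imaginary part of a power of the unitary
  \<open>1 + w + i a / M\<close>. Its norm is bounded however large \<open>a\<close> is, and \<open>f y\<close> is close to \<open>f a\<close> because \<open>sin\<close> is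
  the identity up to third order at \<open>0\<close>.\<close>

lemma approximate_lift_selfadjoint:
  assumes a: "a \<in> S" "op_adj a = a" and small: "norm (f a) \<le> 1/20"
  shows "\<exists>y\<in>S. \<nu> y \<le> 2 \<and> norm (f y - f a) \<le> 1/80"
proof -
  obtain M0 :: nat where M0: "3 * \<nu> a < real M0" using reals_Archimedean2 by blast
  define M where "M = Suc M0"
  have M: "real M \<ge> 1" "real M > 0" "\<nu> a / real M \<le> 1/3"
    using M0 by (auto simp: M_def field_simps)
  define a' where "a' = (1 / real M) *\<^sub>R a"
  have a': "a' \<in> S" "op_adj a' = a'" "\<nu> a' \<le> 1/3"
    using a M S_bounded[OF a(1)] by (auto simp: a'_def op_adj_scaleR nu_scaleR)
  define b where "b = a' \<odot> a'"
  have nb: "\<nu> b \<le> 1/9"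
    using nu_comp[OF a'(1) a'(1)] mult_mono[OF a'(3) a'(3)] a'(1) by (simp add: b_def)
  have b: "b \<in> S" "op_adj b = b" "\<nu> b \<le> 1/2"
    using a' S_bounded[OF a'(1)] nb by (auto simp: b_def op_adj_comp)
  obtain w where w: "w \<in> S" "op_adj w = w" "2 *\<^sub>R w + w \<odot> w = - b" "\<nu> w \<le> \<nu> b"
    and comm: "\<And>c. c \<in> S \<Longrightarrow> c \<odot> b = b \<odot> c \<Longrightarrow> c \<odot> w = w \<odot> c"
    using square_root[OF b] by metis
  have wa: "a' \<odot> w = w \<odot> a'" by (rule comm[OF a'(1)]) (simp add: b_def comp_assoc)
  have bd: "a' \<in> bounded_ops" "w \<in> bounded_ops" using a' w S_bounded by auto
  \<comment> \<open>\<open>1 + v\<close> is unitary, being \<open>\<surd>(1 - a'\<^sup>2) + \<i> a'\<close>. The algebra may lack a unit, so unitarity is the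
    identity \<open>vv\<close> and the powers of \<open>1 + v\<close> appear below as \<open>1 + V j\<close>.\<close>
  define v where "v = w + op_scale \<i> a'"
  have v: "v \<in> S" using w a' by (simp add: v_def)
  have adjv: "op_adj v = w - op_scale \<i> a'"
    using bd w a' by (simp add: v_def op_adj_add op_adj_scale) (metis add_uminus_conv_diff mult_minus1 op_scale_minus1 op_scale_scale)
  have vv: "op_adj v \<odot> v + v + op_adj v = 0"
  proof -
    have "op_adj v \<odot> v = w \<odot> w + b"
      unfolding adjv using bd
      by (simp add: v_def comp_add_right comp_diff_left op_scale_comp_left op_scale_comp_right
          op_scale_scale op_scale_minus1 wa b_def)
    moreover have "v + op_adj v = 2 *\<^sub>R w" unfolding adjv by (simp add: v_def scaleR_2)
    ultimately show ?thesis using w(3) by (simp add: add.assoc) (simp add: algebra_simps eq_neg_iff_add_eq_0)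
  qed
  define V where "V = rec_nat 0 (\<lambda>j x. x + v + v \<odot> x)"
  have V0: "V 0 = 0" and VS: "V (Suc j) = V j + v + v \<odot> V j" for j by (simp_all add: V_def)
  have V: "V j \<in> S" for j by (induction j) (auto simp: V0 VS v)
  have VV: "op_adj (V j) \<odot> V j + V j + op_adj (V j) = 0" for j
  proof (induction j)
    case (Suc j)
    let ?x = "V j"
    have bx: "?x \<in> bounded_ops" "v \<in> bounded_ops" using V v S_bounded by auto
    have "op_adj (V (Suc j)) \<odot> V (Suc j) + V (Suc j) + op_adj (V (Suc j)) =
      (op_adj ?x \<odot> ?x + ?x + op_adj ?x) + (op_adj v \<odot> v + v + op_adj v)
      + op_adj ?x \<odot> (op_adj v \<odot> v + v + op_adj v) + (op_adj v \<odot> v + v + op_adj v) \<odot> ?x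
      + op_adj ?x \<odot> ((op_adj v \<odot> v + v + op_adj v) \<odot> ?x)"
      using bx by (simp add: VS op_adj_add op_adj_comp comp_add_left comp_add_right comp_assoc algebra_simps)
    then show ?case using Suc vv by (simp add: comp_zero_left comp_zero_right)
  qed (simp add: V0 comp_zero_left comp_zero_right)
  have nuV: "\<nu> (V j) \<le> 2" for j
  proof (cases "\<nu> (V j) = 0")
    case False
    have "op_adj (V j) \<odot> V j = - (V j + op_adj (V j))"
      using VV[of j] by (intro eq_neg_iff_add_eq_0[THEN iffD2]) (simp only: add.assoc)
    then have "(\<nu> (V j))\<^sup>2 = \<nu> (V j + op_adj (V j))"
      using nu_cstar[OF V[of j]] nu_minus[of "V j + op_adj (V j)"] V by simp
    also have "\<dots> \<le> 2 * \<nu> (V j)" using nu_add[of "V j" "op_adj (V j)"] nu_adj[of "V j"] V by simp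
    finally have "\<nu> (V j) * \<nu> (V j) \<le> 2 * \<nu> (V j)" by (simp add: power2_eq_square)
    then show ?thesis using False V[of j] by (simp add: mult_le_cancel_right order_less_le)
  qed simp
  define \<delta> where "\<delta> = norm (f a)"
  have delta: "0 \<le> \<delta>" "\<delta> \<le> 1/20" using small by (auto simp: \<delta>_def)
  have na': "norm (f a') = \<delta> / real M" using a M by (simp add: a'_def f_scaleR \<delta>_def)
  define x where "x = norm (f w)"
  have "x \<le> 2/9" using hom_bounded[OF w(1)] w(4) nb by (simp add: x_def)
  have "2 * x \<le> (\<delta> / real M)\<^sup>2 + x * x"
  proof -
    have "2 *\<^sub>R f w = - f b - f w \<odot> f w"
      using arg_cong[OF w(3), of f] w b by (simp add: f_add f_scaleR f_comp f_minus algebra_simps)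
    then have "2 * x \<le> norm (f b) + norm (f w \<odot> f w)"
      unfolding x_def using norm_triangle_ineq4[of "- f b" "f w \<odot> f w"] by (metis norm_minus_cancel norm_scaleR abs_numeral)
    moreover have "norm (f b) \<le> (\<delta> / real M)\<^sup>2"
      using norm_blinfun_compose[of "f a'" "f a'"] a' by (simp add: b_def f_comp na' power2_eq_square)
    ultimately show ?thesis using norm_blinfun_compose[of "f w" "f w"] by (simp add: x_def)
  qed
  moreover have "x * x \<le> (2/9) * x" using \<open>x \<le> 2/9\<close> by (intro mult_right_mono) (auto simp: x_def)
  ultimately have "x \<le> (\<delta> / real M)\<^sup>2" using zero_le_power2[of "\<delta> / real M"] by linarith
  then have "real M * x \<le> real M * (\<delta> / real M)\<^sup>2" using M by (intro mult_left_mono) auto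
  also have "\<dots> = \<delta>\<^sup>2 / real M" using M by (simp add: power2_eq_square)
  also have "\<dots> \<le> \<delta>\<^sup>2 / 1" using M by (intro divide_left_mono) auto
  finally have Mx: "real M * x \<le> \<delta>\<^sup>2" by simp
  have d2: "\<delta>\<^sup>2 \<le> \<delta> / 20" using mult_left_mono[OF delta(2) delta(1)] by (simp add: power2_eq_square)
  define z where "z = f v"
  have z: "z = f w + op_scale \<i> (f a')" using w a' by (simp add: z_def v_def f_add f_scale)
  have "norm z \<le> x + \<delta> / real M"
    unfolding z x_def using norm_triangle_ineq[of "f w" "op_scale \<i> (f a')"] by (simp add: norm_op_scale na')
  then have "real M * norm z \<le> real M * (x + \<delta> / real M)" using M by (intro mult_left_mono) auto
  also have "\<dots> = real M * x + \<delta>" using M by (simp add: field_simps)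
  also have "\<dots> \<le> 2 * \<delta>" using Mx d2 delta by linarith
  finally have Mz: "real M * norm z \<le> 2 * \<delta>" .
  have pow: "j \<le> M \<Longrightarrow> norm (f (V j) - real j *\<^sub>R z) \<le> (real j * norm z)\<^sup>2" for j
  proof (induction j)
    case (Suc j)
    define e where "e = f (V j) - real j *\<^sub>R z"
    have jz: "real j * norm z \<le> 1"
      using Suc.prems Mz delta mult_right_mono[of "real j" "real M" "norm z"] by simp
    have "f (V (Suc j)) - real (Suc j) *\<^sub>R z = e + (z \<odot> (real j *\<^sub>R z) + z \<odot> e)"
      using V v by (simp add: VS f_add f_comp z_def e_def comp_diff_right algebra_simps)
    then have "norm (f (V (Suc j)) - real (Suc j) *\<^sub>R z) \<le> norm e + (norm z * (real j * norm z) + norm z * norm e)"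
      using norm_triangle_ineq[of e "z \<odot> (real j *\<^sub>R z) + z \<odot> e"]
        norm_triangle_ineq[of "z \<odot> (real j *\<^sub>R z)" "z \<odot> e"]
        norm_blinfun_compose[of z "real j *\<^sub>R z"] norm_blinfun_compose[of z e] by simp
    also have "\<dots> \<le> (real j * norm z)\<^sup>2 + (norm z * (real j * norm z) + norm z * (real j * norm z)\<^sup>2)"
      using Suc by (intro add_mono mult_left_mono) (auto simp: e_def)
    also have "norm z * (real j * norm z)\<^sup>2 \<le> norm z * (real j * norm z)"
      using jz by (intro mult_left_mono) (auto simp: power2_eq_square mult_left_le_one_le)
    finally have "norm (f (V (Suc j)) - real (Suc j) *\<^sub>R z)
        \<le> (real j * norm z)\<^sup>2 + (norm z * (real j * norm z) + norm z * (real j * norm z))" by simp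
    also have "\<dots> \<le> (real (Suc j) * norm z)\<^sup>2" by (simp add: power2_eq_square algebra_simps)
    finally show ?case .
  qed (simp add: V0)
  \<comment> \<open>\<open>(1 + f v)\<^sup>M - 1 \<approx> M f v \<approx> \<i> f a\<close>, with an error of second order in the norm of \<open>f a\<close>.\<close>
  define E where "E = f (V M) - op_scale \<i> (f a)"
  have nE: "norm E \<le> 1/80"
  proof -
    have "real M *\<^sub>R z - op_scale \<i> (f a) = real M *\<^sub>R f w"
      using M a by (simp add: z a'_def f_scaleR op_scale_scaleR algebra_simps)
    then have "E = (f (V M) - real M *\<^sub>R z) + real M *\<^sub>R f w" by (simp add: E_def algebra_simps)
    then have "norm E \<le> (real M * norm z)\<^sup>2 + real M * x"
      using norm_triangle_ineq[of "f (V M) - real M *\<^sub>R z" "real M *\<^sub>R f w"] pow[of M] by (simp add: x_def)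
    also have "(real M * norm z)\<^sup>2 \<le> (2 * \<delta>)\<^sup>2" using Mz by (intro power_mono) auto
    finally have "norm E \<le> 5 * \<delta>\<^sup>2" using Mx by (simp add: power_mult_distrib)
    also have "\<dots> \<le> 1/80" using d2 delta by linarith
    finally show ?thesis .
  qed
  define y where "y = op_scale (- \<i> / 2) (V M - op_adj (V M))"
  have "y \<in> S" by (simp add: y_def V)
  moreover have "\<nu> y \<le> 2"
    using nu_diff[of "V M" "op_adj (V M)"] nu_adj[of "V M"] nuV[of M] V by (simp add: y_def nu_scale norm_divide)
  moreover have "norm (f y - f a) \<le> 1/80"
  proof -
    have fb: "f (V M) \<in> bounded_ops" "f a \<in> bounded_ops" using f_in V a by auto
    then have Eb: "E \<in> bounded_ops" by (simp add: E_def)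
    have fa: "op_adj (f a) = f a" using f_adj[OF a(1)] a(2) by simp
    define G where "G = op_scale \<i> (f a)"
    have "op_adj G = - G" unfolding G_def op_adj_scale[OF fb(2)] fa op_scale_minus1[symmetric] op_scale_scale by simp
    then have "op_scale (- \<i> / 2) (G - op_adj G) = op_scale (- \<i> / 2) (op_scale 2 G)"
      by (simp add: scaleR_2[symmetric] scaleR_op_scale)
    also have "\<dots> = f a" by (simp add: G_def op_scale_scale)
    finally have "f a = op_scale (- \<i> / 2) (G - op_adj G)" by simp
    moreover have "f y = op_scale (- \<i> / 2) (f (V M) - op_adj (f (V M)))"
      using V by (simp add: y_def f_scale f_diff f_adj)
    moreover have "E - op_adj E = (f (V M) - op_adj (f (V M))) - (G - op_adj G)"
      using fb by (simp add: E_def G_def op_adj_diff)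
    ultimately have "f y - f a = op_scale (- \<i> / 2) (E - op_adj E)" by (simp only: op_scale_diff)
    then have "norm (f y - f a) = norm (E - op_adj E) / 2" by (simp add: norm_op_scale norm_divide)
    then show ?thesis using norm_triangle_ineq4[of E "op_adj E"] norm_op_adj[OF Eb] nE by simp
  qed
  ultimately show ?thesis by blast
qed

text \<open>Real and imaginary parts are lifted separately. Scaling brings them to norm at most \<open>1/20\<close>, where the
  error \<open>1/80\<close> of each lift is a quarter of that.\<close>

lemma approximate_lift:
  assumes a: "a \<in> S"
  shows "\<exists>y\<in>S. norm (f a - f y) \<le> norm (f a) / 2 \<and> \<nu> y \<le> 80 * norm (f a)"
proof (cases "f a = 0")
  case True
  then show ?thesis by (intro bexI[of _ 0]) auto
next
  case False
  define t where "t = 1 / (20 * norm (f a))"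
  have t: "t > 0" using False by (simp add: t_def)
  have ab: "a \<in> bounded_ops" "f a \<in> bounded_ops" using a S_bounded f_in by auto
  define p where "p = (t/2) *\<^sub>R (a + op_adj a)"
  define q where "q = (t/2) *\<^sub>R op_scale (- \<i>) (a - op_adj a)"
  have pq: "p \<in> S" "q \<in> S" using a by (auto simp: p_def q_def)
  have adj: "op_adj p = p" "op_adj q = q"
    using ab by (auto simp: p_def q_def op_adj_scaleR op_adj_add op_adj_scale op_adj_diff add.commute)
       (metis minus_diff_eq op_scale_minus1 op_scale_scale mult_minus1 mult_minus1_right minus_minus)
  have fp: "norm (f p) \<le> 1/20"
  proof -
    have "norm (f p) = (t/2) * norm (f a + op_adj (f a))"
      using a t by (simp add: p_def f_scaleR f_add f_adj)
    also have "\<dots> \<le> (t/2) * (2 * norm (f a))"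
      using norm_triangle_ineq[of "f a" "op_adj (f a)"] norm_op_adj[OF ab(2)] t by (intro mult_left_mono) auto
    also have "\<dots> = 1/20" using False by (simp add: t_def)
    finally show ?thesis .
  qed
  have fq: "norm (f q) \<le> 1/20"
  proof -
    have "norm (f q) = (t/2) * norm (f a - op_adj (f a))"
      using a t by (simp add: q_def f_scaleR f_scale f_diff f_adj norm_op_scale)
    also have "\<dots> \<le> (t/2) * (2 * norm (f a))"
      using norm_triangle_ineq4[of "f a" "op_adj (f a)"] norm_op_adj[OF ab(2)] t by (intro mult_left_mono) auto
    also have "\<dots> = 1/20" using False by (simp add: t_def)
    finally show ?thesis .
  qed
  obtain y1 where y1: "y1 \<in> S" "\<nu> y1 \<le> 2" "norm (f y1 - f p) \<le> 1/80"
    using approximate_lift_selfadjoint[OF pq(1) adj(1) fp] by blast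
  obtain y2 where y2: "y2 \<in> S" "\<nu> y2 \<le> 2" "norm (f y2 - f q) \<le> 1/80"
    using approximate_lift_selfadjoint[OF pq(2) adj(2) fq] by blast
  define y where "y = (1/t) *\<^sub>R (y1 + op_scale \<i> y2)"
  have "y \<in> S" using y1 y2 by (simp add: y_def)
  have "p + op_scale \<i> q = t *\<^sub>R a"
    unfolding p_def q_def op_scale_scaleR op_scale_scale
    by (simp add: scaleR_add_right[symmetric] scaleR_2[symmetric])
  then have "f p + op_scale \<i> (f q) = t *\<^sub>R f a"
    using pq a by (metis f_add f_scale f_scaleR scale_in)
  then have fa: "f a = (1/t) *\<^sub>R (f p + op_scale \<i> (f q))" using t by simp
  have fy: "f y = (1/t) *\<^sub>R (f y1 + op_scale \<i> (f y2))" using y1 y2 by (simp add: y_def f_scaleR f_add f_scale)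
  have "f a - f y = (1/t) *\<^sub>R ((f p + op_scale \<i> (f q)) - (f y1 + op_scale \<i> (f y2)))"
    by (simp only: fa fy scaleR_diff_right)
  also have "(f p + op_scale \<i> (f q)) - (f y1 + op_scale \<i> (f y2)) = - (f y1 - f p) - op_scale \<i> (f y2 - f q)"
    by (simp add: op_scale_diff)
  finally have "f a - f y = (1/t) *\<^sub>R (- (f y1 - f p) - op_scale \<i> (f y2 - f q))" .
  then have "norm (f a - f y) = (1/t) * norm (- (f y1 - f p) - op_scale \<i> (f y2 - f q))" using t by simp
  also have "\<dots> \<le> (1/t) * (1/80 + 1/80)"
    using norm_triangle_ineq4[of "- (f y1 - f p)" "op_scale \<i> (f y2 - f q)"] y1 y2 t
    unfolding norm_op_scale norm_minus_cancel by (intro mult_left_mono) auto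
  also have "\<dots> = norm (f a) / 2" using False by (simp add: t_def)
  finally have 1: "norm (f a - f y) \<le> norm (f a) / 2" .
  have "\<nu> y = (1/t) * \<nu> (y1 + op_scale \<i> y2)" using t y1 y2 by (simp add: y_def nu_scaleR)
  also have "\<dots> \<le> (1/t) * 4"
    using nu_add[of y1 "op_scale \<i> y2"] nu_scale[of y2 \<i>] y1 y2 t by (intro mult_left_mono) auto
  also have "\<dots> = 80 * norm (f a)" using False by (simp add: t_def)
  finally show ?thesis using 1 \<open>y \<in> S\<close> by blast
qed

text \<open>The iteration of the open mapping theorem turns approximate lifts into exact ones; as it starts
  from a point of the closure of the range, the range is closed.\<close>

lemma exact_lift:
  assumes T: "T \<in> closure (f ` S)"
  shows "\<exists>y\<in>S. f y = T \<and> \<nu> y \<le> 800 * norm T"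
proof -
  \<comment> \<open>Approximating \<open>T\<close> by \<open>f a\<close> up to a quarter of its norm leaves \<open>1/4 + 5/4 \<sqdot> 1/2 = 7/8\<close> at the cost
    \<open>80 \<sqdot> 5/4 = 100\<close>; the geometric series has sum \<open>8 \<sqdot> 100\<close>.\<close>
  have step: "\<exists>y\<in>S. norm (T - f y) \<le> (7/8) * norm T \<and> \<nu> y \<le> 100 * norm T" if T: "T \<in> closure (f ` S)" for T
  proof (cases "T = 0")
    case True then show ?thesis by (intro bexI[of _ 0]) auto
  next
    case False
    then obtain a where a: "a \<in> S" "dist (f a) T < norm T / 4"
      using T unfolding closure_approachable by (metis imageE zero_less_norm_iff divide_pos_pos zero_less_numeral)
    then have d: "norm (T - f a) \<le> norm T / 4" by (simp add: dist_norm norm_minus_commute)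
    then have na: "norm (f a) \<le> (5/4) * norm T" using norm_triangle_ineq2[of "f a" T] by (simp add: norm_minus_commute)
    obtain y where y: "y \<in> S" "norm (f a - f y) \<le> norm (f a) / 2" "\<nu> y \<le> 80 * norm (f a)"
      using approximate_lift[OF a(1)] by blast
    have "norm (T - f y) \<le> norm (T - f a) + norm (f a - f y)"
      using norm_triangle_ineq[of "T - f a" "f a - f y"] by simp
    then show ?thesis using d na y by (intro bexI[of _ y]) auto
  qed
  define g where "g T = (SOME y. y \<in> S \<and> norm (T - f y) \<le> (7/8) * norm T \<and> \<nu> y \<le> 100 * norm T)" for T
  have g: "g T \<in> S" "norm (T - f (g T)) \<le> (7/8) * norm T" "\<nu> (g T) \<le> 100 * norm T"
    if "T \<in> closure (f ` S)" for T
    using someI_ex[OF step[OF that, unfolded Bex_def]] unfolding g_def by blast+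
  define R where "R = rec_nat T (\<lambda>n x. x - f (g x))"
  have R0: "R 0 = T" and RS: "R (Suc n) = R n - f (g (R n))" for n by (simp_all add: R_def)
  have "subspace (f ` S)"
    unfolding subspace_def
  proof (intro conjI ballI allI)
    show "0 \<in> f ` S" using f_0 zero_in by (metis imageI)
    show "x + y \<in> f ` S" if "x \<in> f ` S" "y \<in> f ` S" for x y
      using that by (metis (no_types, lifting) add_in f_add imageE imageI)
    show "c *\<^sub>R x \<in> f ` S" if "x \<in> f ` S" for c x
      using that by (metis (no_types, lifting) scaleR_in f_scaleR imageE imageI)
  qed
  then have sub: "subspace (closure (f ` S))" by (rule subspace_closure)
  have Rcl: "R n \<in> closure (f ` S)" for n
  proof (induction n)
    case (Suc n)
    have "f (g (R n)) \<in> closure (f ` S)" using g(1)[OF Suc] closure_subset by (meson imageI subsetD)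
    then show ?case unfolding RS by (intro subspace_diff[OF sub] Suc)
  qed (simp add: R0 T)
  note gR = g[OF Rcl]
  have nR: "norm (R n) \<le> (7/8) ^ n * norm T" for n
  proof (induction n)
    case (Suc n) then show ?case using gR(2)[of n] by (simp add: RS)
  qed (simp add: R0)
  define Y where "Y n = (\<Sum>i<n. g (R i))" for n
  have Y: "Y n \<in> S" for n unfolding Y_def by (rule sum_in) (rule gR(1))
  have fY: "T - f (Y n) = R n" for n
  proof (induction n)
    case (Suc n) then show ?case using Y[of n] gR(1)[of n] f_add[of "Y n" "g (R n)"]
      by (simp add: RS Y_def algebra_simps)
  qed (simp add: R0 Y_def)
  have gn: "\<nu> (g (R n)) \<le> 100 * norm T * (7/8) ^ n" for n
    using gR(3)[of n] nR[of n] by (simp add: mult.commute)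
  have "\<nu> (Y (Suc n) - Y n) \<le> 100 * norm T * (7/8) ^ n" for n
    using gn by (simp add: Y_def)
  from geometric_limit[OF Y this] obtain y where y: "y \<in> S" "(\<lambda>n. \<nu> (Y n - y)) \<longlonglongrightarrow> 0" by auto
  have pw: "(\<lambda>n. (7/8::real) ^ n) \<longlonglongrightarrow> 0" by (intro LIMSEQ_power_zero) auto
  have "norm (T - f y) \<le> (7/8) ^ n * norm T + 2 * \<nu> (Y n - y)" for n
  proof -
    have "T - f y = R n + f (Y n - y)" using fY[of n] Y y by (simp add: f_diff algebra_simps)
    then show ?thesis
      using norm_triangle_ineq[of "R n" "f (Y n - y)"] nR[of n] hom_bounded[of "Y n - y"] Y y by simp
  qed
  moreover have "(\<lambda>n. (7/8) ^ n * norm T + 2 * \<nu> (Y n - y)) \<longlonglongrightarrow> 0 * norm T + 2 * 0"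
    by (intro tendsto_intros pw y)
  ultimately have "norm (T - f y) \<le> 0 * norm T + 2 * 0" by (intro LIMSEQ_le_const) auto
  then have "f y = T" by simp
  have nY: "\<nu> (Y n) \<le> 800 * norm T * (1 - (7/8) ^ n)" for n
  proof (induction n)
    case (Suc n)
    have "\<nu> (Y (Suc n)) \<le> \<nu> (Y n) + \<nu> (g (R n))"
      using nu_add[of "Y n" "g (R n)"] Y[of n] gR(1)[of n] by (simp add: Y_def)
    then show ?case using Suc gn[of n] by (simp add: algebra_simps)
  qed (simp add: Y_def)
  have "\<nu> y \<le> 800 * norm T + \<nu> (Y n - y)" for n
  proof -
    have "800 * norm T * (1 - (7/8) ^ n) \<le> 800 * norm T * 1" by (intro mult_left_mono) auto
    then show ?thesis
      using nY[of n] nu_add[of "Y n" "y - Y n"] nu_commute[of y "Y n"] Y y by simp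
  qed
  moreover have "(\<lambda>n. 800 * norm T + \<nu> (Y n - y)) \<longlonglongrightarrow> 800 * norm T + 0" by (intro tendsto_intros y)
  ultimately have "\<nu> y \<le> 800 * norm T + 0" by (intro LIMSEQ_le_const) auto
  then show ?thesis using \<open>f y = T\<close> y by auto
qed

corollary closed_range: "closed (f ` S)"
  unfolding closure_subset_eq[symmetric] using exact_lift by blast

corollary injective_bounded_below:
  assumes "inj_on f S" "a \<in> S" shows "\<nu> a \<le> 800 * norm (f a)"
proof -
  obtain y where "y \<in> S" "f y = f a" "\<nu> y \<le> 800 * norm (f a)"
    using exact_lift[of "f a"] assms closure_subset by (metis imageI subsetD)
  then show ?thesis using assms by (metis inj_onD)
qed

end

section \<open>Limits along an ultrafilter\<close>

lemma ultrafilter_limit_exists: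
  fixes f :: "nat \<Rightarrow> 'a::topological_space"
  assumes om: "free_ultrafilter \<omega>" and K: "compact K" "\<And>n. f n \<in> K"
  shows "\<exists>l\<in>K. (f \<longlongrightarrow> l) \<omega>"
proof -
  have "filtermap f \<omega> \<noteq> bot" using om by (simp add: free_ultrafilter_def filtermap_bot_iff)
  moreover have "eventually (\<lambda>x. x \<in> K) (filtermap f \<omega>)" using K by (simp add: eventually_filtermap)
  ultimately obtain l where l: "l \<in> K" "inf (nhds l) (filtermap f \<omega>) \<noteq> bot"
    using K(1) unfolding compact_filter by blast
  have "eventually (\<lambda>n. f n \<in> V) \<omega>" if V: "open V" "l \<in> V" for V
  proof (rule ccontr)
    assume "\<not> ?thesis"
    then have "eventually (\<lambda>n. f n \<notin> V) \<omega>" using om unfolding free_ultrafilter_def by blast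
    then have "eventually (\<lambda>x. x \<notin> V) (filtermap f \<omega>)" by (simp add: eventually_filtermap)
    moreover have "eventually (\<lambda>x. x \<in> V) (nhds l)" using V by (auto simp: eventually_nhds)
    ultimately have "eventually (\<lambda>x. False) (inf (nhds l) (filtermap f \<omega>))"
      unfolding eventually_inf by (intro exI[of _ "\<lambda>x. x \<in> V"] exI[of _ "\<lambda>x. x \<notin> V"]) auto
    then show False using l by (simp add: trivial_limit_def)
  qed
  then show ?thesis using l(1) by (auto simp: tendsto_def)
qed

lemma ultrafilter_nontrivial: "free_ultrafilter \<omega> \<Longrightarrow> \<omega> \<noteq> bot" by (simp add: free_ultrafilter_def)

lemma ultrafilter_limit_bounded:
  fixes f :: "nat \<Rightarrow> 'a::heine_borel"
  assumes "free_ultrafilter \<omega>" "bounded (range f)"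
  shows "\<exists>l. (f \<longlongrightarrow> l) \<omega>"
proof -
  have "compact (closure (range f))" using assms(2) by (simp add: compact_closure)
  moreover have "f n \<in> closure (range f)" for n using closure_subset by (metis rangeI subsetD)
  ultimately show ?thesis using ultrafilter_limit_exists[OF assms(1)] by blast
qed

section \<open>Metric calculus in an abstract C*-algebra\<close>

context cstar_algebra
begin

abbreviation "C \<equiv> cs_carrier A"
abbreviation cadd (infixl "\<oplus>" 65) where "x \<oplus> y \<equiv> cs_add A x y"
abbreviation cmul (infixl "\<otimes>" 70) where "x \<otimes> y \<equiv> cs_mult A x y"
abbreviation "neg \<equiv> cs_scale A (- 1)"
abbreviation "nrm \<equiv> cs_norm A"
abbreviation "zer \<equiv> cs_zero A"

text \<open>The distance is the only form in which differences occur below.\<close>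

definition dst :: "'a \<Rightarrow> 'a \<Rightarrow> real" where "dst x y = nrm (cs_diff A x y)"

lemma diff_closed: "x \<in> C \<Longrightarrow> y \<in> C \<Longrightarrow> cs_diff A x y \<in> C"
  by (simp add: cs_diff_def add_closed scale_closed)

lemma add_zero_right: "x \<in> C \<Longrightarrow> x \<oplus> zer = x" by (metis add_commute add_zero zero_closed)
lemma add_neg: "x \<in> C \<Longrightarrow> x \<oplus> neg x = zer" using add_inverse by (simp add: cs_diff_def)
lemma neg_add: "x \<in> C \<Longrightarrow> neg x \<oplus> x = zer" by (metis add_neg add_commute scale_closed)
lemma neg_neg: "x \<in> C \<Longrightarrow> neg (neg x) = x" by (simp add: scale_scale scale_one)
lemma add_left_commute: "x \<in> C \<Longrightarrow> y \<in> C \<Longrightarrow> z \<in> C \<Longrightarrow> x \<oplus> (y \<oplus> z) = y \<oplus> (x \<oplus> z)"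
  by (metis add_assoc add_commute)
lemma scale_0: "x \<in> C \<Longrightarrow> cs_scale A 0 x = zer"
proof -
  assume x: "x \<in> C"
  have "cs_scale A (1 + (- 1)) x = x \<oplus> neg x" using x by (simp only: scale_add_left scale_one)
  then show ?thesis using add_neg[OF x] by simp
qed
lemma scale_zer: "cs_scale A c zer = zer"
  using scale_scale[OF zero_closed, of c 0] scale_0[OF zero_closed] by simp

lemma add_diff_cancel: "x \<in> C \<Longrightarrow> z \<in> C \<Longrightarrow> x \<oplus> cs_diff A z x = z"
  by (simp add: cs_diff_def add_left_commute[of x z] scale_closed add_neg add_zero_right)

lemma add_diff_cancel_left: "x \<in> C \<Longrightarrow> z \<in> C \<Longrightarrow> cs_diff A (x \<oplus> z) x = z"
  by (simp add: cs_diff_def add_assoc add_commute[of z] scale_closed)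
     (simp add: add_assoc[symmetric] scale_closed add_neg add_zero)

lemma norm_zero: "nrm zer = 0" using norm_eq_zero[OF zero_closed] by simp

lemma diff_zero: "x \<in> C \<Longrightarrow> cs_diff A x zer = x" by (simp add: cs_diff_def scale_zer add_zero_right)

lemma dst_zero: "x \<in> C \<Longrightarrow> dst x zer = nrm x" by (simp add: dst_def diff_zero)

lemma dst_nonneg: "x \<in> C \<Longrightarrow> y \<in> C \<Longrightarrow> 0 \<le> dst x y" by (simp add: dst_def norm_nonneg diff_closed)

lemma dst_self: "x \<in> C \<Longrightarrow> dst x x = 0" by (simp add: dst_def add_inverse norm_zero)

lemma dst_commute: assumes "x \<in> C" "y \<in> C" shows "dst x y = dst y x"
proof -
  have "cs_diff A y x = neg (cs_diff A x y)"
    using assms by (simp add: cs_diff_def scale_add_right scale_closed neg_neg add_commute)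
  then show ?thesis using assms by (simp add: dst_def norm_scale diff_closed)
qed

lemma diff_trans: assumes "x \<in> C" "y \<in> C" "z \<in> C" shows "cs_diff A x z = cs_diff A x y \<oplus> cs_diff A y z"
proof -
  have "cs_diff A x y \<oplus> cs_diff A y z = x \<oplus> (neg y \<oplus> (y \<oplus> neg z))"
    using assms by (simp add: cs_diff_def add_assoc add_closed scale_closed)
  also have "neg y \<oplus> (y \<oplus> neg z) = neg z"
    using assms by (simp add: add_assoc[symmetric] scale_closed neg_add add_zero)
  finally show ?thesis by (simp add: cs_diff_def)
qed

lemma dst_triangle: "x \<in> C \<Longrightarrow> y \<in> C \<Longrightarrow> z \<in> C \<Longrightarrow> dst x z \<le> dst x y + dst y z"
  unfolding dst_def by (subst diff_trans[of x y z]) (auto intro: norm_add diff_closed)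

lemma dst_add:
  assumes "x \<in> C" "y \<in> C" "x' \<in> C" "y' \<in> C"
  shows "dst (x \<oplus> y) (x' \<oplus> y') \<le> dst x x' + dst y y'"
proof -
  have "cs_diff A (x \<oplus> y) (x' \<oplus> y') = (x \<oplus> y) \<oplus> (neg x' \<oplus> neg y')"
    using assms by (simp add: cs_diff_def scale_add_right)
  also have "\<dots> = cs_diff A x x' \<oplus> cs_diff A y y'"
    using assms by (simp add: cs_diff_def add_assoc add_closed scale_closed add_left_commute[of y])
  finally show ?thesis using assms by (simp add: dst_def norm_add diff_closed)
qed

lemma dst_scale: assumes "x \<in> C" "y \<in> C" shows "dst (cs_scale A c x) (cs_scale A c y) = cmod c * dst x y"
proof -
  have "cs_diff A (cs_scale A c x) (cs_scale A c y) = cs_scale A c (cs_diff A x y)"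
    using assms by (simp add: cs_diff_def scale_add_right scale_closed scale_scale)
  then show ?thesis using assms by (simp add: dst_def norm_scale diff_closed)
qed

lemma norm_star_le: assumes x: "x \<in> C" shows "nrm x \<le> nrm (cs_star A x)"
proof (cases "nrm x = 0")
  case False
  have "nrm x * nrm x \<le> nrm (cs_star A x) * nrm x"
    using cstar_identity[OF x] norm_mult[of "cs_star A x" x] x by (simp add: power2_eq_square star_closed)
  then show ?thesis using False norm_nonneg[OF x] by (simp add: mult_le_cancel_right)
qed (use x norm_nonneg star_closed in auto)

lemma norm_star: "x \<in> C \<Longrightarrow> nrm (cs_star A x) = nrm x"
  using norm_star_le[of x] norm_star_le[of "cs_star A x"] by (simp add: star_closed star_star)

lemma dst_star: assumes "x \<in> C" "y \<in> C" shows "dst (cs_star A x) (cs_star A y) = dst x y"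
proof -
  have "cs_diff A (cs_star A x) (cs_star A y) = cs_star A (cs_diff A x y)"
    using assms by (simp add: cs_diff_def star_add scale_closed star_scale)
  then show ?thesis using assms by (simp add: dst_def norm_star diff_closed)
qed

lemma dst_mult:
  assumes "x \<in> C" "y \<in> C" "x' \<in> C" "y' \<in> C"
  shows "dst (x \<otimes> y) (x' \<otimes> y') \<le> nrm x * dst y y' + dst x x' * nrm y'"
proof -
  have "cs_diff A (x \<otimes> y) (x' \<otimes> y') = cs_diff A (x \<otimes> y) (x \<otimes> y') \<oplus> cs_diff A (x \<otimes> y') (x' \<otimes> y')"
    using assms by (intro diff_trans) (auto intro: mult_closed)
  also have "cs_diff A (x \<otimes> y) (x \<otimes> y') = x \<otimes> cs_diff A y y'"
    using assms by (simp add: cs_diff_def mult_add_right scale_closed mult_scale_right)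
  also have "cs_diff A (x \<otimes> y') (x' \<otimes> y') = cs_diff A x x' \<otimes> y'"
    using assms by (simp add: cs_diff_def mult_add_left scale_closed mult_scale_left)
  finally have "dst (x \<otimes> y) (x' \<otimes> y') \<le> nrm (x \<otimes> cs_diff A y y') + nrm (cs_diff A x x' \<otimes> y')"
    using assms by (simp add: dst_def norm_add diff_closed mult_closed)
  also have "\<dots> \<le> nrm x * dst y y' + dst x x' * nrm y'"
    unfolding dst_def using assms by (intro add_mono norm_mult diff_closed)
  finally show ?thesis .
qed

lemma dst_norm: "x \<in> C \<Longrightarrow> y \<in> C \<Longrightarrow> \<bar>nrm x - nrm y\<bar> \<le> dst x y"
  using dst_triangle[of x y zer] dst_triangle[of y x zer] dst_commute[of x y] zero_closed
  by (simp add: dst_zero abs_le_iff)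

lemma dst_eq_0: "x \<in> C \<Longrightarrow> y \<in> C \<Longrightarrow> dst x y = 0 \<longleftrightarrow> x = y"
  using norm_eq_zero[of "cs_diff A x y"] add_diff_cancel[of y x] add_zero_right[of y] add_inverse
  by (auto simp: dst_def diff_closed norm_zero)

lemma geometric_limit:
  assumes X: "\<And>k. X k \<in> C" and le: "\<And>k. dst (X (Suc k)) (X k) \<le> (1/2) ^ k"
  shows "\<exists>y\<in>C. \<forall>k. dst (X k) y \<le> 2 * (1/2) ^ k"
proof -
  have 1: "dst (X (n + k)) (X n) \<le> 2 * (1/2) ^ n" for n k
  proof -
    have "dst (X (n + k)) (X n) \<le> 2 * (1/2) ^ n * (1 - (1/2) ^ k)"
    proof (induction k)
      case (Suc k)
      have "dst (X (n + Suc k)) (X n) \<le> dst (X (Suc (n + k))) (X (n + k)) + dst (X (n + k)) (X n)"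
        using dst_triangle[OF X[of "Suc (n + k)"] X[of "n + k"] X[of n]] by simp
      then show ?case using le[of "n + k"] Suc by (simp add: algebra_simps power_add)
    qed (simp add: dst_self X)
    also have "\<dots> \<le> 2 * (1/2) ^ n * 1" by (intro mult_left_mono) auto
    finally show ?thesis by simp
  qed
  have 2: "dst (X m) (X n) \<le> 2 * (1/2) ^ min m n" for m n
    using 1[of n "m - n"] 1[of m "n - m"] dst_commute[OF X X, of m n] by (cases "n \<le> m") (auto simp: min_def)
  have pw: "(\<lambda>n. 2 * (1/2::real) ^ n) \<longlonglongrightarrow> 2 * 0" by (intro tendsto_intros LIMSEQ_power_zero) auto
  have "\<exists>y\<in>C. (\<lambda>n. nrm (cs_diff A (X n) y)) \<longlonglongrightarrow> 0"
  proof (rule complete[OF X], intro allI impI)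
    fix e :: real assume "e > 0"
    then have "eventually (\<lambda>n. 2 * (1/2::real) ^ n < e) sequentially" using order_tendstoD(2)[OF pw] by simp
    then obtain N where N: "\<And>n. n \<ge> N \<Longrightarrow> 2 * (1/2::real) ^ n < e" by (auto simp: eventually_sequentially)
    have "dst (X m) (X n) < e" if "m \<ge> N" "n \<ge> N" for m n
      using 2[of m n] N[of "min m n"] that by simp
    then show "\<exists>N. \<forall>m\<ge>N. \<forall>n\<ge>N. nrm (cs_diff A (X m) (X n)) < e" unfolding dst_def by blast
  qed
  then obtain y where y: "y \<in> C" "(\<lambda>n. dst (X n) y) \<longlonglongrightarrow> 0" unfolding dst_def by blast
  have "dst (X k) y \<le> 2 * (1/2) ^ k" for k
  proof -
    have "(\<lambda>n. 2 * (1/2) ^ k + dst (X (n + k)) y) \<longlonglongrightarrow> 2 * (1/2) ^ k + 0"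
      by (intro tendsto_intros LIMSEQ_ignore_initial_segment y)
    moreover have "dst (X k) y \<le> 2 * (1/2) ^ k + dst (X (n + k)) y" for n
      using dst_triangle[OF X X y(1), of k "n + k"] 1[of k n] dst_commute[OF X X, of k "n + k"]
      by (simp add: add.commute)
    ultimately have "dst (X k) y \<le> 2 * (1/2) ^ k + 0" by (intro LIMSEQ_le_const) auto
    then show ?thesis by simp
  qed
  then show ?thesis using y by blast
qed

end

section \<open>The ultraproduct\<close>

locale ultra = cstar_algebra A for A :: "'a cstar" +
  fixes \<omega> :: "nat filter"
  assumes om: "free_ultrafilter \<omega>"
begin

abbreviation "L \<equiv> cs_carrier (linf A)"
abbreviation "U \<equiv> ultraproduct \<omega> A"
abbreviation "cls \<equiv> ultra_class \<omega> A"

lemma L_iff: "x \<in> L \<longleftrightarrow> (\<forall>n. x n \<in> C) \<and> (\<exists>B. \<forall>n. nrm (x n) \<le> B)"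
  by (auto simp: linf_def bdd_above_def)

lemma L_D: "x \<in> L \<Longrightarrow> x n \<in> C" by (simp add: L_iff)

lemma L_I: "(\<And>n. x n \<in> C) \<Longrightarrow> (\<And>n. nrm (x n) \<le> B) \<Longrightarrow> x \<in> L" by (auto simp: L_iff)

lemma L_B: assumes "x \<in> L" obtains B where "\<And>n. nrm (x n) \<le> B" "B \<ge> 0"
proof -
  obtain B where B: "\<And>n. nrm (x n) \<le> B" using assms by (auto simp: L_iff)
  have "B \<ge> 0" using B[of 0] norm_nonneg[OF L_D[OF assms, of 0]] by linarith
  then show thesis using B that by blast
qed

lemma L_zero: "(\<lambda>_. zer) \<in> L" by (rule L_I[of _ 0]) (auto simp: zero_closed norm_zero)

lemma L_add: assumes "x \<in> L" "y \<in> L" shows "(\<lambda>n. x n \<oplus> y n) \<in> L"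
proof -
  obtain B B' where "\<And>n. nrm (x n) \<le> B" "\<And>n. nrm (y n) \<le> B'" using assms L_B by metis
  then have "nrm (x n \<oplus> y n) \<le> B + B'" for n
    using norm_add[OF L_D[OF assms(1)] L_D[OF assms(2)], of n n] add_mono order_trans by blast
  then show ?thesis using assms by (intro L_I) (simp add: add_closed L_D)
qed

lemma L_scale: assumes "x \<in> L" shows "(\<lambda>n. cs_scale A c (x n)) \<in> L"
proof -
  obtain B where "\<And>n. nrm (x n) \<le> B" using assms L_B by metis
  then have "nrm (cs_scale A c (x n)) \<le> cmod c * B" for n
    using assms by (simp add: norm_scale L_D mult_left_mono)
  then show ?thesis using assms by (intro L_I) (simp add: scale_closed L_D)
qed

lemma L_mult: assumes "x \<in> L" "y \<in> L" shows "(\<lambda>n. x n \<otimes> y n) \<in> L"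
proof -
  obtain B B' where "\<And>n. nrm (x n) \<le> B" "B \<ge> 0" "\<And>n. nrm (y n) \<le> B'" using assms L_B by metis
  then have "nrm (x n) * nrm (y n) \<le> B * B'" for n
    using assms by (intro mult_mono) (auto simp: norm_nonneg L_D)
  then have "nrm (x n \<otimes> y n) \<le> B * B'" for n
    using norm_mult[OF L_D[OF assms(1)] L_D[OF assms(2)], of n n] order_trans by blast
  then show ?thesis using assms by (intro L_I) (simp add: mult_closed L_D)
qed

lemma L_star: assumes "x \<in> L" shows "(\<lambda>n. cs_star A (x n)) \<in> L"
proof -
  obtain B where "\<And>n. nrm (x n) \<le> B" using assms L_B by metis
  then show ?thesis using assms by (intro L_I[of _ B]) (auto simp: star_closed norm_star L_D)
qed

lemma L_diff: "x \<in> L \<Longrightarrow> y \<in> L \<Longrightarrow> (\<lambda>n. cs_diff A (x n) (y n)) \<in> L"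
  unfolding cs_diff_def by (intro L_add L_scale)

lemmas L_closed = L_zero L_add L_scale L_mult L_star L_diff

definition eqv :: "(nat \<Rightarrow> 'a) \<Rightarrow> (nat \<Rightarrow> 'a) \<Rightarrow> bool" where
  "eqv x y \<longleftrightarrow> ((\<lambda>n. dst (x n) (y n)) \<longlongrightarrow> 0) \<omega>"

lemma null_by_bound:
  assumes "\<And>n. 0 \<le> f n" "\<And>n. f n \<le> g n" "(g \<longlongrightarrow> 0) \<omega>" shows "(f \<longlongrightarrow> (0::real)) \<omega>"
  by (rule tendsto_sandwich[OF _ _ tendsto_const assms(3)]) (use assms in auto)

lemma eqv_refl: "x \<in> L \<Longrightarrow> eqv x x" by (simp add: eqv_def dst_self L_D)

lemma eqv_sym: "x \<in> L \<Longrightarrow> y \<in> L \<Longrightarrow> eqv x y \<Longrightarrow> eqv y x"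
  by (simp add: eqv_def dst_commute[of "y _" "x _"] L_D)

lemma eqv_trans: assumes "x \<in> L" "y \<in> L" "z \<in> L" "eqv x y" "eqv y z" shows "eqv x z"
  unfolding eqv_def
proof (rule null_by_bound)
  show "((\<lambda>n. dst (x n) (y n) + dst (y n) (z n)) \<longlongrightarrow> 0) \<omega>"
    using tendsto_add[OF assms(4,5)[unfolded eqv_def]] by simp
qed (use assms in \<open>auto intro!: dst_nonneg dst_triangle L_D\<close>)

lemma mem_cls: assumes x: "x \<in> L" shows "z \<in> cls x \<longleftrightarrow> z \<in> L \<and> eqv z x"
proof
  assume "z \<in> cls x"
  then obtain j where j: "j \<in> L" "((\<lambda>n. nrm (j n)) \<longlongrightarrow> 0) \<omega>" "z = (\<lambda>n. x n \<oplus> j n)"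
    by (auto simp: ultra_class_def coset_def comega_def) (simp add: linf_def)
  then show "z \<in> L \<and> eqv z x" using x
    by (simp add: L_add eqv_def dst_def add_diff_cancel_left L_D)
next
  assume z: "z \<in> L \<and> eqv z x"
  then have "(\<lambda>n. cs_diff A (z n) (x n)) \<in> comega \<omega> A"
    using x by (simp add: comega_def L_diff eqv_def dst_def)
  moreover have "z = cs_add (linf A) x (\<lambda>n. cs_diff A (z n) (x n))"
    using z x by (auto simp: linf_def fun_eq_iff add_diff_cancel)
  ultimately show "z \<in> cls x" unfolding ultra_class_def coset_def by (intro image_eqI)
qed

lemma cls_self: "x \<in> L \<Longrightarrow> x \<in> cls x" by (simp add: mem_cls eqv_refl)

lemma cls_eq: "x \<in> L \<Longrightarrow> y \<in> L \<Longrightarrow> cls x = cls y \<longleftrightarrow> eqv x y"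
  by (metis (no_types, lifting) cls_self mem_cls eqv_sym eqv_trans subsetI subset_antisym)

lemma carrier_U: "cs_carrier U = cls ` L"
  by (simp add: ultraproduct_def quotient_cstar_def ultra_class_def)

lemma zero_U: "cs_zero U = cls (\<lambda>_. zer)"
  by (simp add: ultraproduct_def quotient_cstar_def ultra_class_def linf_def)

lemma UN_const_eq: "x0 \<in> X \<Longrightarrow> (\<And>x. x \<in> X \<Longrightarrow> f x = Y) \<Longrightarrow> (\<Union>x\<in>X. f x) = Y" by auto

lemma eqv_add: assumes "x \<in> L" "y \<in> L" "x' \<in> L" "y' \<in> L" "eqv x x'" "eqv y y'"
  shows "eqv (\<lambda>n. x n \<oplus> y n) (\<lambda>n. x' n \<oplus> y' n)"
  unfolding eqv_def
proof (rule null_by_bound)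
  show "((\<lambda>n. dst (x n) (x' n) + dst (y n) (y' n)) \<longlongrightarrow> 0) \<omega>"
    using tendsto_add[OF assms(5,6)[unfolded eqv_def]] by simp
  show "0 \<le> dst (x n \<oplus> y n) (x' n \<oplus> y' n)" for n
    using assms(1-4)[THEN L_D] by (intro dst_nonneg add_closed)
qed (use assms in \<open>auto intro!: dst_add L_D\<close>)

lemma eqv_scale: assumes "x \<in> L" "x' \<in> L" "eqv x x'"
  shows "eqv (\<lambda>n. cs_scale A c (x n)) (\<lambda>n. cs_scale A c (x' n))"
  using tendsto_mult_left[OF assms(3)[unfolded eqv_def], of "cmod c"] assms
  by (simp add: eqv_def dst_scale L_D)

lemma eqv_star: assumes "x \<in> L" "x' \<in> L" "eqv x x'"
  shows "eqv (\<lambda>n. cs_star A (x n)) (\<lambda>n. cs_star A (x' n))"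
  using assms by (simp add: eqv_def dst_star L_D)

lemma eqv_mult: assumes "x \<in> L" "y \<in> L" "x' \<in> L" "y' \<in> L" "eqv x x'" "eqv y y'"
  shows "eqv (\<lambda>n. x n \<otimes> y n) (\<lambda>n. x' n \<otimes> y' n)"
proof -
  obtain B B' where B: "\<And>n. nrm (x n) \<le> B" "\<And>n. nrm (y' n) \<le> B'" using assms L_B by metis
  show ?thesis unfolding eqv_def
  proof (rule null_by_bound)
    show "((\<lambda>n. B * dst (y n) (y' n) + dst (x n) (x' n) * B') \<longlongrightarrow> 0) \<omega>"
      using tendsto_add[OF tendsto_mult_left[OF assms(6)[unfolded eqv_def], of B]
          tendsto_mult_right[OF assms(5)[unfolded eqv_def], of B']] by simp
    show "0 \<le> dst (x n \<otimes> y n) (x' n \<otimes> y' n)" for n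
      using assms by (intro dst_nonneg mult_closed L_D)
    show "dst (x n \<otimes> y n) (x' n \<otimes> y' n) \<le> B * dst (y n) (y' n) + dst (x n) (x' n) * B'" for n
    proof (rule order_trans[OF dst_mult])
      show "nrm (x n) * dst (y n) (y' n) + dst (x n) (x' n) * nrm (y' n) \<le> B * dst (y n) (y' n) + dst (x n) (x' n) * B'"
        using assms B by (intro add_mono mult_right_mono mult_left_mono dst_nonneg L_D) auto
    qed (use assms in \<open>auto intro: L_D\<close>)
  qed
qed

lemma add_U: assumes "x \<in> L" "y \<in> L" shows "cs_add U (cls x) (cls y) = cls (\<lambda>n. x n \<oplus> y n)"
proof -
  have "cs_add U (cls x) (cls y) = (\<Union>x'\<in>cls x. \<Union>y'\<in>cls y. cls (\<lambda>n. x' n \<oplus> y' n))"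
    by (simp add: ultraproduct_def quotient_cstar_def ultra_class_def linf_def)
  also have "\<dots> = cls (\<lambda>n. x n \<oplus> y n)"
    using assms
    by (intro UN_const_eq[OF cls_self] cls_eq[THEN iffD2] eqv_add L_add) (auto simp: mem_cls)
  finally show ?thesis .
qed

lemma mult_U: assumes "x \<in> L" "y \<in> L" shows "cs_mult U (cls x) (cls y) = cls (\<lambda>n. x n \<otimes> y n)"
proof -
  have "cs_mult U (cls x) (cls y) = (\<Union>x'\<in>cls x. \<Union>y'\<in>cls y. cls (\<lambda>n. x' n \<otimes> y' n))"
    by (simp add: ultraproduct_def quotient_cstar_def ultra_class_def linf_def)
  also have "\<dots> = cls (\<lambda>n. x n \<otimes> y n)"
    using assms
    by (intro UN_const_eq[OF cls_self] cls_eq[THEN iffD2] eqv_mult L_mult) (auto simp: mem_cls)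
  finally show ?thesis .
qed

lemma scale_U: assumes "x \<in> L" shows "cs_scale U c (cls x) = cls (\<lambda>n. cs_scale A c (x n))"
proof -
  have "cs_scale U c (cls x) = (\<Union>x'\<in>cls x. cls (\<lambda>n. cs_scale A c (x' n)))"
    by (simp add: ultraproduct_def quotient_cstar_def ultra_class_def linf_def)
  also have "\<dots> = cls (\<lambda>n. cs_scale A c (x n))"
    using assms
    by (intro UN_const_eq[OF cls_self] cls_eq[THEN iffD2] eqv_scale L_scale) (auto simp: mem_cls)
  finally show ?thesis .
qed

lemma star_U: assumes "x \<in> L" shows "cs_star U (cls x) = cls (\<lambda>n. cs_star A (x n))"
proof -
  have "cs_star U (cls x) = (\<Union>x'\<in>cls x. cls (\<lambda>n. cs_star A (x' n)))"
    by (simp add: ultraproduct_def quotient_cstar_def ultra_class_def linf_def)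
  also have "\<dots> = cls (\<lambda>n. cs_star A (x n))"
    using assms
    by (intro UN_const_eq[OF cls_self] cls_eq[THEN iffD2] eqv_star L_star) (auto simp: mem_cls)
  finally show ?thesis .
qed

lemma diff_U: "x \<in> L \<Longrightarrow> y \<in> L \<Longrightarrow> cs_diff U (cls x) (cls y) = cls (\<lambda>n. cs_diff A (x n) (y n))"
  by (simp add: cs_diff_def scale_U add_U L_scale)

lemma norm_limit_exists: assumes "x \<in> L" shows "\<exists>l. ((\<lambda>n. nrm (x n)) \<longlongrightarrow> l) \<omega>"
proof (rule ultrafilter_limit_bounded[OF om])
  obtain B where "\<And>n. nrm (x n) \<le> B" "B \<ge> 0" using assms L_B by metis
  then show "bounded (range (\<lambda>n. nrm (x n)))"
    by (intro boundedI[where B=B]) (auto simp: norm_nonneg L_D[OF assms])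
qed

text \<open>The quotient norm is the \<open>\<omega>\<close>-limit of the norms: the entries that exceed the limit by more
  than \<open>\<epsilon>\<close> may be replaced by \<open>0\<close> without changing the class.\<close>

lemma norm_U:
  assumes x: "x \<in> L" and l: "((\<lambda>n. nrm (x n)) \<longlongrightarrow> l) \<omega>"
  shows "cs_norm U (cls x) = l"
    and "e > 0 \<Longrightarrow> \<exists>z\<in>L. cls z = cls x \<and> (\<forall>n. nrm (z n) \<le> l + e)"
proof -
  have nb: "\<omega> \<noteq> bot" using om by (rule ultrafilter_nontrivial)
  have l0: "l \<ge> 0" by (rule tendsto_lowerbound[OF l _ nb]) (use x in \<open>auto simp: norm_nonneg L_D\<close>)
  have approx: "\<exists>z\<in>L. z \<in> cls x \<and> (\<forall>n. nrm (z n) \<le> l + e)" if e: "e > 0" for e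
  proof -
    define z where "z n = (if nrm (x n) \<le> l + e then x n else zer)" for n
    have z: "z \<in> L" by (rule L_I[of _ "l + e"]) (use x l0 e in \<open>auto simp: z_def L_D zero_closed norm_zero\<close>)
    have "eventually (\<lambda>n. nrm (x n) < l + e) \<omega>" using order_tendstoD(2)[OF l] e by simp
    then have "eventually (\<lambda>n. dst (z n) (x n) = 0) \<omega>"
      by eventually_elim (use x in \<open>auto simp: z_def dst_self L_D\<close>)
    then have "eqv z x" unfolding eqv_def by (rule tendsto_eventually)
    then show ?thesis using z x e l0 by (intro bexI[of _ z]) (auto simp: mem_cls z_def norm_zero)
  qed
  show "\<exists>z\<in>L. cls z = cls x \<and> (\<forall>n. nrm (z n) \<le> l + e)" if "e > 0" for e
    using approx[OF that] x by (auto simp: mem_cls cls_eq)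
  have NU: "cs_norm U X = (INF z\<in>X. SUP n. nrm (z n))" for X
    by (simp add: ultraproduct_def quotient_cstar_def linf_def)
  have lower: "l \<le> (SUP n. nrm (z n))" if "z \<in> cls x" for z
  proof -
    have z: "z \<in> L" "eqv z x" using that x by (auto simp: mem_cls)
    obtain B where B: "\<And>n. nrm (z n) \<le> B" using z(1) L_B by metis
    have le: "nrm (z n) \<le> (SUP n. nrm (z n))" for n by (rule cSUP_upper) (auto intro: bdd_aboveI2 B)
    have "((\<lambda>n. nrm (x n) - dst (z n) (x n)) \<longlongrightarrow> l - 0) \<omega>"
      using z(2) unfolding eqv_def by (intro tendsto_diff l)
    then have "l - 0 \<le> (SUP n. nrm (z n))"
    proof (rule tendsto_upperbound[OF _ always_eventually nb], intro allI)
      show "nrm (x n) - dst (z n) (x n) \<le> (SUP n. nrm (z n))" for n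
        using le[of n] dst_norm[OF L_D[OF z(1)] L_D[OF x], of n n] by linarith
    qed
    then show ?thesis by simp
  qed
  show "cs_norm U (cls x) = l"
  proof (rule antisym)
    show "l \<le> cs_norm U (cls x)"
      unfolding NU using cls_self[OF x] lower by (intro cINF_greatest) auto
    show "cs_norm U (cls x) \<le> l"
    proof (rule field_le_epsilon)
      fix e :: real assume "e > 0"
      then obtain z where z: "z \<in> cls x" "\<And>n. nrm (z n) \<le> l + e" using approx by blast
      have "cs_norm U (cls x) \<le> (SUP n. nrm (z n))"
        unfolding NU by (rule cINF_lower[OF _ z(1)]) (rule bdd_belowI2[where m=l], rule lower)
      also have "\<dots> \<le> l + e" by (rule cSUP_least) (use z(2) in auto)
      finally show "cs_norm U (cls x) \<le> l + e" .
    qed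
  qed
qed

lemma norm_U_tendsto: "x \<in> L \<Longrightarrow> ((\<lambda>n. nrm (x n)) \<longlongrightarrow> cs_norm U (cls x)) \<omega>"
  using norm_limit_exists[of x] norm_U(1)[of x] by auto

lemma norm_U_le:
  assumes "x \<in> L" "eventually (\<lambda>n. nrm (x n) \<le> B) \<omega>" shows "cs_norm U (cls x) \<le> B"
  by (rule tendsto_upperbound[OF norm_U_tendsto[OF assms(1)] assms(2) ultrafilter_nontrivial[OF om]])

lemma cls_eq_norm: "x \<in> L \<Longrightarrow> y \<in> L \<Longrightarrow> cls x = cls y \<longleftrightarrow> cs_norm U (cs_diff U (cls x) (cls y)) = 0"
  unfolding cls_eq diff_U eqv_def dst_def
  using norm_U_tendsto[OF L_diff, of x y] norm_U(1)[OF L_diff, of x y 0] by auto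

text \<open>Completeness is that of a Banach space modulo a closed subspace: successive differences of a
  rapidly convergent sequence of classes have small representatives, which are summed entrywise.\<close>

lemma complete_U:
  assumes X: "\<And>k. X k \<in> cs_carrier U"
    and cau: "\<forall>e>0. \<exists>N. \<forall>m\<ge>N. \<forall>n\<ge>N. cs_norm U (cs_diff U (X m) (X n)) < e"
  shows "\<exists>x\<in>cs_carrier U. (\<lambda>n. cs_norm U (cs_diff U (X n) x)) \<longlonglongrightarrow> 0"
proof -
  have "\<forall>k. \<exists>x\<in>L. X k = cls x" using X by (auto simp: carrier_U)
  then obtain x where x: "\<And>k. x k \<in> L" "\<And>k. X k = cls (x k)" by metis
  have "\<forall>k. \<exists>N. \<forall>m\<ge>N. \<forall>n\<ge>N. cs_norm U (cs_diff U (X m) (X n)) < (1/2) ^ k" using cau by simp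
  then obtain N where N: "\<And>k m n. m \<ge> N k \<Longrightarrow> n \<ge> N k \<Longrightarrow> cs_norm U (cs_diff U (X m) (X n)) < (1/2) ^ k"
    by metis
  define r where "r k = (\<Sum>i\<le>k. N i)" for k
  have rN: "N k \<le> r k" for k unfolding r_def by (rule member_le_sum) auto
  have rmono: "r k \<le> r (Suc k)" for k by (simp add: r_def)
  have "\<exists>d\<in>L. cls d = cls (\<lambda>n. cs_diff A (x (r (Suc k)) n) (x (r k) n)) \<and> (\<forall>n. nrm (d n) \<le> (1/2) ^ k)" for k
  proof -
    let ?D = "\<lambda>n. cs_diff A (x (r (Suc k)) n) (x (r k) n)"
    have D: "?D \<in> L" by (intro L_diff x)
    have "cs_norm U (cls ?D) < (1/2) ^ k"
      using N[of k "r (Suc k)" "r k"] rN[of k] rmono[of k] by (simp add: x diff_U)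
    then show ?thesis
      using norm_U(2)[OF D norm_U_tendsto[OF D], of "(1/2) ^ k - cs_norm U (cls ?D)"] by simp
  qed
  then obtain d where d: "\<And>k. d k \<in> L" "\<And>k. cls (d k) = cls (\<lambda>n. cs_diff A (x (r (Suc k)) n) (x (r k) n))"
    "\<And>k n. nrm (d k n) \<le> (1/2) ^ k" by metis
  define y where "y = rec_nat (x (r 0)) (\<lambda>k z n. z n \<oplus> d k n)"
  have y0: "y 0 = x (r 0)" and yS: "y (Suc k) = (\<lambda>n. y k n \<oplus> d k n)" for k by (simp_all add: y_def)
  have yL: "y k \<in> L" for k by (induction k) (auto simp: y0 yS x d L_add)
  have ycls: "cls (y k) = X (r k)" for k
  proof (induction k)
    case (Suc k)
    have "cls (y (Suc k)) = cs_add U (cls (x (r k))) (cls (\<lambda>n. cs_diff A (x (r (Suc k)) n) (x (r k) n)))"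
      using Suc by (simp add: yS add_U[symmetric] yL d x)
    also have "\<dots> = cls (x (r (Suc k)))"
      by (simp add: add_U x L_diff add_diff_cancel L_D[OF x(1)])
    finally show ?case by (simp add: x)
  qed (simp add: y0 x)
  have "\<exists>z\<in>C. \<forall>k. dst (y k n) z \<le> 2 * (1/2) ^ k" for n
  proof (rule geometric_limit)
    show "y k n \<in> C" for k by (rule L_D[OF yL])
    show "dst (y (Suc k) n) (y k n) \<le> (1/2) ^ k" for k
      using d(3)[of k n] by (simp add: yS dst_def add_diff_cancel_left L_D[OF yL] L_D[OF d(1)])
  qed
  then obtain z where z: "\<And>n. z n \<in> C" "\<And>n k. dst (y k n) (z n) \<le> 2 * (1/2) ^ k" by metis
  have zL: "z \<in> L"
  proof -
    obtain B where B: "\<And>n. nrm (y 0 n) \<le> B" using yL L_B by metis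
    show ?thesis
    proof (rule L_I[OF z(1)])
      show "nrm (z n) \<le> B + 2" for n
        using dst_norm[OF L_D[OF yL[of 0], of n] z(1)[of n]] z(2)[of 0 n] B[of n] by simp
    qed
  qed
  have lim: "cs_norm U (cs_diff U (X (r k)) (cls z)) \<le> 2 * (1/2) ^ k" for k
    unfolding ycls[symmetric] diff_U[OF yL zL]
    by (rule norm_U_le[OF L_diff[OF yL zL]]) (use z(2)[of k] in \<open>auto simp: dst_def\<close>)
  have "(\<lambda>n. cs_norm U (cs_diff U (X n) (cls z))) \<longlonglongrightarrow> 0"
  proof (rule LIMSEQ_I)
    fix e :: real assume e: "e > 0"
    have pw: "(\<lambda>n. 3 * (1/2::real) ^ n) \<longlonglongrightarrow> 3 * 0" by (intro tendsto_intros LIMSEQ_power_zero) auto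
    then obtain k where k: "3 * (1/2::real) ^ k < e"
      using order_tendstoD(2)[OF pw, of e] e by (auto simp: eventually_sequentially)
    have "norm (cs_norm U (cs_diff U (X n) (cls z)) - 0) < e" if n: "n \<ge> r k" for n
    proof -
      have t1: "((\<lambda>i. dst (x n i) (z i)) \<longlongrightarrow> cs_norm U (cs_diff U (X n) (cls z))) \<omega>"
        unfolding x(2) diff_U[OF x(1) zL] dst_def by (rule norm_U_tendsto[OF L_diff[OF x(1) zL]])
      have t2: "((\<lambda>i. dst (x n i) (x (r k) i) + dst (x (r k) i) (z i)) \<longlongrightarrow>
          cs_norm U (cs_diff U (X n) (X (r k))) + cs_norm U (cs_diff U (X (r k)) (cls z))) \<omega>"
        unfolding x(2) diff_U[OF x(1) zL] diff_U[OF x(1) x(1)] dst_def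
        by (intro tendsto_add norm_U_tendsto L_diff x zL)
      have "cs_norm U (cs_diff U (X n) (cls z))
          \<le> cs_norm U (cs_diff U (X n) (X (r k))) + cs_norm U (cs_diff U (X (r k)) (cls z))"
        by (rule tendsto_le[OF ultrafilter_nontrivial[OF om] t2 t1])
           (auto intro!: always_eventually dst_triangle L_D[OF x(1)] z)
      also have "\<dots> < (1/2) ^ k + 2 * (1/2) ^ k"
        using N[of k n "r k"] n rN[of k] lim[of k] by (intro add_less_le_mono) auto
      finally have "cs_norm U (cs_diff U (X n) (cls z)) < e" using k by simp
      moreover have "0 \<le> cs_norm U (cs_diff U (X n) (cls z))"
        by (rule tendsto_lowerbound[OF t1 _ ultrafilter_nontrivial[OF om]])
           (auto intro!: always_eventually dst_nonneg L_D[OF x(1)] z)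
      ultimately show ?thesis by simp
    qed
    then show "\<exists>no. \<forall>n\<ge>no. norm (cs_norm U (cs_diff U (X n) (cls z)) - 0) < e" by blast
  qed
  then show ?thesis using zL by (auto simp: carrier_U)
qed

lemma cstar_algebra_U: "cstar_algebra U"
proof
  note simps = carrier_U zero_U add_U mult_U scale_U star_U diff_U L_closed
  note nb = ultrafilter_nontrivial[OF om]
  show "\<exists>x\<in>cs_carrier U. (\<lambda>n. cs_norm U (cs_diff U (X n) x)) \<longlonglongrightarrow> 0"
    if "\<And>n. X n \<in> cs_carrier U" "\<forall>e>0. \<exists>N. \<forall>m\<ge>N. \<forall>n\<ge>N. cs_norm U (cs_diff U (X m) (X n)) < e" for X
    by (rule complete_U[OF that])
  fix c d :: complex and x' y' z'
  assume x': "x' \<in> cs_carrier U"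
  then obtain x where x: "x \<in> L" "x' = cls x" by (auto simp: carrier_U)
  note xL = x(1) L_D[OF x(1)]
  show "cs_scale U c x' \<in> cs_carrier U" "cs_star U x' \<in> cs_carrier U"
    "cs_add U (cs_zero U) x' = x'" "cs_diff U x' x' = cs_zero U"
    "cs_scale U (c + d) x' = cs_add U (cs_scale U c x') (cs_scale U d x')"
    "cs_scale U c (cs_scale U d x') = cs_scale U (c * d) x'" "cs_scale U 1 x' = x'"
    "cs_star U (cs_star U x') = x'" "cs_star U (cs_scale U c x') = cs_scale U (cnj c) (cs_star U x')"
    using xL by (simp_all add: x simps add_zero add_inverse scale_add_left scale_scale scale_one star_star star_scale)
  show "cs_norm U x' \<ge> 0" unfolding x
    by (rule tendsto_lowerbound[OF norm_U_tendsto[OF x(1)] _ nb]) (simp add: norm_nonneg xL)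
  show "cs_norm U x' = 0 \<longleftrightarrow> x' = cs_zero U"
    using cls_eq_norm[OF x(1) L_zero] by (simp add: x simps diff_zero xL)
  have scale_lim: "((\<lambda>n. nrm (cs_scale A c (x n))) \<longlongrightarrow> cmod c * cs_norm U (cls x)) \<omega>"
    using tendsto_mult_left[OF norm_U_tendsto[OF x(1)], of "cmod c"] by (simp add: norm_scale xL)
  show "cs_norm U (cs_scale U c x') = cmod c * cs_norm U x'"
    using norm_U(1)[OF L_scale[OF x(1)] scale_lim] by (simp add: x simps)
  have "((\<lambda>n. nrm (cs_star A (x n) \<otimes> x n)) \<longlongrightarrow> (cs_norm U (cls x))\<^sup>2) \<omega>"
    using tendsto_power[OF norm_U_tendsto[OF x(1)], of 2] by (simp add: cstar_identity xL)
  from norm_U(1)[OF L_mult[OF L_star[OF x(1)] x(1)] this]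
  show "cs_norm U (cs_mult U (cs_star U x') x') = (cs_norm U x')\<^sup>2" by (simp add: x simps)
  assume y': "y' \<in> cs_carrier U"
  then obtain y where y: "y \<in> L" "y' = cls y" by (auto simp: carrier_U)
  note yL = y(1) L_D[OF y(1)]
  show "cs_add U x' y' \<in> cs_carrier U" "cs_mult U x' y' \<in> cs_carrier U"
    "cs_scale U c (cs_add U x' y') = cs_add U (cs_scale U c x') (cs_scale U c y')"
    "cs_mult U (cs_scale U c x') y' = cs_scale U c (cs_mult U x' y')"
    "cs_mult U x' (cs_scale U c y') = cs_scale U c (cs_mult U x' y')"
    "cs_star U (cs_add U x' y') = cs_add U (cs_star U x') (cs_star U y')"
    "cs_star U (cs_mult U x' y') = cs_mult U (cs_star U y') (cs_star U x')"
    using xL yL by (simp_all add: x y simps scale_add_right mult_scale_left mult_scale_right star_add star_mult)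
  show "cs_add U x' y' = cs_add U y' x'"
    using xL yL by (simp add: x y simps add_commute[of "x _"])
  show "cs_norm U (cs_add U x' y') \<le> cs_norm U x' + cs_norm U y'"
  proof -
    have "cs_norm U (cls (\<lambda>n. x n \<oplus> y n)) \<le> cs_norm U (cls x) + cs_norm U (cls y)"
      by (rule tendsto_le[OF nb tendsto_add[OF norm_U_tendsto norm_U_tendsto] norm_U_tendsto])
         (use xL yL in \<open>auto simp: L_add norm_add\<close>)
    then show ?thesis using x y by (simp add: simps)
  qed
  show "cs_norm U (cs_mult U x' y') \<le> cs_norm U x' * cs_norm U y'"
  proof -
    have "cs_norm U (cls (\<lambda>n. x n \<otimes> y n)) \<le> cs_norm U (cls x) * cs_norm U (cls y)"
      by (rule tendsto_le[OF nb tendsto_mult[OF norm_U_tendsto norm_U_tendsto] norm_U_tendsto])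
         (use xL yL in \<open>auto simp: L_mult norm_mult\<close>)
    then show ?thesis using x y by (simp add: simps)
  qed
  assume z': "z' \<in> cs_carrier U"
  then obtain z where z: "z \<in> L" "z' = cls z" by (auto simp: carrier_U)
  note zL = z(1) L_D[OF z(1)]
  show "cs_add U (cs_add U x' y') z' = cs_add U x' (cs_add U y' z')"
    "cs_mult U (cs_mult U x' y') z' = cs_mult U x' (cs_mult U y' z')"
    "cs_mult U (cs_add U x' y') z' = cs_add U (cs_mult U x' z') (cs_mult U y' z')"
    "cs_mult U x' (cs_add U y' z') = cs_add U (cs_mult U x' y') (cs_mult U x' z')"
    using xL yL zL by (simp_all add: x y z simps add_assoc mult_assoc mult_add_left mult_add_right)
next
  show "cs_zero U \<in> cs_carrier U" by (simp add: zero_U carrier_U L_zero)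
qed

end

section \<open>Vectors and operators on \<open>\<ell>\<^sup>2(I; H)\<close>\<close>

lemma ell2_eqI: "(\<And>i. ell2_apply x i = ell2_apply y i) \<Longrightarrow> x = y"
  by (simp add: ell2_apply_inject[symmetric] fun_eq_iff)

lemmas ell2_simps = plus_ell2.rep_eq minus_ell2.rep_eq uminus_ell2.rep_eq zero_ell2.rep_eq
  scaleR_ell2.rep_eq scaleC_ell2.rep_eq

lemma ell2_apply_sum: "ell2_apply (sum f I) i = (\<Sum>j\<in>I. ell2_apply (f j) i)"
  by (induction I rule: infinite_finite_induct) (auto simp: ell2_simps)

definition ev :: "'i \<Rightarrow> ('i, 'h::chilbert_space) ell2 \<Rightarrow>\<^sub>L 'h" where
  "ev i = Blinfun (\<lambda>x. ell2_apply x i)"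

definition sg :: "'i \<Rightarrow> 'h::chilbert_space \<Rightarrow>\<^sub>L ('i, 'h) ell2" where
  "sg i = Blinfun (\<lambda>\<xi>. tensor_vec \<xi> (delta i))"

lemma ev_apply:
  fixes x :: "('i, 'h::chilbert_space) ell2"
  shows "blinfun_apply (ev i) x = ell2_apply x i"
proof -
  have "bounded_linear (\<lambda>x::('i, 'h) ell2. ell2_apply x i)"
    by (rule bounded_linear_intro[where K=1]) (auto simp: ell2_simps norm_ell2_apply_le)
  then show ?thesis by (simp add: ev_def bounded_linear_Blinfun_apply)
qed

lemma norm_single: "norm (tensor_vec \<xi> (delta i)) = norm \<xi>"
proof -
  have "(norm (tensor_vec \<xi> (delta i)))\<^sup>2 = (\<Sum>\<^sub>\<infinity>j\<in>{i}. (norm \<xi>)\<^sup>2)"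
    unfolding norm_ell2_sq by (rule infsum_cong_neutral) (auto simp: ell2_apply_tensor_delta)
  then show ?thesis by (simp add: power2_eq_iff_nonneg)
qed

lemma sg_eq:
  fixes \<xi> :: "'h::chilbert_space"
  shows "blinfun_apply (sg i) \<xi> = tensor_vec \<xi> (delta i)"
proof -
  have "bounded_linear (\<lambda>\<xi>::'h. tensor_vec \<xi> (delta i))"
    by (rule bounded_linear_intro[where K=1])
       (auto intro!: ell2_eqI simp: ell2_simps ell2_apply_tensor_delta norm_single)
  then show ?thesis by (simp add: sg_def bounded_linear_Blinfun_apply)
qed

lemma sg_apply: "ell2_apply (blinfun_apply (sg i) \<xi>) j = (if j = i then \<xi> else 0)"
  by (simp add: sg_eq ell2_apply_tensor_delta)

lemma norm_sg_apply [simp]: "norm (blinfun_apply (sg i) \<xi>) = norm \<xi>" by (simp add: sg_eq norm_single)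

lemma cinner_sg: "cinner x (blinfun_apply (sg i) \<xi>) = cinner (ell2_apply x i) \<xi>"
proof -
  have "cinner x (blinfun_apply (sg i) \<xi>) = (\<Sum>\<^sub>\<infinity>j\<in>{i}. cinner (ell2_apply x i) \<xi>)"
    unfolding cinner_ell2.rep_eq by (rule infsum_cong_neutral) (auto simp: sg_apply)
  then show ?thesis by simp
qed

lemma inner_sg: "x \<bullet> blinfun_apply (sg i) \<xi> = ell2_apply x i \<bullet> \<xi>"
  by (simp add: inner_cinner cinner_sg)

definition trunc :: "'i set \<Rightarrow> ('i, 'h::chilbert_space) ell2 \<Rightarrow> ('i, 'h) ell2" where
  "trunc E x = (\<Sum>i\<in>E. blinfun_apply (sg i) (ell2_apply x i))"

lemma trunc_apply: "finite E \<Longrightarrow> ell2_apply (trunc E x) i = (if i \<in> E then ell2_apply x i else 0)"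
  by (simp add: trunc_def ell2_apply_sum sg_apply if_distrib cong: if_cong)

lemma norm_fin_supp:
  assumes "finite E" "\<And>i. i \<notin> E \<Longrightarrow> ell2_apply x i = 0"
  shows "(norm x)\<^sup>2 = (\<Sum>i\<in>E. (norm (ell2_apply x i))\<^sup>2)"
proof -
  have "(norm x)\<^sup>2 = (\<Sum>\<^sub>\<infinity>i\<in>E. (norm (ell2_apply x i))\<^sup>2)"
    unfolding norm_ell2_sq by (rule infsum_cong_neutral) (use assms in auto)
  then show ?thesis using assms by simp
qed

lemma norm_trunc: "finite E \<Longrightarrow> (norm (trunc E x))\<^sup>2 = (\<Sum>i\<in>E. (norm (ell2_apply x i))\<^sup>2)"
  by (subst norm_fin_supp[of E]) (auto simp: trunc_apply)

lemma norm_trunc_le: "finite E \<Longrightarrow> norm (trunc E x) \<le> norm x"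
  by (rule power2_le_imp_le) (simp_all add: norm_trunc ell2_sum_le)

lemma norm_diff_trunc:
  assumes "finite E" shows "(norm (x - trunc E x))\<^sup>2 = (norm x)\<^sup>2 - (\<Sum>i\<in>E. (norm (ell2_apply x i))\<^sup>2)"
proof -
  have "x \<bullet> trunc E x = (\<Sum>i\<in>E. (norm (ell2_apply x i))\<^sup>2)"
    by (simp add: trunc_def inner_sum_right inner_sg power2_norm_eq_inner)
  then show ?thesis
    using norm_trunc[OF assms, of x]
    by (simp add: power2_norm_eq_inner inner_diff_left inner_diff_right inner_commute)
qed

lemma trunc_dense: assumes "e > 0" shows "\<exists>E. finite E \<and> norm (x - trunc E x) < e"
proof -
  have "((\<lambda>i. (norm (ell2_apply x i))\<^sup>2) has_sum (norm x)\<^sup>2) UNIV"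
    unfolding norm_ell2_sq using ell2_summable by (rule has_sum_infsum)
  then have "eventually (\<lambda>E. dist (\<Sum>i\<in>E. (norm (ell2_apply x i))\<^sup>2) ((norm x)\<^sup>2) < e\<^sup>2) (finite_subsets_at_top UNIV)"
    unfolding has_sum_def using assms by (intro tendstoD) auto
  then obtain E where E: "finite E" "dist (\<Sum>i\<in>E. (norm (ell2_apply x i))\<^sup>2) ((norm x)\<^sup>2) < e\<^sup>2"
    unfolding eventually_finite_subsets_at_top by blast
  then have "(norm (x - trunc E x))\<^sup>2 < e\<^sup>2" by (simp add: norm_diff_trunc dist_real_def)
  then show ?thesis using E assms by (metis power_less_imp_less_base less_imp_le)
qed

lemma blinfun_bound_by_trunc:
  fixes T :: "('i, 'h::chilbert_space) ell2 \<Rightarrow>\<^sub>L 'b::real_normed_vector"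
  assumes "\<And>E x. finite E \<Longrightarrow> norm (blinfun_apply T (trunc E x)) \<le> B * norm (trunc E x)" "B \<ge> 0"
  shows "norm T \<le> B"
proof (rule norm_blinfun_bound[OF assms(2)])
  fix x
  show "norm (blinfun_apply T x) \<le> B * norm x"
  proof (rule field_le_epsilon)
    fix e :: real assume "e > 0"
    then obtain E where E: "finite E" "norm (x - trunc E x) < e / (norm T + 1)"
      using trunc_dense[of "e / (norm T + 1)" x] by (auto simp: add_nonneg_pos)
    have "norm (blinfun_apply T x) \<le> norm (blinfun_apply T (trunc E x)) + norm (blinfun_apply T (x - trunc E x))"
      using norm_triangle_ineq[of "blinfun_apply T (trunc E x)" "blinfun_apply T (x - trunc E x)"]
      by (simp add: blinfun.diff_right)
    also have "norm (blinfun_apply T (trunc E x)) \<le> B * norm x"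
      using assms(1)[OF E(1), of x] mult_left_mono[OF norm_trunc_le[OF E(1), of x] assms(2)] by linarith
    also have "norm (blinfun_apply T (x - trunc E x)) \<le> norm T * norm (x - trunc E x)" by (rule norm_blinfun)
    also have "\<dots> \<le> (norm T + 1) * (e / (norm T + 1))" using E by (intro mult_mono) auto
    also have "\<dots> = e" using norm_ge_zero[of T] by (simp add: add_nonneg_eq_0_iff)
    finally show "norm (blinfun_apply T x) \<le> B * norm x + e" by simp
  qed
qed

lemma op_eqI_single:
  fixes S T :: "('i, 'h::chilbert_space) ell2 \<Rightarrow>\<^sub>L 'b::real_normed_vector"
  assumes "\<And>i \<xi>. blinfun_apply S (blinfun_apply (sg i) \<xi>) = blinfun_apply T (blinfun_apply (sg i) \<xi>)"
  shows "S = T"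
proof -
  have "norm (S - T) \<le> 0"
    by (rule blinfun_bound_by_trunc) (simp_all add: trunc_def blinfun.sum_right blinfun.diff_left assms)
  then show ?thesis by simp
qed

lemma bounded_linear_ell2I:
  assumes "\<And>x y i. ell2_apply (S (x + y)) i = ell2_apply (S x) i + ell2_apply (S y) i"
    and "\<And>r x i. ell2_apply (S (r *\<^sub>R x)) i = r *\<^sub>R ell2_apply (S x) i"
    and "\<And>x. norm (S x) \<le> norm x * K"
  shows "bounded_linear (S :: 'a::real_normed_vector \<Rightarrow> ('i, 'h::chilbert_space) ell2)"
  by (rule bounded_linear_intro[where K=K]) (use assms in \<open>auto intro!: ell2_eqI simp: ell2_simps\<close>)

text \<open>Matrix entries of an operator on \<open>\<ell>\<^sup>2(I; H)\<close>.\<close>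

definition entry :: "'i \<Rightarrow> 'i \<Rightarrow> ('i, 'h::chilbert_space) ell2 op \<Rightarrow> 'h op" where
  "entry i j T = ev i \<odot> T \<odot> sg j"

lemma entry_apply: "blinfun_apply (entry i j T) \<xi> = ell2_apply (blinfun_apply T (blinfun_apply (sg j) \<xi>)) i"
  by (simp add: entry_def ev_apply)

lemma entry_linear [simp]: "entry i j 0 = 0" "entry i j (S + T) = entry i j S + entry i j T"
  "entry i j (r *\<^sub>R T) = r *\<^sub>R entry i j T" "entry i j (S - T) = entry i j S - entry i j T"
  "entry i j (op_scale c T) = op_scale c (entry i j T)"
  by (auto intro!: blinfun_eqI simp: entry_apply blinfun.bilinear_simps ell2_simps op_scale_apply)

lemma norm_entry_le: "norm (entry i j T) \<le> norm T"
proof (rule norm_blinfun_bound)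
  show "norm (blinfun_apply (entry i j T) \<xi>) \<le> norm T * norm \<xi>" for \<xi>
    unfolding entry_apply using norm_ell2_apply_le norm_blinfun[of T "blinfun_apply (sg j) \<xi>"]
    by (metis norm_sg_apply order_trans)
qed simp

lemma bounded_linear_entry: "bounded_linear (entry i j)"
  by (rule bounded_linear_intro[where K=1]) (auto simp: norm_entry_le)

lemma entry_adj: assumes "T \<in> bounded_ops" shows "entry i j (op_adj T) = op_adj (entry j i T)"
proof (rule op_adjI[symmetric])
  fix x y
  have "cinner (blinfun_apply (entry j i T) x) y = cinner (blinfun_apply T (blinfun_apply (sg i) x)) (blinfun_apply (sg j) y)"
    by (simp add: entry_apply cinner_sg)
  also have "\<dots> = cinner x (blinfun_apply (entry i j (op_adj T)) y)"
    unfolding op_adj_cinner[OF assms] entry_apply by (metis cinner_commute cinner_sg)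
  finally show "cinner (blinfun_apply (entry j i T) x) y = cinner x (blinfun_apply (entry i j (op_adj T)) y)" .
qed

lemma entry_comp:
  assumes "finite E" "\<And>k. k \<notin> E \<Longrightarrow> entry k j T = 0"
  shows "entry i j (S \<odot> T) = (\<Sum>k\<in>E. entry i k S \<odot> entry k j T)"
proof (rule blinfun_eqI)
  fix \<xi>
  have "blinfun_apply T (blinfun_apply (sg j) \<xi>) = (\<Sum>k\<in>E. blinfun_apply (sg k) (blinfun_apply (entry k j T) \<xi>))"
  proof (rule ell2_eqI)
    fix i
    have "ell2_apply (blinfun_apply T (blinfun_apply (sg j) \<xi>)) i = (if i \<in> E then blinfun_apply (entry i j T) \<xi> else 0)"
      using assms(2)[of i] by (metis blinfun.zero_left entry_apply)
    then show "ell2_apply (blinfun_apply T (blinfun_apply (sg j) \<xi>)) i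
        = ell2_apply (\<Sum>k\<in>E. blinfun_apply (sg k) (blinfun_apply (entry k j T) \<xi>)) i"
      using assms(1) by (simp add: ell2_apply_sum sg_apply if_distrib cong: if_cong)
  qed
  from arg_cong[OF this, of "\<lambda>v. ell2_apply (blinfun_apply S v) i"]
  show "blinfun_apply (entry i j (S \<odot> T)) \<xi> = blinfun_apply (\<Sum>k\<in>E. entry i k S \<odot> entry k j T) \<xi>"
    by (simp only: entry_apply blinfun.sum_left blinfun.sum_right ell2_apply_sum blinfun_compose.rep_eq comp_def)
qed

lemma op_eqI_entry: "(\<And>i j. entry i j S = entry i j T) \<Longrightarrow> S = T"
  by (rule op_eqI_single, rule ell2_eqI) (metis entry_apply)

section \<open>Representations\<close>

lemma cstar_ops_concrete: assumes "concrete_cstar S" shows "cstar_ops S norm"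
proof -
  note D = concrete_cstarD[OF assms]
  show ?thesis
  proof
    fix X :: "nat \<Rightarrow> 'a op" assume X: "\<And>n. X n \<in> S" and C: "\<forall>e>0. \<exists>N. \<forall>m\<ge>N. \<forall>n\<ge>N. norm (X m - X n) < e"
    have "Cauchy X" by (rule CauchyI) (simp add: C)
    then obtain x where x: "X \<longlonglongrightarrow> x" using Cauchy_convergent convergent_def by blast
    have "x \<in> S" by (rule closed_sequentially[OF D(2) X x])
    moreover have "(\<lambda>n. norm (X n - x)) \<longlonglongrightarrow> 0" by (rule tendsto_norm_zero, rule LIM_zero, rule x)
    ultimately show "\<exists>x\<in>S. (\<lambda>n. norm (X n - x)) \<longlonglongrightarrow> 0" by blast
  qed (auto simp: D norm_triangle_ineq norm_op_scale norm_blinfun_compose norm_adj_comp)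
qed

lemma star_homD:
  assumes "star_hom A B f"
  shows "x \<in> cs_carrier A \<Longrightarrow> f x \<in> cs_carrier B"
    "x \<in> cs_carrier A \<Longrightarrow> y \<in> cs_carrier A \<Longrightarrow> f (cs_add A x y) = cs_add B (f x) (f y)"
    "x \<in> cs_carrier A \<Longrightarrow> f (cs_scale A c x) = cs_scale B c (f x)"
    "x \<in> cs_carrier A \<Longrightarrow> y \<in> cs_carrier A \<Longrightarrow> f (cs_mult A x y) = cs_mult B (f x) (f y)"
    "x \<in> cs_carrier A \<Longrightarrow> f (cs_star A x) = cs_star B (f x)"
  using assms unfolding star_hom_def by blast+

lemma op_cstar_simps [simp]: "cs_carrier (op_cstar S) = S" "cs_zero (op_cstar S) = 0" "cs_add (op_cstar S) = (+)"
  "cs_scale (op_cstar S) = op_scale" "cs_mult (op_cstar S) = (\<odot>)" "cs_star (op_cstar S) = op_adj"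
  "cs_norm (op_cstar S) = norm"
  by (simp_all add: op_cstar_def)

abbreviation "is_rep A \<sigma> \<equiv> star_hom A (op_cstar bounded_ops) \<sigma>"

text \<open>Through \<open>\<rho>\<close> an abstract C*-algebra becomes an instance of \<open>cstar_ops\<close>, and every representation \<open>\<sigma>\<close> a
  homomorphism out of it. The case \<open>\<sigma> = \<rho>\<close> is of interest too: its closed range theorem compares the abstract
  norm with the operator norm.\<close>

lemma cstar_ops_hom_faithful:
  assumes B: "cstar_algebra B" and rho: "faithful_rep B \<rho>" and sigma: "is_rep B \<sigma>"
  defines "\<theta> \<equiv> inv_into (cs_carrier B) \<rho>"
  shows "cstar_ops_hom (\<rho> ` cs_carrier B) (\<lambda>T. cs_norm B (\<theta> T)) (\<lambda>T. \<sigma> (\<theta> T))"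
proof -
  interpret cstar_algebra B by fact
  have inj: "inj_on \<rho> C" and hom: "is_rep B \<rho>" using rho by (auto simp: faithful_rep_def)
  have th: "\<theta> (\<rho> x) = x" if "x \<in> C" for x unfolding \<theta>_def by (rule inv_into_f_f[OF inj that])
  note R = star_homD[OF hom, simplified]
  note R' = R(2-5)[symmetric]
  note S = star_homD[OF sigma, simplified]
  note cl = zero_closed add_closed scale_closed mult_closed star_closed
  have r0: "\<rho> zer = 0" using R(3)[OF zero_closed, of 0] by (simp add: scale_zer)
  have rd: "\<rho> x - \<rho> y = \<rho> (cs_diff B x y)" if "x \<in> C" "y \<in> C" for x y
    using that by (simp add: cs_diff_def R scale_closed op_scale_minus1)
  show ?thesis
  proof
    fix X :: "nat \<Rightarrow> _" assume X: "\<And>n. X n \<in> \<rho> ` C"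
      and cau: "\<forall>e>0. \<exists>N. \<forall>m\<ge>N. \<forall>n\<ge>N. cs_norm B (\<theta> (X m - X n)) < e"
    obtain x where x: "\<And>n. x n \<in> C" "\<And>n. X n = \<rho> (x n)" using X unfolding image_iff by metis
    have "\<exists>y\<in>C. (\<lambda>n. cs_norm B (cs_diff B (x n) y)) \<longlonglongrightarrow> 0"
      by (rule complete) (use cau x in \<open>auto simp: rd th diff_closed\<close>)
    then obtain y where y: "y \<in> C" "(\<lambda>n. cs_norm B (cs_diff B (x n) y)) \<longlonglongrightarrow> 0" by blast
    then have "(\<lambda>n. cs_norm B (\<theta> (X n - \<rho> y))) \<longlonglongrightarrow> 0" by (simp add: x rd th diff_closed)
    then show "\<exists>x\<in>\<rho> ` C. (\<lambda>n. cs_norm B (\<theta> (X n - x))) \<longlonglongrightarrow> 0" using y by blast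
  next
    show "0 \<in> \<rho> ` C" using r0 zero_closed by (metis imageI)
  qed (auto simp: R' th cl R(1) S norm_add norm_scale norm_mult cstar_identity norm_nonneg norm_eq_zero r0)
qed

lemma rep_bounded:
  assumes "cstar_algebra B" "faithful_rep B \<rho>" "is_rep B \<sigma>" "b \<in> cs_carrier B"
  shows "norm (\<sigma> b) \<le> 2 * cs_norm B b"
  using cstar_ops_hom.hom_bounded[OF cstar_ops_hom_faithful[OF assms(1-3)], of "\<rho> b"] assms
  by (simp add: faithful_rep_def)

lemma faithful_rep_bounded_below:
  assumes "cstar_algebra B" "faithful_rep B \<rho>" "b \<in> cs_carrier B"
  shows "cs_norm B b \<le> 800 * norm (\<rho> b)"
proof -
  have rep: "is_rep B \<rho>" and inj: "inj_on \<rho> (cs_carrier B)" using assms by (auto simp: faithful_rep_def)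
  interpret cstar_ops_hom "\<rho> ` cs_carrier B" "\<lambda>T. cs_norm B (inv_into (cs_carrier B) \<rho> T)"
    "\<lambda>T. \<rho> (inv_into (cs_carrier B) \<rho> T)"
    by (rule cstar_ops_hom_faithful[OF assms(1,2) rep])
  have "inj_on (\<lambda>T. \<rho> (inv_into (cs_carrier B) \<rho> T)) (\<rho> ` cs_carrier B)"
    by (auto intro!: inj_onI simp: inj inv_into_f_f)
  from injective_bounded_below[OF this, of "\<rho> b"] show ?thesis using assms(3) inj by simp
qed

lemma faithful_image_concrete:
  assumes "cstar_algebra B" "faithful_rep B \<rho>"
  shows "concrete_cstar (\<rho> ` cs_carrier B)"
proof -
  have rep: "is_rep B \<rho>" and inj: "inj_on \<rho> (cs_carrier B)" using assms by (auto simp: faithful_rep_def)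
  interpret cstar_ops_hom "\<rho> ` cs_carrier B" "\<lambda>T. cs_norm B (inv_into (cs_carrier B) \<rho> T)"
    "\<lambda>T. \<rho> (inv_into (cs_carrier B) \<rho> T)"
    by (rule cstar_ops_hom_faithful[OF assms rep])
  have "(\<lambda>T. \<rho> (inv_into (cs_carrier B) \<rho> T)) ` (\<rho> ` cs_carrier B) = \<rho> ` cs_carrier B"
    by (force simp: inj inv_into_f_f)
  then have cl: "closed (\<rho> ` cs_carrier B)" using closed_range by simp
  moreover have "subspace (\<rho> ` cs_carrier B)"
    unfolding subspace_def by (intro conjI ballI allI zero_in add_in scaleR_in)
  ultimately show ?thesis
    unfolding concrete_cstar_def by (intro conjI ballI allI scale_in comp_in adj_in subsetI S_bounded)
qed

lemma concrete_hom:
  assumes "concrete_cstar S" "star_hom (op_cstar S) (op_cstar R) f" "R \<subseteq> bounded_ops"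
  shows "cstar_ops_hom S norm f"
proof -
  interpret cstar_ops S norm by (rule cstar_ops_concrete[OF assms(1)])
  note F = star_homD[OF assms(2), simplified]
  show ?thesis by unfold_locales (use F assms(3) in auto)
qed

section \<open>Reduced crossed products\<close>

lemma ell2_norm_le_pointwise:
  assumes "\<And>i. norm (ell2_apply y i) \<le> K * norm (ell2_apply x i)" "K \<ge> 0"
  shows "norm y \<le> K * norm x"
proof (rule power2_le_imp_le)
  have "(norm y)\<^sup>2 \<le> (\<Sum>\<^sub>\<infinity>i. K\<^sup>2 * (norm (ell2_apply x i))\<^sup>2)"
    unfolding norm_ell2_sq
  proof (rule infsum_mono[OF ell2_summable])
    show "(\<lambda>i. K\<^sup>2 * (norm (ell2_apply x i))\<^sup>2) summable_on UNIV"
      by (rule summable_on_cmult_right[OF ell2_summable])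
    show "(norm (ell2_apply y i))\<^sup>2 \<le> K\<^sup>2 * (norm (ell2_apply x i))\<^sup>2" for i
      using power_mono[OF assms(1)[of i], of 2] by (simp add: power_mult_distrib)
  qed
  also have "\<dots> = (K * norm x)\<^sup>2" by (simp add: infsum_cmult_right' norm_ell2_sq[symmetric] power_mult_distrib)
  finally show "(norm y)\<^sup>2 \<le> (K * norm x)\<^sup>2" .
qed (use assms in simp)

lemma norm_left_reg_apply [simp]:
  fixes x :: "('g::group_add, 'h::chilbert_space) ell2"
  shows "norm (blinfun_apply (left_reg s) x) = norm x"
proof -
  have "(norm (blinfun_apply (left_reg s) x))\<^sup>2 = (norm x)\<^sup>2"
    unfolding norm_ell2_sq left_reg_apply
    using infsum_reindex_bij_betw[OF bij_plus, of "\<lambda>g. (norm (ell2_apply x g))\<^sup>2" "- s"] by simp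
  then show ?thesis by (simp add: power2_eq_iff_nonneg)
qed

lemma norm_left_reg_le: "norm (left_reg s) \<le> 1"
  by (rule norm_blinfun_bound) auto

lemma left_reg_bounded_ops [simp]: "left_reg s \<in> bounded_ops"
  by (auto simp: bounded_ops_def left_reg_apply ell2_simps intro!: ell2_eqI)

lemma left_reg_comp: "left_reg s \<odot> left_reg t = left_reg (s + t)"
  by (intro blinfun_eqI ell2_eqI) (simp only: left_reg_apply minus_add add.assoc blinfun_apply_blinfun_compose)

lemma left_reg_adj: "op_adj (left_reg s) = left_reg (- s)"
proof (rule op_adjI)
  fix x y :: "('a, 'b) ell2"
  have "(\<Sum>\<^sub>\<infinity>g. cinner (ell2_apply x (- s + g)) (ell2_apply y g)) =
      (\<Sum>\<^sub>\<infinity>g. cinner (ell2_apply x (- s + (s + g))) (ell2_apply y (s + g)))"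
    using infsum_reindex_bij_betw[OF bij_plus, of "\<lambda>g. cinner (ell2_apply x (- s + g)) (ell2_apply y g)" s] by simp
  then show "cinner (blinfun_apply (left_reg s) x) y = cinner x (blinfun_apply (left_reg (- s)) y)"
    by (simp add: cinner_ell2.rep_eq left_reg_apply add.assoc[symmetric])
qed

locale action = cstar_algebra B for B :: "'b cstar" +
  fixes \<beta> :: "'g::group_add \<Rightarrow> 'b \<Rightarrow> 'b" and \<rho> :: "'b \<Rightarrow> 'h::chilbert_space op"
  assumes faithful: "faithful_rep B \<rho>"
    and beta_hom: "star_hom B B (\<beta> g)"
    and beta_0: "b \<in> cs_carrier B \<Longrightarrow> \<beta> 0 b = b"
    and beta_add: "b \<in> cs_carrier B \<Longrightarrow> \<beta> (g + h) b = \<beta> g (\<beta> h b)"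
begin

lemma rho_rep: "is_rep B \<rho>" using faithful by (simp add: faithful_rep_def)

lemmas rho_simps = star_homD[OF rho_rep, simplified]
lemmas beta_simps = star_homD[OF beta_hom]

lemma rho_beta_rep: "is_rep B (\<lambda>b. \<rho> (\<beta> g b))"
  unfolding star_hom_def by (simp add: rho_simps beta_simps)

lemma rho_beta_bound: "b \<in> C \<Longrightarrow> norm (\<rho> (\<beta> g b)) \<le> 2 * nrm b"
  by (rule rep_bounded[OF cstar_algebra_axioms faithful rho_beta_rep])

text \<open>Comparison through \<open>\<rho>\<close> gives a constant that is the same for all group elements.\<close>

lemma beta_bound: "b \<in> C \<Longrightarrow> nrm (\<beta> g b) \<le> 1600 * nrm b"
  using faithful_rep_bounded_below[OF cstar_algebra_axioms faithful beta_simps(1), of b g] rho_beta_bound[of b g]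
  by simp

lemma pt_apply: "b \<in> C \<Longrightarrow> ell2_apply (blinfun_apply (pi_tilde \<beta> \<rho> b) x) g = blinfun_apply (\<rho> (\<beta> (- g) b)) (ell2_apply x g)"
  by (rule pi_tilde_apply) (rule rho_beta_bound)

lemma pt_in: "b \<in> C \<Longrightarrow> pi_tilde \<beta> \<rho> b \<in> bounded_ops"
  by (auto simp: bounded_ops_def pt_apply ell2_simps bounded_opsD[OF rho_simps(1)] beta_simps intro!: ell2_eqI)

lemma pt_rep: "is_rep B (pi_tilde \<beta> \<rho>)"
  unfolding star_hom_def op_cstar_simps
proof (intro conjI ballI allI)
  fix b assume b: "b \<in> C"
  show "pi_tilde \<beta> \<rho> b \<in> bounded_ops" by (rule pt_in[OF b])
  show "pi_tilde \<beta> \<rho> (cs_scale B c b) = op_scale c (pi_tilde \<beta> \<rho> b)" for c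
    using b by (intro blinfun_eqI ell2_eqI)
      (simp add: pt_apply scale_closed op_scale_apply ell2_simps beta_simps rho_simps)
  show "pi_tilde \<beta> \<rho> (cs_star B b) = op_adj (pi_tilde \<beta> \<rho> b)"
  proof (rule op_adjI[symmetric])
    fix x y
    show "cinner (blinfun_apply (pi_tilde \<beta> \<rho> b) x) y = cinner x (blinfun_apply (pi_tilde \<beta> \<rho> (cs_star B b)) y)"
      using b by (simp add: cinner_ell2.rep_eq pt_apply star_closed beta_simps rho_simps op_adj_cinner)
  qed
  fix c assume c: "c \<in> C"
  show "pi_tilde \<beta> \<rho> (cs_add B b c) = pi_tilde \<beta> \<rho> b + pi_tilde \<beta> \<rho> c"
    using b c by (intro blinfun_eqI ell2_eqI)
      (simp add: pt_apply add_closed ell2_simps beta_simps rho_simps blinfun.add_left)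
  show "pi_tilde \<beta> \<rho> (cs_mult B b c) = pi_tilde \<beta> \<rho> b \<odot> pi_tilde \<beta> \<rho> c"
    using b c by (intro blinfun_eqI ell2_eqI)
      (simp add: pt_apply mult_closed beta_simps rho_simps)
qed

lemmas pt_simps = star_homD[OF pt_rep, simplified]

lemma pt_bound: "b \<in> C \<Longrightarrow> norm (pi_tilde \<beta> \<rho> b) \<le> 2 * nrm b"
  by (rule rep_bounded[OF cstar_algebra_axioms faithful pt_rep])

lemma covariance:
  assumes "b \<in> C" shows "left_reg s \<odot> pi_tilde \<beta> \<rho> b = pi_tilde \<beta> \<rho> (\<beta> s b) \<odot> left_reg s"
proof (intro blinfun_eqI ell2_eqI)
  fix x g
  have "- (- s + g) = - g + s" by (simp add: minus_add)
  then show "ell2_apply (blinfun_apply (left_reg s \<odot> pi_tilde \<beta> \<rho> b) x) g =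
      ell2_apply (blinfun_apply (pi_tilde \<beta> \<rho> (\<beta> s b) \<odot> left_reg s) x) g"
    using assms by (simp add: left_reg_apply pt_apply beta_simps beta_add)
qed

abbreviation "cp \<equiv> cp_elem \<beta> \<rho>"

lemma cp_in: "b \<in> C \<Longrightarrow> cp b s \<in> bounded_ops" by (simp add: cp_elem_def pt_in)

lemma cp_apply: "b \<in> C \<Longrightarrow> ell2_apply (blinfun_apply (cp b s) x) g = blinfun_apply (\<rho> (\<beta> (- g) b)) (ell2_apply x (- s + g))"
  by (simp add: cp_elem_def pt_apply left_reg_apply)

lemma cp_bound: assumes "b \<in> C" shows "norm (cp b s) \<le> 2 * nrm b"
proof -
  have "norm (left_reg s :: ('g, 'h) ell2 op) \<le> 1" by (rule norm_left_reg_le)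
  then have "norm (pi_tilde \<beta> \<rho> b) * norm (left_reg s :: ('g, 'h) ell2 op) \<le> (2 * nrm b) * 1"
    using pt_bound[OF assms] norm_nonneg[OF assms] by (intro mult_mono) auto
  then show ?thesis
    using norm_blinfun_compose[of "pi_tilde \<beta> \<rho> b" "left_reg s"] unfolding cp_elem_def by linarith
qed

lemma cp_scale: "b \<in> C \<Longrightarrow> op_scale c (cp b s) = cp (cs_scale B c b) s"
  by (simp add: cp_elem_def pt_simps op_scale_comp_left)

lemma cp_comp: assumes "b \<in> C" "c \<in> C" shows "cp b s \<odot> cp c t = cp (cs_mult B b (\<beta> s c)) (s + t)"
proof -
  have "cp b s \<odot> cp c t = pi_tilde \<beta> \<rho> b \<odot> (left_reg s \<odot> pi_tilde \<beta> \<rho> c) \<odot> left_reg t"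
    by (simp add: cp_elem_def comp_assoc)
  also have "\<dots> = (pi_tilde \<beta> \<rho> b \<odot> pi_tilde \<beta> \<rho> (\<beta> s c)) \<odot> (left_reg s \<odot> left_reg t)"
    by (simp add: covariance[OF assms(2)] comp_assoc)
  finally show ?thesis using assms by (simp add: cp_elem_def left_reg_comp pt_simps beta_simps)
qed

lemma cp_adj: assumes "b \<in> C" shows "op_adj (cp b s) = cp (\<beta> (- s) (cs_star B b)) (- s)"
  using assms covariance[of "cs_star B b" "- s"]
  by (simp add: cp_elem_def op_adj_comp pt_in left_reg_adj pt_simps star_closed)

lemma entry_cp: "b \<in> C \<Longrightarrow> entry g h (cp b s) = (if s + h = g then \<rho> (\<beta> (- g) b) else 0)"
proof -
  have "- s + g = h \<longleftrightarrow> s + h = g" by (metis add.assoc add.left_neutral add.right_inverse add.left_inverse)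
  moreover assume "b \<in> C"
  ultimately show ?thesis by (intro blinfun_eqI) (auto simp: entry_apply cp_apply sg_apply)
qed

definition "cross = closed_cspan {cp b s |b s. b \<in> C}"

lemma crossed_product_eq: "crossed_product B \<beta> \<rho> = op_cstar cross"
  by (simp add: crossed_product_def cross_def)

lemma cross_concrete: "concrete_cstar cross"
  unfolding cross_def
proof (rule concrete_closed_cspan)
  show "{cp b s |b s. b \<in> C} \<subseteq> bounded_ops" using cp_in by auto
  show "S \<odot> T \<in> closed_cspan {cp b s |b s. b \<in> C}" if ST: "S \<in> {cp b s |b s. b \<in> C}" "T \<in> {cp b s |b s. b \<in> C}" for S T
  proof -
    obtain b s c t where "b \<in> C" "c \<in> C" "S = cp b s" "T = cp c t" using ST by blast
    then show ?thesis
      by (intro closed_cspan_base) (auto simp: cp_comp intro!: exI mult_closed beta_simps)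
  qed
  show "op_adj T \<in> closed_cspan {cp b s |b s. b \<in> C}" if T: "T \<in> {cp b s |b s. b \<in> C}" for T
  proof -
    obtain b s where "b \<in> C" "T = cp b s" using T by blast
    then show ?thesis
      by (intro closed_cspan_base) (auto simp: cp_adj intro!: exI star_closed beta_simps)
  qed
qed

lemma cp_cross: "b \<in> C \<Longrightarrow> cp b s \<in> cross"
  unfolding cross_def by (rule closed_cspan_base) blast

end

section \<open>Matrices over the ultraproduct\<close>

locale ultra_action_rep = ultra A \<omega> + base: action A \<alpha> \<pi>
  for A :: "'a cstar" and \<omega> and \<alpha> :: "'g::group_add \<Rightarrow> 'a \<Rightarrow> 'a" and \<pi> :: "'a \<Rightarrow> 'h::chilbert_space op" +
  fixes \<rho> :: "(nat \<Rightarrow> 'a) set \<Rightarrow> 'k::chilbert_space op"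
  assumes rho_faithful: "faithful_rep (ultraproduct \<omega> A) \<rho>"
begin

lemma alpha_dst: assumes "a \<in> C" "b \<in> C" shows "dst (\<alpha> g a) (\<alpha> g b) \<le> 1600 * dst a b"
proof -
  have "cs_diff A (\<alpha> g a) (\<alpha> g b) = \<alpha> g (cs_diff A a b)"
    using assms by (simp add: cs_diff_def base.beta_simps scale_closed)
  then show ?thesis using base.beta_bound[OF diff_closed[OF assms], of g] by (simp add: dst_def)
qed

lemma L_alpha: assumes "x \<in> L" shows "(\<lambda>n. \<alpha> g (x n)) \<in> L"
proof -
  obtain K where "\<And>n. nrm (x n) \<le> K" using assms L_B by metis
  then have "nrm (\<alpha> g (x n)) \<le> 1600 * K" for n
    using base.beta_bound[OF L_D[OF assms], of g n] by (smt (verit))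
  then show ?thesis by (intro L_I) (simp add: base.beta_simps L_D[OF assms])
qed

lemma ultra_action_cls: assumes x: "x \<in> L" shows "ultra_action \<omega> A \<alpha> g (cls x) = cls (\<lambda>n. \<alpha> g (x n))"
  unfolding ultra_action_def
proof (rule UN_const_eq[OF cls_self[OF x]])
  fix y assume "y \<in> cls x"
  then have y: "y \<in> L" "eqv y x" using x by (auto simp: mem_cls)
  have lim: "((\<lambda>n. 1600 * dst (y n) (x n)) \<longlongrightarrow> 0) \<omega>"
    using tendsto_mult_left[OF y(2)[unfolded eqv_def], of 1600] by simp
  have "eqv (\<lambda>n. \<alpha> g (y n)) (\<lambda>n. \<alpha> g (x n))"
    unfolding eqv_def
  proof (rule null_by_bound[OF _ _ lim])
    show "0 \<le> dst (\<alpha> g (y n)) (\<alpha> g (x n))" for n by (rule dst_nonneg; rule base.beta_simps(1); rule L_D; rule x y)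
    show "dst (\<alpha> g (y n)) (\<alpha> g (x n)) \<le> 1600 * dst (y n) (x n)" for n by (rule alpha_dst; rule L_D; rule x y)
  qed
  then show "cls (\<lambda>n. \<alpha> g (y n)) = cls (\<lambda>n. \<alpha> g (x n))" using x y by (simp add: cls_eq L_alpha)
qed

lemma ultra_action_action: "action U (ultra_action \<omega> A \<alpha>) \<rho>"
proof -
  interpret U: cstar_algebra U by (rule cstar_algebra_U)
  note simps = carrier_U zero_U add_U mult_U scale_U star_U L_closed ultra_action_cls L_alpha
  show ?thesis
  proof
    show "faithful_rep U \<rho>" by (rule rho_faithful)
    show "star_hom U U (ultra_action \<omega> A \<alpha> g)" for g
      unfolding star_hom_def
      by (auto simp: simps base.beta_simps L_D)
    show "ultra_action \<omega> A \<alpha> 0 b = b" if "b \<in> U.C" for b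
      using that by (auto simp: simps base.beta_0 L_D)
    show "ultra_action \<omega> A \<alpha> (g + h) b = ultra_action \<omega> A \<alpha> g (ultra_action \<omega> A \<alpha> h b)" if "b \<in> U.C" for g h b
      using that by (auto simp: simps base.beta_add L_D)
  qed
qed

sublocale up: action U "ultra_action \<omega> A \<alpha>" \<rho> by (rule ultra_action_action)

text \<open>\<open>lifts \<sigma> r z\<close> relates an operator \<open>r\<close> in the image of the ultraproduct to the sequences \<open>z\<close> of
  operators that represent it under a representation \<open>\<sigma>\<close> of the original algebra. Algebraic relations
  among the former hold for the latter up to null sequences.\<close>

definition lifts :: "('a \<Rightarrow> 'c::chilbert_space op) \<Rightarrow> 'k op \<Rightarrow> (nat \<Rightarrow> 'c op) \<Rightarrow> bool" where
  "lifts \<sigma> r z \<longleftrightarrow> (\<exists>b\<in>L. r = \<rho> (cls b) \<and> z = (\<lambda>n. \<sigma> (b n)))"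

lemma lifts_ex: "r \<in> \<rho> ` cs_carrier U \<Longrightarrow> \<exists>z. lifts \<sigma> r z"
  by (auto simp: lifts_def carrier_U)

lemma liftsI: "b \<in> L \<Longrightarrow> lifts \<sigma> (\<rho> (cls b)) (\<lambda>n. \<sigma> (b n))" by (auto simp: lifts_def)

lemma cls_in [simp]: "b \<in> L \<Longrightarrow> cls b \<in> cs_carrier U" by (simp add: carrier_U)

context
  fixes \<sigma> :: "'a \<Rightarrow> 'c::chilbert_space op"
  assumes sigma: "is_rep A \<sigma>"
begin

lemmas sigma_simps = star_homD[OF sigma, simplified]

lemma lifts_bounded_ops: "lifts \<sigma> r z \<Longrightarrow> z n \<in> bounded_ops"
  by (auto simp: lifts_def sigma_simps L_D)

lemma lifts_add: assumes "lifts \<sigma> r z" "lifts \<sigma> r' z'" shows "lifts \<sigma> (r + r') (\<lambda>n. z n + z' n)"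
proof -
  obtain b b' where "b \<in> L" "b' \<in> L" "r = \<rho> (cls b)" "r' = \<rho> (cls b')" "z = (\<lambda>n. \<sigma> (b n))" "z' = (\<lambda>n. \<sigma> (b' n))"
    using assms by (auto simp: lifts_def)
  then show ?thesis unfolding lifts_def
    by (intro bexI[of _ "\<lambda>n. b n \<oplus> b' n"]) (auto simp: L_add add_U[symmetric] up.rho_simps sigma_simps L_D)
qed

lemma lifts_scale: assumes "lifts \<sigma> r z" shows "lifts \<sigma> (op_scale c r) (\<lambda>n. op_scale c (z n))"
proof -
  obtain b where "b \<in> L" "r = \<rho> (cls b)" "z = (\<lambda>n. \<sigma> (b n))" using assms by (auto simp: lifts_def)
  then show ?thesis unfolding lifts_def
    by (intro bexI[of _ "\<lambda>n. cs_scale A c (b n)"]) (auto simp: L_scale scale_U[symmetric] up.rho_simps sigma_simps L_D)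
qed

lemma lifts_scaleR: "lifts \<sigma> r z \<Longrightarrow> lifts \<sigma> (t *\<^sub>R r) (\<lambda>n. t *\<^sub>R z n)"
  unfolding scaleR_op_scale by (rule lifts_scale)

lemma lifts_comp: assumes "lifts \<sigma> r z" "lifts \<sigma> r' z'" shows "lifts \<sigma> (r \<odot> r') (\<lambda>n. z n \<odot> z' n)"
proof -
  obtain b b' where "b \<in> L" "b' \<in> L" "r = \<rho> (cls b)" "r' = \<rho> (cls b')" "z = (\<lambda>n. \<sigma> (b n))" "z' = (\<lambda>n. \<sigma> (b' n))"
    using assms by (auto simp: lifts_def)
  then show ?thesis unfolding lifts_def
    by (intro bexI[of _ "\<lambda>n. b n \<otimes> b' n"]) (auto simp: L_mult mult_U[symmetric] up.rho_simps sigma_simps L_D)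
qed

lemma lifts_adj: assumes "lifts \<sigma> r z" shows "lifts \<sigma> (op_adj r) (\<lambda>n. op_adj (z n))"
proof -
  obtain b where "b \<in> L" "r = \<rho> (cls b)" "z = (\<lambda>n. \<sigma> (b n))" using assms by (auto simp: lifts_def)
  then show ?thesis unfolding lifts_def
    by (intro bexI[of _ "\<lambda>n. cs_star A (b n)"]) (auto simp: L_star star_U[symmetric] up.rho_simps sigma_simps L_D)
qed

lemma lifts_0: "lifts \<sigma> 0 (\<lambda>_. 0)"
  using lifts_scale[OF liftsI[OF L_zero], of 0] by simp

lemma lifts_sum:
  "(\<And>i. i \<in> I \<Longrightarrow> lifts \<sigma> (r i) (z i)) \<Longrightarrow> lifts \<sigma> (sum r I) (\<lambda>n. \<Sum>i\<in>I. z i n)"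
  by (induction I rule: infinite_finite_induct) (auto intro: lifts_0 lifts_add)

text \<open>A faithful \<open>\<rho>\<close> is bounded below, so that an operator can only vanish if its sequence tends to \<open>0\<close>.\<close>

lemma lifts_null: assumes "lifts \<sigma> 0 z" shows "((\<lambda>n. norm (z n)) \<longlongrightarrow> 0) \<omega>"
proof -
  obtain b where b: "b \<in> L" "\<rho> (cls b) = 0" "z = (\<lambda>n. \<sigma> (b n))" using assms by (auto simp: lifts_def)
  have "cs_norm U (cls b) \<le> 800 * norm (\<rho> (cls b))"
    by (rule faithful_rep_bounded_below[OF cstar_algebra_U rho_faithful]) (simp add: b)
  then have "cs_norm U (cls b) = 0" using up.norm_nonneg[of "cls b"] b by simp
  then have "((\<lambda>n. nrm (b n)) \<longlongrightarrow> 0) \<omega>" using norm_U_tendsto[OF b(1)] by simp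
  then have "((\<lambda>n. 2 * nrm (b n)) \<longlongrightarrow> 0) \<omega>" using tendsto_mult_left by fastforce
  then show ?thesis
    by (rule null_by_bound[rotated 2])
       (auto simp: b intro!: rep_bounded[OF cstar_algebra_axioms base.faithful sigma] L_D[OF b(1)])
qed

end

end

text \<open>The algebra of \<open>E \<times> E\<close> matrices over a concrete C*-algebra, as operators on \<open>\<ell>\<^sup>2(I; H)\<close>.\<close>

definition matrices :: "'i set \<Rightarrow> 'h::chilbert_space op set \<Rightarrow> ('i, 'h) ell2 op set" where
  "matrices E R = {T \<in> bounded_ops. \<forall>i j. entry i j T \<in> (if i \<in> E \<and> j \<in> E then R else {0})}"

lemma mem_matrices: "T \<in> matrices E R \<longleftrightarrow> T \<in> bounded_ops \<and> (\<forall>i j. i \<in> E \<longrightarrow> j \<in> E \<longrightarrow> entry i j T \<in> R) \<and>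
    (\<forall>i j. \<not> (i \<in> E \<and> j \<in> E) \<longrightarrow> entry i j T = 0)"
  unfolding matrices_def by auto

lemma matrices_concrete:
  assumes E: "finite E" and R: "concrete_cstar R"
  shows "concrete_cstar (matrices E R)"
proof -
  note D = concrete_cstarD[OF R]
  have "closed (matrices E R)"
  proof -
    have "matrices E R = bounded_ops \<inter> (\<Inter>i. \<Inter>j. entry i j -` (if i \<in> E \<and> j \<in> E then R else {0}))"
      by (simp add: set_eq_iff matrices_def)
    also have "closed \<dots>"
      by (intro closed_Int closed_bounded_ops closed_INT ballI continuous_closed_vimage
          linear_continuous_at bounded_linear_entry) (auto simp: D)
    finally show ?thesis .
  qed
  moreover have "subspace (matrices E R)"
    unfolding subspace_def by (intro conjI ballI allI) (auto simp: mem_matrices D scaleR_op_scale)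
  moreover have "op_scale c T \<in> matrices E R" if "T \<in> matrices E R" for c T
    using that by (auto simp: mem_matrices D)
  moreover have "op_adj T \<in> matrices E R" if "T \<in> matrices E R" for T
    using that by (auto simp: mem_matrices entry_adj D)
  moreover have "S \<odot> T \<in> matrices E R" if S: "S \<in> matrices E R" and T: "T \<in> matrices E R" for S T
  proof -
    have ec: "entry i j (S \<odot> T) = (\<Sum>k\<in>E. entry i k S \<odot> entry k j T)" for i j
      by (rule entry_comp[OF E]) (use T in \<open>simp add: mem_matrices\<close>)
    have sum: "(\<Sum>k\<in>F. g k) \<in> R" if "\<And>k. k \<in> F \<Longrightarrow> g k \<in> R" for F :: "'a set" and g
      using that by (induction F rule: infinite_finite_induct) (auto simp: D)
    have "entry i j (S \<odot> T) \<in> R" if "i \<in> E" "j \<in> E" for i j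
      unfolding ec by (rule sum) (use S T that D in \<open>auto simp: mem_matrices\<close>)
    moreover have "entry i j (S \<odot> T) = 0" if "\<not> (i \<in> E \<and> j \<in> E)" for i j
      unfolding ec by (rule sum.neutral) (use S T that in \<open>auto simp: mem_matrices comp_zero_left comp_zero_right\<close>)
    ultimately show ?thesis using S T by (simp add: mem_matrices)
  qed
  ultimately show ?thesis unfolding concrete_cstar_def by (auto simp: matrices_def)
qed

text \<open>In matrix notation \<open>r = 2 w + w\<^sup>* w + y\<^sup>* y\<close>, and the identity is
  \<open>\<parallel>y \<zeta>\<parallel>\<^sup>2 + \<parallel>(1 + w) \<zeta>\<parallel>\<^sup>2 = \<parallel>\<zeta>\<parallel>\<^sup>2 + \<zeta> \<bullet> r \<zeta>\<close>. For \<open>w = \<surd>(1 - y\<^sup>* y) - 1\<close> the defect \<open>r\<close> is \<open>0\<close>.\<close>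

lemma matrix_norm_identity:
  fixes y w :: "'i \<Rightarrow> 'i \<Rightarrow> 'h::chilbert_space op" and \<zeta> :: "'i \<Rightarrow> 'h" and E :: "'i set"
  assumes "\<And>g h. y g h \<in> bounded_ops" "\<And>g h. w g h \<in> bounded_ops"
  defines "r g h \<equiv> 2 *\<^sub>R w g h + (\<Sum>k\<in>E. op_adj (w k g) \<odot> w k h) + (\<Sum>k\<in>E. op_adj (y k g) \<odot> y k h)"
  shows "(\<Sum>g\<in>E. (norm (\<Sum>h\<in>E. blinfun_apply (y g h) (\<zeta> h)))\<^sup>2)
      + (\<Sum>g\<in>E. (norm (\<zeta> g + (\<Sum>h\<in>E. blinfun_apply (w g h) (\<zeta> h))))\<^sup>2)
    = (\<Sum>g\<in>E. (norm (\<zeta> g))\<^sup>2) + (\<Sum>g\<in>E. \<Sum>h\<in>E. \<zeta> g \<bullet> blinfun_apply (r g h) (\<zeta> h))"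
proof -
  have sq: "(\<Sum>k\<in>E. (norm (\<Sum>h\<in>E. blinfun_apply (v k h) (\<zeta> h)))\<^sup>2)
      = (\<Sum>g\<in>E. \<Sum>h\<in>E. \<zeta> g \<bullet> blinfun_apply (\<Sum>k\<in>E. op_adj (v k g) \<odot> v k h) (\<zeta> h))"
    if v: "\<And>g h. v g h \<in> bounded_ops" for v :: "'i \<Rightarrow> 'i \<Rightarrow> 'h op"
  proof -
    have "(\<Sum>k\<in>E. (norm (\<Sum>h\<in>E. blinfun_apply (v k h) (\<zeta> h)))\<^sup>2)
        = (\<Sum>k\<in>E. \<Sum>g\<in>E. \<Sum>h\<in>E. \<zeta> g \<bullet> blinfun_apply (op_adj (v k g) \<odot> v k h) (\<zeta> h))"
      by (simp add: power2_norm_eq_inner inner_sum_left inner_sum_right op_adj_inner[OF v])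
         (intro sum.cong refl sum.swap)
    also have "\<dots> = (\<Sum>g\<in>E. \<Sum>k\<in>E. \<Sum>h\<in>E. \<zeta> g \<bullet> blinfun_apply (op_adj (v k g) \<odot> v k h) (\<zeta> h))"
      by (rule sum.swap)
    also have "\<dots> = (\<Sum>g\<in>E. \<Sum>h\<in>E. \<Sum>k\<in>E. \<zeta> g \<bullet> blinfun_apply (op_adj (v k g) \<odot> v k h) (\<zeta> h))"
      by (intro sum.cong refl sum.swap)
    finally show ?thesis by (simp add: blinfun.sum_left inner_sum_right)
  qed
  have "(\<Sum>g\<in>E. (norm (\<zeta> g + (\<Sum>h\<in>E. blinfun_apply (w g h) (\<zeta> h))))\<^sup>2) =
      (\<Sum>g\<in>E. (norm (\<zeta> g))\<^sup>2) + (\<Sum>g\<in>E. \<Sum>h\<in>E. \<zeta> g \<bullet> blinfun_apply (2 *\<^sub>R w g h) (\<zeta> h))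
      + (\<Sum>g\<in>E. (norm (\<Sum>h\<in>E. blinfun_apply (w g h) (\<zeta> h)))\<^sup>2)"
    by (simp add: power2_norm_eq_inner inner_add_left inner_add_right sum.distrib inner_sum_right
        blinfun.scaleR_left inner_commute sum_distrib_left[symmetric])
  then show ?thesis
    unfolding sq[OF assms(1)] sq[OF assms(2)] r_def
    by (simp add: blinfun.add_left inner_add_right sum.distrib)
qed

context ultra_action_rep
begin

text \<open>The norm of a finite matrix over the ultraproduct dominates, up to a constant, the norms of
  the representing matrices almost everywhere: the square root of \<open>1 - Y\<^sup>* Y\<close> in the matrix algebra
  lifts to the sequences, with an error that tends to \<open>0\<close> entrywise. This is where the size of \<open>E\<close> must
  be fixed.\<close>

lemma matrix_bound:
  fixes X :: "('i, 'k) ell2 op" and \<sigma> :: "'a \<Rightarrow> 'c::chilbert_space op"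
  assumes sigma: "is_rep A \<sigma>" and E: "finite E" and X: "X \<in> bounded_ops" "norm X \<le> \<kappa>" and kap: "\<kappa> > 0"
    and z: "\<And>g h. g \<in> E \<Longrightarrow> h \<in> E \<Longrightarrow> lifts \<sigma> (entry g h X) (z g h)"
  shows "eventually (\<lambda>n. \<forall>\<zeta>. (\<Sum>g\<in>E. (norm (\<Sum>h\<in>E. blinfun_apply (z g h n) (\<zeta> h)))\<^sup>2)
      \<le> (3 * \<kappa>)\<^sup>2 * (\<Sum>g\<in>E. (norm (\<zeta> g))\<^sup>2)) \<omega>"
proof -
  define R where "R = \<rho> ` cs_carrier U"
  have R: "concrete_cstar R" unfolding R_def by (rule faithful_image_concrete[OF cstar_algebra_U rho_faithful])
  interpret S: cstar_ops "matrices E R" norm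
    by (rule cstar_ops_concrete[OF matrices_concrete[OF E R]])
  define P :: "('i, 'k) ell2 op" where "P = Blinfun (trunc E)"
  have P: "blinfun_apply P x = trunc E x" for x
  proof -
    have "bounded_linear (trunc E :: ('i, 'k) ell2 \<Rightarrow> _)"
      by (rule bounded_linear_ell2I[where K=1]) (auto simp: trunc_apply[OF E] ell2_simps norm_trunc_le[OF E])
    then show ?thesis by (simp add: P_def bounded_linear_Blinfun_apply)
  qed
  have Pn: "norm P \<le> 1" by (rule norm_blinfun_bound) (auto simp: P norm_trunc_le[OF E])
  have Pb: "P \<in> bounded_ops" by (auto simp: bounded_ops_def P trunc_apply[OF E] ell2_simps intro!: ell2_eqI)
  have Psg: "trunc E (blinfun_apply (sg j) \<xi>) = (if j \<in> E then blinfun_apply (sg j) \<xi> else 0)"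
    for j and \<xi> :: 'k
    by (rule ell2_eqI) (auto simp: trunc_apply[OF E] sg_apply ell2_simps)
  define Y where "Y = (1 / (2 * \<kappa>)) *\<^sub>R (P \<odot> X \<odot> P)"
  have eY: "entry g h Y = (if g \<in> E \<and> h \<in> E then (1 / (2 * \<kappa>)) *\<^sub>R entry g h X else 0)" for g h
    by (rule blinfun_eqI) (auto simp: Y_def entry_apply P Psg trunc_apply[OF E] blinfun.bilinear_simps ell2_simps)
  have zR: "entry g h X \<in> R" if "g \<in> E" "h \<in> E" for g h
    using z[OF that] unfolding lifts_def R_def by auto
  have Yb: "Y \<in> bounded_ops" by (simp add: Y_def Pb X)
  have Y: "Y \<in> matrices E R"
    using Yb zR concrete_cstarD(7)[OF R] by (auto simp: mem_matrices eY scaleR_op_scale)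
  have "norm (P \<odot> X \<odot> P) \<le> norm P * norm X * norm P"
    using norm_blinfun_compose[of "P \<odot> X" P] mult_right_mono[OF norm_blinfun_compose[of P X], of "norm P"] by simp
  also have "\<dots> \<le> 1 * \<kappa> * 1" using Pn X kap by (intro mult_mono) auto
  finally have nY: "norm Y \<le> 1/2" using kap by (simp add: Y_def field_simps)
  define b where "b = op_adj Y \<odot> Y"
  have "norm b \<le> 1/2 * (1/2)"
    unfolding b_def norm_adj_comp[OF Yb] power2_eq_square using nY by (intro mult_mono) auto
  then have b: "b \<in> matrices E R" "op_adj b = b" "norm b \<le> 1/2"
    using Y Yb by (auto simp: b_def op_adj_comp)
  obtain w where w: "w \<in> matrices E R" "op_adj w = w" "2 *\<^sub>R w + w \<odot> w = - b"
    using S.square_root[OF b] by metis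
  have wb: "w \<in> bounded_ops" using w(1) by (simp add: matrices_def)
  have wR: "entry g h w \<in> R" if "g \<in> E" "h \<in> E" for g h using w(1) that by (simp add: mem_matrices)
  then have "\<forall>g h. \<exists>v. (g \<in> E \<longrightarrow> h \<in> E \<longrightarrow> lifts \<sigma> (entry g h w) v)"
    unfolding R_def using lifts_ex by blast
  then obtain v where v: "\<And>g h. g \<in> E \<Longrightarrow> h \<in> E \<Longrightarrow> lifts \<sigma> (entry g h w) (v g h)" by metis
  define y where "y g h n = (if g \<in> E \<and> h \<in> E then (1 / (2 * \<kappa>)) *\<^sub>R z g h n else 0)" for g h n
  define u where "u g h n = (if g \<in> E \<and> h \<in> E then v g h n else 0)" for g h n
  have y: "lifts \<sigma> (entry g h Y) (y g h)" and u: "lifts \<sigma> (entry g h w) (u g h)" if "g \<in> E" "h \<in> E" for g h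
    using that z v lifts_scaleR[OF sigma z[OF that], of "1 / (2 * \<kappa>)"] by (simp_all add: y_def[abs_def] u_def[abs_def] eY)
  have bd: "y g h n \<in> bounded_ops" "u g h n \<in> bounded_ops" for g h n
    using lifts_bounded_ops[OF sigma z] lifts_bounded_ops[OF sigma v] by (auto simp: y_def u_def)
  \<comment> \<open>The matrices \<open>u\<close> of sequences solve the equation of \<open>w\<close> up to this defect.\<close>
  define r where "r n g h = 2 *\<^sub>R u g h n + (\<Sum>k\<in>E. op_adj (u k g n) \<odot> u k h n) + (\<Sum>k\<in>E. op_adj (y k g n) \<odot> y k h n)" for n g h
  have rnull: "((\<lambda>n. norm (r n g h)) \<longlongrightarrow> 0) \<omega>" if gh: "g \<in> E" "h \<in> E" for g h
  proof (rule lifts_null[OF sigma])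
    have "lifts \<sigma> (2 *\<^sub>R entry g h w + (\<Sum>k\<in>E. op_adj (entry k g w) \<odot> entry k h w)
        + (\<Sum>k\<in>E. op_adj (entry k g Y) \<odot> entry k h Y)) (\<lambda>n. r n g h)"
      unfolding r_def using gh
      by (intro lifts_add[OF sigma] lifts_scaleR[OF sigma] lifts_sum[OF sigma] lifts_comp[OF sigma] lifts_adj[OF sigma] y u)
    moreover have "(\<Sum>k\<in>E. op_adj (entry k g T) \<odot> entry k h T) = entry g h (op_adj T \<odot> T)" if "T \<in> matrices E R" for T
    proof -
      have T: "T \<in> bounded_ops" "\<And>k j. k \<notin> E \<Longrightarrow> entry k j T = 0" using that by (auto simp: mem_matrices)
      show ?thesis by (simp add: entry_comp[OF E T(2)] entry_adj[OF T(1)])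
    qed
    moreover have "2 *\<^sub>R w + op_adj w \<odot> w + op_adj Y \<odot> Y = 0" using w(2,3) by (simp add: b_def)
    then have "entry g h (2 *\<^sub>R w + op_adj w \<odot> w + op_adj Y \<odot> Y) = 0" by simp
    then have "2 *\<^sub>R entry g h w + entry g h (op_adj w \<odot> w) + entry g h (op_adj Y \<odot> Y) = 0" by simp
    ultimately show "lifts \<sigma> 0 (\<lambda>n. r n g h)" using w(1) Y by simp
  qed
  have "((\<lambda>n. \<Sum>g\<in>E. \<Sum>h\<in>E. norm (r n g h)) \<longlongrightarrow> (\<Sum>g\<in>E. \<Sum>h\<in>E. 0)) \<omega>"
    by (intro tendsto_sum rnull)
  then have "eventually (\<lambda>n. (\<Sum>g\<in>E. \<Sum>h\<in>E. norm (r n g h)) < 1) \<omega>"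
    by (intro order_tendstoD(2)) auto
  then show ?thesis
  proof (eventually_elim, intro allI)
    fix n and \<zeta> :: "'i \<Rightarrow> 'c"
    assume small: "(\<Sum>g\<in>E. \<Sum>h\<in>E. norm (r n g h)) < 1"
    define q where "q = (\<Sum>g\<in>E. (norm (\<zeta> g))\<^sup>2)"
    have q0: "q \<ge> 0" unfolding q_def by (intro sum_nonneg) auto
    have le: "norm (\<zeta> g) * norm (\<zeta> h) \<le> q" if "g \<in> E" "h \<in> E" for g h
    proof -
      have m: "(norm (\<zeta> g))\<^sup>2 \<le> q" if "g \<in> E" for g unfolding q_def by (rule member_le_sum) (use that E in auto)
      have "2 * (norm (\<zeta> g) * norm (\<zeta> h)) \<le> (norm (\<zeta> g))\<^sup>2 + (norm (\<zeta> h))\<^sup>2"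
        using sum_squares_bound[of "norm (\<zeta> g)" "norm (\<zeta> h)"] by simp
      then show ?thesis using m[OF that(1)] m[OF that(2)] by linarith
    qed
    have "(\<Sum>g\<in>E. \<Sum>h\<in>E. \<zeta> g \<bullet> blinfun_apply (r n g h) (\<zeta> h)) \<le> (\<Sum>g\<in>E. \<Sum>h\<in>E. norm (r n g h) * q)"
    proof (intro sum_mono)
      fix g h assume gh: "g \<in> E" "h \<in> E"
      have "\<zeta> g \<bullet> blinfun_apply (r n g h) (\<zeta> h) \<le> norm (\<zeta> g) * norm (blinfun_apply (r n g h) (\<zeta> h))"
        by (rule norm_cauchy_schwarz)
      also have "\<dots> \<le> norm (\<zeta> g) * (norm (r n g h) * norm (\<zeta> h))" by (intro mult_left_mono norm_blinfun) auto
      also have "\<dots> = norm (r n g h) * (norm (\<zeta> g) * norm (\<zeta> h))" by simp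
      also have "\<dots> \<le> norm (r n g h) * q" by (intro mult_left_mono le gh) auto
      finally show "\<zeta> g \<bullet> blinfun_apply (r n g h) (\<zeta> h) \<le> norm (r n g h) * q" .
    qed
    also have "\<dots> = (\<Sum>g\<in>E. \<Sum>h\<in>E. norm (r n g h)) * q" by (simp add: sum_distrib_right)
    also have "\<dots> \<le> 1 * q" using small q0 by (intro mult_right_mono) auto
    finally have "(\<Sum>g\<in>E. \<Sum>h\<in>E. \<zeta> g \<bullet> blinfun_apply (r n g h) (\<zeta> h)) \<le> q" by simp
    moreover have "(\<Sum>g\<in>E. (norm (\<Sum>h\<in>E. blinfun_apply (y g h n) (\<zeta> h)))\<^sup>2)
      \<le> q + (\<Sum>g\<in>E. \<Sum>h\<in>E. \<zeta> g \<bullet> blinfun_apply (r n g h) (\<zeta> h))"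
    proof -
      have "(\<Sum>g\<in>E. (norm (\<Sum>h\<in>E. blinfun_apply (y g h n) (\<zeta> h)))\<^sup>2)
        + (\<Sum>g\<in>E. (norm (\<zeta> g + (\<Sum>h\<in>E. blinfun_apply (u g h n) (\<zeta> h))))\<^sup>2)
        = q + (\<Sum>g\<in>E. \<Sum>h\<in>E. \<zeta> g \<bullet> blinfun_apply (r n g h) (\<zeta> h))"
        unfolding q_def r_def by (rule matrix_norm_identity) (rule bd)+
      moreover have "0 \<le> (\<Sum>g\<in>E. (norm (\<zeta> g + (\<Sum>h\<in>E. blinfun_apply (u g h n) (\<zeta> h))))\<^sup>2)"
        by (intro sum_nonneg) auto
      ultimately show ?thesis by linarith
    qed
    moreover have "(\<Sum>g\<in>E. (norm (\<Sum>h\<in>E. blinfun_apply (y g h n) (\<zeta> h)))\<^sup>2)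
        = (1 / (2 * \<kappa>))\<^sup>2 * (\<Sum>g\<in>E. (norm (\<Sum>h\<in>E. blinfun_apply (z g h n) (\<zeta> h)))\<^sup>2)"
      unfolding sum_distrib_left
    proof (rule sum.cong[OF refl])
      fix g assume "g \<in> E"
      then have "(\<Sum>h\<in>E. blinfun_apply (y g h n) (\<zeta> h)) = (1 / (2 * \<kappa>)) *\<^sub>R (\<Sum>h\<in>E. blinfun_apply (z g h n) (\<zeta> h))"
        by (simp add: y_def blinfun.scaleR_left scaleR_sum_right)
      then show "(norm (\<Sum>h\<in>E. blinfun_apply (y g h n) (\<zeta> h)))\<^sup>2
          = (1 / (2 * \<kappa>))\<^sup>2 * (norm (\<Sum>h\<in>E. blinfun_apply (z g h n) (\<zeta> h)))\<^sup>2"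
        by (simp add: power_mult_distrib power_divide)
    qed
    ultimately have "(1 / (2 * \<kappa>))\<^sup>2 * (\<Sum>g\<in>E. (norm (\<Sum>h\<in>E. blinfun_apply (z g h n) (\<zeta> h)))\<^sup>2) \<le> 2 * q" by linarith
    then have "(\<Sum>g\<in>E. (norm (\<Sum>h\<in>E. blinfun_apply (z g h n) (\<zeta> h)))\<^sup>2) \<le> 8 * \<kappa>\<^sup>2 * q"
      using kap by (simp add: field_simps power2_eq_square)
    also have "\<dots> \<le> (3 * \<kappa>)\<^sup>2 * q" using q0 by (intro mult_right_mono) (auto simp: power_mult_distrib)
    finally show "(\<Sum>g\<in>E. (norm (\<Sum>h\<in>E. blinfun_apply (z g h n) (\<zeta> h)))\<^sup>2)
      \<le> (3 * \<kappa>)\<^sup>2 * (\<Sum>g\<in>E. (norm (\<zeta> g))\<^sup>2)" unfolding q_def .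
  qed
qed

end

section \<open>Spatial tensor products\<close>

text \<open>\<open>d \<otimes> 1\<close> on \<open>H \<otimes> \<ell>\<^sup>2(I)\<close>.\<close>

definition amp :: "'h::chilbert_space op \<Rightarrow> ('i, 'h) ell2 op" where
  "amp d = Blinfun (\<lambda>x. Abs_ell2 (\<lambda>i. blinfun_apply d (ell2_apply x i)))"

lemma
  fixes d :: "'h::chilbert_space op" and x :: "('i, 'h) ell2"
  shows amp_apply: "ell2_apply (blinfun_apply (amp d) x) i = blinfun_apply d (ell2_apply x i)"
    and norm_amp_le: "norm (amp d :: ('i, 'h) ell2 op) \<le> norm d"
proof -
  define S :: "('i, 'h) ell2 \<Rightarrow> ('i, 'h) ell2" where "S = (\<lambda>x. Abs_ell2 (\<lambda>i. blinfun_apply d (ell2_apply x i)))"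
  have "sq_summable (\<lambda>i. blinfun_apply d (ell2_apply x i))" for x :: "('i, 'h) ell2"
    by (rule sq_summable_comparison[OF ell2_apply[of x, simplified] norm_blinfun])
  then have app: "ell2_apply (S x) i = blinfun_apply d (ell2_apply x i)" for x i
    by (simp add: S_def Abs_ell2_inverse)
  have nS: "norm (S x) \<le> norm d * norm x" for x
    by (rule ell2_norm_le_pointwise) (simp_all add: app norm_blinfun)
  have "bounded_linear S"
    by (rule bounded_linear_ell2I[where K="norm d"])
       (use nS in \<open>simp_all add: app ell2_simps blinfun.bilinear_simps mult.commute\<close>)
  then have eq: "blinfun_apply (amp d) x = S x" for x
    unfolding amp_def S_def[symmetric] by (simp add: bounded_linear_Blinfun_apply)
  show "ell2_apply (blinfun_apply (amp d) x) i = blinfun_apply d (ell2_apply x i)" by (simp add: eq app)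
  show "norm (amp d :: ('i, 'h) ell2 op) \<le> norm d" by (rule norm_blinfun_bound) (simp_all add: eq nS)
qed

lemma amp_comp: "amp (d \<odot> d') = amp d \<odot> amp d'"
  by (intro blinfun_eqI ell2_eqI) (simp add: amp_apply)

lemma amp_bounded_ops [simp]: "d \<in> bounded_ops \<Longrightarrow> amp d \<in> bounded_ops"
  by (auto simp: bounded_ops_def amp_apply ell2_simps intro!: ell2_eqI)

lemma amp_adj: "d \<in> bounded_ops \<Longrightarrow> op_adj (amp d) = amp (op_adj d)"
  by (rule op_adjI) (simp add: cinner_ell2.rep_eq amp_apply op_adj_cinner)

lemma has_sum_norm: "((\<lambda>i. (norm (ell2_apply x i))\<^sup>2) has_sum (norm x)\<^sup>2) UNIV"
  unfolding norm_ell2_sq by (rule has_sum_infsum[OF ell2_summable])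

lemma has_sum_finite_sum:
  fixes f :: "'i \<Rightarrow> 'j \<Rightarrow> real"
  assumes "\<And>j. j \<in> F \<Longrightarrow> ((\<lambda>i. f i j) has_sum s j) A"
  shows "((\<lambda>i. \<Sum>j\<in>F. f i j) has_sum (\<Sum>j\<in>F. s j)) A"
  using assms by (induction F rule: infinite_finite_induct) (auto intro: has_sum_add)

text \<open>Exchanging the two factors of \<open>\<ell>\<^sup>2(I) \<otimes> \<ell>\<^sup>2(J)\<close> allows an operator on the scalar factor to be
  applied coordinatewise.\<close>

definition flip :: "('i, ('j, complex) ell2) ell2 \<Rightarrow> ('j, ('i, complex) ell2) ell2" where
  "flip x = Abs_ell2 (\<lambda>j. Abs_ell2 (\<lambda>i. ell2_apply (ell2_apply x i) j))"

lemma flip_apply: "ell2_apply (ell2_apply (flip x) j) i = ell2_apply (ell2_apply x i) j"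
  and norm_flip_le: "norm (flip x) \<le> norm x"
proof -
  have "sq_summable (\<lambda>i. ell2_apply (ell2_apply x i) j)" for j
    by (rule sq_summable_comparison[OF ell2_apply[of x, simplified], where C=1])
       (simp add: norm_ell2_apply_le)
  then have col: "ell2_apply (Abs_ell2 (\<lambda>i. ell2_apply (ell2_apply x i) j)) i = ell2_apply (ell2_apply x i) j" for i j
    by (simp add: Abs_ell2_inverse)
  have bd: "(\<Sum>j\<in>F. (norm (Abs_ell2 (\<lambda>i. ell2_apply (ell2_apply x i) j)))\<^sup>2) \<le> (norm x)\<^sup>2" if F: "finite F" for F
  proof -
    have "((\<lambda>i. (norm (ell2_apply (ell2_apply x i) j))\<^sup>2) has_sum (norm (Abs_ell2 (\<lambda>i. ell2_apply (ell2_apply x i) j)))\<^sup>2) UNIV" for j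
      using has_sum_norm[of "Abs_ell2 (\<lambda>i. ell2_apply (ell2_apply x i) j)"] by (simp only: col)
    then have "((\<lambda>i. \<Sum>j\<in>F. (norm (ell2_apply (ell2_apply x i) j))\<^sup>2) has_sum
        (\<Sum>j\<in>F. (norm (Abs_ell2 (\<lambda>i. ell2_apply (ell2_apply x i) j)))\<^sup>2)) UNIV"
      by (rule has_sum_finite_sum)
    moreover have "((\<lambda>i. (norm (ell2_apply x i))\<^sup>2) has_sum (norm x)\<^sup>2) UNIV" by (rule has_sum_norm)
    ultimately show ?thesis by (rule has_sum_mono) (rule ell2_sum_le[OF F])
  qed
  show "ell2_apply (ell2_apply (flip x) j) i = ell2_apply (ell2_apply x i) j"
    unfolding flip_def using ell2_boundedI(1)[OF bd] by (simp add: Abs_ell2_inverse col)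
  show "norm (flip x) \<le> norm x"
    unfolding flip_def by (rule ell2_boundedI(2)[OF bd]) auto
qed

lemma flip_flip [simp]: "flip (flip x) = x"
  by (intro ell2_eqI) (simp add: flip_apply)

lemma flip_linear: "flip (x + y) = flip x + flip y" "flip (x - y) = flip x - flip y"
  "flip (r *\<^sub>R x) = r *\<^sub>R flip x" "flip (c *\<^sub>C x) = c *\<^sub>C flip x"
  by (intro ell2_eqI; simp add: flip_apply ell2_simps)+

lemma norm_flip: "norm (flip x) = norm x"
  using norm_flip_le[of x] norm_flip_le[of "flip x"] by simp

lemma inner_flip: "flip x \<bullet> y = x \<bullet> flip y"
proof -
  have "flip x \<bullet> flip z = x \<bullet> z" for z
    using norm_flip[of "x + z"] norm_flip[of x] norm_flip[of z]
    by (simp add: flip_linear inner_add_left inner_add_right inner_commute norm_eq_sqrt_inner)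
  from this[of "flip y"] show ?thesis by simp
qed

lemma cinner_flip: "cinner (flip x) y = cinner x (flip y)"
  by (simp add: complex_eq_iff inner_cinner[symmetric] Im_cinner inner_flip flip_linear(4)[symmetric])

definition flipL :: "('i, ('j, complex) ell2) ell2 \<Rightarrow>\<^sub>L ('j, ('i, complex) ell2) ell2" where
  "flipL = Blinfun flip"

lemma flipL_apply [simp]:
  fixes x :: "('i, ('j, complex) ell2) ell2"
  shows "blinfun_apply flipL x = flip x"
proof -
  have "bounded_linear (flip :: ('i, ('j, complex) ell2) ell2 \<Rightarrow> ('j, ('i, complex) ell2) ell2)"
    by (rule bounded_linear_intro[where K=1]) (auto simp: flip_linear norm_flip)
  then show ?thesis by (simp add: flipL_def bounded_linear_Blinfun_apply)
qed

text \<open>\<open>1 \<otimes> b\<close> on \<open>\<ell>\<^sup>2(J) \<otimes> \<ell>\<^sup>2(I)\<close>, that is \<open>b \<otimes> 1\<close> conjugated by the exchange of the factors.\<close>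

definition ramp :: "('i, complex) ell2 op \<Rightarrow> ('i, ('j, complex) ell2) ell2 op" where
  "ramp b = flipL \<odot> amp b \<odot> flipL"

lemma ramp_apply: "blinfun_apply (ramp b) x = flip (blinfun_apply (amp b) (flip x))"
  by (simp add: ramp_def)

lemma norm_ramp_le:
  fixes b :: "('i, complex) ell2 op"
  shows "norm (ramp b :: ('i, ('j, complex) ell2) ell2 op) \<le> norm b"
proof (rule norm_blinfun_bound)
  show "norm (blinfun_apply (ramp b) x) \<le> norm b * norm x" for x :: "('i, ('j, complex) ell2) ell2"
  proof -
    have "norm (blinfun_apply (amp b) (flip x)) \<le> norm (amp b :: ('j, ('i, complex) ell2) ell2 op) * norm (flip x)"
      by (rule norm_blinfun)
    also have "\<dots> \<le> norm b * norm (flip x)" by (intro mult_right_mono norm_amp_le) auto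
    finally show ?thesis by (simp add: ramp_apply norm_flip)
  qed
qed simp

lemma bounded_opsI: "(\<And>c x. blinfun_apply T (c *\<^sub>C x) = c *\<^sub>C blinfun_apply T x) \<Longrightarrow> T \<in> bounded_ops"
  by (simp add: bounded_ops_def)

lemma ramp_bounded_ops [simp]:
  fixes b :: "('i, complex) ell2 op"
  assumes "b \<in> bounded_ops" shows "(ramp b :: ('i, ('j, complex) ell2) ell2 op) \<in> bounded_ops"
  by (rule bounded_opsI) (simp add: ramp_apply flip_linear bounded_opsD[OF amp_bounded_ops[OF assms]])

lemma ramp_comp: "ramp (b \<odot> b') = ramp b \<odot> ramp b'"
  by (rule blinfun_eqI) (simp add: ramp_apply amp_comp)

lemma ramp_adj: "b \<in> bounded_ops \<Longrightarrow> op_adj (ramp b) = ramp (op_adj b)"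
  by (rule op_adjI) (simp add: ramp_apply cinner_flip op_adj_cinner[OF amp_bounded_ops] amp_adj)

lemma flip_tensor_vec: "flip (tensor_vec \<xi> v) = tensor_vec v \<xi>"
  by (intro ell2_eqI) (simp add: flip_apply ell2_apply_tensor_vec ell2_simps scaleC_complex_def mult.commute)

lemma amp_tensor_vec: "d \<in> bounded_ops \<Longrightarrow> blinfun_apply (amp d) (tensor_vec \<xi> v) = tensor_vec (blinfun_apply d \<xi>) v"
  by (intro ell2_eqI) (simp add: amp_apply ell2_apply_tensor_vec bounded_opsD)

lemma ramp_tensor_vec: "b \<in> bounded_ops \<Longrightarrow> blinfun_apply (ramp b) (tensor_vec \<xi> v) = tensor_vec \<xi> (blinfun_apply b v)"
  by (simp add: ramp_apply flip_tensor_vec amp_tensor_vec)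

lemma ramp_left_reg: "ramp (left_reg s) = left_reg s"
  by (intro blinfun_eqI ell2_eqI) (simp add: ramp_apply flip_apply amp_apply left_reg_apply)

lemma amp_ramp_commute: "d \<in> bounded_ops \<Longrightarrow> b \<in> bounded_ops \<Longrightarrow> amp d \<odot> ramp b = ramp b \<odot> amp d"
  by (rule op_eqI_single) (simp add: sg_eq amp_tensor_vec ramp_tensor_vec)

lemma tensor_op_eq:
  fixes a :: "('j, complex) ell2 op"
  assumes "a \<in> bounded_ops" "b \<in> bounded_ops"
  shows "tensor_op a b = amp a \<odot> ramp b"
  unfolding tensor_op_def
proof (rule the_equality)
  show "\<forall>\<xi> v. blinfun_apply (amp a \<odot> ramp b) (tensor_vec \<xi> v) = tensor_vec (blinfun_apply a \<xi>) (blinfun_apply b v)"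
    by (simp add: assms ramp_tensor_vec amp_tensor_vec)
  fix R assume R: "\<forall>\<xi> v. blinfun_apply R (tensor_vec \<xi> v) = tensor_vec (blinfun_apply a \<xi>) (blinfun_apply b v)"
  show "R = amp a \<odot> ramp b"
    by (rule op_eqI_single) (simp add: R sg_eq assms ramp_tensor_vec amp_tensor_vec)
qed

lemma tensor_op_comp:
  fixes a a' :: "('j, complex) ell2 op"
  assumes "a \<in> bounded_ops" "b \<in> bounded_ops" "a' \<in> bounded_ops" "b' \<in> bounded_ops"
  shows "tensor_op a b \<odot> tensor_op a' b' = tensor_op (a \<odot> a') (b \<odot> b')"
proof -
  have "tensor_op a b \<odot> tensor_op a' b' = amp a \<odot> (ramp b \<odot> amp a') \<odot> ramp b'"
    using assms by (simp add: tensor_op_eq comp_assoc)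
  also have "ramp b \<odot> amp a' = amp a' \<odot> ramp b" using assms by (simp add: amp_ramp_commute)
  finally show ?thesis using assms by (simp add: tensor_op_eq amp_comp ramp_comp comp_assoc)
qed

lemma tensor_op_adj:
  fixes a :: "('j, complex) ell2 op"
  assumes "a \<in> bounded_ops" "b \<in> bounded_ops"
  shows "op_adj (tensor_op a b) = tensor_op (op_adj a) (op_adj b)"
  using assms by (simp add: tensor_op_eq op_adj_comp amp_adj ramp_adj amp_ramp_commute)

lemma tensor_op_bounded_ops [simp]:
  fixes a :: "('j, complex) ell2 op"
  shows "a \<in> bounded_ops \<Longrightarrow> b \<in> bounded_ops \<Longrightarrow> tensor_op a b \<in> bounded_ops"
  by (simp add: tensor_op_eq)

lemma min_tensor_concrete:
  fixes S :: "(nat, complex) ell2 op set"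
  assumes S: "concrete_cstar S" and T: "concrete_cstar T"
  shows "concrete_cstar (min_tensor S T)"
  unfolding min_tensor_def
proof (rule concrete_closed_cspan)
  note D = concrete_cstarD[OF S] and D' = concrete_cstarD[OF T]
  let ?G = "{tensor_op a b |a b. a \<in> S \<and> b \<in> T}"
  show "?G \<subseteq> bounded_ops" using D(10) D'(10) by auto
  show "X \<odot> Y \<in> closed_cspan ?G" if XY: "X \<in> ?G" "Y \<in> ?G" for X Y
  proof -
    obtain a b a' b' where ab: "a \<in> S" "b \<in> T" "a' \<in> S" "b' \<in> T" "X = tensor_op a b" "Y = tensor_op a' b'"
      using XY by blast
    then have "X \<odot> Y = tensor_op (a \<odot> a') (b \<odot> b')" using D(10) D'(10) by (simp add: tensor_op_comp)
    then show ?thesis using ab D(8) D'(8) by (intro closed_cspan_base) blast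
  qed
  show "op_adj X \<in> closed_cspan ?G" if X: "X \<in> ?G" for X
  proof -
    obtain a b where ab: "a \<in> S" "b \<in> T" "X = tensor_op a b" using X by blast
    then have "op_adj X = tensor_op (op_adj a) (op_adj b)" using D(10) D'(10) by (simp add: tensor_op_adj)
    then show ?thesis using ab D(9) D'(9) by (intro closed_cspan_base) blast
  qed
qed

lemma min_tensor_base: "a \<in> S \<Longrightarrow> b \<in> T \<Longrightarrow> tensor_op a b \<in> min_tensor S T"
  unfolding min_tensor_def by (rule closed_cspan_base) blast

lemma reduced_group_concrete: "concrete_cstar (reduced_group_cstar :: ('g::group_add, complex) ell2 op set)"
  unfolding reduced_group_cstar_def
  by (rule concrete_closed_cspan) (auto simp: left_reg_comp left_reg_adj intro: closed_cspan_base)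

lemma left_reg_in_reduced: "left_reg s \<in> reduced_group_cstar"
  unfolding reduced_group_cstar_def by (rule closed_cspan_base) simp

text \<open>Exactness identifies the kernel of \<open>A \<otimes> T \<rightarrow> \<phi> A \<otimes> T\<close> with \<open>J \<otimes> T\<close>; the closed range theorem selects an
  element over the given image whose norm is controlled by that image.\<close>

lemma exact_norm_lift:
  fixes \<phi> :: "(nat, complex) ell2 op \<Rightarrow> (nat, complex) ell2 op" and T :: "('i, complex) ell2 op set"
  assumes ex: "exact_cstar T" and T: "concrete_cstar T"
    and A: "concrete_cstar A" and phi: "cstar_ops_hom A norm \<phi>" and k: "\<And>i. i < k \<Longrightarrow> a i \<in> A \<and> b i \<in> T"
  defines "J \<equiv> {x \<in> A. \<phi> x = 0}"
  shows "\<exists>y. (\<Sum>i<k. tensor_op (a i) (b i)) - y \<in> min_tensor J T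
    \<and> norm y \<le> 800 * norm (\<Sum>i<k. tensor_op (\<phi> (a i)) (b i))"
proof -
  interpret A: cstar_ops_hom A norm \<phi> by (rule phi)
  note DA = concrete_cstarD[OF A]
  have subspaceI: "subspace S" if "0 \<in> S" "\<And>x y. x \<in> S \<Longrightarrow> y \<in> S \<Longrightarrow> x + y \<in> S" "\<And>c x. x \<in> S \<Longrightarrow> op_scale c x \<in> S"
    for S :: "(nat, complex) ell2 op set" using that by (simp add: subspace_def scaleR_op_scale)
  define Q where "Q = \<phi> ` A"
  have Q: "concrete_cstar Q"
  proof -
    have "subspace Q"
    proof (rule subspaceI)
      show "0 \<in> Q" unfolding Q_def using A.f_0 A.zero_in by (metis imageI)
      show "x + y \<in> Q" if "x \<in> Q" "y \<in> Q" for x y using that unfolding Q_def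
        by (metis (no_types, lifting) A.add_in A.f_add imageE imageI)
      show "op_scale c x \<in> Q" if "x \<in> Q" for c x using that unfolding Q_def
        by (metis (no_types, lifting) A.scale_in A.f_scale imageE imageI)
    qed
    then show ?thesis
      unfolding concrete_cstar_def Q_def using A.closed_range
      by (auto simp: A.f_in A.f_scale[symmetric] A.f_comp[symmetric] A.f_adj[symmetric])
  qed
  have J: "concrete_cstar J"
  proof -
    have "subspace J" by (rule subspaceI) (auto simp: J_def A.f_add A.f_scale)
    moreover have "closed J"
      unfolding closed_sequential_limits
    proof (intro allI impI, elim conjE)
      fix x l assume x: "\<forall>n. x n \<in> J" and l: "x \<longlonglongrightarrow> l"
      have lA: "l \<in> A" by (rule closed_sequentially[OF DA(2) _ l]) (use x in \<open>simp add: J_def\<close>)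
      have le: "norm (\<phi> l) \<le> 2 * norm (l - x n)" for n
      proof -
        have "x n \<in> A" "\<phi> (x n) = 0" using x by (auto simp: J_def)
        then show ?thesis using A.hom_bounded[of "l - x n"] lA by (simp add: A.f_diff)
      qed
      have lim: "(\<lambda>n. 2 * norm (l - x n)) \<longlonglongrightarrow> 2 * norm (l - l)" by (intro tendsto_intros l)
      have "norm (\<phi> l) \<le> 2 * norm (l - l)" by (rule LIMSEQ_le_const[OF lim]) (use le in blast)
      then show "l \<in> J" using lA by (simp add: J_def)
    qed
    ultimately show ?thesis
      unfolding concrete_cstar_def
      by (auto simp: J_def DA A.f_scale A.f_comp A.f_adj comp_zero_left)
  qed
  have se: "short_exact (op_cstar J) (\<lambda>x. x) (op_cstar A) \<phi> (op_cstar Q)"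
    unfolding short_exact_def star_hom_def
    by (auto simp: J_def Q_def A.f_add A.f_scale A.f_comp A.f_adj)
  from ex[unfolded exact_cstar_def, rule_format, OF conjI[OF J conjI[OF A conjI[OF Q se]]]]
  obtain \<iota>' \<phi>' where ind: "induced J T (\<lambda>x. x) \<iota>'" "induced A T \<phi> \<phi>'"
    and se': "short_exact (op_cstar (min_tensor J T)) \<iota>' (op_cstar (min_tensor A T)) \<phi>' (op_cstar (min_tensor Q T))"
    by blast
  note JT = min_tensor_concrete[OF J T] and AT = min_tensor_concrete[OF A T] and QT = min_tensor_concrete[OF Q T]
  have hom: "star_hom (op_cstar (min_tensor J T)) (op_cstar (min_tensor A T)) \<iota>'"
    "star_hom (op_cstar (min_tensor A T)) (op_cstar (min_tensor Q T)) \<phi>'"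
    and ker: "\<iota>' ` min_tensor J T = {x \<in> min_tensor A T. \<phi>' x = 0}"
    using se' unfolding short_exact_def by simp_all
  interpret AT: cstar_ops_hom "min_tensor A T" norm \<phi>'
    by (rule concrete_hom[OF AT hom(2) concrete_cstarD(1)[OF QT]])
  interpret JT: cstar_ops_hom "min_tensor J T" norm \<iota>'
    by (rule concrete_hom[OF JT hom(1) concrete_cstarD(1)[OF AT]])
  \<comment> \<open>The induced map of the inclusion is the inclusion, by continuity.\<close>
  have iota: "\<iota>' x = x" if "x \<in> min_tensor J T" for x
  proof -
    let ?K = "{x \<in> min_tensor J T. \<iota>' x = x}"
    have "closed ?K"
      unfolding closed_sequential_limits
    proof (intro allI impI, elim conjE)
      fix x l assume x: "\<forall>n. x n \<in> ?K" and l: "x \<longlonglongrightarrow> l"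
      have lJ: "l \<in> min_tensor J T" by (rule closed_sequentially[OF concrete_cstarD(2)[OF JT] _ l]) (use x in simp)
      have le: "norm (\<iota>' l - l) \<le> 2 * norm (l - x n) + norm (x n - l)" for n
      proof -
        have xn: "x n \<in> min_tensor J T" "\<iota>' (x n) = x n" using x by auto
        have eq: "\<iota>' l - l = \<iota>' (l - x n) + (x n - l)" using lJ xn by (simp add: JT.f_diff)
        have "norm (\<iota>' (l - x n)) \<le> 2 * norm (l - x n)" by (rule JT.hom_bounded) (use lJ xn in simp)
        then show ?thesis
          using norm_triangle_ineq[of "\<iota>' (l - x n)" "x n - l"] unfolding eq by linarith
      qed
      have lim: "(\<lambda>n. 2 * norm (l - x n) + norm (x n - l)) \<longlonglongrightarrow> 2 * norm (l - l) + norm (l - l)"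
        by (intro tendsto_intros l)
      have "norm (\<iota>' l - l) \<le> 2 * norm (l - l) + norm (l - l)" by (rule LIMSEQ_le_const[OF lim]) (use le in blast)
      then show "l \<in> ?K" using lJ by simp
    qed
    moreover have "subspace ?K"
      unfolding subspace_def by (auto simp: JT.f_add JT.f_scaleR)
    moreover have base: "tensor_op a b \<in> ?K" if "a \<in> J" "b \<in> T" for a b
      using that ind(1) by (auto simp: induced_def min_tensor_base)
    then have "op_scale c X \<in> ?K" if "X \<in> {tensor_op a b |a b. a \<in> J \<and> b \<in> T}" for c X
      using that JT.f_scale JT.scale_in by fastforce
    ultimately have "min_tensor J T \<subseteq> ?K"
      unfolding min_tensor_def[of J T] using base by (intro closed_cspan_subset) (auto simp: min_tensor_def)
    then show ?thesis using that by blast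
  qed
  let ?X = "\<Sum>i<k. tensor_op (a i) (b i)"
  have base: "tensor_op (a i) (b i) \<in> min_tensor A T" if "i < k" for i using k[OF that] by (simp add: min_tensor_base)
  have XA: "?X \<in> min_tensor A T" by (rule AT.sum_in) (use base in simp)
  have fX: "\<phi>' ?X = (\<Sum>i<k. tensor_op (\<phi> (a i)) (b i))"
    using ind(2) k base by (subst AT.f_sum) (auto simp: induced_def)
  have "\<phi>' ?X \<in> closure (\<phi>' ` min_tensor A T)" using XA closure_subset by (meson imageI subsetD)
  from AT.exact_lift[OF this] obtain y where y: "y \<in> min_tensor A T" "\<phi>' y = \<phi>' ?X" "norm y \<le> 800 * norm (\<phi>' ?X)"
    by blast
  have "?X - y \<in> {x \<in> min_tensor A T. \<phi>' x = 0}" using XA y by (simp add: AT.f_diff)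
  then have "?X - y \<in> min_tensor J T" using ker iota by (metis (no_types, lifting) imageE)
  then show ?thesis using y fX by auto
qed

section \<open>Gram-Schmidt and compressions to \<open>\<ell>\<^sup>2(\<nat>)\<close>\<close>

lemma norm_blinfun_le1: "norm T \<le> 1 \<Longrightarrow> norm (blinfun_apply T x) \<le> norm x"
  using norm_blinfun[of T x] mult_right_mono[of "norm T" 1 "norm x"] by simp

declare sum.cong [fundef_cong]

text \<open>A vector that depends linearly on its predecessors leaves the residual \<open>0\<close>, which \<open>r /\<^sub>R norm r\<close> maps to \<open>0\<close>.\<close>

function gs :: "(nat \<Rightarrow> 'h::chilbert_space) \<Rightarrow> nat \<Rightarrow> 'h" where
  "gs v k = (let r = v k - (\<Sum>j<k. cinner (v k) (gs v j) *\<^sub>C gs v j) in r /\<^sub>R norm r)"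
  by pat_completeness auto
termination by (relation "Wellfounded.measure snd") auto

declare gs.simps [simp del]

text \<open>Zero vectors are allowed, so that linearly dependent sequences need no special treatment.\<close>

definition ons :: "(nat \<Rightarrow> 'h::chilbert_space) \<Rightarrow> bool" where
  "ons e \<longleftrightarrow> (\<forall>i j. i \<noteq> j \<longrightarrow> cinner (e i) (e j) = 0) \<and> (\<forall>i. e i = 0 \<or> norm (e i) = 1)"

definition proj :: "(nat \<Rightarrow> 'h::chilbert_space) \<Rightarrow> nat \<Rightarrow> 'h \<Rightarrow> 'h" where
  "proj e m x = (\<Sum>j<m. cinner x (e j) *\<^sub>C e j)"

lemma gs_residual: "gs v k = (v k - proj (gs v) k (v k)) /\<^sub>R norm (v k - proj (gs v) k (v k))"
  by (subst gs.simps) (simp add: Let_def proj_def)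

lemma cnj_mult_self: "cnj z * z = complex_of_real ((cmod z)\<^sup>2)"
  by (simp only: complex_norm_square mult.commute)

lemma gs_unit: "gs v k = 0 \<or> norm (gs v k) = 1"
  by (subst (1 2) gs_residual) (cases "v k - proj (gs v) k (v k) = 0", simp_all)

lemma cinner_unit: "e = 0 \<or> norm e = 1 \<Longrightarrow> cinner x e * cinner e e = cinner x e"
  by (auto simp: cinner_self)

lemma gs_eq: "v k = proj (gs v) k (v k) + norm (v k - proj (gs v) k (v k)) *\<^sub>R gs v k"
proof -
  have "norm r *\<^sub>R (r /\<^sub>R norm r) = r" for r :: 'a by (cases "r = 0") auto
  from this[of "v k - proj (gs v) k (v k)"] show ?thesis unfolding gs_residual[symmetric] by simp
qed

lemma gs_orthogonal: "i < k \<Longrightarrow> cinner (gs v k) (gs v i) = 0"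
proof (induction k arbitrary: i rule: less_induct)
  case (less k)
  have orth: "cinner (gs v j) (gs v i) = 0" if "j < k" "j \<noteq> i" for j
  proof (cases "i < j")
    case True then show ?thesis using less that by blast
  next
    case False
    then have "cinner (gs v i) (gs v j) = 0" using less that by auto
    then show ?thesis by (metis cinner_commute complex_cnj_zero)
  qed
  have "cinner (proj (gs v) k (v k)) (gs v i) = (\<Sum>j<k. cinner (v k) (gs v j) * cinner (gs v j) (gs v i))"
    by (simp add: proj_def cinner_sum_left cinner_scaleC_left)
  also have "\<dots> = (\<Sum>j<k. if j = i then cinner (v k) (gs v i) else 0)"
    by (rule sum.cong) (auto simp: orth cinner_unit[OF gs_unit])
  also have "\<dots> = cinner (v k) (gs v i)" using less.prems by simp
  finally have "cinner (v k - proj (gs v) k (v k)) (gs v i) = 0" by (simp add: cinner_diff_left)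
  then show ?case by (subst gs_residual) (simp add: scaleR_scaleC cinner_scaleC_left)
qed

lemma ons_gs: "ons (gs v)"
  unfolding ons_def
proof (intro conjI allI impI gs_unit)
  fix i j :: nat assume "i \<noteq> j"
  then show "cinner (gs v i) (gs v j) = 0"
    by (cases "i < j") (metis gs_orthogonal cinner_commute complex_cnj_zero, simp add: gs_orthogonal)
qed

lemma proj_linear: "proj e m (x + y) = proj e m x + proj e m y" "proj e m (c *\<^sub>C x) = c *\<^sub>C proj e m x"
  "proj e m (r *\<^sub>R x) = r *\<^sub>R proj e m x" "proj e m 0 = 0"
  by (simp_all add: proj_def cinner_add_left cinner_scaleC_left scaleC_add_left sum.distrib scaleC_sum_right
      scaleC_scaleC scaleR_scaleC)

lemma proj_sum: "proj e m (sum f I) = (\<Sum>i\<in>I. proj e m (f i))"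
  by (induction I rule: infinite_finite_induct) (auto simp: proj_linear)

context
  fixes e :: "nat \<Rightarrow> 'h::chilbert_space"
  assumes e: "ons e"
begin

lemma ons_unit: "cinner x (e i) * cinner (e i) (e i) = cinner x (e i)"
  by (rule cinner_unit) (use e in \<open>auto simp: ons_def\<close>)

lemma ons_self: "cinner (e i) (e i) *\<^sub>C e i = e i"
  using e by (cases "e i = 0") (auto simp: ons_def cinner_self)

lemma proj_basis: "j < m \<Longrightarrow> proj e m (e j) = e j"
proof -
  assume j: "j < m"
  have "proj e m (e j) = (\<Sum>i<m. if i = j then e j else 0)"
    unfolding proj_def by (rule sum.cong) (use e in \<open>auto simp: ons_self ons_def\<close>)
  then show ?thesis using j by simp
qed

lemma proj_mono: assumes "proj e m x = x" "m \<le> m'" shows "proj e m' x = x"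
proof -
  have "proj e m' (proj e m x) = proj e m x"
    unfolding proj_def[of e m] using assms(2) by (simp add: proj_sum proj_linear proj_basis)
  then show ?thesis using assms(1) by simp
qed

text \<open>\<open>An\<close> is the analysis operator of the system \<open>e\<close>; its adjoint \<open>Sy\<close> is the synthesis operator. Both are
  partial isometries, and \<open>Sy \<circ> An\<close> is the projection onto the closed span of the system.\<close>

definition An :: "'h \<Rightarrow>\<^sub>L (nat, complex) ell2" where
  "An = Blinfun (\<lambda>x. Abs_ell2 (\<lambda>k. cinner x (e k)))"

lemma An_apply: "ell2_apply (blinfun_apply An x) k = cinner x (e k)"
  and norm_An_le: "norm An \<le> 1"
proof -
  have bessel: "(\<Sum>k\<in>F. (cmod (cinner x (e k)))\<^sup>2) \<le> (norm x)\<^sup>2" if F: "finite F" for F x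
  proof -
    define y where "y = (\<Sum>k\<in>F. cinner x (e k) *\<^sub>C e k)"
    define s where "s = (\<Sum>k\<in>F. (cmod (cinner x (e k)))\<^sup>2)"
    have "cinner x y = (\<Sum>k\<in>F. complex_of_real ((cmod (cinner x (e k)))\<^sup>2))"
      by (simp only: y_def cinner_sum_right cinner_scaleC_right cnj_mult_self)
    then have xy: "x \<bullet> y = s" by (simp add: inner_cinner s_def)
    have ye: "cinner y (e k) = cinner x (e k)" if "k \<in> F" for k
    proof -
      have "cinner y (e k) = (\<Sum>j\<in>F. if j = k then cinner x (e k) else 0)"
        unfolding y_def cinner_sum_left cinner_scaleC_left
        by (rule sum.cong) (use e in \<open>auto simp: ons_unit ons_def\<close>)
      then show ?thesis using F that by simp
    qed
    have "cinner y y = (\<Sum>k\<in>F. complex_of_real ((cmod (cinner x (e k)))\<^sup>2))"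
    proof -
      have "cinner y y = (\<Sum>k\<in>F. cnj (cinner x (e k)) * cinner y (e k))"
        by (subst (2) y_def) (simp only: cinner_sum_right cinner_scaleC_right)
      also have "\<dots> = (\<Sum>k\<in>F. complex_of_real ((cmod (cinner x (e k)))\<^sup>2))"
        by (rule sum.cong) (simp_all only: ye cnj_mult_self)
      finally show ?thesis .
    qed
    then have yy: "y \<bullet> y = s" by (simp add: inner_cinner s_def)
    have "y \<bullet> y \<le> norm x * norm y" using norm_cauchy_schwarz[of x y] xy yy by simp
    then have "norm y * norm y \<le> norm x * norm y" by (simp add: power2_norm_eq_inner[symmetric] power2_eq_square)
    then have "norm y \<le> norm x" by (cases "norm y = 0") (auto simp: mult_le_cancel_right)
    then have "(norm y)\<^sup>2 \<le> (norm x)\<^sup>2" by (intro power_mono) auto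
    then show ?thesis using yy by (simp add: s_def power2_norm_eq_inner)
  qed
  define S where "S x = Abs_ell2 (\<lambda>k. cinner x (e k))" for x
  have app: "ell2_apply (S x) k = cinner x (e k)" for x k
    unfolding S_def using ell2_boundedI(1)[OF bessel] by (simp add: Abs_ell2_inverse)
  have nS: "norm (S x) \<le> norm x" for x
    unfolding S_def by (rule ell2_boundedI(2)[OF bessel]) auto
  have "bounded_linear S"
    by (rule bounded_linear_ell2I[where K=1])
       (use nS in \<open>auto simp: app cinner_add_left scaleR_scaleC cinner_scaleC_left scaleC_complex_def scaleR_conv_of_real\<close>)
  then have eq: "blinfun_apply An x = S x" for x
    unfolding An_def S_def[symmetric] by (simp add: bounded_linear_Blinfun_apply)
  show "ell2_apply (blinfun_apply An x) k = cinner x (e k)" by (simp add: eq app)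
  show "norm An \<le> 1" by (rule norm_blinfun_bound) (simp_all add: eq nS)
qed

lemma An_scaleC: "blinfun_apply An (c *\<^sub>C x) = c *\<^sub>C blinfun_apply An x"
  by (rule ell2_eqI) (simp add: An_apply ell2_simps cinner_scaleC_left scaleC_complex_def)

definition Sy :: "(nat, complex) ell2 \<Rightarrow>\<^sub>L 'h" where
  "Sy = (SOME S. \<forall>x y. cinner (blinfun_apply An x) y = cinner x (blinfun_apply S y))"

lemma An_Sy: "cinner (blinfun_apply An x) y = cinner x (blinfun_apply Sy y)"
  using someI_ex[OF adjoint_exists[of An, OF An_scaleC]] unfolding Sy_def by blast

lemma Sy_An: "cinner (blinfun_apply Sy y) x = cinner y (blinfun_apply An x)"
  by (metis An_Sy cinner_commute)

lemma Sy_scaleC: "blinfun_apply Sy (c *\<^sub>C y) = c *\<^sub>C blinfun_apply Sy y"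
  by (rule cinner_eqI) (simp add: An_Sy[symmetric] cinner_scaleC_right)

lemma norm_Sy_le: "norm Sy \<le> 1"
proof (rule norm_blinfun_bound)
  fix y
  let ?x = "blinfun_apply Sy y"
  have "norm ?x * norm ?x = ?x \<bullet> ?x" by (simp add: power2_norm_eq_inner[symmetric] power2_eq_square)
  also have "\<dots> = y \<bullet> blinfun_apply An ?x" by (simp add: inner_cinner Sy_An)
  also have "\<dots> \<le> norm y * norm (blinfun_apply An ?x)" by (rule norm_cauchy_schwarz)
  also have "\<dots> \<le> norm y * norm ?x" by (intro mult_left_mono norm_blinfun_le1 norm_An_le) auto
  finally show "norm ?x \<le> 1 * norm y" by (cases "norm ?x = 0") (auto simp: mult_le_cancel_right)
qed simp

lemma Sy_sg: "blinfun_apply Sy (blinfun_apply (sg k) z) = z *\<^sub>C e k"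
proof (rule cinner_eqI)
  fix x
  have "cinner x (blinfun_apply Sy (blinfun_apply (sg k) z)) = cinner (cinner x (e k)) z"
    by (simp add: An_Sy[symmetric] cinner_sg An_apply)
  then show "cinner x (blinfun_apply Sy (blinfun_apply (sg k) z)) = cinner x (z *\<^sub>C e k)"
    by (simp add: cinner_scaleC_right cinner_complex_def mult.commute)
qed

lemma An_basis: "blinfun_apply An (e k) = blinfun_apply (sg k) (cinner (e k) (e k))"
  using e by (intro ell2_eqI) (auto simp: An_apply sg_apply ons_def)

lemma Sy_An_fixed: assumes "proj e m x = x" shows "blinfun_apply Sy (blinfun_apply An x) = x"
proof -
  have "blinfun_apply Sy (blinfun_apply An (proj e m x)) = proj e m x"
    unfolding proj_def
    by (simp add: blinfun.sum_right An_scaleC Sy_scaleC An_basis Sy_sg ons_self scaleC_scaleC)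
  then show ?thesis using assms by simp
qed

lemma norm_An_fixed: assumes "proj e m x = x" shows "norm (blinfun_apply An x) = norm x"
  using norm_blinfun_le1[OF norm_An_le, of x] norm_blinfun_le1[OF norm_Sy_le, of "blinfun_apply An x"]
  by (simp add: Sy_An_fixed[OF assms])

definition compr :: "'h op \<Rightarrow> (nat, complex) ell2 op" where "compr T = An \<odot> T \<odot> Sy"

lemma compr_apply: "blinfun_apply (compr T) y = blinfun_apply An (blinfun_apply T (blinfun_apply Sy y))"
  by (simp add: compr_def)

lemma compr_bounded_ops: "T \<in> bounded_ops \<Longrightarrow> compr T \<in> bounded_ops"
  by (rule bounded_opsI) (simp add: compr_apply Sy_scaleC bounded_opsD An_scaleC)

lemma norm_compr_le: "norm (compr T) \<le> norm T"
proof (rule norm_blinfun_bound)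
  fix y
  have "norm (blinfun_apply (compr T) y) \<le> norm (blinfun_apply T (blinfun_apply Sy y))"
    unfolding compr_apply by (rule norm_blinfun_le1[OF norm_An_le])
  also have "\<dots> \<le> norm T * norm (blinfun_apply Sy y)" by (rule norm_blinfun)
  also have "\<dots> \<le> norm T * norm y" by (intro mult_left_mono norm_blinfun_le1 norm_Sy_le) auto
  finally show "norm (blinfun_apply (compr T) y) \<le> norm T * norm y" .
qed simp

lemma compr_adj: "T \<in> bounded_ops \<Longrightarrow> op_adj (compr T) = compr (op_adj T)"
  by (rule op_adjI) (simp add: compr_apply An_Sy Sy_An op_adj_cinner)

text \<open>Nothing is lost between the two factors if the right one leaves the span of the system invariant.\<close>

lemma compr_comp:
  assumes "\<And>k. \<exists>m. proj e m (blinfun_apply T (e k)) = blinfun_apply T (e k)" "T \<in> bounded_ops"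
  shows "compr S \<odot> compr T = compr (S \<odot> T)"
proof (rule op_eqI_single)
  fix k z
  obtain m where "proj e m (blinfun_apply T (e k)) = blinfun_apply T (e k)" using assms(1) by blast
  then have "proj e m (blinfun_apply T (z *\<^sub>C e k)) = blinfun_apply T (z *\<^sub>C e k)"
    by (simp add: bounded_opsD[OF assms(2)] proj_linear)
  then show "blinfun_apply (compr S \<odot> compr T) (blinfun_apply (sg k) z) = blinfun_apply (compr (S \<odot> T)) (blinfun_apply (sg k) z)"
    by (simp add: compr_apply Sy_sg Sy_An_fixed)
qed

end

lemma An_coordinate_vanishes:
  assumes "ons e" "proj e m x = x" "m \<le> j" shows "ell2_apply (blinfun_apply (An e) x) j = 0"
proof -
  have "cinner (proj e m x) (e j) = 0"
    unfolding proj_def cinner_sum_left cinner_scaleC_left using assms(1,3)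
    by (intro sum.neutral) (auto simp: ons_def)
  then show ?thesis using assms(2) by (simp add: An_apply[OF assms(1)])
qed

section \<open>Block diagonal operators on \<open>\<ell>\<^sup>2(\<nat>)\<close>\<close>

text \<open>\<open>\<ell>\<^sup>2(\<nat>) = \<ell>\<^sup>2(\<nat> \<times> \<nat>)\<close> carries operators with infinitely many infinite blocks. \<open>Rb n\<close> is the
  coordinate map onto the \<open>n\<close>-th block and \<open>Ib n\<close> the inclusion of that block.\<close>

type_synonym l2 = "(nat, complex) ell2"

definition Rb :: "nat \<Rightarrow> l2 op" where
  "Rb n = Blinfun (\<lambda>c. Abs_ell2 (\<lambda>k. ell2_apply c (prod_encode (n, k))))"

lemma Rb_apply: "ell2_apply (blinfun_apply (Rb n) c) k = ell2_apply c (prod_encode (n, k))"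
  and norm_Rb_le: "norm (Rb n) \<le> 1"
proof -
  have bd: "(\<Sum>k\<in>F. (norm (ell2_apply c (prod_encode (n, k))))\<^sup>2) \<le> (norm c)\<^sup>2" if F: "finite F" for F and c :: l2
  proof -
    have "inj_on (\<lambda>k. prod_encode (n, k)) F" by (auto intro!: inj_onI)
    then have "(\<Sum>k\<in>F. (norm (ell2_apply c (prod_encode (n, k))))\<^sup>2)
        = (\<Sum>m\<in>(\<lambda>k. prod_encode (n, k)) ` F. (norm (ell2_apply c m))\<^sup>2)"
      by (simp add: sum.reindex)
    also have "\<dots> \<le> (norm c)\<^sup>2" using F by (intro ell2_sum_le) auto
    finally show ?thesis .
  qed
  define S :: "l2 \<Rightarrow> l2" where "S c = Abs_ell2 (\<lambda>k. ell2_apply c (prod_encode (n, k)))" for c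
  have app: "ell2_apply (S c) k = ell2_apply c (prod_encode (n, k))" for c k
    unfolding S_def using ell2_boundedI(1)[OF bd] by (simp add: Abs_ell2_inverse)
  have nS: "norm (S c) \<le> norm c" for c
    unfolding S_def by (rule ell2_boundedI(2)[OF bd]) auto
  have "bounded_linear S"
    by (rule bounded_linear_ell2I[where K=1]) (use nS in \<open>auto simp: app ell2_simps\<close>)
  then have eq: "blinfun_apply (Rb n) x = S x" for x
    unfolding Rb_def S_def[symmetric] by (simp add: bounded_linear_Blinfun_apply)
  show "ell2_apply (blinfun_apply (Rb n) c) k = ell2_apply c (prod_encode (n, k))" by (simp add: eq app)
  show "norm (Rb n) \<le> 1" by (rule norm_blinfun_bound) (simp_all add: eq nS)
qed

lemma Rb_in [simp]: "Rb n \<in> bounded_ops"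
  by (rule bounded_opsI, rule ell2_eqI) (simp add: Rb_apply ell2_simps)

definition Ib :: "nat \<Rightarrow> l2 op" where "Ib n = op_adj (Rb n)"

lemma norm_Ib_le: "norm (Ib n) \<le> 1" using norm_Rb_le[of n] by (simp add: Ib_def)
lemma Ib_in [simp]: "Ib n \<in> bounded_ops" by (simp add: Ib_def)
lemma Ib_adj [simp]: "op_adj (Ib n) = Rb n" by (simp add: Ib_def)
lemma Rb_adj [simp]: "op_adj (Rb n) = Ib n" by (simp add: Ib_def)

lemma Rb_sg:
  fixes z :: complex
  shows "blinfun_apply (Rb n) (blinfun_apply (sg m) z) =
    (if fst (prod_decode m) = n then blinfun_apply (sg (snd (prod_decode m))) z else (0::l2))"
proof (rule ell2_eqI)
  fix k
  obtain a b where ab: "prod_decode m = (a, b)" by (rule prod.exhaust)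
  have m: "m = prod_encode (a, b)" by (simp only: ab[symmetric] prod_decode_inverse)
  show "ell2_apply (blinfun_apply (Rb n) (blinfun_apply (sg m) z)) k =
    ell2_apply (if fst (prod_decode m) = n then blinfun_apply (sg (snd (prod_decode m))) z else (0::l2)) k"
    unfolding ab by (cases "a = n") (simp_all add: m Rb_apply sg_apply ell2_simps prod_encode_eq)
qed

lemma Ib_apply: "ell2_apply (blinfun_apply (Ib n) c) m = (if fst (prod_decode m) = n then ell2_apply c (snd (prod_decode m)) else 0)"
proof -
  have "cinner (blinfun_apply (Ib n) c) (blinfun_apply (sg m) 1) = cinner c (blinfun_apply (Rb n) (blinfun_apply (sg m) 1))"
    unfolding Ib_def by (rule op_adj_cinner') simp
  then show ?thesis
    by (cases "fst (prod_decode m) = n") (simp_all add: Rb_sg cinner_sg cinner_complex_def)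
qed

lemma Rb_Ib: "Rb n \<odot> Ib m = (if n = m then id_blinfun else 0)"
  by (cases "n = m"; rule blinfun_eqI; rule ell2_eqI; simp add: Rb_apply Ib_apply ell2_simps)

definition Pb :: "nat \<Rightarrow> l2 op" where "Pb n = Ib n \<odot> Rb n"

lemma Pb_in [simp]: "Pb n \<in> bounded_ops" by (simp add: Pb_def)
lemma Pb_adj [simp]: "op_adj (Pb n) = Pb n" by (simp add: Pb_def op_adj_comp)
lemma Pb_Ib: "Pb n \<odot> Ib n = Ib n" by (simp add: Pb_def comp_assoc Rb_Ib)
lemma Rb_Pb: "Rb n \<odot> Pb n = Rb n" by (simp add: Pb_def comp_assoc[symmetric] Rb_Ib)

lemma blocks_eqI: "(\<And>n. blinfun_apply (Rb n) x = blinfun_apply (Rb n) y) \<Longrightarrow> x = y"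
proof (rule ell2_eqI)
  fix m assume eq: "\<And>n. blinfun_apply (Rb n) x = blinfun_apply (Rb n) y"
  obtain n k where "m = prod_encode (n, k)" by (metis prod.collapse prod_decode_inverse)
  then show "ell2_apply x m = ell2_apply y m" using eq[of n] by (metis Rb_apply)
qed

lemma blocks_op_eqI: "(\<And>n. Rb n \<odot> S = Rb n \<odot> T) \<Longrightarrow> S = T"
  by (rule blinfun_eqI, rule blocks_eqI) (metis blinfun_apply_blinfun_compose)

lemma blocks_sum_le: assumes N: "finite N" shows "(\<Sum>n\<in>N. (norm (blinfun_apply (Rb n) c))\<^sup>2) \<le> (norm c)\<^sup>2"
proof -
  define y where "y = (\<Sum>n\<in>N. blinfun_apply (Ib n) (blinfun_apply (Rb n) c))"
  define s where "s = (\<Sum>n\<in>N. (norm (blinfun_apply (Rb n) c))\<^sup>2)"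
  have Ry: "blinfun_apply (Rb n) y = blinfun_apply (Rb n) c" if "n \<in> N" for n
  proof -
    have "blinfun_apply (Rb n) (blinfun_apply (Ib m) x) = (if n = m then x else 0)" for m x
      using arg_cong[OF Rb_Ib[of n m], of "\<lambda>T. blinfun_apply T x"] by (auto split: if_splits)
    then show ?thesis using N that by (simp add: y_def blinfun.sum_right)
  qed
  have in1: "y \<bullet> x = (\<Sum>n\<in>N. blinfun_apply (Rb n) c \<bullet> blinfun_apply (Rb n) x)" for x
    by (simp add: y_def inner_sum_left op_adj_inner)
  have "y \<bullet> c = s" by (simp add: in1 s_def power2_norm_eq_inner)
  moreover have yy: "y \<bullet> y = s" by (simp add: in1 s_def Ry power2_norm_eq_inner)
  ultimately have "norm y * norm y \<le> norm y * norm c"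
    using norm_cauchy_schwarz[of y c] by (simp add: power2_norm_eq_inner[symmetric] power2_eq_square)
  then have "norm y \<le> norm c" by (cases "norm y = 0") (auto simp: mult_le_cancel_left)
  then have "(norm y)\<^sup>2 \<le> (norm c)\<^sup>2" by (intro power_mono) auto
  then show ?thesis using yy by (simp add: s_def power2_norm_eq_inner)
qed

definition blk :: "(nat \<Rightarrow> l2 op) \<Rightarrow> l2 op" where
  "blk d = Blinfun (\<lambda>c. Abs_ell2 (\<lambda>m. case prod_decode m of (n, k) \<Rightarrow> ell2_apply (blinfun_apply (d n) (blinfun_apply (Rb n) c)) k))"

lemma blk_Rb: assumes d: "\<And>n. norm (d n) \<le> B" shows "Rb n \<odot> blk d = d n \<odot> Rb n"
proof -
  have B: "B \<ge> 0" using d[of 0] norm_ge_zero order_trans by blast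
  define h where "h c m = (case prod_decode m of (n, k) \<Rightarrow> ell2_apply (blinfun_apply (d n) (blinfun_apply (Rb n) c)) k)" for c m
  have bd: "(\<Sum>m\<in>F. (norm (h c m))\<^sup>2) \<le> (B * norm c)\<^sup>2" if F: "finite F" for F c
  proof -
    define N where "N = (fst \<circ> prod_decode) ` F"
    define K where "K = (snd \<circ> prod_decode) ` F"
    have fin: "finite N" "finite K" using F by (auto simp: N_def K_def)
    have sub: "F \<subseteq> prod_encode ` (N \<times> K)"
    proof
      fix m assume "m \<in> F"
      then have "prod_decode m \<in> N \<times> K" by (auto simp: N_def K_def mem_Times_iff)
      then show "m \<in> prod_encode ` (N \<times> K)" by (metis imageI prod_decode_inverse)
    qed
    have "(\<Sum>m\<in>F. (norm (h c m))\<^sup>2) \<le> (\<Sum>m\<in>prod_encode ` (N \<times> K). (norm (h c m))\<^sup>2)"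
      by (rule sum_mono2) (use sub fin in auto)
    also have "\<dots> = (\<Sum>p\<in>N \<times> K. (norm (h c (prod_encode p)))\<^sup>2)"
      by (subst sum.reindex) (auto intro!: inj_onI)
    also have "\<dots> = (\<Sum>n\<in>N. \<Sum>k\<in>K. (norm (ell2_apply (blinfun_apply (d n) (blinfun_apply (Rb n) c)) k))\<^sup>2)"
      by (simp add: sum.cartesian_product h_def case_prod_unfold)
    also have "\<dots> \<le> (\<Sum>n\<in>N. (norm (blinfun_apply (d n) (blinfun_apply (Rb n) c)))\<^sup>2)"
      by (intro sum_mono ell2_sum_le fin)
    also have "\<dots> \<le> (\<Sum>n\<in>N. B\<^sup>2 * (norm (blinfun_apply (Rb n) c))\<^sup>2)"
    proof (intro sum_mono)
      fix n
      have "norm (blinfun_apply (d n) (blinfun_apply (Rb n) c)) \<le> B * norm (blinfun_apply (Rb n) c)"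
        using norm_blinfun[of "d n" "blinfun_apply (Rb n) c"] mult_right_mono[OF d[of n], of "norm (blinfun_apply (Rb n) c)"] by simp
      then show "(norm (blinfun_apply (d n) (blinfun_apply (Rb n) c)))\<^sup>2 \<le> B\<^sup>2 * (norm (blinfun_apply (Rb n) c))\<^sup>2"
        unfolding power_mult_distrib[symmetric] by (intro power_mono) auto
    qed
    also have "\<dots> = B\<^sup>2 * (\<Sum>n\<in>N. (norm (blinfun_apply (Rb n) c))\<^sup>2)" by (simp add: sum_distrib_left)
    also have "\<dots> \<le> B\<^sup>2 * (norm c)\<^sup>2" by (intro mult_left_mono blocks_sum_le fin) auto
    finally show ?thesis by (simp add: power_mult_distrib)
  qed
  define S where "S c = Abs_ell2 (h c)" for c
  have app: "ell2_apply (S c) m = h c m" for c m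
    unfolding S_def using ell2_boundedI(1)[OF bd] B by (simp add: Abs_ell2_inverse)
  have nS: "norm (S c) \<le> B * norm c" for c
    unfolding S_def by (rule ell2_boundedI(2)[OF bd]) (use B in auto)
  have "bounded_linear S"
    by (rule bounded_linear_ell2I[where K=B])
       (use nS in \<open>auto simp: app h_def ell2_simps blinfun.bilinear_simps mult.commute split: prod.split\<close>)
  then have eq: "blinfun_apply (blk d) x = S x" for x
    unfolding blk_def S_def[symmetric] h_def[symmetric] by (simp add: bounded_linear_Blinfun_apply)
  show ?thesis
    by (intro blinfun_eqI ell2_eqI) (simp add: Rb_apply eq app h_def)
qed

context
  fixes d :: "nat \<Rightarrow> l2 op" and B
  assumes d: "\<And>n. norm (d n) \<le> B" and d_in: "\<And>n. d n \<in> bounded_ops"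
begin

lemma blk_in: "blk d \<in> bounded_ops"
proof (rule bounded_opsI, rule blocks_eqI)
  fix c x n
  have R: "blinfun_apply (Rb n) (blinfun_apply (blk d) y) = blinfun_apply (d n) (blinfun_apply (Rb n) y)" for y
    using arg_cong[OF blk_Rb[of d B n, OF d], of "\<lambda>T. blinfun_apply T y"] by simp
  show "blinfun_apply (Rb n) (blinfun_apply (blk d) (c *\<^sub>C x)) = blinfun_apply (Rb n) (c *\<^sub>C blinfun_apply (blk d) x)"
    by (simp add: R bounded_opsD[OF Rb_in] bounded_opsD[OF d_in])
qed

lemma blk_Ib: "blk d \<odot> Ib n = Ib n \<odot> d n"
proof (rule blocks_op_eqI)
  fix m
  have "Rb m \<odot> (blk d \<odot> Ib n) = d m \<odot> (Rb m \<odot> Ib n)"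
    by (simp add: comp_assoc[symmetric] blk_Rb[OF d])
  also have "\<dots> = Rb m \<odot> Ib n \<odot> d n" by (simp add: Rb_Ib comp_zero_left comp_zero_right)
  finally show "Rb m \<odot> (blk d \<odot> Ib n) = Rb m \<odot> (Ib n \<odot> d n)" by (simp add: comp_assoc)
qed

lemma blk_Pb: "blk d \<odot> Pb n = Pb n \<odot> blk d"
  by (simp add: Pb_def comp_assoc[symmetric] blk_Ib) (simp add: comp_assoc blk_Rb[OF d])

lemma blk_adj: "op_adj (blk d) = blk (\<lambda>n. op_adj (d n))"
proof (rule blocks_op_eqI)
  fix n
  have "Rb n \<odot> op_adj (blk d) = op_adj (blk d \<odot> Ib n)" by (simp add: op_adj_comp blk_in)
  also have "\<dots> = op_adj (d n) \<odot> Rb n" by (simp add: blk_Ib op_adj_comp d_in)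
  also have "\<dots> = Rb n \<odot> blk (\<lambda>n. op_adj (d n))" by (rule blk_Rb[symmetric, of _ B]) (simp add: d d_in)
  finally show "Rb n \<odot> op_adj (blk d) = Rb n \<odot> blk (\<lambda>n. op_adj (d n))" .
qed

end

lemma blk_comp:
  assumes d: "\<And>n. norm (d n) \<le> B" and d': "\<And>n. norm (d' n) \<le> B'"
  shows "blk d \<odot> blk d' = blk (\<lambda>n. d n \<odot> d' n)"
proof (rule blocks_op_eqI)
  fix n
  have B: "B \<ge> 0" using d[of 0] norm_ge_zero order_trans by blast
  have dd: "norm (d n \<odot> d' n) \<le> B * B'" for n
    using norm_blinfun_compose[of "d n" "d' n"] mult_mono[OF d[of n] d'[of n] B] by simp
  have "Rb n \<odot> (blk d \<odot> blk d') = (Rb n \<odot> blk d) \<odot> blk d'" by (simp add: comp_assoc)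
  also have "\<dots> = d n \<odot> (Rb n \<odot> blk d')" by (simp add: blk_Rb[OF d] comp_assoc)
  also have "\<dots> = Rb n \<odot> blk (\<lambda>n. d n \<odot> d' n)" by (simp add: blk_Rb[OF d'] blk_Rb[OF dd] comp_assoc)
  finally show "Rb n \<odot> (blk d \<odot> blk d') = Rb n \<odot> blk (\<lambda>n. d n \<odot> d' n)" .
qed

definition bl :: "nat \<Rightarrow> l2 op \<Rightarrow> l2 op" where "bl n X = Rb n \<odot> X \<odot> Ib n"

lemma bl_linear: "bl n (X + Y) = bl n X + bl n Y" "bl n (X - Y) = bl n X - bl n Y" "bl n (op_scale c X) = op_scale c (bl n X)"
  by (simp_all add: bl_def comp_add_left comp_add_right comp_diff_left comp_diff_right op_scale_comp_left op_scale_comp_right)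

lemma norm_bl_le: "norm (bl n X) \<le> norm X"
proof -
  have "norm (bl n X) \<le> norm (Rb n \<odot> X) * norm (Ib n)" unfolding bl_def by (rule norm_blinfun_compose)
  also have "\<dots> \<le> norm (Rb n \<odot> X) * 1" by (intro mult_left_mono norm_Ib_le) auto
  also have "\<dots> \<le> norm (Rb n) * norm X" using norm_blinfun_compose[of "Rb n" X] by simp
  also have "\<dots> \<le> 1 * norm X" by (intro mult_right_mono norm_Rb_le) auto
  finally show ?thesis by simp
qed

lemma bl_in [simp]: "X \<in> bounded_ops \<Longrightarrow> bl n X \<in> bounded_ops" by (simp add: bl_def)

lemma bl_adj: "X \<in> bounded_ops \<Longrightarrow> bl n (op_adj X) = op_adj (bl n X)"
  by (simp add: bl_def op_adj_comp comp_assoc)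

lemma bl_comp: assumes "Y \<odot> Pb n = Pb n \<odot> Y" shows "bl n (X \<odot> Y) = bl n X \<odot> bl n Y"
proof -
  have "bl n X \<odot> bl n Y = Rb n \<odot> X \<odot> (Pb n \<odot> Y) \<odot> Ib n" by (simp add: bl_def Pb_def comp_assoc)
  also have "\<dots> = Rb n \<odot> X \<odot> Y \<odot> (Pb n \<odot> Ib n)" by (simp add: assms[symmetric] comp_assoc)
  finally show ?thesis by (simp add: bl_def Pb_Ib comp_assoc)
qed

lemma bl_blk: assumes "\<And>n. norm (d n) \<le> B" shows "bl n (blk d) = d n"
proof -
  have "bl n (blk d) = d n \<odot> (Rb n \<odot> Ib n)" by (simp only: bl_def blk_Rb[OF assms] comp_assoc)
  then show ?thesis by (simp add: Rb_Ib)
qed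

lemma norm_Pb_block: assumes "X \<odot> Pb n = Pb n \<odot> X" shows "norm (X \<odot> Pb n) \<le> norm (bl n X)"
proof -
  have "X \<odot> Pb n = Pb n \<odot> X \<odot> Pb n" using assms by (simp add: Pb_def comp_assoc) (metis Pb_def Rb_Pb comp_assoc)
  also have "\<dots> = Ib n \<odot> bl n X \<odot> Rb n" by (simp add: bl_def Pb_def comp_assoc)
  finally have eq: "X \<odot> Pb n = Ib n \<odot> bl n X \<odot> Rb n" .
  have "norm (X \<odot> Pb n) \<le> norm (Ib n \<odot> bl n X) * norm (Rb n)" unfolding eq by (rule norm_blinfun_compose)
  also have "\<dots> \<le> norm (Ib n \<odot> bl n X) * 1" by (intro mult_left_mono norm_Rb_le) auto
  also have "\<dots> \<le> norm (Ib n) * norm (bl n X)" using norm_blinfun_compose[of "Ib n" "bl n X"] by simp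
  also have "\<dots> \<le> 1 * norm (bl n X)" by (intro mult_right_mono norm_Ib_le) auto
  finally show ?thesis by simp
qed

section \<open>Block diagonal operators with a strong limit along the ultrafilter\<close>

text \<open>\<open>X\<close> commutes with the projections onto the blocks, and its blocks converge to \<open>Z\<close> along \<open>\<omega>\<close> in the
  *-strong topology. Convergence of the adjoints is included because the adjoint is not strongly
  continuous.\<close>

definition conv :: "nat filter \<Rightarrow> l2 op \<Rightarrow> l2 op \<Rightarrow> bool" where
  "conv \<omega> X Z \<longleftrightarrow> X \<in> bounded_ops \<and> Z \<in> bounded_ops \<and> (\<forall>n. X \<odot> Pb n = Pb n \<odot> X) \<and>
     (\<forall>\<xi>. ((\<lambda>n. blinfun_apply (bl n X) \<xi>) \<longlongrightarrow> blinfun_apply Z \<xi>) \<omega>) \<and>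
     (\<forall>\<xi>. ((\<lambda>n. blinfun_apply (bl n (op_adj X)) \<xi>) \<longlongrightarrow> blinfun_apply (op_adj Z) \<xi>) \<omega>)"

lemma convD:
  assumes "conv \<omega> X Z"
  shows "X \<in> bounded_ops" "Z \<in> bounded_ops" "X \<odot> Pb n = Pb n \<odot> X"
    "((\<lambda>n. blinfun_apply (bl n X) \<xi>) \<longlongrightarrow> blinfun_apply Z \<xi>) \<omega>"
    "((\<lambda>n. blinfun_apply (bl n (op_adj X)) \<xi>) \<longlongrightarrow> blinfun_apply (op_adj Z) \<xi>) \<omega>"
  using assms by (auto simp: conv_def)

lemma conv_norm: assumes "free_ultrafilter \<omega>" "conv \<omega> X Z" shows "norm Z \<le> norm X"
proof (rule norm_blinfun_bound)
  fix \<xi>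
  show "norm (blinfun_apply Z \<xi>) \<le> norm X * norm \<xi>"
  proof (rule tendsto_upperbound[OF tendsto_norm[OF convD(4)[OF assms(2)]] always_eventually ultrafilter_nontrivial[OF assms(1)]], rule allI)
    show "norm (blinfun_apply (bl n X) \<xi>) \<le> norm X * norm \<xi>" for n
      using norm_blinfun[of "bl n X" \<xi>] mult_right_mono[OF norm_bl_le[of n X], of "norm \<xi>"] by simp
  qed
qed simp

lemma conv_add: assumes "conv \<omega> X Z" "conv \<omega> X' Z'" shows "conv \<omega> (X + X') (Z + Z')"
  using convD[OF assms(1)] convD[OF assms(2)]
  by (auto simp: conv_def comp_add_left comp_add_right op_adj_add bl_linear blinfun.add_left intro: tendsto_add)

lemma tendsto_scaleC: assumes "(f \<longlongrightarrow> (l::'a::chilbert_space)) F" shows "((\<lambda>n. c *\<^sub>C f n) \<longlongrightarrow> c *\<^sub>C l) F"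
proof -
  have "bounded_linear (\<lambda>x::'a. c *\<^sub>C x)"
    by (rule bounded_linear_intro[where K="cmod c"])
       (auto simp: scaleC_add_right scaleC_scaleR_commute norm_scaleC)
  from bounded_linear.tendsto[OF this assms] show ?thesis .
qed

lemma conv_scale: assumes "conv \<omega> X Z" shows "conv \<omega> (op_scale c X) (op_scale c Z)"
  using convD[OF assms]
  by (auto simp: conv_def op_scale_comp_left op_scale_comp_right op_adj_scale bl_linear op_scale_apply intro: tendsto_scaleC)

lemma conv_adj: assumes "conv \<omega> X Z" shows "conv \<omega> (op_adj X) (op_adj Z)"
proof -
  have "op_adj X \<odot> Pb n = Pb n \<odot> op_adj X" for n
    using arg_cong[OF convD(3)[OF assms, of n], of op_adj] convD(1)[OF assms] by (simp add: op_adj_comp)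
  then show ?thesis using convD[OF assms] by (auto simp: conv_def)
qed

lemma strong_comp:
  fixes S T :: "nat \<Rightarrow> l2 op"
  assumes S: "\<And>\<xi>. ((\<lambda>n. blinfun_apply (S n) \<xi>) \<longlongrightarrow> blinfun_apply S0 \<xi>) \<omega>" "\<And>n. norm (S n) \<le> B"
    and T: "((\<lambda>n. blinfun_apply (T n) \<xi>) \<longlongrightarrow> blinfun_apply T0 \<xi>) \<omega>"
  shows "((\<lambda>n. blinfun_apply (S n \<odot> T n) \<xi>) \<longlongrightarrow> blinfun_apply (S0 \<odot> T0) \<xi>) \<omega>"
proof -
  have "((\<lambda>n. blinfun_apply (S n) (blinfun_apply (T n) \<xi> - blinfun_apply T0 \<xi>)) \<longlongrightarrow> 0) \<omega>"
  proof (rule tendsto_norm_zero_cancel, rule tendsto_sandwich[OF _ _ tendsto_const])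
    have "((\<lambda>n. B * norm (blinfun_apply (T n) \<xi> - blinfun_apply T0 \<xi>)) \<longlongrightarrow> B * 0) \<omega>"
      by (intro tendsto_mult_left tendsto_norm_zero LIM_zero T)
    then show "((\<lambda>n. B * norm (blinfun_apply (T n) \<xi> - blinfun_apply T0 \<xi>)) \<longlongrightarrow> 0) \<omega>" by simp
    show "\<forall>\<^sub>F n in \<omega>. norm (blinfun_apply (S n) (blinfun_apply (T n) \<xi> - blinfun_apply T0 \<xi>))
        \<le> B * norm (blinfun_apply (T n) \<xi> - blinfun_apply T0 \<xi>)"
      by (intro always_eventually allI order_trans[OF norm_blinfun] mult_right_mono S(2)) auto
  qed auto
  from tendsto_add[OF this S(1)[of "blinfun_apply T0 \<xi>"]] show ?thesis
    by (simp add: blinfun.diff_right)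
qed

lemma conv_comp: assumes "conv \<omega> X Z" "conv \<omega> X' Z'" shows "conv \<omega> (X \<odot> X') (Z \<odot> Z')"
proof -
  note C = convD[OF assms(1)] and C' = convD[OF assms(2)]
  have 1: "bl n (X \<odot> X') = bl n X \<odot> bl n X'" for n by (rule bl_comp[OF C'(3)])
  have 2: "bl n (op_adj (X \<odot> X')) = bl n (op_adj X') \<odot> bl n (op_adj X)" for n
    unfolding bl_adj[OF bounded_ops_comp[OF C(1) C'(1)]] 1 bl_adj[OF C(1)] bl_adj[OF C'(1)]
    by (rule op_adj_comp) (simp_all add: C C')
  have "X \<odot> X' \<odot> Pb n = Pb n \<odot> (X \<odot> X')" for n by (metis C(3) C'(3) comp_assoc)
  moreover have "((\<lambda>n. blinfun_apply (bl n (X \<odot> X')) \<xi>) \<longlongrightarrow> blinfun_apply (Z \<odot> Z') \<xi>) \<omega>" for \<xi>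
    unfolding 1 by (rule strong_comp[OF C(4) norm_bl_le C'(4)])
  moreover have "((\<lambda>n. blinfun_apply (bl n (op_adj (X \<odot> X'))) \<xi>) \<longlongrightarrow> blinfun_apply (op_adj (Z \<odot> Z')) \<xi>) \<omega>" for \<xi>
    unfolding 2 op_adj_comp[OF C(2) C'(2)] by (rule strong_comp[OF C'(5) norm_bl_le C(5)])
  ultimately show ?thesis using C C' by (simp add: conv_def)
qed

lemma conv_unique:
  assumes "free_ultrafilter \<omega>" "conv \<omega> X Z" "conv \<omega> X Z'" shows "Z = Z'"
  by (rule blinfun_eqI, rule tendsto_unique[OF ultrafilter_nontrivial[OF assms(1)] convD(4)[OF assms(2)] convD(4)[OF assms(3)]])

lemma conv_diff: assumes "conv \<omega> X Z" "conv \<omega> X' Z'" shows "conv \<omega> (X - X') (Z - Z')"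
  using conv_add[OF assms(1) conv_scale[OF assms(2), of "-1"]] by (simp add: op_scale_minus1)

text \<open>The limit depends continuously on \<open>X\<close> by \<open>conv_norm\<close>, so that a norm limit of operators with strong limits
  has the limit of these as its own.\<close>

lemma conv_closed:
  assumes om: "free_ultrafilter \<omega>" and X: "\<And>i. conv \<omega> (X i) (Z i)" and lim: "X \<longlonglongrightarrow> Y"
  shows "\<exists>W. conv \<omega> Y W"
proof -
  have le: "norm (Z i - Z j) \<le> norm (X i - X j)" for i j by (rule conv_norm[OF om conv_diff[OF X X]])
  have "Cauchy X" using lim by (rule LIMSEQ_imp_Cauchy)
  have "Cauchy Z"
  proof (rule CauchyI)
    fix e :: real assume "e > 0"
    then obtain M where "\<forall>m\<ge>M. \<forall>n\<ge>M. norm (X m - X n) < e" using CauchyD[OF \<open>Cauchy X\<close>] by blast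
    then show "\<exists>M. \<forall>m\<ge>M. \<forall>n\<ge>M. norm (Z m - Z n) < e" using le le_less_trans by blast
  qed
  then obtain W where W: "Z \<longlonglongrightarrow> W" using Cauchy_convergent convergent_def by blast
  have Yb: "Y \<in> bounded_ops" by (rule closed_sequentially[OF closed_bounded_ops _ lim]) (rule convD(1)[OF X])
  have Wb: "W \<in> bounded_ops" by (rule closed_sequentially[OF closed_bounded_ops _ W]) (rule convD(2)[OF X])
  have strong: "((\<lambda>n. blinfun_apply (bl n Y) \<xi>) \<longlongrightarrow> blinfun_apply W \<xi>) \<omega>"
    if X: "\<And>i. ((\<lambda>n. blinfun_apply (bl n (X i)) \<xi>) \<longlongrightarrow> blinfun_apply (Z i) \<xi>) \<omega>"
      and "X \<longlonglongrightarrow> Y" "Z \<longlonglongrightarrow> W" for X Z :: "nat \<Rightarrow> l2 op" and Y W \<xi>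
  proof (rule tendstoI)
    fix e :: real assume e: "e > 0"
    have "(\<lambda>i. norm (Y - X i) * norm \<xi> + norm (Z i - W) * norm \<xi>) \<longlonglongrightarrow> norm (Y - Y) * norm \<xi> + norm (W - W) * norm \<xi>"
      by (intro tendsto_intros that)
    then have "eventually (\<lambda>i. norm (Y - X i) * norm \<xi> + norm (Z i - W) * norm \<xi> < e / 2) sequentially"
      using e by (intro order_tendstoD(2)) auto
    then obtain i where i: "norm (Y - X i) * norm \<xi> + norm (Z i - W) * norm \<xi> < e / 2"
      using eventually_happens' sequentially_bot by blast
    have "eventually (\<lambda>n. dist (blinfun_apply (bl n (X i)) \<xi>) (blinfun_apply (Z i) \<xi>) < e / 2) \<omega>"
      by (rule tendstoD[OF X]) (use e in auto)
    then show "eventually (\<lambda>n. dist (blinfun_apply (bl n Y) \<xi>) (blinfun_apply W \<xi>) < e) \<omega>"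
    proof eventually_elim
      fix n assume n: "dist (blinfun_apply (bl n (X i)) \<xi>) (blinfun_apply (Z i) \<xi>) < e / 2"
      have "norm (blinfun_apply (bl n (Y - X i)) \<xi>) \<le> norm (Y - X i) * norm \<xi>"
        using norm_blinfun[of "bl n (Y - X i)" \<xi>] mult_right_mono[OF norm_bl_le[of n "Y - X i"], of "norm \<xi>"] by simp
      moreover have "norm (blinfun_apply (Z i - W) \<xi>) \<le> norm (Z i - W) * norm \<xi>" by (rule norm_blinfun)
      moreover have eq: "blinfun_apply (bl n Y) \<xi> - blinfun_apply W \<xi> = blinfun_apply (bl n (Y - X i)) \<xi>
          + (blinfun_apply (bl n (X i)) \<xi> - blinfun_apply (Z i) \<xi>) + blinfun_apply (Z i - W) \<xi>"
        by (simp add: bl_linear blinfun.diff_left)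
      moreover have "norm (blinfun_apply (bl n (Y - X i)) \<xi>
          + (blinfun_apply (bl n (X i)) \<xi> - blinfun_apply (Z i) \<xi>) + blinfun_apply (Z i - W) \<xi>)
        \<le> norm (blinfun_apply (bl n (Y - X i)) \<xi>) + norm (blinfun_apply (bl n (X i)) \<xi> - blinfun_apply (Z i) \<xi>)
          + norm (blinfun_apply (Z i - W) \<xi>)" by (intro norm_triangle_le add_mono order_refl)
      ultimately show "dist (blinfun_apply (bl n Y) \<xi>) (blinfun_apply W \<xi>) < e"
        using n i unfolding dist_norm eq by linarith
    qed
  qed
  have "Y \<odot> Pb n = Pb n \<odot> Y" for n
  proof (rule LIMSEQ_unique)
    show "(\<lambda>i. X i \<odot> Pb n) \<longlonglongrightarrow> Y \<odot> Pb n"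
      by (rule bounded_linear.tendsto[OF bounded_bilinear.bounded_linear_left[OF bounded_bilinear_blinfun_compose] lim])
    show "(\<lambda>i. X i \<odot> Pb n) \<longlonglongrightarrow> Pb n \<odot> Y"
      unfolding convD(3)[OF X]
      by (rule bounded_linear.tendsto[OF bounded_bilinear.bounded_linear_right[OF bounded_bilinear_blinfun_compose] lim])
  qed
  moreover have "((\<lambda>n. blinfun_apply (bl n Y) \<xi>) \<longlongrightarrow> blinfun_apply W \<xi>) \<omega>" for \<xi>
    by (rule strong[OF convD(4)[OF X] lim W])
  moreover have "((\<lambda>n. blinfun_apply (bl n (op_adj Y)) \<xi>) \<longlongrightarrow> blinfun_apply (op_adj W) \<xi>) \<omega>" for \<xi>
    by (rule strong[OF convD(5)[OF X] tendsto_op_adj[OF lim convD(1)[OF X] Yb] tendsto_op_adj[OF W convD(2)[OF X] Wb]])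
  ultimately have "conv \<omega> Y W" using Yb Wb by (simp add: conv_def)
  then show ?thesis ..
qed

text \<open>A bounded sequence of operators on \<open>\<ell>\<^sup>2(\<nat>)\<close> has a weak limit along an ultrafilter. If the columns
  have uniformly finite support, the limit is a strong one.\<close>

lemma weak_limit:
  fixes d :: "nat \<Rightarrow> l2 op"
  assumes om: "free_ultrafilter \<omega>" and d: "\<And>n. d n \<in> bounded_ops" "\<And>n. norm (d n) \<le> B"
  shows "\<exists>Z\<in>bounded_ops. \<forall>\<xi> k. ((\<lambda>n. ell2_apply (blinfun_apply (d n) \<xi>) k) \<longlongrightarrow> ell2_apply (blinfun_apply Z \<xi>) k) \<omega>"
proof -
  note nb = ultrafilter_nontrivial[OF om]
  have B: "B \<ge> 0" using d(2)[of 0] norm_ge_zero order_trans by blast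
  have nd: "norm (blinfun_apply (d n) \<xi>) \<le> B * norm \<xi>" for n \<xi>
    using norm_blinfun[of "d n" \<xi>] mult_right_mono[OF d(2)[of n], of "norm \<xi>"] by simp
  have "\<exists>l. ((\<lambda>n. ell2_apply (blinfun_apply (d n) \<xi>) k) \<longlongrightarrow> l) \<omega>" for \<xi> k
  proof (rule ultrafilter_limit_bounded[OF om])
    show "bounded (range (\<lambda>n. ell2_apply (blinfun_apply (d n) \<xi>) k))"
    proof (rule boundedI[where B="B * norm \<xi>"])
      fix y assume "y \<in> range (\<lambda>n. ell2_apply (blinfun_apply (d n) \<xi>) k)"
      then obtain n where y: "y = ell2_apply (blinfun_apply (d n) \<xi>) k" by blast
      show "norm y \<le> B * norm \<xi>" unfolding y by (rule order_trans[OF norm_ell2_apply_le nd])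
    qed
  qed
  then obtain h where h: "\<And>\<xi> k. ((\<lambda>n. ell2_apply (blinfun_apply (d n) \<xi>) k) \<longlongrightarrow> h \<xi> k) \<omega>" by metis
  have bd: "(\<Sum>k\<in>F. (norm (h \<xi> k))\<^sup>2) \<le> (B * norm \<xi>)\<^sup>2" if F: "finite F" for F \<xi>
  proof (rule tendsto_upperbound[OF _ always_eventually nb])
    show "((\<lambda>n. \<Sum>k\<in>F. (norm (ell2_apply (blinfun_apply (d n) \<xi>) k))\<^sup>2) \<longlongrightarrow> (\<Sum>k\<in>F. (norm (h \<xi> k))\<^sup>2)) \<omega>"
      by (intro tendsto_intros h)
    show "\<forall>n. (\<Sum>k\<in>F. (norm (ell2_apply (blinfun_apply (d n) \<xi>) k))\<^sup>2) \<le> (B * norm \<xi>)\<^sup>2"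
      using order_trans[OF ell2_sum_le[OF F] power_mono[OF nd]] by auto
  qed
  define S :: "l2 \<Rightarrow> l2" where "S \<xi> = Abs_ell2 (h \<xi>)" for \<xi>
  have app: "ell2_apply (S \<xi>) k = h \<xi> k" for \<xi> k
    unfolding S_def using ell2_boundedI(1)[OF bd] B by (simp add: Abs_ell2_inverse)
  have nS: "norm (S \<xi>) \<le> B * norm \<xi>" for \<xi>
    unfolding S_def by (rule ell2_boundedI(2)[OF bd]) (use B in auto)
  have add: "h (x + y) k = h x k + h y k" for x y k
    by (rule tendsto_unique[OF nb h]) (simp add: blinfun.add_right ell2_simps tendsto_add h)
  have scC: "h (c *\<^sub>C x) k = c * h x k" for c x k
    by (rule tendsto_unique[OF nb h]) (simp add: bounded_opsD[OF d(1)] ell2_simps scaleC_complex_def tendsto_mult_left h)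
  have sc: "h (r *\<^sub>R x) k = r *\<^sub>R h x k" for r x k
    by (simp add: scaleR_scaleC scC scaleC_complex_def)
  have "bounded_linear S"
    by (rule bounded_linear_ell2I[where K=B]) (use nS in \<open>auto simp: app add sc mult.commute\<close>)
  then have eq: "blinfun_apply (Blinfun S) x = S x" for x by (simp add: bounded_linear_Blinfun_apply)
  show ?thesis
  proof (intro bexI[of _ "Blinfun S"] allI)
    show "((\<lambda>n. ell2_apply (blinfun_apply (d n) \<xi>) k) \<longlongrightarrow> ell2_apply (blinfun_apply (Blinfun S) \<xi>) k) \<omega>" for \<xi> k
      by (simp add: eq app h)
    show "Blinfun S \<in> bounded_ops"
      by (rule bounded_opsI, rule ell2_eqI) (simp add: eq app scC ell2_simps scaleC_complex_def)
  qed
qed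

lemma strong_on_finite_support:
  fixes x :: "nat \<Rightarrow> l2"
  assumes "\<And>k. ((\<lambda>n. ell2_apply (x n) k) \<longlongrightarrow> ell2_apply y k) \<omega>" "\<omega> \<noteq> bot"
    and "\<And>n k. k \<ge> M \<Longrightarrow> ell2_apply (x n) k = 0"
  shows "(x \<longlongrightarrow> y) \<omega>"
proof -
  have y0: "ell2_apply y k = 0" if "k \<ge> M" for k
    using assms(1)[of k] assms(3)[OF that] tendsto_unique[OF assms(2) _ tendsto_const] by fastforce
  have "(norm (x n - y))\<^sup>2 = (\<Sum>k<M. (norm (ell2_apply (x n) k - ell2_apply y k))\<^sup>2)" for n
    by (subst norm_fin_supp[of "{..<M}"]) (auto simp: ell2_simps y0 assms(3))
  moreover have "((\<lambda>n. \<Sum>k<M. (norm (ell2_apply (x n) k - ell2_apply y k))\<^sup>2) \<longlongrightarrow>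
      (\<Sum>k<M. (norm (ell2_apply y k - ell2_apply y k))\<^sup>2)) \<omega>"
    by (intro tendsto_intros assms(1))
  ultimately have "((\<lambda>n. (norm (x n - y))\<^sup>2) \<longlongrightarrow> 0) \<omega>" by simp
  then have "((\<lambda>n. sqrt ((norm (x n - y))\<^sup>2)) \<longlongrightarrow> sqrt 0) \<omega>" by (rule tendsto_real_sqrt)
  then have "((\<lambda>n. norm (x n - y)) \<longlongrightarrow> 0) \<omega>" by simp
  then show ?thesis by (rule LIM_zero_cancel[OF tendsto_norm_zero_cancel])
qed

lemma strong_limit:
  fixes d :: "nat \<Rightarrow> l2 op"
  assumes om: "free_ultrafilter \<omega>" and d: "\<And>n. d n \<in> bounded_ops" "\<And>n. norm (d n) \<le> B"
    and fin: "\<And>k. \<exists>M. \<forall>n z. \<forall>j\<ge>M. ell2_apply (blinfun_apply (d n) (blinfun_apply (sg k) z)) j = 0"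
  shows "\<exists>Z\<in>bounded_ops. \<forall>\<xi>. ((\<lambda>n. blinfun_apply (d n) \<xi>) \<longlongrightarrow> blinfun_apply Z \<xi>) \<omega>"
proof -
  obtain Z where Z: "Z \<in> bounded_ops" "\<And>\<xi> k. ((\<lambda>n. ell2_apply (blinfun_apply (d n) \<xi>) k) \<longlongrightarrow> ell2_apply (blinfun_apply Z \<xi>) k) \<omega>"
    using weak_limit[OF om, of d B] d by blast
  have B: "B \<ge> 0" using d(2)[of 0] norm_ge_zero order_trans by blast
  have sgl: "((\<lambda>n. blinfun_apply (d n) (blinfun_apply (sg k) z)) \<longlongrightarrow> blinfun_apply Z (blinfun_apply (sg k) z)) \<omega>" for k z
  proof -
    obtain M where "\<forall>n z. \<forall>j\<ge>M. ell2_apply (blinfun_apply (d n) (blinfun_apply (sg k) z)) j = 0" using fin by blast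
    then show ?thesis
      by (intro strong_on_finite_support[where M=M] Z(2) ultrafilter_nontrivial[OF om]) auto
  qed
  have trunc: "((\<lambda>n. blinfun_apply (d n) (trunc E \<xi>)) \<longlongrightarrow> blinfun_apply Z (trunc E \<xi>)) \<omega>" for E \<xi>
    unfolding trunc_def blinfun.sum_right by (intro tendsto_sum sgl)
  have "((\<lambda>n. blinfun_apply (d n) \<xi>) \<longlongrightarrow> blinfun_apply Z \<xi>) \<omega>" for \<xi>
  proof (rule tendstoI)
    fix e :: real assume e: "e > 0"
    define K where "K = B + norm Z + 1"
    have K: "K > 0" using B by (simp add: K_def add_nonneg_pos)
    obtain E where E: "finite E" "norm (\<xi> - trunc E \<xi>) < e / (2 * K)"
      using trunc_dense[of "e / (2 * K)" \<xi>] e K by auto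
    have "eventually (\<lambda>n. dist (blinfun_apply (d n) (trunc E \<xi>)) (blinfun_apply Z (trunc E \<xi>)) < e / 2) \<omega>"
      by (rule tendstoD[OF trunc]) (use e in auto)
    then show "eventually (\<lambda>n. dist (blinfun_apply (d n) \<xi>) (blinfun_apply Z \<xi>) < e) \<omega>"
    proof eventually_elim
      fix n assume n: "dist (blinfun_apply (d n) (trunc E \<xi>)) (blinfun_apply Z (trunc E \<xi>)) < e / 2"
      have "norm (blinfun_apply (d n - Z) (\<xi> - trunc E \<xi>)) \<le> norm (d n - Z) * norm (\<xi> - trunc E \<xi>)"
        by (rule norm_blinfun)
      also have "\<dots> \<le> K * (e / (2 * K))"
        using E(2) norm_triangle_ineq4[of "d n" Z] d(2)[of n] K by (intro mult_mono) (auto simp: K_def)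
      also have "\<dots> = e / 2" using K by simp
      finally have "norm (blinfun_apply (d n - Z) (\<xi> - trunc E \<xi>)) \<le> e / 2" .
      moreover have "blinfun_apply (d n) \<xi> - blinfun_apply Z \<xi> =
          (blinfun_apply (d n) (trunc E \<xi>) - blinfun_apply Z (trunc E \<xi>)) + blinfun_apply (d n - Z) (\<xi> - trunc E \<xi>)"
        by (simp add: blinfun.diff_left blinfun.diff_right)
      ultimately show "dist (blinfun_apply (d n) \<xi>) (blinfun_apply Z \<xi>) < e"
        using n norm_triangle_ineq[of "blinfun_apply (d n) (trunc E \<xi>) - blinfun_apply Z (trunc E \<xi>)" "blinfun_apply (d n - Z) (\<xi> - trunc E \<xi>)"]
        by (simp add: dist_norm)
    qed
  qed
  then show ?thesis using Z(1) by blast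
qed

lemma conv_blk:
  assumes om: "free_ultrafilter \<omega>" and d: "\<And>n. d n \<in> bounded_ops" "\<And>n. norm (d n) \<le> B"
    and fin: "\<And>k. \<exists>M. \<forall>n z. \<forall>j\<ge>M. ell2_apply (blinfun_apply (d n) (blinfun_apply (sg k) z)) j = 0"
    and fin': "\<And>k. \<exists>M. \<forall>n z. \<forall>j\<ge>M. ell2_apply (blinfun_apply (op_adj (d n)) (blinfun_apply (sg k) z)) j = 0"
  shows "\<exists>Z. conv \<omega> (blk d) Z"
proof -
  obtain Z where Z: "Z \<in> bounded_ops" "\<And>\<xi>. ((\<lambda>n. blinfun_apply (d n) \<xi>) \<longlongrightarrow> blinfun_apply Z \<xi>) \<omega>"
    using strong_limit[OF om, of d B] d fin by blast
  have "\<exists>Z\<in>bounded_ops. \<forall>\<xi>. ((\<lambda>n. blinfun_apply (op_adj (d n)) \<xi>) \<longlongrightarrow> blinfun_apply Z \<xi>) \<omega>"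
    by (rule strong_limit[OF om _ _ fin', where B=B]) (use d in auto)
  then obtain Z' where Z': "Z' \<in> bounded_ops" "\<And>\<xi>. ((\<lambda>n. blinfun_apply (op_adj (d n)) \<xi>) \<longlongrightarrow> blinfun_apply Z' \<xi>) \<omega>"
    by blast
  have "op_adj Z = Z'"
  proof (rule op_adjI)
    fix x y
    have "((\<lambda>n. cinner (blinfun_apply (d n) x) y) \<longlongrightarrow> cinner (blinfun_apply Z x) y) \<omega>"
      by (intro tendsto_cinner_left Z)
    moreover have "((\<lambda>n. cinner (blinfun_apply (d n) x) y) \<longlongrightarrow> cinner x (blinfun_apply Z' y)) \<omega>"
      unfolding op_adj_cinner[OF d(1)] by (intro tendsto_cinner_right Z')
    ultimately show "cinner (blinfun_apply Z x) y = cinner x (blinfun_apply Z' y)"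
      by (rule tendsto_unique[OF ultrafilter_nontrivial[OF om]])
  qed
  moreover have "bl n (blk d) = d n" for n by (rule bl_blk[OF d(2)])
  moreover have "bl n (op_adj (blk d)) = op_adj (d n)" for n
    unfolding blk_adj[OF d(2) d(1)] by (rule bl_blk[of _ B]) (simp add: d)
  ultimately have "conv \<omega> (blk d) Z"
    using Z Z' blk_in[OF d(2) d(1)] blk_Pb[OF d(2) d(1)] by (simp add: conv_def)
  then show ?thesis ..
qed

section \<open>Separable models of finitely many bounded sequences of operators\<close>

text \<open>Given sequences \<open>c i\<close> of operators, \<open>(i, False)\<close> stands for \<open>c i\<close> and \<open>(i, True)\<close> for its adjoint; a word is
  a product of such letters, and a code is a linear combination of words with coefficients in
  \<open>\<rat>(\<i>)\<close>. What matters is that these symbols are countable and do not depend on \<open>n\<close>.\<close>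

type_synonym word = "(nat \<times> bool) list"
type_synonym code = "((rat \<times> rat) \<times> (nat \<times> bool) list) list"

locale words =
  fixes c :: "nat \<Rightarrow> nat \<Rightarrow> 'h::chilbert_space op"
  assumes c_in: "c i n \<in> bounded_ops" and c_bound: "\<exists>B. \<forall>n. norm (c i n) \<le> B"
begin

definition letter :: "nat \<Rightarrow> nat \<times> bool \<Rightarrow> 'h op" where
  "letter n l = (if snd l then op_adj (c (fst l) n) else c (fst l) n)"

primrec wop :: "nat \<Rightarrow> word \<Rightarrow> 'h op" where
  "wop n [] = id_blinfun"
| "wop n (l # w) = letter n l \<odot> wop n w"

definition cval :: "rat \<times> rat \<Rightarrow> complex" where "cval z = Complex (of_rat (fst z)) (of_rat (snd z))"

definition cop :: "nat \<Rightarrow> code \<Rightarrow> 'h op" where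
  "cop n q = (\<Sum>p\<leftarrow>q. op_scale (cval (fst p)) (wop n (snd p)))"

lemma letter_in [simp]: "letter n l \<in> bounded_ops" by (simp add: letter_def c_in)

lemma wop_in [simp]: "wop n w \<in> bounded_ops" by (induction w) auto

lemma wop_bound: "\<exists>B. \<forall>n. norm (wop n w) \<le> B"
proof (induction w)
  case Nil
  have "norm (id_blinfun :: 'h op) \<le> 1" by (rule norm_blinfun_bound) auto
  then show ?case by auto
next
  case (Cons l w)
  then obtain B where B: "\<And>n. norm (wop n w) \<le> B" by blast
  obtain B' where B': "\<And>n. norm (c (fst l) n) \<le> B'" using c_bound by blast
  have l: "norm (letter n l) \<le> B'" for n by (simp add: letter_def B' c_in)
  have "B' \<ge> 0" using B'[of 0] norm_ge_zero order_trans by blast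
  then have "norm (wop n (l # w)) \<le> B' * B" for n
    using norm_blinfun_compose[of "letter n l" "wop n w"] mult_mono[OF l[of n] B[of n]] by simp
  then show ?case by blast
qed

lemma wop_append: "wop n (w @ w') = wop n w \<odot> wop n w'"
  by (induction w) (auto simp: comp_assoc)

lemma wop_adj: "op_adj (wop n w) = wop n (map (\<lambda>l. (fst l, \<not> snd l)) (rev w))"
  by (induction w) (auto simp: op_adj_comp wop_append letter_def c_in)

end

text \<open>The vectors \<open>xi n (Inl q)\<close> nearly norm the operator coded by \<open>q\<close>. The vectors \<open>xi n (Inr j)\<close> are arbitrary
  further ones that the compression has to retain.\<close>

locale words_vec = words c for c :: "nat \<Rightarrow> nat \<Rightarrow> 'h::chilbert_space op" +
  fixes \<omega> :: "nat filter" and xi :: "nat \<Rightarrow> code + nat \<Rightarrow> 'h"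
  assumes om: "free_ultrafilter \<omega>"
    and xi_norm: "norm (xi n (Inl q)) \<le> 1"
    and xi_near: "norm (cop n q) \<le> 2 * norm (blinfun_apply (cop n q) (xi n (Inl q)))"
begin

text \<open>All vectors \<open>w \<xi>\<close> in one sequence, by an enumeration that is the same for all \<open>n\<close>.\<close>

definition v :: "nat \<Rightarrow> nat \<Rightarrow> 'h" where
  "v n k = (case from_nat k :: word \<times> (code + nat) of (w, s) \<Rightarrow> blinfun_apply (wop n w) (xi n s))"

definition e :: "nat \<Rightarrow> nat \<Rightarrow> 'h" where "e n = gs (v n)"

lemma on: "ons (e n)" unfolding e_def by (rule ons_gs)

text \<open>Membership in the span of the first \<open>m\<close> vectors of the system.\<close>

definition fixp :: "nat \<Rightarrow> nat \<Rightarrow> 'h \<Rightarrow> bool" where "fixp n m x \<longleftrightarrow> proj (e n) m x = x"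

lemma fixp_mono: "fixp n m x \<Longrightarrow> m \<le> m' \<Longrightarrow> fixp n m' x"
  unfolding fixp_def by (rule proj_mono[OF on])

lemma fixp_linear: "fixp n m x \<Longrightarrow> fixp n m y \<Longrightarrow> fixp n m (x + y)" "fixp n m x \<Longrightarrow> fixp n m (a *\<^sub>C x)"
  "fixp n m x \<Longrightarrow> fixp n m (r *\<^sub>R x)" "fixp n m 0"
  by (simp_all add: fixp_def proj_linear)

lemma fixp_sum: "(\<And>i. i \<in> I \<Longrightarrow> fixp n m (f i)) \<Longrightarrow> fixp n m (sum f I)"
  by (induction I rule: infinite_finite_induct) (auto simp: fixp_linear)

lemma fixp_basis: "j < m \<Longrightarrow> fixp n m (e n j)"
  unfolding fixp_def by (rule proj_basis[OF on])

lemma fixp_v: "fixp n (Suc k) (v n k)"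
proof -
  have "fixp n (Suc k) (proj (e n) k (v n k) + norm (v n k - proj (e n) k (v n k)) *\<^sub>R e n k)"
    unfolding proj_def by (intro fixp_linear fixp_sum fixp_basis) auto
  then show ?thesis using gs_eq[of "v n" k] by (simp add: e_def)
qed

text \<open>The index to which multiplication by the letter \<open>l\<close> moves the vector with index \<open>k\<close>.\<close>

definition shift :: "nat \<times> bool \<Rightarrow> nat \<Rightarrow> nat" where
  "shift l k = (case from_nat k :: word \<times> (code + nat) of (w, s) \<Rightarrow> to_nat (l # w, s))"

lemma letter_v: "blinfun_apply (letter n l) (v n k) = v n (shift l k)"
  by (simp add: v_def shift_def split: prod.split)

definition width :: "nat \<times> bool \<Rightarrow> nat \<Rightarrow> nat" where "width l k = (\<Sum>j\<le>k. Suc (shift l j))"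

text \<open>A generator maps the \<open>k\<close>-th basis vector into the span of the first \<open>width l k\<close> ones, with a
  bound that does not depend on \<open>n\<close>. This is why the vectors are enumerated by words.\<close>

lemma letter_basis: "fixp n (width l k) (blinfun_apply (letter n l) (e n k))"
proof (induction k rule: less_induct)
  case (less k)
  have w: "width l j \<le> width l k" if "j < k" for j
    unfolding width_def using that by (intro sum_mono2) auto
  have "Suc (shift l k) \<le> width l k" unfolding width_def by (rule member_le_sum) auto
  then have 1: "fixp n (width l k) (blinfun_apply (letter n l) (v n k))"
    unfolding letter_v by (intro fixp_mono[OF fixp_v])
  have 2: "fixp n (width l k) (\<Sum>j<k. cinner (v n k) (e n j) *\<^sub>C blinfun_apply (letter n l) (e n j))"
    by (intro fixp_sum fixp_linear fixp_mono[OF less w]) auto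
  have "e n k = inverse (norm (v n k - proj (e n) k (v n k))) *\<^sub>R (v n k + (- 1) *\<^sub>R proj (e n) k (v n k))"
    using gs_residual[of "v n" k] by (simp add: e_def)
  then have "blinfun_apply (letter n l) (e n k) = inverse (norm (v n k - proj (e n) k (v n k))) *\<^sub>R
      (blinfun_apply (letter n l) (v n k) + (- 1) *\<^sub>R (\<Sum>j<k. cinner (v n k) (e n j) *\<^sub>C blinfun_apply (letter n l) (e n j)))"
    by (simp add: blinfun.bilinear_simps proj_def blinfun.sum_right bounded_opsD)
  then show ?case using fixp_linear(3)[OF fixp_linear(1)[OF 1 fixp_linear(3)[OF 2, of "- 1"]]] by simp
qed

lemma letter_fixp: assumes "fixp n m x" shows "fixp n (\<Sum>j<m. width l j) (blinfun_apply (letter n l) x)"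
proof -
  have "blinfun_apply (letter n l) (proj (e n) m x) = (\<Sum>j<m. cinner x (e n j) *\<^sub>C blinfun_apply (letter n l) (e n j))"
    by (simp add: proj_def blinfun.sum_right bounded_opsD)
  moreover have "width l j \<le> (\<Sum>j<m. width l j)" if "j < m" for j by (rule member_le_sum) (use that in auto)
  ultimately show ?thesis using assms
    by (simp add: fixp_def[of n m]) (intro fixp_sum fixp_linear fixp_mono[OF letter_basis], auto)
qed

primrec wwidth :: "word \<Rightarrow> nat \<Rightarrow> nat" where
  "wwidth [] m = m"
| "wwidth (l # w) m = (\<Sum>j<wwidth w m. width l j)"

lemma word_fixp: "fixp n m x \<Longrightarrow> fixp n (wwidth w m) (blinfun_apply (wop n w) x)"
  by (induction w) (auto simp: letter_fixp)

lemma word_basis: "fixp n (wwidth w (Suc k)) (blinfun_apply (wop n w) (a *\<^sub>C e n k))"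
  by (intro word_fixp fixp_linear fixp_basis) simp

lemma xi_fixp: "fixp n (Suc (to_nat ([] :: word, s))) (xi n s)"
  using fixp_v[of n "to_nat ([] :: word, s)"] by (simp add: v_def)

lemma cop_fixp: assumes "fixp n m x" shows "\<exists>m'. fixp n m' (blinfun_apply (cop n q) x)"
proof (induction q)
  case Nil then show ?case by (auto simp: cop_def fixp_linear intro: exI[of _ 0])
next
  case (Cons p q)
  then obtain m' where m': "fixp n m' (blinfun_apply (cop n q) x)" by blast
  have "fixp n (max (wwidth (snd p) m) m') (blinfun_apply (cop n (p # q)) x)"
    unfolding cop_def list.map sum_list.Cons blinfun.add_left op_scale_apply
    using m' by (intro fixp_linear fixp_mono[OF word_fixp[OF assms]]) (auto simp: cop_def intro: fixp_mono)
  then show ?case by blast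
qed

text \<open>The block diagonal operator on \<open>\<ell>\<^sup>2(\<nat>)\<close> that stands for the sequence of values of the word \<open>w\<close>. By
  \<open>word_basis\<close> the columns of its blocks have supports bounded uniformly in \<open>n\<close>, so that it has a strong
  limit (\<open>conv_G\<close>).\<close>

definition G :: "word \<Rightarrow> l2 op" where "G w = blk (\<lambda>n. compr (e n) (wop n w))"

lemma G_block_in: "compr (e n) (wop n w) \<in> bounded_ops" by (rule compr_bounded_ops[OF on wop_in])

lemma G_block_bound: "\<exists>B. \<forall>n. norm (compr (e n) (wop n w)) \<le> B"
  using wop_bound[of w] norm_compr_le[OF on] order_trans by blast

lemma bl_G: "bl n (G w) = compr (e n) (wop n w)"
proof -
  obtain B where B: "\<And>n. norm (compr (e n) (wop n w)) \<le> B" using G_block_bound by blast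
  show ?thesis unfolding G_def by (rule bl_blk[OF B])
qed

lemma G_comp: "G w \<odot> G w' = G (w @ w')"
proof -
  obtain B where B: "\<And>n. norm (compr (e n) (wop n w)) \<le> B" using G_block_bound by blast
  obtain B' where B': "\<And>n. norm (compr (e n) (wop n w')) \<le> B'" using G_block_bound by blast
  have "compr (e n) (wop n w) \<odot> compr (e n) (wop n w') = compr (e n) (wop n (w @ w'))" for n
    unfolding wop_append
    by (rule compr_comp[OF on]) (use word_basis[of n w' _ 1] in \<open>auto simp: fixp_def\<close>)
  then show ?thesis unfolding G_def blk_comp[OF B B'] by simp
qed

lemma G_adj: "op_adj (G w) = G (map (\<lambda>l. (fst l, \<not> snd l)) (rev w))"
proof -
  obtain B where B: "\<And>n. norm (compr (e n) (wop n w)) \<le> B" using G_block_bound by blast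
  show ?thesis unfolding G_def blk_adj[OF B G_block_in] compr_adj[OF on wop_in] wop_adj ..
qed

lemma G_Ib: "G w \<odot> Ib n = Ib n \<odot> compr (e n) (wop n w)"
proof -
  obtain B where B: "\<And>n. norm (compr (e n) (wop n w)) \<le> B" using G_block_bound by blast
  show ?thesis unfolding G_def by (rule blk_Ib[OF B G_block_in])
qed

lemma conv_G: "\<exists>Z. conv \<omega> (G w) Z"
proof -
  obtain B where B: "\<And>n. norm (compr (e n) (wop n w)) \<le> B" using G_block_bound by blast
  have fin: "\<exists>M. \<forall>n z. \<forall>j\<ge>M. ell2_apply (blinfun_apply (compr (e n) (wop n w)) (blinfun_apply (sg k) z)) j = 0" for w k
    using An_coordinate_vanishes[OF on word_basis[unfolded fixp_def]]
    by (intro exI[of _ "wwidth w (Suc k)"]) (auto simp: compr_apply[OF on] Sy_sg[OF on])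
  show ?thesis unfolding G_def
    by (rule conv_blk[OF om G_block_in B fin]) (use fin in \<open>simp add: compr_adj[OF on wop_in] wop_adj\<close>)
qed

definition D :: "l2 op set" where "D = closed_cspan (range G)"

lemma G_in_D: "G w \<in> D" unfolding D_def by (rule closed_cspan_base) simp

lemma G_bounded_ops: "G w \<in> bounded_ops" using conv_G[of w] convD(1) by blast

lemma D_concrete: "concrete_cstar D"
  unfolding D_def
proof (rule concrete_closed_cspan)
  show "range G \<subseteq> bounded_ops" using G_bounded_ops by blast
  show "S \<odot> T \<in> closed_cspan (range G)" if ST: "S \<in> range G" "T \<in> range G" for S T
    using ST by (auto simp: G_comp intro!: closed_cspan_base)
  show "op_adj T \<in> closed_cspan (range G)" if T: "T \<in> range G" for T
    using T by (auto simp: G_adj intro!: closed_cspan_base)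
qed

lemmas D_simps = concrete_cstarD[OF D_concrete]

lemma conv_zero: "conv \<omega> 0 0"
  using conv_scale[of \<omega> "G []" _ 0] conv_G[of "[]"] by auto

lemma conv_D: "X \<in> D \<Longrightarrow> \<exists>Z. conv \<omega> X Z"
proof -
  have "D \<subseteq> {X. \<exists>Z. conv \<omega> X Z}"
    unfolding D_def
  proof (rule closed_cspan_subset)
    show "range G \<subseteq> {X. \<exists>Z. conv \<omega> X Z}" using conv_G by blast
    show "closed {X. \<exists>Z. conv \<omega> X Z}"
      unfolding closed_sequential_limits
    proof (intro allI impI, elim conjE)
      fix x l assume x: "\<forall>i. x i \<in> {X. \<exists>Z. conv \<omega> X Z}" and l: "x \<longlonglongrightarrow> l"
      have "\<forall>i. \<exists>Z. conv \<omega> (x i) Z" using x by blast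
      then obtain Z where Z: "\<And>i. conv \<omega> (x i) (Z i)" by metis
      show "l \<in> {X. \<exists>Z. conv \<omega> X Z}" using conv_closed[OF om Z l] by simp
    qed
    show "subspace {X. \<exists>Z. conv \<omega> X Z}"
      unfolding subspace_def scaleR_op_scale using conv_zero conv_add conv_scale by blast
    show "op_scale c T \<in> {X. \<exists>Z. conv \<omega> X Z}" if T: "T \<in> range G" for c T
      using T conv_G conv_scale by blast
  qed
  then show "X \<in> D \<Longrightarrow> \<exists>Z. conv \<omega> X Z" by blast
qed

definition phi :: "l2 op \<Rightarrow> l2 op" where "phi X = (SOME Z. conv \<omega> X Z)"

lemma phi_conv: "X \<in> D \<Longrightarrow> conv \<omega> X (phi X)"
  unfolding phi_def by (rule someI_ex[OF conv_D])

lemma phi_eqI: "X \<in> D \<Longrightarrow> conv \<omega> X Z \<Longrightarrow> phi X = Z"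
  by (rule conv_unique[OF om phi_conv])

lemma phi_hom: "cstar_ops_hom D norm phi"
proof -
  interpret cstar_ops D norm by (rule cstar_ops_concrete[OF D_concrete])
  show ?thesis
    by unfold_locales
       (auto intro!: phi_eqI conv_add conv_scale conv_comp conv_adj phi_conv convD(2)[OF phi_conv])
qed

definition cq :: "code \<Rightarrow> l2 op" where
  "cq q = (\<Sum>p\<leftarrow>q. op_scale (cval (fst p)) (G (snd p)))"

lemma cq_D: "cq q \<in> D"
  by (induction q) (auto simp: cq_def D_simps(4,5,7) G_in_D)

lemma compr_linear: "compr (e n) (S + T) = compr (e n) S + compr (e n) T"
  "compr (e n) (op_scale a T) = op_scale a (compr (e n) T)" "compr (e n) 0 = 0"
  by (auto intro!: blinfun_eqI simp: compr_apply[OF on] blinfun.bilinear_simps op_scale_apply An_scaleC[OF on])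

lemma bl_cq: "bl n (cq q) = compr (e n) (cop n q)"
proof (induction q)
  case Nil
  have "bl n 0 = 0" using bl_linear(3)[of n 0 0] by simp
  then show ?case by (simp add: cq_def cop_def compr_linear)
next
  case (Cons p q)
  then show ?case by (simp add: cq_def cop_def bl_linear bl_G compr_linear)
qed

lemma rational_dense:
  fixes a :: complex
  assumes "\<epsilon> > 0" shows "\<exists>z. cmod (a - cval z) < \<epsilon>"
proof -
  have r: "\<exists>q. \<bar>x - real_of_rat q\<bar> < \<epsilon> / 2" for x
  proof -
    obtain q where "x - \<epsilon> / 2 < real_of_rat q" "real_of_rat q < x + \<epsilon> / 2"
      using of_rat_dense[of "x - \<epsilon> / 2" "x + \<epsilon> / 2"] assms by auto
    then show ?thesis by (intro exI[of _ q]) (simp only: abs_less_iff, linarith)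
  qed
  obtain p q where pq: "\<bar>Re a - real_of_rat p\<bar> < \<epsilon> / 2" "\<bar>Im a - real_of_rat q\<bar> < \<epsilon> / 2" using r by blast
  have "cmod (a - cval (p, q)) \<le> \<bar>Re a - real_of_rat p\<bar> + \<bar>Im a - real_of_rat q\<bar>"
    using cmod_le[of "a - cval (p, q)"] by (simp add: cval_def)
  then show ?thesis using pq by (intro exI[of _ "(p, q)"]) linarith
qed

lemma cq_dense: "X \<in> D \<Longrightarrow> \<epsilon> > 0 \<Longrightarrow> \<exists>q. norm (X - cq q) < \<epsilon>"
proof -
  let ?K = "closure (range cq)"
  have add: "x + y \<in> ?K" if xy: "x \<in> ?K" "y \<in> ?K" for x y
  proof -
    obtain a b where a: "\<And>n. a n \<in> range cq" "a \<longlonglongrightarrow> x" and b: "\<And>n. b n \<in> range cq" "b \<longlonglongrightarrow> y"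
      using closure_seqE[OF xy(1)] closure_seqE[OF xy(2)] by metis
    have "a n + b n \<in> range cq" for n
    proof -
      obtain p q where "a n = cq p" "b n = cq q" using a(1)[of n] b(1)[of n] by blast
      then have "a n + b n = cq (p @ q)" by (simp add: cq_def)
      then show ?thesis by simp
    qed
    then show ?thesis unfolding closure_sequential
      by (intro exI[of _ "\<lambda>n. a n + b n"] conjI allI tendsto_add[OF a(2) b(2)])
  qed
  have gen: "op_scale c (G w) \<in> ?K" for c w
    unfolding closure_approachable
  proof (intro allI impI)
    fix \<epsilon> :: real assume eps: "\<epsilon> > 0"
    then obtain z where z: "cmod (c - cval z) < \<epsilon> / (norm (G w) + 1)"
      using rational_dense[of "\<epsilon> / (norm (G w) + 1)" c] by (auto simp: add_nonneg_pos)
    have "cq [(z, w)] - op_scale c (G w) = op_scale (cval z + - c) (G w)"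
      unfolding op_scale_add_left using op_scale_scale[of "- 1" c "G w"] by (simp add: cq_def op_scale_minus1)
    then have "dist (cq [(z, w)]) (op_scale c (G w)) = cmod (c - cval z) * norm (G w)"
      by (simp add: dist_norm norm_op_scale norm_minus_commute)
    also have "\<dots> \<le> cmod (c - cval z) * (norm (G w) + 1)" by (intro mult_left_mono) auto
    also have "\<dots> < \<epsilon>" using z by (subst (asm) pos_less_divide_eq) (auto simp: add_nonneg_pos)
    finally show "\<exists>y\<in>range cq. dist y (op_scale c (G w)) < \<epsilon>" by blast
  qed
  have "x \<in> ?K" if "x \<in> span {op_scale c T |c T. T \<in> range G}" for x
    using that
  proof (induction rule: span_induct_alt)
    case base
    have "cq [] = 0" by (simp add: cq_def)
    then show ?case using closure_subset by (metis rangeI subsetD)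
  next
    case (step r x y)
    then obtain c w where "x = op_scale c (G w)" by blast
    then have "r *\<^sub>R x \<in> ?K" using gen by (simp add: scaleR_op_scale op_scale_scale)
    then show ?case using step add by blast
  qed
  then have "D \<subseteq> ?K" unfolding D_def closed_cspan_def by (intro closure_minimal) auto
  then show "X \<in> D \<Longrightarrow> \<epsilon> > 0 \<Longrightarrow> \<exists>q. norm (X - cq q) < \<epsilon>"
    unfolding closure_approachable[of X] dist_norm subset_iff closure_approachable
    by (metis norm_minus_commute rangeE)
qed

text \<open>The blocks of \<open>cq q\<close> nearly attain their norms on the compressions of \<open>xi n (Inl q)\<close>. These are
  supported on a fixed finite set of coordinates, so they have a limit \<open>y\<close> in norm, and \<open>phi (cq q)\<close> applied
  to \<open>y\<close> is the limit of the norming values.\<close>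

lemma cq_norm_limit: assumes eps: "\<epsilon> > 0" shows "eventually (\<lambda>n. norm (bl n (cq q)) \<le> 2 * norm (phi (cq q)) + \<epsilon>) \<omega>"
proof -
  define s where "s = (Inl q :: code + nat)"
  define M where "M = Suc (to_nat ([] :: word, s))"
  define u where "u n = blinfun_apply (An (e n)) (xi n s)" for n
  have fx: "proj (e n) M (xi n s) = xi n s" for n using xi_fixp[of n s] by (simp add: fixp_def M_def)
  have nu: "norm (u n) \<le> 1" for n using norm_An_fixed[OF on fx, of n] xi_norm[of n q] by (simp add: u_def s_def)
  have uv: "ell2_apply (u n) k = 0" if "k \<ge> M" for n k
    unfolding u_def by (rule An_coordinate_vanishes[OF on fx that])
  have "\<exists>l. ((\<lambda>n. ell2_apply (u n) k) \<longlongrightarrow> l) \<omega>" for k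
  proof (rule ultrafilter_limit_bounded[OF om], rule boundedI[where B=1])
    show "norm x \<le> 1" if "x \<in> range (\<lambda>n. ell2_apply (u n) k)" for x
      using that order_trans[OF norm_ell2_apply_le nu] by blast
  qed
  then obtain l where l: "\<And>k. ((\<lambda>n. ell2_apply (u n) k) \<longlongrightarrow> l k) \<omega>" by metis
  define y :: l2 where "y = (\<Sum>k<M. blinfun_apply (sg k) (l k))"
  have ul: "(u \<longlongrightarrow> y) \<omega>"
  proof (rule strong_on_finite_support[OF _ ultrafilter_nontrivial[OF om] uv])
    fix k
    have "l k = ell2_apply y k"
    proof (cases "k < M")
      case True then show ?thesis by (simp add: y_def ell2_apply_sum sg_apply)
    next
      case False
      then have "(\<lambda>n. ell2_apply (u n) k) = (\<lambda>_. 0)" using uv by auto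
      then have "l k = 0" using l[of k] tendsto_unique[OF ultrafilter_nontrivial[OF om] _ tendsto_const] by fastforce
      then show ?thesis using False by (auto simp: y_def ell2_apply_sum sg_apply intro!: sum.neutral[symmetric])
    qed
    then show "((\<lambda>n. ell2_apply (u n) k) \<longlongrightarrow> ell2_apply y k) \<omega>" using l[of k] by simp
  qed
  have ny: "norm y \<le> 1"
    by (rule tendsto_upperbound[OF tendsto_norm[OF ul] _ ultrafilter_nontrivial[OF om]]) (use nu in auto)
  have key: "norm (bl n (cq q)) \<le> 2 * norm (blinfun_apply (bl n (cq q)) (u n))" for n
  proof -
    obtain m where m: "proj (e n) m (blinfun_apply (cop n q) (xi n s)) = blinfun_apply (cop n q) (xi n s)"
      using cop_fixp[OF xi_fixp[of n s], of q] by (auto simp: fixp_def)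
    have "blinfun_apply (bl n (cq q)) (u n) = blinfun_apply (An (e n)) (blinfun_apply (cop n q) (xi n s))"
      by (simp add: bl_cq compr_apply[OF on] u_def Sy_An_fixed[OF on fx])
    then have "norm (blinfun_apply (bl n (cq q)) (u n)) = norm (blinfun_apply (cop n q) (xi n s))"
      by (simp add: norm_An_fixed[OF on m])
    moreover have "norm (bl n (cq q)) \<le> norm (cop n q)" unfolding bl_cq by (rule norm_compr_le[OF on])
    ultimately show ?thesis using xi_near[of n q] by (simp add: s_def)
  qed
  have lim: "((\<lambda>n. blinfun_apply (bl n (cq q)) (u n)) \<longlongrightarrow> blinfun_apply (phi (cq q)) y) \<omega>"
  proof -
    have "((\<lambda>n. blinfun_apply (bl n (cq q)) (u n - y)) \<longlongrightarrow> 0) \<omega>"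
    proof (rule tendsto_norm_zero_cancel, rule tendsto_sandwich[OF _ _ tendsto_const])
      have "((\<lambda>n. norm (cq q) * norm (u n - y)) \<longlongrightarrow> norm (cq q) * 0) \<omega>"
        by (intro tendsto_mult_left tendsto_norm_zero LIM_zero ul)
      then show "((\<lambda>n. norm (cq q) * norm (u n - y)) \<longlongrightarrow> 0) \<omega>" by simp
      show "\<forall>\<^sub>F n in \<omega>. norm (blinfun_apply (bl n (cq q)) (u n - y)) \<le> norm (cq q) * norm (u n - y)"
        by (intro always_eventually allI order_trans[OF norm_blinfun] mult_right_mono norm_bl_le) auto
    qed auto
    from tendsto_add[OF this convD(4)[OF phi_conv[OF cq_D[of q]], of y]] show ?thesis
      by (simp add: blinfun.diff_right)
  qed
  have "norm (blinfun_apply (phi (cq q)) y) \<le> norm (phi (cq q)) * 1"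
    by (rule order_trans[OF norm_blinfun]) (intro mult_left_mono ny norm_ge_zero)
  then have "eventually (\<lambda>n. norm (blinfun_apply (bl n (cq q)) (u n)) < norm (phi (cq q)) + \<epsilon> / 2) \<omega>"
    using eps by (intro order_tendstoD(2)[OF tendsto_norm[OF lim]]) auto
  then show ?thesis by eventually_elim (use key in \<open>smt (verit) field_sum_of_halves\<close>)
qed

text \<open>Strong convergence to \<open>0\<close> does not make norms small in general. It does on \<open>D\<close>, because \<open>cq_norm_limit\<close>
  controls a dense subset.\<close>

lemma kernel_vanishes:
  assumes j: "j \<in> D" "phi j = 0" and eps: "\<epsilon> > 0"
  shows "eventually (\<lambda>n. norm (bl n j) < \<epsilon>) \<omega>"
proof -
  obtain q where q: "norm (j - cq q) < \<epsilon> / 8" using cq_dense[OF j(1), of "\<epsilon> / 8"] eps by auto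
  have "norm (phi j - phi (cq q)) \<le> norm (j - cq q)"
    by (rule conv_norm[OF om conv_diff[OF phi_conv[OF j(1)] phi_conv[OF cq_D]]])
  then have ph: "norm (phi (cq q)) < \<epsilon> / 8" using q j by simp
  have "eventually (\<lambda>n. norm (bl n (cq q)) \<le> 2 * norm (phi (cq q)) + \<epsilon> / 8) \<omega>"
    by (rule cq_norm_limit) (use eps in simp)
  then show ?thesis
  proof eventually_elim
    fix n assume n: "norm (bl n (cq q)) \<le> 2 * norm (phi (cq q)) + \<epsilon> / 8"
    have "bl n j = bl n (j - cq q) + bl n (cq q)" by (simp add: bl_linear)
    then have "norm (bl n j) \<le> norm (bl n (j - cq q)) + norm (bl n (cq q))" by (metis norm_triangle_ineq)
    then show "norm (bl n j) < \<epsilon>" using norm_bl_le[of n "j - cq q"] q n ph eps by linarith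
  qed
qed

end

section \<open>Exactness and uniform norm bounds\<close>

lemma norm_amp_Pb_le: "norm (amp (Pb n) :: ('i, l2) ell2 op) \<le> 1"
proof -
  have "norm (amp (Pb n) :: ('i, l2) ell2 op) \<le> norm (Pb n)" by (rule norm_amp_le)
  also have "\<dots> \<le> norm (Ib n) * norm (Rb n)" unfolding Pb_def by (rule norm_blinfun_compose)
  also have "\<dots> \<le> 1 * 1" by (intro mult_mono norm_Ib_le norm_Rb_le) auto
  finally show ?thesis by simp
qed

context words_vec
begin

text \<open>For an elementary tensor \<open>j \<otimes> b\<close> this is \<open>kernel_vanishes\<close>, and the property is preserved by sums and norm limits.\<close>

lemma min_tensor_vanishes:
  fixes T :: "('i, complex) ell2 op set"
  assumes T: "T \<subseteq> bounded_ops" and Y: "Y \<in> min_tensor {x \<in> D. phi x = 0} T" and eps: "\<epsilon> > 0"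
  shows "eventually (\<lambda>n. norm (Y \<odot> amp (Pb n)) < \<epsilon>) \<omega>"
proof -
  define N where "N = {Y :: ('i, l2) ell2 op. \<forall>\<epsilon>>0. eventually (\<lambda>n. norm (Y \<odot> amp (Pb n)) < \<epsilon>) \<omega>}"
  have add: "X + Y \<in> N" if XY: "X \<in> N" "Y \<in> N" for X Y
    unfolding N_def
  proof (intro CollectI allI impI)
    fix \<epsilon> :: real assume eps: "\<epsilon> > 0"
    have "\<And>\<epsilon>. \<epsilon> > 0 \<Longrightarrow> eventually (\<lambda>n. norm (X \<odot> amp (Pb n)) < \<epsilon>) \<omega>"
      "\<And>\<epsilon>. \<epsilon> > 0 \<Longrightarrow> eventually (\<lambda>n. norm (Y \<odot> amp (Pb n)) < \<epsilon>) \<omega>"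
      using XY unfolding N_def by blast+
    from this(1)[OF half_gt_zero[OF eps]] this(2)[OF half_gt_zero[OF eps]] show "eventually (\<lambda>n. norm ((X + Y) \<odot> amp (Pb n)) < \<epsilon>) \<omega>"
    proof eventually_elim
      case (elim n)
      then show ?case
        using norm_triangle_ineq[of "X \<odot> amp (Pb n)" "Y \<odot> amp (Pb n)"] by (simp add: comp_add_left)
    qed
  qed
  have scale: "op_scale c X \<in> N" if X: "X \<in> N" for c X
    unfolding N_def
  proof (intro CollectI allI impI)
    fix \<epsilon> :: real assume eps: "\<epsilon> > 0"
    have pos: "cmod c + 1 > 0" by (simp add: add_nonneg_pos)
    have "eventually (\<lambda>n. norm (X \<odot> amp (Pb n)) < \<epsilon> / (cmod c + 1)) \<omega>"
      using X pos eps unfolding N_def by simp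
    then show "eventually (\<lambda>n. norm (op_scale c X \<odot> amp (Pb n)) < \<epsilon>) \<omega>"
    proof eventually_elim
      case (elim n)
      have "norm (op_scale c X \<odot> amp (Pb n)) = cmod c * norm (X \<odot> amp (Pb n))"
        by (simp add: op_scale_comp_left norm_op_scale)
      also have "\<dots> \<le> (cmod c + 1) * norm (X \<odot> amp (Pb n))" by (intro mult_right_mono) auto
      also have "\<dots> < \<epsilon>" using elim pos by (simp add: pos_less_divide_eq mult.commute)
      finally show ?case .
    qed
  qed
  have zero: "0 \<in> N" by (simp add: N_def comp_zero_left)
  have sub: "subspace N" unfolding subspace_def scaleR_op_scale using add scale zero by blast
  have cl: "closed N"
    unfolding closed_sequential_limits
  proof (intro allI impI, elim conjE)
    fix x l assume x: "\<forall>i. x i \<in> N" and l: "x \<longlonglongrightarrow> l"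
    show "l \<in> N" unfolding N_def
    proof (intro CollectI allI impI)
      fix \<epsilon> :: real assume eps: "\<epsilon> > 0"
      obtain i where i: "norm (x i - l) < \<epsilon> / 2" using LIMSEQ_D[OF l, of "\<epsilon> / 2"] eps by auto
      have "\<And>\<epsilon>. \<epsilon> > 0 \<Longrightarrow> eventually (\<lambda>n. norm (x i \<odot> amp (Pb n)) < \<epsilon>) \<omega>" using x unfolding N_def by blast
      from this[OF half_gt_zero[OF eps]] show "eventually (\<lambda>n. norm (l \<odot> amp (Pb n)) < \<epsilon>) \<omega>"
      proof eventually_elim
        case (elim n)
        have "norm ((l - x i) \<odot> amp (Pb n)) \<le> norm (l - x i) * norm (amp (Pb n) :: ('i, l2) ell2 op)" by (rule norm_blinfun_compose)
        also have "\<dots> \<le> norm (l - x i) * 1" by (intro mult_left_mono norm_amp_Pb_le) auto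
        finally have "norm ((l - x i) \<odot> amp (Pb n)) < \<epsilon> / 2" using i by (simp add: norm_minus_commute)
        then show ?case
          using elim norm_triangle_ineq[of "(l - x i) \<odot> amp (Pb n)" "x i \<odot> amp (Pb n)"] by (simp add: comp_diff_left)
      qed
    qed
  qed
  have gen: "tensor_op j b \<in> N" if jb: "j \<in> D" "phi j = 0" "b \<in> T" for j b
    unfolding N_def
  proof (intro CollectI allI impI)
    fix \<epsilon> :: real assume eps: "\<epsilon> > 0"
    have jb': "j \<in> bounded_ops" "b \<in> bounded_ops" using jb D_simps(10) T by auto
    have pos: "norm b + 1 > 0" by (simp add: add_nonneg_pos)
    have "eventually (\<lambda>n. norm (bl n j) < \<epsilon> / (norm b + 1)) \<omega>"
      by (rule kernel_vanishes[OF jb(1,2)]) (use eps pos in simp)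
    then show "eventually (\<lambda>n. norm (tensor_op j b \<odot> amp (Pb n)) < \<epsilon>) \<omega>"
    proof eventually_elim
      case (elim n)
      have "tensor_op j b \<odot> amp (Pb n) = amp j \<odot> (ramp b \<odot> amp (Pb n))" using jb' by (simp add: tensor_op_eq comp_assoc)
      also have "\<dots> = amp (j \<odot> Pb n) \<odot> ramp b" using jb' by (simp add: amp_ramp_commute[symmetric] amp_comp comp_assoc)
      finally have "norm (tensor_op j b \<odot> amp (Pb n)) \<le> norm (amp (j \<odot> Pb n) :: ('i, l2) ell2 op) * norm (ramp b :: ('i, l2) ell2 op)"
        by (simp add: norm_blinfun_compose)
      also have "\<dots> \<le> norm (bl n j) * (norm b + 1)"
      proof (rule mult_mono)
        show "norm (amp (j \<odot> Pb n) :: ('i, l2) ell2 op) \<le> norm (bl n j)"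
          using norm_Pb_block[OF convD(3)[OF phi_conv[OF jb(1)]]] norm_amp_le order_trans by blast
        show "norm (ramp b :: ('i, l2) ell2 op) \<le> norm b + 1" using norm_ramp_le[of b, where ?'j=nat] by simp
      qed auto
      also have "\<dots> < \<epsilon>" using elim pos by (simp add: pos_less_divide_eq)
      finally show ?case .
    qed
  qed
  have "min_tensor {x \<in> D. phi x = 0} T \<subseteq> N"
    unfolding min_tensor_def by (rule closed_cspan_subset[OF _ cl sub]) (use gen scale in auto)
  then show ?thesis using Y eps unfolding N_def by blast
qed

end

text \<open>The operator \<open>\<Sum> a\<^sub>i \<otimes> \<lambda>\<^sub>i\<close> with \<open>\<lambda>\<^sub>i\<close> the translation by \<open>s i\<close>; it acts by convolution.\<close>

definition conv_op :: "nat \<Rightarrow> (nat \<Rightarrow> 'h::chilbert_space op) \<Rightarrow> (nat \<Rightarrow> 'g::group_add) \<Rightarrow> ('g, 'h) ell2 op" where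
  "conv_op k a s = (\<Sum>i<k. amp (a i) \<odot> left_reg (s i))"

lemma conv_op_apply:
  "ell2_apply (blinfun_apply (conv_op k a s) x) g = (\<Sum>i<k. blinfun_apply (a i) (ell2_apply x (- s i + g)))"
  by (simp add: conv_op_def blinfun.sum_left ell2_apply_sum amp_apply left_reg_apply)

lemma norm_conv_op_finite:
  fixes s :: "nat \<Rightarrow> 'g::group_add" and k :: nat
  assumes "finite E" "\<And>g. g \<notin> E \<Longrightarrow> ell2_apply x g = 0"
  defines "F \<equiv> E \<union> (\<Union>i<k. (\<lambda>h. s i + h) ` E)"
  shows "finite F" "(norm (blinfun_apply (conv_op k a s) x))\<^sup>2 = (\<Sum>g\<in>F. (norm (ell2_apply (blinfun_apply (conv_op k a s) x) g))\<^sup>2)"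
    "g \<notin> F \<Longrightarrow> ell2_apply (blinfun_apply (conv_op k a s) x) g = 0"
proof -
  show fin: "finite F" using assms by (simp add: F_def)
  have zero: "ell2_apply (blinfun_apply (conv_op k a s) x) g = 0" if g: "g \<notin> F" for g
    unfolding conv_op_apply
  proof (rule sum.neutral, rule ballI)
    fix i assume i: "i \<in> {..<k}"
    have "- s i + g \<notin> E"
    proof
      assume "- s i + g \<in> E"
      then have "s i + (- s i + g) \<in> F" using i unfolding F_def by blast
      then show False using g by (simp add: add.assoc[symmetric])
    qed
    then show "blinfun_apply (a i) (ell2_apply x (- s i + g)) = 0" using assms(2) by simp
  qed
  then show "g \<notin> F \<Longrightarrow> ell2_apply (blinfun_apply (conv_op k a s) x) g = 0" .
  show "(norm (blinfun_apply (conv_op k a s) x))\<^sup>2 = (\<Sum>g\<in>F. (norm (ell2_apply (blinfun_apply (conv_op k a s) x) g))\<^sup>2)"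
    by (rule norm_fin_supp[OF fin zero])
qed

lemma ell2_norm_eq_pointwise: "(\<And>i. norm (ell2_apply x i) = norm (ell2_apply y i)) \<Longrightarrow> norm x = norm y"
proof -
  assume "\<And>i. norm (ell2_apply x i) = norm (ell2_apply y i)"
  then have "(norm x)\<^sup>2 = (norm y)\<^sup>2" unfolding norm_ell2_sq by simp
  then show ?thesis by (simp add: power2_eq_iff_nonneg)
qed

lemma near_norming: "\<exists>x. norm x \<le> 1 \<and> norm T \<le> 2 * norm (blinfun_apply T x)" for T :: "'a::real_normed_vector \<Rightarrow>\<^sub>L 'b::real_normed_vector"
proof (rule ccontr)
  assume "\<not> ?thesis"
  then have small: "norm x \<le> 1 \<Longrightarrow> norm (blinfun_apply T x) < norm T / 2" for x by force
  have "norm T \<le> norm T / 2"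
  proof (rule norm_blinfun_bound)
    fix x
    show "norm (blinfun_apply T x) \<le> norm T / 2 * norm x"
    proof (cases "x = 0")
      case False
      have "norm (blinfun_apply T (x /\<^sub>R norm x)) < norm T / 2" by (rule small) (use False in simp)
      then show ?thesis using False by (simp add: blinfun.scaleR_right field_simps)
    qed simp
  qed simp
  then have "norm T = 0" by simp
  then show False using small[of 0] by simp
qed

lemma near_norming_trunc:
  fixes T :: "('i, 'h::chilbert_space) ell2 op"
  shows "\<exists>E x. finite E \<and> norm (trunc E x) \<le> 1 \<and> norm T \<le> 2 * norm (blinfun_apply T (trunc E x))"
proof (rule ccontr)
  assume contra: "\<not> ?thesis"
  then have small: "2 * norm (blinfun_apply T (trunc E x)) < norm T" if "finite E" "norm (trunc E x) \<le> 1" for E :: "'i set" and x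
    using that by force
  have cutR: "trunc E (r *\<^sub>R x) = r *\<^sub>R trunc E x" if "finite E" for E :: "'i set" and r and x :: "('i, 'h) ell2"
    by (rule ell2_eqI) (simp add: trunc_apply[OF that] ell2_simps)
  have "norm T \<le> norm T / 2"
  proof (rule blinfun_bound_by_trunc)
    fix E :: "'i set" and x :: "('i, 'h) ell2" assume E: "finite E"
    show "norm (blinfun_apply T (trunc E x)) \<le> norm T / 2 * norm (trunc E x)"
    proof (cases "trunc E x = 0")
      case False
      have "2 * norm (blinfun_apply T (trunc E (x /\<^sub>R norm (trunc E x)))) < norm T"
        by (rule small[OF E]) (use False in \<open>simp add: cutR[OF E]\<close>)
      then show ?thesis using False by (simp add: cutR[OF E] blinfun.scaleR_right field_simps)
    qed simp
  qed simp
  then have "norm T = 0" by simp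
  moreover have "trunc {} (0 :: ('i, 'h) ell2) = 0" by (simp add: trunc_def)
  ultimately show False using small[of "{}" 0] by simp
qed

text \<open>The operators \<open>\<Sum> c\<^sub>i(n) \<otimes> \<lambda>\<^sub>i\<close> nearly attain their norms on vectors \<open>\<zeta> n\<close> of finite supports \<open>E n\<close>, which may
  grow with \<open>n\<close>. The coordinates of \<open>\<zeta> n\<close> are put among the vectors that the compression retains.\<close>

locale words_exact = words_vec c \<omega> xi
  for c :: "nat \<Rightarrow> nat \<Rightarrow> 'h::chilbert_space op" and \<omega> xi +
  fixes s :: "nat \<Rightarrow> 'g::group_add" and k :: nat and K :: real
    and E :: "nat \<Rightarrow> 'g set" and \<zeta> :: "nat \<Rightarrow> ('g, 'h) ell2"
  assumes exact: "exact_group TYPE('g)" and K: "K \<ge> 0"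
    and bound: "\<And>F. finite F \<Longrightarrow> eventually (\<lambda>n. \<forall>x. norm (blinfun_apply (conv_op k (\<lambda>i. c i n) s) (trunc F x)) \<le> K * norm (trunc F x)) \<omega>"
    and E: "finite (E n)" and zeta_norm: "norm (trunc (E n) (\<zeta> n)) \<le> 1"
    and zeta_near: "norm (conv_op k (\<lambda>i. c i n) s) \<le> 2 * norm (blinfun_apply (conv_op k (\<lambda>i. c i n) s) (trunc (E n) (\<zeta> n)))"
    and zeta_xi: "g \<in> E n \<Longrightarrow> \<exists>j. xi n (Inr j) = ell2_apply (\<zeta> n) g"
begin

abbreviation "X n \<equiv> conv_op k (\<lambda>i. c i n) s"
abbreviation "a i \<equiv> G [(i, False)]"

lemma wop_single: "wop n [(i, False)] = c i n" by (simp add: letter_def)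

definition W :: "('g, l2) ell2 op" where "W = conv_op k a s"

lemma tensor_conv_op: "(\<And>i. i < k \<Longrightarrow> d i \<in> bounded_ops) \<Longrightarrow> (\<Sum>i<k. tensor_op (d i) (left_reg (s i))) = conv_op k d s"
  for d :: "nat \<Rightarrow> l2 op"
  unfolding conv_op_def by (rule sum.cong) (simp_all add: tensor_op_eq ramp_left_reg)

text \<open>On vectors of fixed finite support, the limit operator inherits the bound from the operators
  \<open>X n\<close>.\<close>

lemma limit_bound: "norm (conv_op k (\<lambda>i. phi (a i)) s) \<le> K"
proof (rule blinfun_bound_by_trunc[OF _ K])
  fix F :: "'g set" and x :: "('g, l2) ell2" assume F: "finite F"
  define y where "y = trunc F x"
  have y0: "ell2_apply y g = 0" if "g \<notin> F" for g using that by (simp add: y_def trunc_apply[OF F])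
  define F' where "F' = F \<union> (\<Union>i<k. (\<lambda>h. s i + h) ` F)"
  note fin = norm_conv_op_finite[where k=k and s=s, OF F y0, folded F'_def]
  have lim: "((\<lambda>n. \<Sum>g\<in>F'. (norm (\<Sum>i<k. blinfun_apply (bl n (a i)) (ell2_apply y (- s i + g))))\<^sup>2)
      \<longlongrightarrow> (\<Sum>g\<in>F'. (norm (\<Sum>i<k. blinfun_apply (phi (a i)) (ell2_apply y (- s i + g))))\<^sup>2)) \<omega>"
    by (intro tendsto_intros tendsto_sum convD(4)[OF phi_conv[OF G_in_D]])
  define z where "z n = (\<Sum>h\<in>F. blinfun_apply (sg h) (blinfun_apply (Sy (e n)) (ell2_apply y h)))" for n
  have z: "ell2_apply (z n) h = blinfun_apply (Sy (e n)) (ell2_apply y h)" for n h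
    using F y0 by (simp add: z_def ell2_apply_sum sg_apply if_distrib cong: if_cong)
  have zc: "z n = trunc F (z n)" for n by (rule ell2_eqI) (simp add: trunc_apply[OF F] z y0)
  have nz: "norm (z n) \<le> norm y" for n
    using ell2_norm_le_pointwise[of "z n" 1 y] norm_blinfun_le1[OF norm_Sy_le[OF on]] by (simp add: z)
  have "eventually (\<lambda>n. (\<Sum>g\<in>F'. (norm (\<Sum>i<k. blinfun_apply (bl n (a i)) (ell2_apply y (- s i + g))))\<^sup>2) \<le> (K * norm y)\<^sup>2) \<omega>"
    using bound[OF F]
  proof eventually_elim
    case (elim n)
    have "(\<Sum>i<k. blinfun_apply (bl n (a i)) (ell2_apply y (- s i + g))) = blinfun_apply (An (e n)) (ell2_apply (blinfun_apply (X n) (z n)) g)" for g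
      by (simp add: bl_G compr_apply[OF on] conv_op_apply z blinfun.sum_right letter_def)
    then have "(\<Sum>g\<in>F'. (norm (\<Sum>i<k. blinfun_apply (bl n (a i)) (ell2_apply y (- s i + g))))\<^sup>2)
        \<le> (\<Sum>g\<in>F'. (norm (ell2_apply (blinfun_apply (X n) (z n)) g))\<^sup>2)"
      by (simp) (intro sum_mono power_mono norm_blinfun_le1 norm_An_le[OF on], simp)
    also have "\<dots> \<le> (norm (blinfun_apply (X n) (z n)))\<^sup>2" by (rule ell2_sum_le[OF fin(1)])
    also have "\<dots> \<le> (K * norm y)\<^sup>2"
    proof (rule power_mono)
      have "norm (blinfun_apply (X n) (z n)) \<le> K * norm (z n)" using elim zc[of n] by metis
      also have "\<dots> \<le> K * norm y" by (intro mult_left_mono nz K)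
      finally show "norm (blinfun_apply (X n) (z n)) \<le> K * norm y" .
    qed simp
    finally show ?case .
  qed
  then have "(\<Sum>g\<in>F'. (norm (\<Sum>i<k. blinfun_apply (phi (a i)) (ell2_apply y (- s i + g))))\<^sup>2) \<le> (K * norm y)\<^sup>2"
    by (rule tendsto_upperbound[OF lim _ ultrafilter_nontrivial[OF om]])
  moreover have "(norm (blinfun_apply (conv_op k (\<lambda>i. phi (a i)) s) y))\<^sup>2
      = (\<Sum>g\<in>F'. (norm (\<Sum>i<k. blinfun_apply (phi (a i)) (ell2_apply y (- s i + g))))\<^sup>2)"
    unfolding conv_op_apply[symmetric] by (rule fin(2))
  ultimately have "(norm (blinfun_apply (conv_op k (\<lambda>i. phi (a i)) s) y))\<^sup>2 \<le> (K * norm y)\<^sup>2" by simp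
  then have "norm (blinfun_apply (conv_op k (\<lambda>i. phi (a i)) s) y) \<le> K * norm y"
    by (rule power2_le_imp_le) (simp add: K)
  then show "norm (blinfun_apply (conv_op k (\<lambda>i. phi (a i)) s) (trunc F x)) \<le> K * norm (trunc F x)" by (simp add: y_def)
qed

text \<open>The compressions lose nothing on the nearly norming vectors, whose entries were put into the
  enumeration.\<close>

lemma block_lower_bound: "norm (X n) \<le> 2 * norm (W \<odot> amp (Pb n))"
proof -
  define y where "y = trunc (E n) (\<zeta> n)"
  have fixy: "\<exists>m. fixp n m (ell2_apply y g)" for g
  proof (cases "g \<in> E n")
    case True
    then obtain j where "xi n (Inr j) = ell2_apply y g" using zeta_xi by (auto simp: y_def trunc_apply[OF E])
    then show ?thesis using xi_fixp[of n "Inr j"] by auto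
  next
    case False
    then show ?thesis using fixp_linear(4) by (auto simp: y_def trunc_apply[OF E])
  qed
  have SA: "blinfun_apply (Sy (e n)) (blinfun_apply (An (e n)) (ell2_apply y g)) = ell2_apply y g" for g
    using fixy[of g] Sy_An_fixed[OF on] by (auto simp: fixp_def)
  have Inorm: "norm (blinfun_apply (Ib n) x) = norm x" for x
  proof -
    have "blinfun_apply (Rb n) (blinfun_apply (Ib n) x) = x"
      using arg_cong[OF Rb_Ib[of n n], of "\<lambda>T. blinfun_apply T x"] by simp
    then show ?thesis using norm_blinfun_le1[OF norm_Ib_le, of n x] norm_blinfun_le1[OF norm_Rb_le, of n "blinfun_apply (Ib n) x"] by simp
  qed
  define \<eta> where "\<eta> = (\<Sum>g\<in>E n. blinfun_apply (sg g) (blinfun_apply (Ib n) (blinfun_apply (An (e n)) (ell2_apply y g))))"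
  have eta: "ell2_apply \<eta> g = blinfun_apply (Ib n) (blinfun_apply (An (e n)) (ell2_apply y g))" for g
    using E[of n] by (simp add: \<eta>_def ell2_apply_sum sg_apply y_def trunc_apply[OF E] if_distrib cong: if_cong)
  have neta: "norm \<eta> \<le> 1"
    using ell2_norm_le_pointwise[of \<eta> 1 y] norm_blinfun_le1[OF norm_An_le[OF on]] zeta_norm[of n]
    by (simp add: eta Inorm y_def)
  have P: "blinfun_apply (amp (Pb n)) \<eta> = \<eta>"
  proof (rule ell2_eqI)
    fix g
    show "ell2_apply (blinfun_apply (amp (Pb n)) \<eta>) g = ell2_apply \<eta> g"
      using arg_cong[OF Pb_Ib[of n], of "\<lambda>T. blinfun_apply T (blinfun_apply (An (e n)) (ell2_apply y g))"]
      by (simp add: amp_apply eta)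
  qed
  have "norm (blinfun_apply W \<eta>) = norm (blinfun_apply (X n) y)"
  proof (rule ell2_norm_eq_pointwise)
    fix g
    have GI: "blinfun_apply (a i) (blinfun_apply (Ib n) x) = blinfun_apply (Ib n) (blinfun_apply (compr (e n) (c i n)) x)" for i x
      using arg_cong[OF G_Ib[of "[(i, False)]" n], of "\<lambda>T. blinfun_apply T x"] unfolding wop_single by simp
    have eq: "ell2_apply (blinfun_apply W \<eta>) g = blinfun_apply (Ib n) (blinfun_apply (An (e n)) (ell2_apply (blinfun_apply (X n) y) g))"
      by (simp add: W_def conv_op_apply eta GI compr_apply[OF on] SA blinfun.sum_right)
    have "\<exists>m. fixp n m (ell2_apply (blinfun_apply (X n) y) g)"
    proof -
      have "\<exists>m. fixp n m (blinfun_apply (c i n) (ell2_apply y h))" for i h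
        using fixy[of h] word_fixp[of n _ "ell2_apply y h" "[(i, False)]"] unfolding wop_single by blast
      then obtain m where m: "\<And>i h. fixp n (m i h) (blinfun_apply (c i n) (ell2_apply y h))" by metis
      have "fixp n (\<Sum>i<k. m i (- s i + g)) (ell2_apply (blinfun_apply (X n) y) g)"
        unfolding conv_op_apply
      proof (rule fixp_sum)
        fix i assume i: "i \<in> {..<k}"
        have "m i (- s i + g) \<le> (\<Sum>i<k. m i (- s i + g))" by (rule member_le_sum) (use i in auto)
        then show "fixp n (\<Sum>i<k. m i (- s i + g)) (blinfun_apply (c i n) (ell2_apply y (- s i + g)))"
          by (rule fixp_mono[OF m])
      qed
      then show ?thesis ..
    qed
    then show "norm (ell2_apply (blinfun_apply W \<eta>) g) = norm (ell2_apply (blinfun_apply (X n) y) g)"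
      unfolding eq Inorm using norm_An_fixed[OF on] by (auto simp: fixp_def)
  qed
  moreover have "norm (blinfun_apply W \<eta>) \<le> norm (W \<odot> amp (Pb n)) * norm \<eta>"
    using norm_blinfun[of "W \<odot> amp (Pb n)" \<eta>] by (simp add: P)
  moreover have "norm (W \<odot> amp (Pb n)) * norm \<eta> \<le> norm (W \<odot> amp (Pb n)) * 1"
    by (intro mult_left_mono neta) auto
  ultimately show ?thesis using zeta_near[of n] by (simp add: y_def)
qed

text \<open>The operator \<open>W\<close> that combines all \<open>X n\<close> as its blocks equals some \<open>y\<close> of norm at most \<open>800 K\<close> modulo
  \<open>J \<otimes> C*\<^sub>r(\<Gamma>)\<close>. On the \<open>n\<close>-th block the difference tends to \<open>0\<close>. The lower bound for the blocks of \<open>W\<close> costs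
  another factor \<open>2\<close>.\<close>

lemma uniform_bound: assumes eps: "\<epsilon> > 0" shows "eventually (\<lambda>n. norm (X n) \<le> 1600 * K + \<epsilon>) \<omega>"
proof -
  define T where "T = (reduced_group_cstar :: ('g, complex) ell2 op set)"
  have T: "concrete_cstar T" unfolding T_def by (rule reduced_group_concrete)
  have ex: "exact_cstar T" using exact by (simp add: exact_group_def T_def)
  have phin: "phi (a i) \<in> bounded_ops" for i by (rule convD(2)[OF phi_conv[OF G_in_D]])
  obtain y where y: "(\<Sum>i<k. tensor_op (a i) (left_reg (s i))) - y \<in> min_tensor {x \<in> D. phi x = 0} T"
    "norm y \<le> 800 * norm (\<Sum>i<k. tensor_op (phi (a i)) (left_reg (s i)))"
    using exact_norm_lift[OF ex T D_concrete phi_hom, of k a "\<lambda>i. left_reg (s i)"]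
    by (auto simp: G_in_D T_def left_reg_in_reduced)
  have Wy: "W - y \<in> min_tensor {x \<in> D. phi x = 0} T"
    using y(1) by (simp add: tensor_conv_op G_bounded_ops W_def)
  have ny: "norm y \<le> 800 * K" using y(2) limit_bound by (simp add: tensor_conv_op phin)
  have "eventually (\<lambda>n. norm ((W - y) \<odot> amp (Pb n)) < \<epsilon> / 2) \<omega>"
    by (rule min_tensor_vanishes[OF concrete_cstarD(1)[OF T] Wy]) (use eps in simp)
  then show ?thesis
  proof eventually_elim
    case (elim n)
    have "norm (y \<odot> amp (Pb n)) \<le> norm y * norm (amp (Pb n) :: ('g, l2) ell2 op)" by (rule norm_blinfun_compose)
    also have "\<dots> \<le> norm y * 1" by (intro mult_left_mono norm_amp_Pb_le) auto
    finally have "norm (y \<odot> amp (Pb n)) \<le> norm y * 1" .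
    moreover have "W \<odot> amp (Pb n) = (W - y) \<odot> amp (Pb n) + y \<odot> amp (Pb n)" by (simp add: comp_diff_left)
    then have "norm (W \<odot> amp (Pb n)) \<le> norm ((W - y) \<odot> amp (Pb n)) + norm (y \<odot> amp (Pb n))" by (metis norm_triangle_ineq)
    ultimately show ?case using elim ny block_lower_bound[of n] by linarith
  qed
qed

end

text \<open>Exactness upgrades bounds on vectors of fixed finite support, which hold only from some index on
  that depends on the support, to bounds of the operator norms.\<close>

theorem exactness_uniform:
  fixes c :: "nat \<Rightarrow> nat \<Rightarrow> 'h::chilbert_space op" and s :: "nat \<Rightarrow> 'g::group_add"
  assumes om: "free_ultrafilter \<omega>" and exact: "exact_group TYPE('g)"
    and c: "\<And>i n. c i n \<in> bounded_ops" "\<And>i. \<exists>B. \<forall>n. norm (c i n) \<le> B" and K: "K \<ge> 0"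
    and bound: "\<And>F. finite F \<Longrightarrow> eventually (\<lambda>n. \<forall>x. norm (blinfun_apply (conv_op k (\<lambda>i. c i n) s) (trunc F x)) \<le> K * norm (trunc F x)) \<omega>"
    and eps: "\<epsilon> > 0"
  shows "eventually (\<lambda>n. norm (conv_op k (\<lambda>i. c i n) s) \<le> 1600 * K + \<epsilon>) \<omega>"
proof -
  interpret words c by unfold_locales (rule c)+
  have "\<forall>n. \<exists>E x. finite E \<and> norm (trunc E x) \<le> 1 \<and>
      norm (conv_op k (\<lambda>i. c i n) s) \<le> 2 * norm (blinfun_apply (conv_op k (\<lambda>i. c i n) s) (trunc E x))"
    by (intro allI near_norming_trunc)
  then obtain E \<zeta> where E: "\<And>n. finite (E n)" "\<And>n. norm (trunc (E n) (\<zeta> n)) \<le> 1"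
    "\<And>n. norm (conv_op k (\<lambda>i. c i n) s) \<le> 2 * norm (blinfun_apply (conv_op k (\<lambda>i. c i n) s) (trunc (E n) (\<zeta> n)))"
    by metis
  have "\<forall>n q. \<exists>x. norm x \<le> 1 \<and> norm (cop n q) \<le> 2 * norm (blinfun_apply (cop n q) x)"
    by (intro allI near_norming)
  then obtain x where x: "\<And>n q. norm (x n q) \<le> 1" "\<And>n q. norm (cop n q) \<le> 2 * norm (blinfun_apply (cop n q) (x n q))"
    by metis
  define xi where "xi n t = (case t of Inl q \<Rightarrow> x n q | Inr j \<Rightarrow> ell2_apply (\<zeta> n) (from_nat_into (E n) j))" for n and t :: "code + nat"
  interpret words_exact c \<omega> xi s k K E \<zeta>
  proof
    show "\<exists>j. xi n (Inr j) = ell2_apply (\<zeta> n) g" if g: "g \<in> E n" for g n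
      using from_nat_into_surj[OF countable_finite[OF E(1)] g] by (auto simp: xi_def)
  qed (use om exact K bound E x in \<open>auto simp: xi_def\<close>)
  show ?thesis by (rule uniform_bound[OF eps])
qed

section \<open>Extending densely defined bounded *-homomorphisms\<close>

text \<open>A *-homomorphism on a dense *-algebra of operators is handled through its graph \<open>R\<close>. A bound
  makes the closure of the graph the graph of a function; completeness of the target makes it
  everywhere defined.\<close>

locale bounded_graph = V: cstar_algebra V for V :: "'v cstar" +
  fixes R :: "('h::chilbert_space op \<times> 'v) set" and M :: real
  assumes R_in: "(x, u) \<in> R \<Longrightarrow> x \<in> bounded_ops" "(x, u) \<in> R \<Longrightarrow> u \<in> cs_carrier V"
    and R_zero: "(0, cs_zero V) \<in> R"
    and R_add: "(x, u) \<in> R \<Longrightarrow> (y, v) \<in> R \<Longrightarrow> (x + y, cs_add V u v) \<in> R"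
    and R_scale: "(x, u) \<in> R \<Longrightarrow> (op_scale c x, cs_scale V c u) \<in> R"
    and R_mult: "(x, u) \<in> R \<Longrightarrow> (y, v) \<in> R \<Longrightarrow> (x \<odot> y, cs_mult V u v) \<in> R"
    and R_star: "(x, u) \<in> R \<Longrightarrow> (op_adj x, cs_star V u) \<in> R"
    and R_bound: "(x, u) \<in> R \<Longrightarrow> cs_norm V u \<le> M * norm x"
begin

lemma R_dst: assumes "(x, u) \<in> R" "(y, v) \<in> R" shows "V.dst u v \<le> M * norm (x - y)"
proof -
  have "(x - y, cs_diff V u v) \<in> R"
    using R_add[OF assms(1) R_scale[OF assms(2), of "- 1"]] by (simp add: cs_diff_def op_scale_minus1)
  then show ?thesis unfolding V.dst_def by (rule R_bound)
qed

definition closed_graph :: "'h op \<Rightarrow> 'v \<Rightarrow> bool" where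
  "closed_graph x u \<longleftrightarrow> u \<in> cs_carrier V \<and>
     (\<exists>X W. (\<forall>n. (X n, W n) \<in> R) \<and> X \<longlonglongrightarrow> x \<and> (\<lambda>n. V.dst u (W n)) \<longlonglongrightarrow> 0)"

lemma closed_graphI:
  "u \<in> cs_carrier V \<Longrightarrow> (\<And>n. (X n, W n) \<in> R) \<Longrightarrow> X \<longlonglongrightarrow> x \<Longrightarrow> (\<lambda>n. V.dst u (W n)) \<longlonglongrightarrow> 0 \<Longrightarrow> closed_graph x u"
  unfolding closed_graph_def by blast

lemma closed_graphE:
  assumes "closed_graph x u"
  obtains X W where "u \<in> cs_carrier V" "\<And>n. (X n, W n) \<in> R" "X \<longlonglongrightarrow> x" "(\<lambda>n. V.dst u (W n)) \<longlonglongrightarrow> 0"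
    "\<And>n. W n \<in> cs_carrier V" "\<And>n. X n \<in> bounded_ops"
  using assms R_in unfolding closed_graph_def by blast

lemma closed_graph_base: "(x, u) \<in> R \<Longrightarrow> closed_graph x u"
  by (rule closed_graphI[of u "\<lambda>_. x" "\<lambda>_. u"]) (auto simp: R_in V.dst_self)

lemma null_sandwich:
  "(\<And>n. 0 \<le> f n) \<Longrightarrow> (\<And>n. f n \<le> g n) \<Longrightarrow> g \<longlonglongrightarrow> 0 \<Longrightarrow> f \<longlonglongrightarrow> (0::real)"
  by (rule tendsto_sandwich[OF _ _ tendsto_const]) auto

lemma closed_graph_unique: assumes "closed_graph x u" "closed_graph x v" shows "u = v"
proof -
  from assms(1) obtain X W where u: "u \<in> cs_carrier V" "\<And>n. (X n, W n) \<in> R" "X \<longlonglongrightarrow> x"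
    "(\<lambda>n. V.dst u (W n)) \<longlonglongrightarrow> 0" "\<And>n. W n \<in> cs_carrier V"
    by (rule closed_graphE) (rule that, assumption+)
  from assms(2) obtain Y Z where v: "v \<in> cs_carrier V" "\<And>n. (Y n, Z n) \<in> R" "Y \<longlonglongrightarrow> x"
    "(\<lambda>n. V.dst v (Z n)) \<longlonglongrightarrow> 0" "\<And>n. Z n \<in> cs_carrier V"
    by (rule closed_graphE) (rule that, assumption+)
  have "(\<lambda>n. V.dst u (W n) + (M * norm (X n - Y n) + V.dst v (Z n))) \<longlonglongrightarrow> 0 + (M * norm (x - x) + 0)"
    by (intro tendsto_intros u v)
  moreover have le: "V.dst u v \<le> V.dst u (W n) + (M * norm (X n - Y n) + V.dst v (Z n))" for n
    using V.dst_triangle[OF u(1) u(5)[of n] v(1)] V.dst_triangle[OF u(5)[of n] v(5)[of n] v(1)]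
      R_dst[OF u(2) v(2), of n n] V.dst_commute[OF v(1) v(5)[of n]] by linarith
  ultimately have "V.dst u v \<le> 0 + (M * norm (x - x) + 0)"
    by (intro LIMSEQ_le_const) auto
  then show ?thesis using V.dst_nonneg[OF u(1) v(1)] V.dst_eq_0[OF u(1) v(1)] by simp
qed

lemma closed_graph_total: assumes "x \<in> closure (fst ` R)" shows "\<exists>u. closed_graph x u"
proof -
  obtain X where X: "\<And>n. X n \<in> fst ` R" "X \<longlonglongrightarrow> x" by (rule closure_seqE[OF assms]) (rule that, assumption+)
  have "\<forall>n. \<exists>w. (X n, w) \<in> R" using X(1) by force
  then obtain W where W: "\<And>n. (X n, W n) \<in> R" by metis
  have pos: "\<bar>M\<bar> + 1 > 0" by simp
  have "\<exists>u\<in>cs_carrier V. (\<lambda>n. cs_norm V (cs_diff V (W n) u)) \<longlonglongrightarrow> 0"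
  proof (rule V.complete[OF R_in(2)[OF W]], intro allI impI)
    fix e :: real assume "e > 0"
    then have "e / (\<bar>M\<bar> + 1) > 0" using pos by simp
    from CauchyD[OF LIMSEQ_imp_Cauchy[OF X(2)] this]
    obtain N where N: "\<And>m n. m \<ge> N \<Longrightarrow> n \<ge> N \<Longrightarrow> norm (X m - X n) < e / (\<bar>M\<bar> + 1)" by blast
    have "cs_norm V (cs_diff V (W m) (W n)) < e" if mn: "m \<ge> N" "n \<ge> N" for m n
    proof -
      have "cs_norm V (cs_diff V (W m) (W n)) \<le> M * norm (X m - X n)"
        using R_dst[OF W W] by (simp add: V.dst_def)
      also have "\<dots> \<le> (\<bar>M\<bar> + 1) * norm (X m - X n)" by (intro mult_right_mono) auto
      also have "\<dots> < e" using N[OF mn] pos by (simp add: pos_less_divide_eq mult.commute)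
      finally show ?thesis .
    qed
    then show "\<exists>N. \<forall>m\<ge>N. \<forall>n\<ge>N. cs_norm V (cs_diff V (W m) (W n)) < e" by blast
  qed
  then obtain u where u: "u \<in> cs_carrier V" "(\<lambda>n. V.dst (W n) u) \<longlonglongrightarrow> 0" unfolding V.dst_def by blast
  have "V.dst u (W n) = V.dst (W n) u" for n by (rule V.dst_commute[OF u(1) R_in(2)[OF W]])
  then have "closed_graph x u" using u by (intro closed_graphI[OF u(1) W X(2)]) simp
  then show ?thesis ..
qed

lemma closed_graph_add: assumes "closed_graph x u" "closed_graph y v" shows "closed_graph (x + y) (cs_add V u v)"
proof -
  from assms(1) obtain X W where u: "u \<in> cs_carrier V" "\<And>n. (X n, W n) \<in> R" "X \<longlonglongrightarrow> x"
    "(\<lambda>n. V.dst u (W n)) \<longlonglongrightarrow> 0" "\<And>n. W n \<in> cs_carrier V"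
    by (rule closed_graphE) (rule that, assumption+)
  from assms(2) obtain Y Z where v: "v \<in> cs_carrier V" "\<And>n. (Y n, Z n) \<in> R" "Y \<longlonglongrightarrow> y"
    "(\<lambda>n. V.dst v (Z n)) \<longlonglongrightarrow> 0" "\<And>n. Z n \<in> cs_carrier V"
    by (rule closed_graphE) (rule that, assumption+)
  have lim: "(\<lambda>n. V.dst u (W n) + V.dst v (Z n)) \<longlonglongrightarrow> 0"
    using tendsto_add[OF u(4) v(4)] by simp
  show ?thesis
  proof (rule closed_graphI[OF V.add_closed[OF u(1) v(1)] R_add[OF u(2) v(2)] tendsto_add[OF u(3) v(3)]])
    show "(\<lambda>n. V.dst (cs_add V u v) (cs_add V (W n) (Z n))) \<longlonglongrightarrow> 0"
      by (rule null_sandwich[OF V.dst_nonneg V.dst_add lim]) (simp_all add: V.add_closed u v)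
  qed
qed

lemma closed_graph_scale: assumes "closed_graph x u" shows "closed_graph (op_scale c x) (cs_scale V c u)"
proof -
  from assms(1) obtain X W where u: "u \<in> cs_carrier V" "\<And>n. (X n, W n) \<in> R" "X \<longlonglongrightarrow> x"
    "(\<lambda>n. V.dst u (W n)) \<longlonglongrightarrow> 0" "\<And>n. W n \<in> cs_carrier V"
    by (rule closed_graphE) (rule that, assumption+)
  have "(\<lambda>n. cmod c * V.dst u (W n)) \<longlonglongrightarrow> cmod c * 0" by (intro tendsto_intros u)
  then show ?thesis
    by (intro closed_graphI[OF V.scale_closed[OF u(1)] R_scale[OF u(2)] bounded_linear.tendsto[OF bounded_linear_op_scale u(3)]])
      (simp add: V.dst_scale u)
qed

lemma closed_graph_star: assumes "closed_graph x u" shows "closed_graph (op_adj x) (cs_star V u)"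
proof -
  from assms(1) obtain X W where u: "u \<in> cs_carrier V" "\<And>n. (X n, W n) \<in> R" "X \<longlonglongrightarrow> x"
    "(\<lambda>n. V.dst u (W n)) \<longlonglongrightarrow> 0" "\<And>n. W n \<in> cs_carrier V" "\<And>n. X n \<in> bounded_ops"
    by (rule closed_graphE) (rule that, assumption+)
  have "x \<in> bounded_ops" by (rule closed_sequentially[OF closed_bounded_ops u(6,3)])
  then show ?thesis
    by (intro closed_graphI[OF V.star_closed[OF u(1)] R_star[OF u(2)] tendsto_op_adj[OF u(3,6)]])
      (simp_all add: V.dst_star u)
qed

lemma closed_graph_mult: assumes "closed_graph x u" "closed_graph y v" shows "closed_graph (x \<odot> y) (cs_mult V u v)"
proof -
  from assms(1) obtain X W where u: "u \<in> cs_carrier V" "\<And>n. (X n, W n) \<in> R" "X \<longlonglongrightarrow> x"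
    "(\<lambda>n. V.dst u (W n)) \<longlonglongrightarrow> 0" "\<And>n. W n \<in> cs_carrier V"
    by (rule closed_graphE) (rule that, assumption+)
  from assms(2) obtain Y Z where v: "v \<in> cs_carrier V" "\<And>n. (Y n, Z n) \<in> R" "Y \<longlonglongrightarrow> y"
    "(\<lambda>n. V.dst v (Z n)) \<longlonglongrightarrow> 0" "\<And>n. Z n \<in> cs_carrier V"
    by (rule closed_graphE) (rule that, assumption+)
  have "(\<lambda>n. cs_norm V u * V.dst v (Z n) + V.dst u (W n) * (cs_norm V v + V.dst v (Z n)))
      \<longlonglongrightarrow> cs_norm V u * 0 + 0 * (cs_norm V v + 0)"
    by (intro tendsto_intros u v)
  then have lim: "(\<lambda>n. cs_norm V u * V.dst v (Z n) + V.dst u (W n) * (cs_norm V v + V.dst v (Z n))) \<longlonglongrightarrow> 0" by simp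
  have le: "V.dst (cs_mult V u v) (cs_mult V (W n) (Z n))
      \<le> cs_norm V u * V.dst v (Z n) + V.dst u (W n) * (cs_norm V v + V.dst v (Z n))" for n
  proof -
    have "cs_norm V (Z n) \<le> cs_norm V v + V.dst v (Z n)" using V.dst_norm[OF v(1) v(5)[of n]] by linarith
    then have "V.dst u (W n) * cs_norm V (Z n) \<le> V.dst u (W n) * (cs_norm V v + V.dst v (Z n))"
      by (rule mult_left_mono[OF _ V.dst_nonneg[OF u(1) u(5)]])
    then show ?thesis using V.dst_mult[OF u(1) v(1) u(5)[of n] v(5)[of n]] by linarith
  qed
  show ?thesis
  proof (rule closed_graphI[OF V.mult_closed[OF u(1) v(1)] R_mult[OF u(2) v(2)]
      bounded_bilinear.tendsto[OF bounded_bilinear_blinfun_compose u(3) v(3)]])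
    show "(\<lambda>n. V.dst (cs_mult V u v) (cs_mult V (W n) (Z n))) \<longlonglongrightarrow> 0"
      by (rule null_sandwich[OF V.dst_nonneg le lim]) (simp_all add: V.mult_closed u v)
  qed
qed

definition extension :: "'h op \<Rightarrow> 'v" where "extension x = (SOME u. closed_graph x u)"

lemma extension_graph: "x \<in> closure (fst ` R) \<Longrightarrow> closed_graph x (extension x)"
  unfolding extension_def by (rule someI_ex) (rule closed_graph_total)

lemma extension_eq: "closed_graph x u \<Longrightarrow> extension x = u"
  unfolding extension_def by (rule some_equality) (auto intro: closed_graph_unique)

lemma extension_hom: "star_hom (op_cstar (closure (fst ` R))) V extension"
  unfolding star_hom_def op_cstar_simps
proof (intro conjI ballI allI)
  fix x assume x: "x \<in> closure (fst ` R)"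
  note xg = extension_graph[OF x]
  show "extension x \<in> cs_carrier V" using xg by (simp add: closed_graph_def)
  show "extension (op_scale c x) = cs_scale V c (extension x)" for c
    by (rule extension_eq[OF closed_graph_scale[OF xg]])
  show "extension (op_adj x) = cs_star V (extension x)"
    by (rule extension_eq[OF closed_graph_star[OF xg]])
  fix y assume y: "y \<in> closure (fst ` R)"
  note yg = extension_graph[OF y]
  show "extension (x + y) = cs_add V (extension x) (extension y)"
    by (rule extension_eq[OF closed_graph_add[OF xg yg]])
  show "extension (x \<odot> y) = cs_mult V (extension x) (extension y)"
    by (rule extension_eq[OF closed_graph_mult[OF xg yg]])
qed

end

section \<open>Absorption of the regular representation\<close>

text \<open>The vectors supported on the diagonal span an invariant copy of \<open>\<ell>\<^sup>2(\<Gamma>; H)\<close>, on which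
  \<open>\<Sum> b\<^sub>i u\<^sub>i \<otimes> \<lambda>\<^sub>i\<close> acts as \<open>\<Sum> b\<^sub>i u\<^sub>i\<close>.\<close>

lemma (in action) norm_sum_cp_le_conv_op:
  assumes b: "\<And>i. i < k \<Longrightarrow> b i \<in> C"
  shows "norm (\<Sum>i<k. cp (b i) (s i)) \<le> norm (conv_op k (\<lambda>i. cp (b i) (s i)) s)"
proof (rule norm_blinfun_bound[OF norm_ge_zero])
  fix x :: "('g, 'h) ell2"
  let ?y = "\<Sum>i<k. cp (b i) (s i)" and ?Y = "conv_op k (\<lambda>i. cp (b i) (s i)) s"
  define D where "D = (\<lambda>z :: ('g, 'h) ell2. Abs_ell2 (\<lambda>g. blinfun_apply (sg g) (ell2_apply z g)))"
  have D: "ell2_apply (D z) g = blinfun_apply (sg g) (ell2_apply z g)" for z g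
  proof -
    have "sq_summable (\<lambda>g. blinfun_apply (sg g) (ell2_apply z g))"
      using ell2_summable[of z] by (simp add: sq_summable_def norm_sg_apply)
    then show ?thesis by (simp add: D_def Abs_ell2_inverse)
  qed
  have nD: "norm (D z) = norm z" for z by (rule ell2_norm_eq_pointwise) (simp add: D norm_sg_apply)
  have "blinfun_apply ?Y (D x) = D (blinfun_apply ?y x)"
  proof (rule ell2_eqI)
    fix g
    have "blinfun_apply (cp (b i) (s i)) (blinfun_apply (sg (- s i + g)) \<xi>) = blinfun_apply (sg g) (blinfun_apply (\<rho> (\<beta> (- g) (b i))) \<xi>)"
      if i: "i < k" for i \<xi>
      by (rule ell2_eqI) (auto simp: cp_apply[OF b[OF i]] sg_apply)
    then show "ell2_apply (blinfun_apply ?Y (D x)) g = ell2_apply (D (blinfun_apply ?y x)) g"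
      by (simp add: conv_op_apply D blinfun.sum_left ell2_apply_sum cp_apply[OF b] blinfun.sum_right)
  qed
  then have "norm (blinfun_apply ?y x) = norm (blinfun_apply ?Y (D x))" by (simp add: nD)
  also have "\<dots> \<le> norm ?Y * norm x" using norm_blinfun[of ?Y "D x"] by (simp add: nD)
  finally show "norm (blinfun_apply ?y x) \<le> norm ?Y * norm x" .
qed

section \<open>The graph on trigonometric polynomials\<close>

context ultra_action_rep
begin

text \<open>The pairs of a finite sum \<open>\<Sum> [a\<^sub>i]\<^sub>\<omega> u\<^sub>i\<close> and its representing sequence \<open>\<Sum> a\<^sub>i(n) u\<^sub>i\<close>. A sum
  may be written in several ways, so this is not yet known to be a function.\<close>

inductive_set poly :: "(('g, 'k) ell2 op \<times> (nat \<Rightarrow> ('g, 'h) ell2 op)) set" where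
  poly_zero: "(0, \<lambda>_. 0) \<in> poly"
| poly_plus: "(x, y) \<in> poly \<Longrightarrow> a \<in> L \<Longrightarrow> (up.cp (cls a) s + x, \<lambda>n. base.cp (a n) s + y n) \<in> poly"

lemma poly_sum:
  assumes "finite F" "\<And>s. s \<in> F \<Longrightarrow> a s \<in> L"
  shows "(\<Sum>s\<in>F. up.cp (cls (a s)) s, \<lambda>n. \<Sum>s\<in>F. base.cp (a s n) s) \<in> poly"
  using assms
proof (induction F)
  case empty
  show ?case using poly_zero by simp
next
  case (insert s F)
  then show ?case using poly_plus[of "\<Sum>s\<in>F. up.cp (cls (a s)) s" "\<lambda>n. \<Sum>s\<in>F. base.cp (a s n) s" "a s" s] by simp
qed

lemma poly_single: "a \<in> L \<Longrightarrow> (up.cp (cls a) s, \<lambda>n. base.cp (a n) s) \<in> poly"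
  using poly_plus[OF poly_zero, of a s] by simp

lemma poly_add: "(x, y) \<in> poly \<Longrightarrow> (x', y') \<in> poly \<Longrightarrow> (x + x', \<lambda>n. y n + y' n) \<in> poly"
proof (induction rule: poly.induct)
  case (poly_plus x y a s)
  then show ?case using poly.poly_plus[of "x + x'" "\<lambda>n. y n + y' n" a s] by (simp add: add.assoc)
qed simp

lemma poly_scale: "(x, y) \<in> poly \<Longrightarrow> (op_scale c x, \<lambda>n. op_scale c (y n)) \<in> poly"
proof (induction rule: poly.induct)
  case (poly_plus x y a s)
  then have "(up.cp (cls (\<lambda>n. cs_scale A c (a n))) s + op_scale c x, \<lambda>n. base.cp (cs_scale A c (a n)) s + op_scale c (y n)) \<in> poly"
    by (intro poly.poly_plus L_scale)
  then show ?case using poly_plus by (simp add: op_scale_add up.cp_scale base.cp_scale scale_U L_D)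
qed (simp add: poly_zero)

lemma poly_single_comp: "(x, y) \<in> poly \<Longrightarrow> b \<in> L \<Longrightarrow> (up.cp (cls b) t \<odot> x, \<lambda>n. base.cp (b n) t \<odot> y n) \<in> poly"
proof (induction rule: poly.induct)
  case (poly_plus x y a s)
  then have "(up.cp (cls (\<lambda>n. b n \<otimes> \<alpha> t (a n))) (t + s) + up.cp (cls b) t \<odot> x,
      \<lambda>n. base.cp (b n \<otimes> \<alpha> t (a n)) (t + s) + base.cp (b n) t \<odot> y n) \<in> poly"
    by (intro poly.poly_plus L_mult L_alpha) auto
  then show ?case using poly_plus
    by (simp add: comp_add_right up.cp_comp base.cp_comp L_D ultra_action_cls mult_U L_alpha)
qed (simp add: poly_zero comp_zero_right)

lemma poly_comp: "(x, y) \<in> poly \<Longrightarrow> (x', y') \<in> poly \<Longrightarrow> (x \<odot> x', \<lambda>n. y n \<odot> y' n) \<in> poly"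
proof (induction rule: poly.induct)
  case (poly_plus x y a s)
  then show ?case using poly_add[OF poly_single_comp[OF poly_plus.prems, of a s] poly_plus.IH[OF poly_plus.prems]]
    by (simp add: comp_add_left)
qed (simp add: poly_zero comp_zero_left)

lemma poly_fst_bounded_ops: "(x, y) \<in> poly \<Longrightarrow> x \<in> bounded_ops"
  by (induction rule: poly.induct) (auto simp: up.cp_in)

lemma poly_snd_cross: "(x, y) \<in> poly \<Longrightarrow> y n \<in> base.cross"
  by (induction rule: poly.induct)
    (auto intro!: concrete_cstarD(5)[OF base.cross_concrete] base.cp_cross L_D concrete_cstarD(4)[OF base.cross_concrete])

lemma poly_snd_bounded_ops: "(x, y) \<in> poly \<Longrightarrow> y n \<in> bounded_ops"
  by (rule concrete_cstarD(10)[OF base.cross_concrete poly_snd_cross])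

lemma poly_adj: "(x, y) \<in> poly \<Longrightarrow> (op_adj x, \<lambda>n. op_adj (y n)) \<in> poly"
proof (induction rule: poly.induct)
  case (poly_plus x y a s)
  then have "(up.cp (cls (\<lambda>n. \<alpha> (- s) (cs_star A (a n)))) (- s) + op_adj x,
      \<lambda>n. base.cp (\<alpha> (- s) (cs_star A (a n))) (- s) + op_adj (y n)) \<in> poly"
    by (intro poly.poly_plus L_alpha L_star)
  then show ?case using poly_plus
    by (simp add: op_adj_add up.cp_in base.cp_in poly_fst_bounded_ops[OF poly_plus.hyps(1)] poly_snd_bounded_ops[OF poly_plus.hyps(1)]
        up.cp_adj base.cp_adj L_D star_U ultra_action_cls L_star)
qed (simp add: poly_zero)

lemma poly_snd_bounded: "(x, y) \<in> poly \<Longrightarrow> \<exists>B. \<forall>n. norm (y n) \<le> B"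
proof (induction rule: poly.induct)
  case (poly_plus x y a s)
  obtain B where B: "\<And>n. norm (y n) \<le> B" using poly_plus by blast
  obtain K where K: "\<And>n. nrm (a n) \<le> K" by (rule L_B[OF poly_plus.hyps(2)]) (rule that)
  have "norm (base.cp (a n) s + y n) \<le> 2 * K + B" for n
    using base.cp_bound[OF L_D[OF poly_plus.hyps(2)], of n s] K[of n] B[of n]
      norm_triangle_ineq[of "base.cp (a n) s" "y n"] by linarith
  then show ?case by blast
qed auto

lemma poly_entries: "(x, y) \<in> poly \<Longrightarrow> lifts \<pi> (entry g h x) (\<lambda>n. entry g h (y n))"
proof (induction rule: poly.induct)
  case poly_zero
  show ?case using lifts_0[OF base.rho_rep] by simp
next
  case (poly_plus x y a s)
  have "lifts \<pi> (entry g h (up.cp (cls a) s)) (\<lambda>n. entry g h (base.cp (a n) s))"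
    using poly_plus.hyps(2) liftsI[OF L_alpha[OF poly_plus.hyps(2), of "- g"], of \<pi>] lifts_0[OF base.rho_rep]
    by (simp add: up.entry_cp base.entry_cp L_D ultra_action_cls)
  then show ?case using lifts_add[OF base.rho_rep _ poly_plus.IH] by simp
qed

lemma poly_as_sum: "(x, y) \<in> poly \<Longrightarrow> \<exists>k a s. (\<forall>i. a i \<in> L) \<and>
    x = (\<Sum>i<k::nat. up.cp (cls (a i)) (s i)) \<and> y = (\<lambda>n. \<Sum>i<k. base.cp (a i n) (s i))"
proof (induction rule: poly.induct)
  case poly_zero
  show ?case
    by (rule exI[of _ 0], rule exI[of _ "\<lambda>_ _. zer"], rule exI[of _ "\<lambda>_. 0"]) (simp add: L_zero)
next
  case (poly_plus x y b t)
  then obtain k a s where as: "\<And>i. a i \<in> L" "x = (\<Sum>i<k::nat. up.cp (cls (a i)) (s i))" "y = (\<lambda>n. \<Sum>i<k. base.cp (a i n) (s i))"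
    by blast
  have "case_nat b a i \<in> L" for i using as(1) poly_plus.hyps(2) by (cases i) simp_all
  moreover have "up.cp (cls b) t + x = (\<Sum>i<Suc k. up.cp (cls (case_nat b a i)) (case_nat t s i))"
    unfolding as(2) sum.lessThan_Suc_shift by simp
  moreover have "(\<lambda>n. base.cp (b n) t + y n) = (\<lambda>n. \<Sum>i<Suc k. base.cp (case_nat b a i n) (case_nat t s i))"
    unfolding as(3) sum.lessThan_Suc_shift by simp
  ultimately show ?case by blast
qed

text \<open>With \<open>\<sigma> = pi_tilde \<alpha> \<pi>\<close>, conjugation by the translations \<open>\<lambda>\<^sub>g\<close> in the \<open>g\<close>-th coordinate turns
  \<open>\<Sum> a\<^sub>i(n) u\<^sub>i \<otimes> \<lambda>\<^sub>i\<close> into the matrix with entries \<open>\<sigma>(\<alpha>\<^bsub>-g\<^esub>(a\<^sub>i(n)))\<close>, which represents the matrix of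
  \<open>\<Sum> [a\<^sub>i]\<^sub>\<omega> u\<^sub>i\<close>. Finitely supported vectors see only a finite part of that matrix.\<close>

lemma conv_op_finite_bound:
  fixes a :: "nat \<Rightarrow> nat \<Rightarrow> 'a" and s :: "nat \<Rightarrow> 'g"
  assumes a: "\<And>i. a i \<in> L" and F: "finite F"
    and kap: "norm (\<Sum>i<k. up.cp (cls (a i)) (s i)) \<le> \<kappa>" "\<kappa> > 0"
  shows "eventually (\<lambda>n. \<forall>x. norm (blinfun_apply (conv_op k (\<lambda>i. base.cp (a i n) (s i)) s) (trunc F x))
    \<le> 3 * \<kappa> * norm (trunc F x)) \<omega>"
proof -
  define E where "E = F \<union> (\<Union>i<k. (\<lambda>h. s i + h) ` F)"
  define \<sigma> where "\<sigma> = pi_tilde \<alpha> \<pi>"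
  have sigma: "is_rep A \<sigma>" unfolding \<sigma>_def by (rule base.pt_rep)
  define z where "z g h n = (\<Sum>i<k. if s i + h = g then \<sigma> (\<alpha> (- g) (a i n)) else 0)" for g h n
  let ?x = "\<Sum>i<k. up.cp (cls (a i)) (s i)"
  have E: "finite E" using F by (simp add: E_def)
  have lifts: "lifts \<sigma> (entry g h ?x) (z g h)" for g h
  proof -
    have "entry g h ?x = (\<Sum>i<k. if s i + h = g then \<rho> (cls (\<lambda>n. \<alpha> (- g) (a i n))) else 0)"
      by (simp add: bounded_linear_sum[OF bounded_linear_entry] linear_sum[OF bounded_linear.linear[OF bounded_linear_entry]]
          up.entry_cp a ultra_action_cls cong: if_cong)
    moreover have "lifts \<sigma> (\<Sum>i<k. if s i + h = g then \<rho> (cls (\<lambda>n. \<alpha> (- g) (a i n))) else 0)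
        (\<lambda>n. \<Sum>i<k. (\<lambda>i n. if s i + h = g then \<sigma> (\<alpha> (- g) (a i n)) else 0) i n)"
      by (rule lifts_sum[OF sigma]) (auto simp: lifts_0[OF sigma] liftsI[OF L_alpha[OF a]])
    ultimately show ?thesis unfolding z_def by simp
  qed
  have "?x \<in> bounded_ops" by (rule bounded_ops_sum) (simp add: up.cp_in a)
  from matrix_bound[OF sigma E this kap lifts] show ?thesis
  proof eventually_elim
    case (elim n)
    show ?case
    proof
      fix x :: "('g, ('g, 'h) ell2) ell2"
      let ?Y = "conv_op k (\<lambda>i. base.cp (a i n) (s i)) s" and ?y = "trunc F x"
      define \<zeta> where "\<zeta> h = blinfun_apply (left_reg (- h)) (ell2_apply ?y h)" for h
      have y0: "ell2_apply ?y g = 0" if "g \<notin> F" for g using that by (simp add: trunc_apply[OF F])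
      note fin = norm_conv_op_finite[where k=k and s=s, OF F y0, folded E_def]
      have coord: "ell2_apply (blinfun_apply ?Y ?y) g = blinfun_apply (left_reg g) (\<Sum>h\<in>E. blinfun_apply (z g h n) (\<zeta> h))" for g
      proof -
        have "(\<Sum>h\<in>E. blinfun_apply (z g h n) (\<zeta> h)) =
            (\<Sum>h\<in>E. \<Sum>i<k. if - s i + g = h then blinfun_apply (\<sigma> (\<alpha> (- g) (a i n))) (\<zeta> h) else 0)"
        proof (rule sum.cong[OF refl])
          fix h
          have "s i + h = g \<longleftrightarrow> - s i + g = h" for i
            by (metis add.assoc add.left_neutral add.right_inverse add.left_inverse)
          then show "blinfun_apply (z g h n) (\<zeta> h) = (\<Sum>i<k. if - s i + g = h then blinfun_apply (\<sigma> (\<alpha> (- g) (a i n))) (\<zeta> h) else 0)"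
            by (auto simp: z_def blinfun.sum_left intro!: sum.cong)
        qed
        also have "\<dots> = (\<Sum>i<k. \<Sum>h\<in>E. if - s i + g = h then blinfun_apply (\<sigma> (\<alpha> (- g) (a i n))) (\<zeta> h) else 0)"
          by (rule sum.swap)
        also have "\<dots> = (\<Sum>i<k. blinfun_apply (\<sigma> (\<alpha> (- g) (a i n))) (\<zeta> (- s i + g)))"
        proof (rule sum.cong[OF refl])
          fix i
          have "\<zeta> (- s i + g) = 0" if "- s i + g \<notin> E" using that y0[of "- s i + g"] by (simp add: \<zeta>_def E_def)
          then show "(\<Sum>h\<in>E. if - s i + g = h then blinfun_apply (\<sigma> (\<alpha> (- g) (a i n))) (\<zeta> h) else 0) =
              blinfun_apply (\<sigma> (\<alpha> (- g) (a i n))) (\<zeta> (- s i + g))" using E by simp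
        qed
        finally have sum: "(\<Sum>h\<in>E. blinfun_apply (z g h n) (\<zeta> h)) = (\<Sum>i<k. blinfun_apply (\<sigma> (\<alpha> (- g) (a i n))) (\<zeta> (- s i + g)))" .
        have "blinfun_apply (left_reg g) (blinfun_apply (\<sigma> (\<alpha> (- g) (a i n))) (\<zeta> (- s i + g)))
            = blinfun_apply (base.cp (a i n) (s i)) (ell2_apply ?y (- s i + g))" for i
        proof -
          have ai: "a i n \<in> C" by (rule L_D[OF a])
          have "\<alpha> g (\<alpha> (- g) (a i n)) = a i n"
            using base.beta_add[OF ai, of g "- g"] base.beta_0[OF ai] by simp
          then have "left_reg g \<odot> \<sigma> (\<alpha> (- g) (a i n)) = \<sigma> (a i n) \<odot> left_reg g"
            unfolding \<sigma>_def using base.covariance[OF base.beta_simps(1)[OF ai], of g "- g"] by simp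
          then have "left_reg g \<odot> \<sigma> (\<alpha> (- g) (a i n)) \<odot> left_reg (- (- s i + g)) = \<sigma> (a i n) \<odot> (left_reg g \<odot> left_reg (- (- s i + g)))"
            by (simp add: comp_assoc)
          also have "left_reg g \<odot> left_reg (- (- s i + g)) = (left_reg (s i) :: ('g, 'h) ell2 op)"
            by (simp add: left_reg_comp minus_add add.assoc[symmetric])
          finally show ?thesis
            unfolding \<zeta>_def cp_elem_def \<sigma>_def[symmetric]
            by (metis blinfun_apply_blinfun_compose)
        qed
        then show ?thesis by (simp add: conv_op_apply sum blinfun.sum_right)
      qed
      have "(norm (blinfun_apply ?Y ?y))\<^sup>2 = (\<Sum>g\<in>E. (norm (\<Sum>h\<in>E. blinfun_apply (z g h n) (\<zeta> h)))\<^sup>2)"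
        by (simp add: fin(2) coord)
      also have "\<dots> \<le> (3 * \<kappa>)\<^sup>2 * (\<Sum>g\<in>E. (norm (\<zeta> g))\<^sup>2)" using elim by blast
      also have "(\<Sum>g\<in>E. (norm (\<zeta> g))\<^sup>2) = (norm ?y)\<^sup>2"
        using norm_fin_supp[OF E, of ?y] y0 by (simp add: \<zeta>_def E_def)
      finally have "(norm (blinfun_apply ?Y ?y))\<^sup>2 \<le> (3 * \<kappa> * norm ?y)\<^sup>2" by (simp add: power_mult_distrib)
      then show "norm (blinfun_apply ?Y ?y) \<le> 3 * \<kappa> * norm ?y"
        by (rule power2_le_imp_le) (use kap in simp)
    qed
  qed
qed

text \<open>The estimate of \<open>conv_op_finite_bound\<close> holds for almost all \<open>n\<close>, but for which ones depends on \<open>F\<close>.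
  Exactness makes it uniform, and absorption takes it back to \<open>y\<close>.\<close>

lemma poly_bound:
  assumes exact: "exact_group TYPE('g)" and xy: "(x, y) \<in> poly" and eps: "\<epsilon> > 0"
  shows "eventually (\<lambda>n. norm (y n) \<le> 4800 * norm x + \<epsilon>) \<omega>"
proof -
  obtain k a s where a: "\<And>i. a i \<in> L" and x: "x = (\<Sum>i<k::nat. up.cp (cls (a i)) (s i))" and y: "y = (\<lambda>n. \<Sum>i<k. base.cp (a i n) (s i))"
    by (insert poly_as_sum[OF xy], elim exE conjE, rule that, erule spec, assumption+)
  define \<kappa> where "\<kappa> = norm x + \<epsilon> / 9600"
  have kap: "norm (\<Sum>i<k. up.cp (cls (a i)) (s i)) \<le> \<kappa>" "\<kappa> > 0"
    using eps by (auto simp: \<kappa>_def x add_nonneg_pos)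
  have bnd: "\<exists>B. \<forall>n. norm (base.cp (a i n) (s i)) \<le> B" for i
  proof -
    obtain K where K: "\<And>n. nrm (a i n) \<le> K" by (rule L_B[OF a]) (rule that)
    have "norm (base.cp (a i n) (s i)) \<le> 2 * K" for n
      using base.cp_bound[OF L_D[OF a], of i n "s i"] K[of n] by linarith
    then show ?thesis by blast
  qed
  have "eventually (\<lambda>n. norm (conv_op k (\<lambda>i. base.cp (a i n) (s i)) s) \<le> 1600 * (3 * \<kappa>) + \<epsilon> / 2) \<omega>"
    by (rule exactness_uniform[OF om exact _ bnd _ conv_op_finite_bound[OF a _ kap]])
      (use kap eps in \<open>auto simp: base.cp_in L_D a\<close>)
  then show ?thesis
  proof eventually_elim
    case (elim n)
    have "norm (y n) \<le> norm (conv_op k (\<lambda>i. base.cp (a i n) (s i)) s)"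
      unfolding y by (rule base.norm_sum_cp_le_conv_op) (rule L_D[OF a])
    then show ?case using elim by (simp add: \<kappa>_def)
  qed
qed

text \<open>Each entry of \<open>x\<close> is \<open>\<rho>\<close> of a class whose representatives are, under \<open>\<pi>\<close>, the entries of \<open>y\<close>. As \<open>\<pi>\<close> is
  bounded below, they are small if \<open>y\<close> is.\<close>

lemma norm_entry_poly_le:
  assumes xy: "(x, y) \<in> poly" and le: "eventually (\<lambda>n. norm (y n) \<le> \<delta>) \<omega>"
  shows "norm (entry g h x) \<le> 1600 * \<delta>"
proof -
  obtain b where b: "b \<in> L" "entry g h x = \<rho> (cls b)" "(\<lambda>n. entry g h (y n)) = (\<lambda>n. \<pi> (b n))"
    using poly_entries[OF xy, of g h] unfolding lifts_def by blast
  have "eventually (\<lambda>n. nrm (b n) \<le> 800 * \<delta>) \<omega>"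
    using le
  proof eventually_elim
    case (elim n)
    have "nrm (b n) \<le> 800 * norm (\<pi> (b n))"
      by (rule faithful_rep_bounded_below[OF cstar_algebra_axioms base.faithful L_D[OF b(1)]])
    also have "\<pi> (b n) = entry g h (y n)" using fun_cong[OF b(3)] by simp
    finally show ?case using norm_entry_le[of g h "y n"] elim by linarith
  qed
  then have "cs_norm U (cls b) \<le> 800 * \<delta>" by (rule norm_U_le[OF b(1)])
  moreover have "norm (\<rho> (cls b)) \<le> 2 * cs_norm U (cls b)"
    by (rule rep_bounded[OF cstar_algebra_U rho_faithful up.rho_rep]) (simp add: b)
  ultimately show ?thesis by (simp add: b(2))
qed

text \<open>The first components are the span of the generators \<open>b u\<^sub>s\<close>: each \<open>b\<close> in the ultraproduct has a representative.\<close>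

lemma closure_poly: "closure (fst ` poly) = up.cross"
proof
  show "closure (fst ` poly) \<subseteq> up.cross"
  proof (rule closure_minimal)
    have "x \<in> up.cross" if "(x, y) \<in> poly" for x y
      using that
      by (induction rule: poly.induct)
        (auto intro!: concrete_cstarD(5)[OF up.cross_concrete] up.cp_cross concrete_cstarD(4)[OF up.cross_concrete])
    then show "fst ` poly \<subseteq> up.cross" by auto
    show "closed up.cross" by (rule concrete_cstarD(2)[OF up.cross_concrete])
  qed
  have gen: "op_scale c (up.cp b s) \<in> fst ` poly" if b: "b \<in> cs_carrier U" for c b s
  proof -
    obtain a where a: "a \<in> L" "b = cls a" using b by (auto simp: carrier_U)
    show ?thesis using imageI[OF poly_scale[OF poly_single[OF a(1), of s], of c], of fst] a(2) by simp
  qed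
  have sub: "subspace (fst ` poly)"
    unfolding subspace_def scaleR_op_scale
  proof (intro conjI ballI allI)
    show "0 \<in> fst ` poly" using imageI[OF poly_zero, of fst] by simp
    fix x assume "x \<in> fst ` poly"
    then obtain y where y: "(x, y) \<in> poly" by auto
    show "op_scale (of_real c) x \<in> fst ` poly" for c using imageI[OF poly_scale[OF y], of fst] by simp
    fix x' assume "x' \<in> fst ` poly"
    then obtain y' where y': "(x', y') \<in> poly" by auto
    show "x + x' \<in> fst ` poly" using imageI[OF poly_add[OF y y'], of fst] by simp
  qed
  show "up.cross \<subseteq> closure (fst ` poly)"
    unfolding up.cross_def closed_cspan_def
    by (rule closure_mono, rule span_minimal[OF _ sub]) (use gen in auto)
qed

section \<open>The embedding\<close>

text \<open>The embedding is the extension of \<open>poly\<close>, read as a graph over classes. An element of the closure that it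
  maps to \<open>0\<close> is a limit of polynomials whose classes tend to \<open>0\<close>; their entries then tend to \<open>0\<close> as well.\<close>

theorem embedding_exists:
  assumes exact: "exact_group TYPE('g)"
  shows "\<exists>\<Theta>. star_hom (crossed_product U (ultra_action \<omega> A \<alpha>) \<rho>) (ultraproduct \<omega> (crossed_product A \<alpha> \<pi>)) \<Theta> \<and>
    inj_on \<Theta> (cs_carrier (crossed_product U (ultra_action \<omega> A \<alpha>) \<rho>)) \<and>
    (\<forall>(x, y)\<in>poly. \<Theta> x = ultra_class \<omega> (crossed_product A \<alpha> \<pi>) y)"
proof -
  interpret W: ultra "op_cstar base.cross" \<omega>
    by (intro ultra.intro ultra_axioms.intro cstar_algebra_op_cstar base.cross_concrete om)
  define R where "R = {(x, W.cls y) |x y. (x, y) \<in> poly}"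
  have WL: "y \<in> W.L" if xy: "(x, y) \<in> poly" for x y
  proof -
    obtain B where "\<And>n. norm (y n) \<le> B" using poly_snd_bounded[OF xy] by blast
    then show ?thesis by (intro W.L_I[of y B]) (auto simp: poly_snd_cross[OF xy])
  qed
  have bound: "cs_norm W.U (W.cls y) \<le> 4800 * norm x" if xy: "(x, y) \<in> poly" for x y
  proof (rule field_le_epsilon)
    fix e :: real assume "e > 0"
    show "cs_norm W.U (W.cls y) \<le> 4800 * norm x + e"
      by (rule W.norm_U_le[OF WL[OF xy]]) (simp add: poly_bound[OF exact xy \<open>e > 0\<close>])
  qed
  have entry_le: "norm (entry g h x) \<le> 1600 * cs_norm W.U (W.cls y)" if xy: "(x, y) \<in> poly" for x y g h
  proof (rule field_le_epsilon)
    fix e :: real assume e: "e > 0"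
    have "((\<lambda>n. norm (y n)) \<longlongrightarrow> cs_norm W.U (W.cls y)) \<omega>"
      using W.norm_U_tendsto[OF WL[OF xy]] by simp
    then have "eventually (\<lambda>n. norm (y n) < cs_norm W.U (W.cls y) + e / 1600) \<omega>"
      by (rule order_tendstoD(2)) (use e in simp)
    then have "eventually (\<lambda>n. norm (y n) \<le> cs_norm W.U (W.cls y) + e / 1600) \<omega>"
      by (rule eventually_mono) simp
    then have "norm (entry g h x) \<le> 1600 * (cs_norm W.U (W.cls y) + e / 1600)"
      by (rule norm_entry_poly_le[OF xy])
    then show "norm (entry g h x) \<le> 1600 * cs_norm W.U (W.cls y) + e" by simp
  qed
  interpret V: cstar_algebra W.U by (rule W.cstar_algebra_U)
  interpret G: bounded_graph W.U R 4800
  proof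
    fix x u assume xu: "(x, u) \<in> R"
    then obtain y where y: "(x, y) \<in> poly" "u = W.cls y" by (auto simp: R_def)
    note WLy = WL[OF y(1)]
    show "x \<in> bounded_ops" by (rule poly_fst_bounded_ops[OF y(1)])
    show "u \<in> cs_carrier W.U" using WLy y(2) by (auto simp: W.carrier_U)
    show "(op_scale c x, cs_scale W.U c u) \<in> R" for c
      using poly_scale[OF y(1), of c] WLy y(2) by (auto simp: R_def W.scale_U)
    show "(op_adj x, cs_star W.U u) \<in> R"
      using poly_adj[OF y(1)] WLy y(2) by (auto simp: R_def W.star_U)
    show "cs_norm W.U u \<le> 4800 * norm x" using bound y by simp
    fix x' u' assume "(x', u') \<in> R"
    then obtain y' where y': "(x', y') \<in> poly" "u' = W.cls y'" by (auto simp: R_def)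
    note WLy' = WL[OF y'(1)]
    show "(x + x', cs_add W.U u u') \<in> R"
      using poly_add[OF y(1) y'(1)] WLy y(2) WLy' y'(2) by (auto simp: R_def W.add_U)
    show "(x \<odot> x', cs_mult W.U u u') \<in> R"
      using poly_comp[OF y(1) y'(1)] WLy y(2) WLy' y'(2) by (auto simp: R_def W.mult_U)
  next
    show "(0, cs_zero W.U) \<in> R" using poly_zero by (auto simp: R_def W.zero_U)
  qed
  have fstR: "fst ` R = fst ` poly" by (force simp: R_def)
  have cp_eq: "crossed_product U (ultra_action \<omega> A \<alpha>) \<rho> = op_cstar (closure (fst ` R))"
    "crossed_product A \<alpha> \<pi> = op_cstar base.cross"
    by (simp_all add: up.crossed_product_eq base.crossed_product_eq fstR closure_poly)
  have hom: "star_hom (op_cstar (closure (fst ` R))) W.U G.extension" by (rule G.extension_hom)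
  have kernel: "x = 0" if x: "G.closed_graph x (cs_zero W.U)" for x
  proof -
    from x obtain X u where Xu: "cs_zero W.U \<in> cs_carrier W.U" "\<And>n. (X n, u n) \<in> R" "X \<longlonglongrightarrow> x"
      "(\<lambda>n. V.dst (cs_zero W.U) (u n)) \<longlonglongrightarrow> 0" "\<And>n. u n \<in> cs_carrier W.U"
      by (rule G.closed_graphE) (rule that, assumption+)
    have "norm (entry g h x) \<le> 1600 * 0" for g h
    proof (rule LIMSEQ_le)
      show "(\<lambda>n. norm (entry g h (X n))) \<longlonglongrightarrow> norm (entry g h x)"
        by (intro tendsto_norm bounded_linear.tendsto[OF bounded_linear_entry] Xu)
      show "(\<lambda>n. 1600 * V.dst (cs_zero W.U) (u n)) \<longlonglongrightarrow> 1600 * 0" by (intro tendsto_intros Xu)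
      have "norm (entry g h (X n)) \<le> 1600 * V.dst (cs_zero W.U) (u n)" for n
      proof -
        obtain y where y: "(X n, y) \<in> poly" "u n = W.cls y" using Xu(2)[of n] by (auto simp: R_def)
        have "V.dst (cs_zero W.U) (u n) = cs_norm W.U (u n)"
          by (simp add: V.dst_commute[OF Xu(1) Xu(5)] V.dst_zero Xu(5))
        then show ?thesis using entry_le[OF y(1)] y(2) by simp
      qed
      then show "\<exists>N. \<forall>n\<ge>N. norm (entry g h (X n)) \<le> 1600 * V.dst (cs_zero W.U) (u n)" by blast
    qed
    then show ?thesis by (intro op_eqI_entry) simp
  qed
  have inj: "inj_on G.extension (closure (fst ` R))"
  proof (rule inj_onI)
    fix x y assume x: "x \<in> closure (fst ` R)" and y: "y \<in> closure (fst ` R)" and eq: "G.extension x = G.extension y"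
    note gx = G.extension_graph[OF x] and gy = G.extension_graph[OF y]
    have "G.closed_graph (x + op_scale (- 1) y) (cs_diff W.U (G.extension x) (G.extension x))"
      using G.closed_graph_add[OF gx G.closed_graph_scale[OF gy, of "- 1"]] by (simp add: cs_diff_def eq)
    moreover have "cs_diff W.U (G.extension x) (G.extension x) = cs_zero W.U"
      by (rule V.add_inverse) (use gx in \<open>simp add: G.closed_graph_def\<close>)
    ultimately have "x + op_scale (- 1) y = 0" using kernel by simp
    then show "x = y" by (simp add: op_scale_minus1)
  qed
  have "G.extension x = W.cls y" if "(x, y) \<in> poly" for x y
    by (rule G.extension_eq[OF G.closed_graph_base]) (use that in \<open>auto simp: R_def\<close>)
  then show ?thesis unfolding cp_eq using hom inj by (intro exI[of _ G.extension]) auto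
qed

end

theorem theorem3p2:
  fixes \<omega> :: "nat filter"
    and A :: "'a cstar"
    and \<alpha> :: "'g::group_add \<Rightarrow> 'a \<Rightarrow> 'a"
    and \<pi> :: "'a \<Rightarrow> 'h::chilbert_space op"
    and \<rho> :: "(nat \<Rightarrow> 'a) set \<Rightarrow> 'k::chilbert_space op"
  assumes "free_ultrafilter \<omega>"
    and "exact_group TYPE('g)"
    and "cstar_algebra A"
    and "star_action A \<alpha>"
    and "faithful_rep A \<pi>"
    and "faithful_rep (ultraproduct \<omega> A) \<rho>"
  shows "\<exists>\<Theta>. star_hom (crossed_product (ultraproduct \<omega> A) (ultra_action \<omega> A \<alpha>) \<rho>)
              (ultraproduct \<omega> (crossed_product A \<alpha> \<pi>)) \<Theta> \<and>
            inj_on \<Theta> (cs_carrier (crossed_product (ultraproduct \<omega> A) (ultra_action \<omega> A \<alpha>) \<rho>)) \<and>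
            (\<forall>F a. finite F \<and> (\<forall>s\<in>F. a s \<in> cs_carrier (linf A)) \<longrightarrow>
               \<Theta> (\<Sum>s\<in>F. cp_elem (ultra_action \<omega> A \<alpha>) \<rho> (ultra_class \<omega> A (a s)) s)
               = ultra_class \<omega> (crossed_product A \<alpha> \<pi>) (\<lambda>n. \<Sum>s\<in>F. cp_elem \<alpha> \<pi> (a s n) s))"
proof -
  interpret A: cstar_algebra A by fact
  interpret ultra_action_rep A \<omega> \<alpha> \<pi> \<rho>
    by unfold_locales (use assms in \<open>auto simp: star_action_def\<close>)
  obtain \<Theta> where \<Theta>: "star_hom (crossed_product U (ultra_action \<omega> A \<alpha>) \<rho>) (ultraproduct \<omega> (crossed_product A \<alpha> \<pi>)) \<Theta>"
    "inj_on \<Theta> (cs_carrier (crossed_product U (ultra_action \<omega> A \<alpha>) \<rho>))"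
    "\<forall>(x, y)\<in>poly. \<Theta> x = ultra_class \<omega> (crossed_product A \<alpha> \<pi>) y"
    using embedding_exists[OF assms(2)] by blast
  have "\<Theta> (\<Sum>s\<in>F. up.cp (cls (a s)) s) = ultra_class \<omega> (crossed_product A \<alpha> \<pi>) (\<lambda>n. \<Sum>s\<in>F. base.cp (a s n) s)"
    if "finite F" "\<forall>s\<in>F. a s \<in> L" for F a
    using bspec[OF \<Theta>(3) poly_sum[of F a]] that by simp
  then show ?thesis using \<Theta>(1,2) by blast
qed

end
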